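(* Let $\mathcal{C}$ be the monoidal category of finite dimensional complex $\mathfrak{sl}_2$-modules. All admissible (locally finitary) simple transitive $\mathcal{C}$-module categories of type $A_\infty$ are equivalent to each other as $\mathcal{C}$-module categories.
   Context: Everything is over $\mathbb{C}$. $\mathcal{C}$ denotes the monoidal category (under $\otimes_{\mathbb{C}}$) of finite dimensional $\mathfrak{sl}_2$-modules; $L(1)$ is the simple module of dimension $2$. A $\mathcal{C}$-module category $\mathcal{M}$ is locally finitary if it is $\mathbb{C}$-linear, additive, idempotent split, Krull-Schmidt, has at most countably many indecomposable objects up to isomorphism, and has finite dimensional hom-spaces. It is simple transitive if it has no non-trivial $\mathcal{C}$-invariant ideals (ideals other than $0$ and $\mathcal{M}$). It is of type $A_\infty$ if its indecomposables, up to isomorphism, can be listed without repetition as $X_0,X_1,X_2,\dots$ so that $L(1)\cdot X_0\cong X_1$ and $L(1)\cdot X_i\cong X_{i-1}\oplus X_{i+1}$ for $i\geq 1$. The projective abelianization $\overline{\mathcal{M}}$ has as objects diagrams $X\to Y$ over $\mathcal{M}$ and as morphisms commutative squares modulo those whose component $Y\to Y'$ factors through $X'\to Y'$. $\mathcal{M}$ is called admissible if it has weak kernels; equivalently, $\overline{\mathcal{M}}$ is abelian, with $\mathcal{M}$ embedded, via $P\mapsto (0\to P)$, as the category of projective objects. *)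

theory Defs
  imports "Jordan_Normal_Form.VS_Connect" "HOL-Library.Countable_Set" "HOL-Library.FuncSet"
begin

section \<open>Complex linear categories\<close>

record ('o, 'a) lincat =
  Obj :: "'o set"
  Arr :: "'a set"
  Dom :: "'a \<Rightarrow> 'o"
  Cod :: "'a \<Rightarrow> 'o"
  Ident :: "'o \<Rightarrow> 'a"
  Comp :: "'a \<Rightarrow> 'a \<Rightarrow> 'a"  (infixl \<open>\<cdot>\<index>\<close> 70)
  Plus :: "'a \<Rightarrow> 'a \<Rightarrow> 'a"  (infixl \<open>\<boxplus>\<index>\<close> 65)
  Scale :: "complex \<Rightarrow> 'a \<Rightarrow> 'a"
  Null :: "'o \<Rightarrow> 'o \<Rightarrow> 'a"

definition Hom :: "('o, 'a, 'z) lincat_scheme \<Rightarrow> 'o \<Rightarrow> 'o \<Rightarrow> 'a set" where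
  "Hom M X Y = {f \<in> Arr M. Dom M f = X \<and> Cod M f = Y}"

text \<open>The fields \<open>mult\<close> and \<open>one\<close> play no role in the vector space structure.\<close>

definition hom_space :: "('o, 'a, 'z) lincat_scheme \<Rightarrow> 'o \<Rightarrow> 'o \<Rightarrow> (complex, 'a) module" where
  "hom_space M X Y =
    \<lparr>carrier = Hom M X Y, mult = undefined, one = undefined,
     zero = Null M X Y, add = Plus M, smult = Scale M\<rparr>"

locale linear_category =
  fixes M :: "('o, 'a, 'z) lincat_scheme" (structure)
  assumes dom_cod: "f \<in> Arr M \<Longrightarrow> Dom M f \<in> Obj M \<and> Cod M f \<in> Obj M"
    and ident_in_hom: "X \<in> Obj M \<Longrightarrow> Ident M X \<in> Hom M X X"
    and comp_in_hom: "f \<in> Hom M X Y \<Longrightarrow> g \<in> Hom M Y Z \<Longrightarrow> g \<cdot> f \<in> Hom M X Z"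
    and comp_ident_right: "f \<in> Hom M X Y \<Longrightarrow> f \<cdot> Ident M X = f"
    and comp_ident_left: "f \<in> Hom M X Y \<Longrightarrow> Ident M Y \<cdot> f = f"
    and comp_assoc: "f \<in> Hom M W X \<Longrightarrow> g \<in> Hom M X Y \<Longrightarrow> h \<in> Hom M Y Z \<Longrightarrow>
      (h \<cdot> g) \<cdot> f = h \<cdot> (g \<cdot> f)"
    and hom_vectorspace: "X \<in> Obj M \<Longrightarrow> Y \<in> Obj M \<Longrightarrow>
      vectorspace class_ring (hom_space M X Y)"
    and comp_plus_left: "f \<in> Hom M X Y \<Longrightarrow> g \<in> Hom M Y Z \<Longrightarrow> g' \<in> Hom M Y Z \<Longrightarrow>
      (g \<boxplus> g') \<cdot> f = (g \<cdot> f) \<boxplus> (g' \<cdot> f)"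
    and comp_plus_right: "f \<in> Hom M X Y \<Longrightarrow> f' \<in> Hom M X Y \<Longrightarrow> g \<in> Hom M Y Z \<Longrightarrow>
      g \<cdot> (f \<boxplus> f') = (g \<cdot> f) \<boxplus> (g \<cdot> f')"
    and comp_scale_left: "f \<in> Hom M X Y \<Longrightarrow> g \<in> Hom M Y Z \<Longrightarrow>
      Scale M c g \<cdot> f = Scale M c (g \<cdot> f)"
    and comp_scale_right: "f \<in> Hom M X Y \<Longrightarrow> g \<in> Hom M Y Z \<Longrightarrow>
      g \<cdot> Scale M c f = Scale M c (g \<cdot> f)"

definition iso_in :: "('o, 'a, 'z) lincat_scheme \<Rightarrow> 'a \<Rightarrow> 'o \<Rightarrow> 'o \<Rightarrow> bool" where
  "iso_in M f X Y \<longleftrightarrow> f \<in> Hom M X Y \<and>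
    (\<exists>g \<in> Hom M Y X. g \<cdot>\<^bsub>M\<^esub> f = Ident M X \<and> f \<cdot>\<^bsub>M\<^esub> g = Ident M Y)"

definition isomorphic :: "('o, 'a, 'z) lincat_scheme \<Rightarrow> 'o \<Rightarrow> 'o \<Rightarrow> bool" where
  "isomorphic M X Y \<longleftrightarrow> (\<exists>f. iso_in M f X Y)"

definition zero_object :: "('o, 'a, 'z) lincat_scheme \<Rightarrow> 'o \<Rightarrow> bool" where
  "zero_object M X \<longleftrightarrow> X \<in> Obj M \<and> Ident M X = Null M X X"

text \<open>\<open>direct_sum M S Xs\<close>: the object \<open>S\<close> is a biproduct of the (possibly empty) list \<open>Xs\<close>.
  For the empty list this says that \<open>S\<close> is a zero object.\<close>

definition direct_sum :: "('o, 'a, 'z) lincat_scheme \<Rightarrow> 'o \<Rightarrow> 'o list \<Rightarrow> bool" where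
  "direct_sum M S Xs \<longleftrightarrow> S \<in> Obj M \<and> set Xs \<subseteq> Obj M \<and>
    (\<exists>\<iota> \<pi>.
      (\<forall>i < length Xs. \<iota> i \<in> Hom M (Xs ! i) S \<and> \<pi> i \<in> Hom M S (Xs ! i)) \<and>
      (\<forall>i < length Xs. \<forall>j < length Xs.
        \<pi> i \<cdot>\<^bsub>M\<^esub> \<iota> j = (if i = j then Ident M (Xs ! i) else Null M (Xs ! j) (Xs ! i))) \<and>
      finsum (hom_space M S S) (\<lambda>i. \<iota> i \<cdot>\<^bsub>M\<^esub> \<pi> i) {..<length Xs} = Ident M S)"

definition has_direct_sums :: "('o, 'a, 'z) lincat_scheme \<Rightarrow> bool" where
  "has_direct_sums M \<longleftrightarrow> (\<forall>Xs. set Xs \<subseteq> Obj M \<longrightarrow> (\<exists>S. direct_sum M S Xs))"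

definition idempotent_split :: "('o, 'a, 'z) lincat_scheme \<Rightarrow> bool" where
  "idempotent_split M \<longleftrightarrow>
    (\<forall>X \<in> Obj M. \<forall>e \<in> Hom M X X. e \<cdot>\<^bsub>M\<^esub> e = e \<longrightarrow>
      (\<exists>Y \<in> Obj M. \<exists>p \<in> Hom M X Y. \<exists>i \<in> Hom M Y X.
        i \<cdot>\<^bsub>M\<^esub> p = e \<and> p \<cdot>\<^bsub>M\<^esub> i = Ident M Y))"

text \<open>The endomorphism ring of \<open>X\<close> is local: it is non-zero and its non-units are closed under
  addition.\<close>

definition local_endomorphisms :: "('o, 'a, 'z) lincat_scheme \<Rightarrow> 'o \<Rightarrow> bool" where
  "local_endomorphisms M X \<longleftrightarrow> X \<in> Obj M \<and> \<not> zero_object M X \<and>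
    (\<forall>f \<in> Hom M X X. \<forall>g \<in> Hom M X X.
      \<not> iso_in M f X X \<longrightarrow> \<not> iso_in M g X X \<longrightarrow> \<not> iso_in M (f \<boxplus>\<^bsub>M\<^esub> g) X X)"

definition krull_schmidt :: "('o, 'a, 'z) lincat_scheme \<Rightarrow> bool" where
  "krull_schmidt M \<longleftrightarrow>
    (\<forall>X \<in> Obj M. \<exists>Xs. direct_sum M X Xs \<and> (\<forall>Y \<in> set Xs. local_endomorphisms M Y))"

definition indecomposable :: "('o, 'a, 'z) lincat_scheme \<Rightarrow> 'o \<Rightarrow> bool" where
  "indecomposable M X \<longleftrightarrow> X \<in> Obj M \<and> \<not> zero_object M X \<and>
    (\<forall>Y Z. direct_sum M X [Y, Z] \<longrightarrow> zero_object M Y \<or> zero_object M Z)"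

definition locally_finitary :: "('o, 'a, 'z) lincat_scheme \<Rightarrow> bool" where
  "locally_finitary M \<longleftrightarrow>
    linear_category M \<and> has_direct_sums M \<and> idempotent_split M \<and> krull_schmidt M \<and>
    (\<exists>S. countable S \<and> (\<forall>X. indecomposable M X \<longrightarrow> (\<exists>Y \<in> S. isomorphic M X Y))) \<and>
    (\<forall>X \<in> Obj M. \<forall>Y \<in> Obj M. vectorspace.fin_dim class_ring (hom_space M X Y))"

definition weak_kernel :: "('o, 'a, 'z) lincat_scheme \<Rightarrow> 'a \<Rightarrow> 'a \<Rightarrow> bool" where
  "weak_kernel M f k \<longleftrightarrow>
    k \<in> Hom M (Dom M k) (Dom M f) \<and> f \<cdot>\<^bsub>M\<^esub> k = Null M (Dom M k) (Cod M f) \<and>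
    (\<forall>Z \<in> Obj M. \<forall>g \<in> Hom M Z (Dom M f). f \<cdot>\<^bsub>M\<^esub> g = Null M Z (Cod M f) \<longrightarrow>
      (\<exists>h \<in> Hom M Z (Dom M k). k \<cdot>\<^bsub>M\<^esub> h = g))"

definition admissible :: "('o, 'a, 'z) lincat_scheme \<Rightarrow> bool" where
  "admissible M \<longleftrightarrow> (\<forall>f \<in> Arr M. \<exists>k. weak_kernel M f k)"

locale linear_functor =
  M: linear_category M + N: linear_category N
  for M :: "('o, 'a, 'z) lincat_scheme" and N :: "('p, 'b, 'y) lincat_scheme" +
  fixes Fo :: "'o \<Rightarrow> 'p" and Fa :: "'a \<Rightarrow> 'b"
  assumes obj: "X \<in> Obj M \<Longrightarrow> Fo X \<in> Obj N"
    and arr: "f \<in> Hom M X Y \<Longrightarrow> Fa f \<in> Hom N (Fo X) (Fo Y)"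
    and ident: "X \<in> Obj M \<Longrightarrow> Fa (Ident M X) = Ident N (Fo X)"
    and comp: "f \<in> Hom M X Y \<Longrightarrow> g \<in> Hom M Y Z \<Longrightarrow> Fa (g \<cdot>\<^bsub>M\<^esub> f) = Fa g \<cdot>\<^bsub>N\<^esub> Fa f"
    and plus: "f \<in> Hom M X Y \<Longrightarrow> g \<in> Hom M X Y \<Longrightarrow> Fa (f \<boxplus>\<^bsub>M\<^esub> g) = Fa f \<boxplus>\<^bsub>N\<^esub> Fa g"
    and scale: "f \<in> Hom M X Y \<Longrightarrow> Fa (Scale M c f) = Scale N c (Fa f)"

definition naturally_isomorphic ::
  "('o, 'a, 'z) lincat_scheme \<Rightarrow> ('p, 'b, 'y) lincat_scheme \<Rightarrow>
    ('o \<Rightarrow> 'p) \<Rightarrow> ('a \<Rightarrow> 'b) \<Rightarrow> ('o \<Rightarrow> 'p) \<Rightarrow> ('a \<Rightarrow> 'b) \<Rightarrow> bool" where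
  "naturally_isomorphic M N Fo Fa Go Ga \<longleftrightarrow>
    (\<exists>\<tau>. (\<forall>X \<in> Obj M. iso_in N (\<tau> X) (Fo X) (Go X)) \<and>
      (\<forall>X \<in> Obj M. \<forall>Y \<in> Obj M. \<forall>f \<in> Hom M X Y. \<tau> Y \<cdot>\<^bsub>N\<^esub> Fa f = Ga f \<cdot>\<^bsub>N\<^esub> \<tau> X))"

definition equivalence_functor ::
  "('o, 'a, 'z) lincat_scheme \<Rightarrow> ('p, 'b, 'y) lincat_scheme \<Rightarrow>
    ('o \<Rightarrow> 'p) \<Rightarrow> ('a \<Rightarrow> 'b) \<Rightarrow> bool" where
  "equivalence_functor M N Fo Fa \<longleftrightarrow> linear_functor M N Fo Fa \<and>
    (\<exists>Go Ga. linear_functor N M Go Ga \<and>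
      naturally_isomorphic M M (Go \<circ> Fo) (Ga \<circ> Fa) id id \<and>
      naturally_isomorphic N N (Fo \<circ> Go) (Fa \<circ> Ga) id id)"


section \<open>Monoidal categories and module categories\<close>

record ('o, 'a) moncat = "('o, 'a) lincat" +
  tens_obj :: "'o \<Rightarrow> 'o \<Rightarrow> 'o"  (infixr \<open>\<otimes>\<^sub>o\<index>\<close> 75)
  tens_arr :: "'a \<Rightarrow> 'a \<Rightarrow> 'a"  (infixr \<open>\<otimes>\<^sub>a\<index>\<close> 75)
  tens_unit :: "'o"
  associator :: "'o \<Rightarrow> 'o \<Rightarrow> 'o \<Rightarrow> 'a"
  lunit :: "'o \<Rightarrow> 'a"
  runit :: "'o \<Rightarrow> 'a"

locale linear_monoidal_category = linear_category C
  for C :: "('o, 'a, 'z) moncat_scheme" (structure) +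
  assumes unit_obj: "tens_unit C \<in> Obj C"
    and tens_obj: "U \<in> Obj C \<Longrightarrow> V \<in> Obj C \<Longrightarrow> U \<otimes>\<^sub>o V \<in> Obj C"
    and tens_arr: "f \<in> Hom C U U' \<Longrightarrow> g \<in> Hom C V V' \<Longrightarrow>
      f \<otimes>\<^sub>a g \<in> Hom C (U \<otimes>\<^sub>o V) (U' \<otimes>\<^sub>o V')"
    and tens_ident: "U \<in> Obj C \<Longrightarrow> V \<in> Obj C \<Longrightarrow>
      Ident C U \<otimes>\<^sub>a Ident C V = Ident C (U \<otimes>\<^sub>o V)"
    and tens_comp: "f \<in> Hom C U U' \<Longrightarrow> f' \<in> Hom C U' U'' \<Longrightarrow> g \<in> Hom C V V' \<Longrightarrow>
      g' \<in> Hom C V' V'' \<Longrightarrow> (f' \<cdot> f) \<otimes>\<^sub>a (g' \<cdot> g) = (f' \<otimes>\<^sub>a g') \<cdot> (f \<otimes>\<^sub>a g)"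
    and tens_plus_left: "f \<in> Hom C U U' \<Longrightarrow> f' \<in> Hom C U U' \<Longrightarrow> g \<in> Hom C V V' \<Longrightarrow>
      (f \<boxplus> f') \<otimes>\<^sub>a g = (f \<otimes>\<^sub>a g) \<boxplus> (f' \<otimes>\<^sub>a g)"
    and tens_plus_right: "f \<in> Hom C U U' \<Longrightarrow> g \<in> Hom C V V' \<Longrightarrow> g' \<in> Hom C V V' \<Longrightarrow>
      f \<otimes>\<^sub>a (g \<boxplus> g') = (f \<otimes>\<^sub>a g) \<boxplus> (f \<otimes>\<^sub>a g')"
    and tens_scale_left: "f \<in> Hom C U U' \<Longrightarrow> g \<in> Hom C V V' \<Longrightarrow>
      Scale C c f \<otimes>\<^sub>a g = Scale C c (f \<otimes>\<^sub>a g)"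
    and tens_scale_right: "f \<in> Hom C U U' \<Longrightarrow> g \<in> Hom C V V' \<Longrightarrow>
      f \<otimes>\<^sub>a Scale C c g = Scale C c (f \<otimes>\<^sub>a g)"
    and associator_iso: "U \<in> Obj C \<Longrightarrow> V \<in> Obj C \<Longrightarrow> W \<in> Obj C \<Longrightarrow>
      iso_in C (associator C U V W) ((U \<otimes>\<^sub>o V) \<otimes>\<^sub>o W) (U \<otimes>\<^sub>o (V \<otimes>\<^sub>o W))"
    and associator_natural: "f \<in> Hom C U U' \<Longrightarrow> g \<in> Hom C V V' \<Longrightarrow> h \<in> Hom C W W' \<Longrightarrow>
      associator C U' V' W' \<cdot> ((f \<otimes>\<^sub>a g) \<otimes>\<^sub>a h) = (f \<otimes>\<^sub>a (g \<otimes>\<^sub>a h)) \<cdot> associator C U V W"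
    and lunit_iso: "V \<in> Obj C \<Longrightarrow> iso_in C (lunit C V) (tens_unit C \<otimes>\<^sub>o V) V"
    and lunit_natural: "f \<in> Hom C V W \<Longrightarrow>
      lunit C W \<cdot> (Ident C (tens_unit C) \<otimes>\<^sub>a f) = f \<cdot> lunit C V"
    and runit_iso: "V \<in> Obj C \<Longrightarrow> iso_in C (runit C V) (V \<otimes>\<^sub>o tens_unit C) V"
    and runit_natural: "f \<in> Hom C V W \<Longrightarrow>
      runit C W \<cdot> (f \<otimes>\<^sub>a Ident C (tens_unit C)) = f \<cdot> runit C V"
    and pentagon: "U \<in> Obj C \<Longrightarrow> V \<in> Obj C \<Longrightarrow> W \<in> Obj C \<Longrightarrow> T \<in> Obj C \<Longrightarrow>
      associator C U V (W \<otimes>\<^sub>o T) \<cdot> associator C (U \<otimes>\<^sub>o V) W T =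
      (Ident C U \<otimes>\<^sub>a associator C V W T) \<cdot> associator C U (V \<otimes>\<^sub>o W) T \<cdot>
        (associator C U V W \<otimes>\<^sub>a Ident C T)"
    and triangle: "U \<in> Obj C \<Longrightarrow> V \<in> Obj C \<Longrightarrow>
      (Ident C U \<otimes>\<^sub>a lunit C V) \<cdot> associator C U (tens_unit C) V = runit C U \<otimes>\<^sub>a Ident C V"

text \<open>A linear category with an action of a monoidal category, written \<open>V \<star>\<^sub>o X\<close> on objects and
  \<open>f \<star>\<^sub>a g\<close> on arrows; \<open>act_assoc M V W X\<close> goes from \<open>(V \<otimes> W) \<star> X\<close> to \<open>V \<star> (W \<star> X)\<close>, and
  \<open>act_unit M X\<close> from \<open>1 \<star> X\<close> to \<open>X\<close>.\<close>

record ('v, 'c, 'o, 'a) modcat = "('o, 'a) lincat" +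
  act_obj :: "'v \<Rightarrow> 'o \<Rightarrow> 'o"  (infixr \<open>\<star>\<^sub>o\<index>\<close> 75)
  act_arr :: "'c \<Rightarrow> 'a \<Rightarrow> 'a"  (infixr \<open>\<star>\<^sub>a\<index>\<close> 75)
  act_assoc :: "'v \<Rightarrow> 'v \<Rightarrow> 'o \<Rightarrow> 'a"
  act_unit :: "'o \<Rightarrow> 'a"

locale module_category =
  C: linear_monoidal_category C + M: linear_category M
  for C :: "('v, 'c, 'y) moncat_scheme" (structure)
    and M :: "('v, 'c, 'o, 'a, 'z) modcat_scheme" (structure) +
  assumes act_obj: "V \<in> Obj C \<Longrightarrow> X \<in> Obj M \<Longrightarrow> V \<star>\<^sub>o\<^bsub>M\<^esub> X \<in> Obj M"
    and act_arr: "f \<in> Hom C V W \<Longrightarrow> g \<in> Hom M X Y \<Longrightarrow>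
      f \<star>\<^sub>a\<^bsub>M\<^esub> g \<in> Hom M (V \<star>\<^sub>o\<^bsub>M\<^esub> X) (W \<star>\<^sub>o\<^bsub>M\<^esub> Y)"
    and act_ident: "V \<in> Obj C \<Longrightarrow> X \<in> Obj M \<Longrightarrow>
      Ident C V \<star>\<^sub>a\<^bsub>M\<^esub> Ident M X = Ident M (V \<star>\<^sub>o\<^bsub>M\<^esub> X)"
    and act_comp: "f \<in> Hom C U V \<Longrightarrow> f' \<in> Hom C V W \<Longrightarrow> g \<in> Hom M X Y \<Longrightarrow> g' \<in> Hom M Y Z \<Longrightarrow>
      (f' \<cdot>\<^bsub>C\<^esub> f) \<star>\<^sub>a\<^bsub>M\<^esub> (g' \<cdot>\<^bsub>M\<^esub> g) = (f' \<star>\<^sub>a\<^bsub>M\<^esub> g') \<cdot>\<^bsub>M\<^esub> (f \<star>\<^sub>a\<^bsub>M\<^esub> g)"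
    and act_plus_left: "f \<in> Hom C V W \<Longrightarrow> f' \<in> Hom C V W \<Longrightarrow> g \<in> Hom M X Y \<Longrightarrow>
      (f \<boxplus>\<^bsub>C\<^esub> f') \<star>\<^sub>a\<^bsub>M\<^esub> g = (f \<star>\<^sub>a\<^bsub>M\<^esub> g) \<boxplus>\<^bsub>M\<^esub> (f' \<star>\<^sub>a\<^bsub>M\<^esub> g)"
    and act_plus_right: "f \<in> Hom C V W \<Longrightarrow> g \<in> Hom M X Y \<Longrightarrow> g' \<in> Hom M X Y \<Longrightarrow>
      f \<star>\<^sub>a\<^bsub>M\<^esub> (g \<boxplus>\<^bsub>M\<^esub> g') = (f \<star>\<^sub>a\<^bsub>M\<^esub> g) \<boxplus>\<^bsub>M\<^esub> (f \<star>\<^sub>a\<^bsub>M\<^esub> g')"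
    and act_scale_left: "f \<in> Hom C V W \<Longrightarrow> g \<in> Hom M X Y \<Longrightarrow>
      Scale C c f \<star>\<^sub>a\<^bsub>M\<^esub> g = Scale M c (f \<star>\<^sub>a\<^bsub>M\<^esub> g)"
    and act_scale_right: "f \<in> Hom C V W \<Longrightarrow> g \<in> Hom M X Y \<Longrightarrow>
      f \<star>\<^sub>a\<^bsub>M\<^esub> Scale M c g = Scale M c (f \<star>\<^sub>a\<^bsub>M\<^esub> g)"
    and act_assoc_iso: "V \<in> Obj C \<Longrightarrow> W \<in> Obj C \<Longrightarrow> X \<in> Obj M \<Longrightarrow>
      iso_in M (act_assoc M V W X) ((V \<otimes>\<^sub>o\<^bsub>C\<^esub> W) \<star>\<^sub>o\<^bsub>M\<^esub> X) (V \<star>\<^sub>o\<^bsub>M\<^esub> (W \<star>\<^sub>o\<^bsub>M\<^esub> X))"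
    and act_assoc_natural: "f \<in> Hom C V V' \<Longrightarrow> f' \<in> Hom C W W' \<Longrightarrow> g \<in> Hom M X X' \<Longrightarrow>
      act_assoc M V' W' X' \<cdot>\<^bsub>M\<^esub> ((f \<otimes>\<^sub>a\<^bsub>C\<^esub> f') \<star>\<^sub>a\<^bsub>M\<^esub> g) =
      (f \<star>\<^sub>a\<^bsub>M\<^esub> (f' \<star>\<^sub>a\<^bsub>M\<^esub> g)) \<cdot>\<^bsub>M\<^esub> act_assoc M V W X"
    and act_unit_iso: "X \<in> Obj M \<Longrightarrow> iso_in M (act_unit M X) (tens_unit C \<star>\<^sub>o\<^bsub>M\<^esub> X) X"
    and act_unit_natural: "g \<in> Hom M X Y \<Longrightarrow>
      act_unit M Y \<cdot>\<^bsub>M\<^esub> (Ident C (tens_unit C) \<star>\<^sub>a\<^bsub>M\<^esub> g) = g \<cdot>\<^bsub>M\<^esub> act_unit M X"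
    and act_pentagon: "U \<in> Obj C \<Longrightarrow> V \<in> Obj C \<Longrightarrow> W \<in> Obj C \<Longrightarrow> X \<in> Obj M \<Longrightarrow>
      act_assoc M U V (W \<star>\<^sub>o\<^bsub>M\<^esub> X) \<cdot>\<^bsub>M\<^esub> act_assoc M (U \<otimes>\<^sub>o\<^bsub>C\<^esub> V) W X =
      (Ident C U \<star>\<^sub>a\<^bsub>M\<^esub> act_assoc M V W X) \<cdot>\<^bsub>M\<^esub> act_assoc M U (V \<otimes>\<^sub>o\<^bsub>C\<^esub> W) X \<cdot>\<^bsub>M\<^esub>
        (associator C U V W \<star>\<^sub>a\<^bsub>M\<^esub> Ident M X)"
    and act_triangle: "V \<in> Obj C \<Longrightarrow> X \<in> Obj M \<Longrightarrow>
      (Ident C V \<star>\<^sub>a\<^bsub>M\<^esub> act_unit M X) \<cdot>\<^bsub>M\<^esub> act_assoc M V (tens_unit C) X =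
      runit C V \<star>\<^sub>a\<^bsub>M\<^esub> Ident M X"

definition invariant_ideal ::
  "('v, 'c, 'y) moncat_scheme \<Rightarrow> ('v, 'c, 'o, 'a, 'z) modcat_scheme \<Rightarrow> 'a set \<Rightarrow> bool" where
  "invariant_ideal C M I \<longleftrightarrow> I \<subseteq> Arr M \<and>
    (\<forall>X \<in> Obj M. \<forall>Y \<in> Obj M.
      VectorSpace.subspace class_ring (I \<inter> Hom M X Y) (hom_space M X Y)) \<and>
    (\<forall>f \<in> I. \<forall>g \<in> Arr M. Dom M g = Cod M f \<longrightarrow> g \<cdot>\<^bsub>M\<^esub> f \<in> I) \<and>
    (\<forall>f \<in> I. \<forall>g \<in> Arr M. Cod M g = Dom M f \<longrightarrow> f \<cdot>\<^bsub>M\<^esub> g \<in> I) \<and>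
    (\<forall>f \<in> I. \<forall>V \<in> Obj C. Ident C V \<star>\<^sub>a\<^bsub>M\<^esub> f \<in> I)"

definition simple_transitive ::
  "('v, 'c, 'y) moncat_scheme \<Rightarrow> ('v, 'c, 'o, 'a, 'z) modcat_scheme \<Rightarrow> bool" where
  "simple_transitive C M \<longleftrightarrow>
    (\<forall>I. invariant_ideal C M I \<longrightarrow>
      I = {Null M X Y | X Y. X \<in> Obj M \<and> Y \<in> Obj M} \<or> I = Arr M)"

text \<open>A module functor is a linear functor \<open>F\<close> with coherent natural isomorphisms \<open>s V X\<close> from
  \<open>F (V \<star> X)\<close> to \<open>V \<star> F X\<close>.\<close>

locale module_functor =
  M: module_category C M + N: module_category C N + linear_functor M N Fo Fa
  for C :: "('v, 'c, 'y) moncat_scheme"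
    and M :: "('v, 'c, 'o, 'a, 'z) modcat_scheme"
    and N :: "('v, 'c, 'p, 'b, 'x) modcat_scheme"
    and Fo :: "'o \<Rightarrow> 'p" and Fa :: "'a \<Rightarrow> 'b" +
  fixes s :: "'v \<Rightarrow> 'o \<Rightarrow> 'b"
  assumes s_iso: "V \<in> Obj C \<Longrightarrow> X \<in> Obj M \<Longrightarrow>
      iso_in N (s V X) (Fo (V \<star>\<^sub>o\<^bsub>M\<^esub> X)) (V \<star>\<^sub>o\<^bsub>N\<^esub> Fo X)"
    and s_natural: "f \<in> Hom C V W \<Longrightarrow> g \<in> Hom M X Y \<Longrightarrow>
      s W Y \<cdot>\<^bsub>N\<^esub> Fa (f \<star>\<^sub>a\<^bsub>M\<^esub> g) = (f \<star>\<^sub>a\<^bsub>N\<^esub> Fa g) \<cdot>\<^bsub>N\<^esub> s V X"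
    and s_assoc: "V \<in> Obj C \<Longrightarrow> W \<in> Obj C \<Longrightarrow> X \<in> Obj M \<Longrightarrow>
      act_assoc N V W (Fo X) \<cdot>\<^bsub>N\<^esub> s (V \<otimes>\<^sub>o\<^bsub>C\<^esub> W) X =
      (Ident C V \<star>\<^sub>a\<^bsub>N\<^esub> s W X) \<cdot>\<^bsub>N\<^esub> s V (W \<star>\<^sub>o\<^bsub>M\<^esub> X) \<cdot>\<^bsub>N\<^esub> Fa (act_assoc M V W X)"
    and s_unit: "X \<in> Obj M \<Longrightarrow>
      act_unit N (Fo X) \<cdot>\<^bsub>N\<^esub> s (tens_unit C) X = Fa (act_unit M X)"

definition module_equivalent ::
  "('v, 'c, 'y) moncat_scheme \<Rightarrow> ('v, 'c, 'o, 'a, 'z) modcat_scheme \<Rightarrow>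
    ('v, 'c, 'p, 'b, 'x) modcat_scheme \<Rightarrow> bool" where
  "module_equivalent C M N \<longleftrightarrow>
    (\<exists>Fo Fa s. module_functor C M N Fo Fa s \<and> equivalence_functor M N Fo Fa)"


section \<open>Finite dimensional modules over \<open>sl\<^sub>2\<close>\<close>

definition sl2 :: "complex mat set" where
  "sl2 = {A \<in> carrier_mat 2 2. A $$ (0, 0) + A $$ (1, 1) = 0}"

definition bracket :: "complex mat \<Rightarrow> complex mat \<Rightarrow> complex mat" where
  "bracket A B = A * B - B * A"

text \<open>A finite dimensional module is given on the underlying space \<open>\<complex>\<^sup>n\<close>, as a pair of \<open>n\<close> and a
  homomorphism of Lie algebras from \<open>sl2\<close> to the \<open>n \<times> n\<close> matrices. The
  homomorphism is extensional, so that equality of pairs is equality of modules.\<close>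

type_synonym sl2_module = "nat \<times> (complex mat \<Rightarrow> complex mat)"

definition sl2_modules :: "sl2_module set" where
  "sl2_modules = {(n, \<rho>). \<rho> \<in> sl2 \<rightarrow>\<^sub>E carrier_mat n n \<and>
    (\<forall>A \<in> sl2. \<forall>B \<in> sl2. \<rho> (A + B) = \<rho> A + \<rho> B) \<and>
    (\<forall>c. \<forall>A \<in> sl2. \<rho> (c \<cdot>\<^sub>m A) = c \<cdot>\<^sub>m \<rho> A) \<and>
    (\<forall>A \<in> sl2. \<forall>B \<in> sl2. \<rho> (bracket A B) = bracket (\<rho> A) (\<rho> B))}"

text \<open>A homomorphism from \<open>V\<close> to \<open>W\<close> is recorded as \<open>(V, W, T)\<close>.\<close>

type_synonym sl2_hom = "sl2_module \<times> sl2_module \<times> complex mat"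

definition sl2_homs :: "sl2_hom set" where
  "sl2_homs = {(V, W, T). V \<in> sl2_modules \<and> W \<in> sl2_modules \<and>
    T \<in> carrier_mat (fst W) (fst V) \<and> (\<forall>A \<in> sl2. T * snd V A = snd W A * T)}"

text \<open>The Kronecker product, which is the tensor product of linear maps when
  \<open>\<complex>\<^sup>m \<otimes> \<complex>\<^sup>n\<close> is identified with \<open>\<complex>\<^sup>m\<^sup>n\<close> by the lexicographic order of the basis
  \<open>e\<^sub>i \<otimes> e\<^sub>j\<close>. With this identification the tensor product is strictly associative and unital.\<close>

definition kron :: "complex mat \<Rightarrow> complex mat \<Rightarrow> complex mat" where
  "kron A B = mat (dim_row A * dim_row B) (dim_col A * dim_col B)
    (\<lambda>(i, j). A $$ (i div dim_row B, j div dim_col B) * B $$ (i mod dim_row B, j mod dim_col B))"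

definition tensor_module :: "sl2_module \<Rightarrow> sl2_module \<Rightarrow> sl2_module" where
  "tensor_module V W = (fst V * fst W,
    \<lambda>A \<in> sl2. kron (snd V A) (1\<^sub>m (fst W)) + kron (1\<^sub>m (fst V)) (snd W A))"

definition trivial_module :: sl2_module where
  "trivial_module = (1, \<lambda>A \<in> sl2. 0\<^sub>m 1 1)"

definition sl2_cat :: "(sl2_module, sl2_hom) moncat" where
  "sl2_cat =
    \<lparr>Obj = sl2_modules,
     Arr = sl2_homs,
     Dom = (\<lambda>(V, W, T). V),
     Cod = (\<lambda>(V, W, T). W),
     Ident = (\<lambda>V. (V, V, 1\<^sub>m (fst V))),
     Comp = (\<lambda>(V', W', T') (V, W, T). (V, W', T' * T)),
     Plus = (\<lambda>(V, W, T) (V', W', T'). (V, W, T + T')),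
     Scale = (\<lambda>c (V, W, T). (V, W, c \<cdot>\<^sub>m T)),
     Null = (\<lambda>V W. (V, W, 0\<^sub>m (fst W) (fst V))),
     tens_obj = tensor_module,
     tens_arr = (\<lambda>(V, W, T) (V', W', T'). (tensor_module V V', tensor_module W W', kron T T')),
     tens_unit = trivial_module,
     associator = (\<lambda>U V W. (tensor_module (tensor_module U V) W, tensor_module U (tensor_module V W),
       1\<^sub>m (fst U * fst V * fst W))),
     lunit = (\<lambda>V. (tensor_module trivial_module V, V, 1\<^sub>m (fst V))),
     runit = (\<lambda>V. (tensor_module V trivial_module, V, 1\<^sub>m (fst V)))\<rparr>"

text \<open>\<open>L(1)\<close> is the natural representation on \<open>\<complex>\<^sup>2\<close>.\<close>

definition L1 :: sl2_module where
  "L1 = (2, \<lambda>A \<in> sl2. A)"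

definition type_A_infinity :: "(sl2_module, sl2_hom, 'o, 'a, 'z) modcat_scheme \<Rightarrow> bool" where
  "type_A_infinity M \<longleftrightarrow>
    (\<exists>X :: nat \<Rightarrow> 'o.
      (\<forall>i. indecomposable M (X i)) \<and>
      (\<forall>Y. indecomposable M Y \<longrightarrow> (\<exists>i. isomorphic M Y (X i))) \<and>
      (\<forall>i j. isomorphic M (X i) (X j) \<longrightarrow> i = j) \<and>
      isomorphic M (L1 \<star>\<^sub>o\<^bsub>M\<^esub> X 0) (X 1) \<and>
      (\<forall>i \<ge> 1. direct_sum M (L1 \<star>\<^sub>o\<^bsub>M\<^esub> X i) [X (i - 1), X (i + 1)]))"


section \<open>The category of modules is a linear monoidal category\<close>

lemma kron_carrier [simp]:
  "A \<in> carrier_mat m n \<Longrightarrow> B \<in> carrier_mat p q \<Longrightarrow> kron A B \<in> carrier_mat (m * p) (n * q)"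
  by (auto simp: kron_def)

lemma kron_dim [simp]: "dim_row (kron A B) = dim_row A * dim_row B"
  "dim_col (kron A B) = dim_col A * dim_col B"
  by (auto simp: kron_def)

lemma div_mod_less: "i < m * n \<Longrightarrow> i div n < m \<and> i mod n < (n::nat)"
  by (metis less_mult_imp_div_less mod_less_divisor mult_0_right not_gr_zero not_less_zero)

lemma kron_index: "i < dim_row A * dim_row B \<Longrightarrow> j < dim_col A * dim_col B \<Longrightarrow>
  kron A B $$ (i, j) = A $$ (i div dim_row B, j div dim_col B) * B $$ (i mod dim_row B, j mod dim_col B)"
  by (auto simp: kron_def)

lemma sum_lex: "(\<Sum>i<m * n. f (i div n) (i mod n)) = (\<Sum>i<m. \<Sum>j<(n::nat). (f i j :: complex))"
proof -
  have "(\<Sum>i<m * n. f (i div n) (i mod n)) = (\<Sum>x<m. \<Sum>i = x * n..<x * n + n. f (i div n) (i mod n))"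
    by (simp add: sum.nat_group)
  also have "\<dots> = (\<Sum>x<m. \<Sum>j<n. f x j)"
  proof (rule sum.cong)
    fix x
    have "(\<Sum>i = x * n..<x * n + n. f (i div n) (i mod n)) =
      (\<Sum>j<n. f ((j + x * n) div n) ((j + x * n) mod n))"
      using sum.shift_bounds_nat_ivl[of "\<lambda>i. f (i div n) (i mod n)" 0 "x * n" n]
      by (simp add: lessThan_atLeast0 add.commute)
    also have "\<dots> = (\<Sum>j<n. f x j)" by (rule sum.cong) auto
    finally show "(\<Sum>i = x * n..<x * n + n. f (i div n) (i mod n)) = (\<Sum>j<n. f x j)" .
  qed simp
  finally show ?thesis .
qed

lemma kron_mult:
  assumes "A \<in> carrier_mat a b" "A' \<in> carrier_mat b c" "B \<in> carrier_mat p q" "B' \<in> carrier_mat q r"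
  shows "kron (A * A') (B * B') = kron A B * kron A' B'"
proof (rule eq_matI)
  fix i j assume "i < dim_row (kron A B * kron A' B')" "j < dim_col (kron A B * kron A' B')"
  with assms have i: "i < a * p" and j: "j < c * r" by auto
  note d = div_mod_less[OF i] div_mod_less[OF j]
  have "(kron A B * kron A' B') $$ (i, j) = (\<Sum>k<b * q. kron A B $$ (i, k) * kron A' B' $$ (k, j))"
    using assms i j by (auto simp: scalar_prod_def lessThan_atLeast0 intro!: sum.cong)
  also have "\<dots> = (\<Sum>k<b * q. (\<lambda>x y. A $$ (i div p, x) * A' $$ (x, j div r) *
      (B $$ (i mod p, y) * B' $$ (y, j mod r))) (k div q) (k mod q))"
    using assms i j by (intro sum.cong) (auto simp: kron_index)
  also have "\<dots> = (\<Sum>x<b. A $$ (i div p, x) * A' $$ (x, j div r)) * (\<Sum>y<q. B $$ (i mod p, y) * B' $$ (y, j mod r))"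
    by (subst sum_lex) (simp add: sum_product)
  also have "\<dots> = (A * A') $$ (i div p, j div r) * (B * B') $$ (i mod p, j mod r)"
    using assms d by (auto simp: scalar_prod_def lessThan_atLeast0 intro!: sum.cong arg_cong2[of _ _ _ _ "(*)"])
  also have "\<dots> = kron (A * A') (B * B') $$ (i, j)"
    using assms i j by (auto simp: kron_index)
  finally show "kron (A * A') (B * B') $$ (i, j) = (kron A B * kron A' B') $$ (i, j)" by simp
qed (use assms in auto)

lemma kron_one [simp]: "kron (1\<^sub>m m) (1\<^sub>m n) = 1\<^sub>m (m * n)"
proof (rule eq_matI)
  fix i j assume "i < dim_row (1\<^sub>m (m * n))" "j < dim_col (1\<^sub>m (m * n))"
  hence i: "i < m * n" and j: "j < m * n" by auto
  have "i div n = j div n \<and> i mod n = j mod n \<longleftrightarrow> i = j" by (metis div_mult_mod_eq)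
  thus "kron (1\<^sub>m m) (1\<^sub>m n) $$ (i, j) = 1\<^sub>m (m * n) $$ (i, j)"
    using i j div_mod_less[OF i] div_mod_less[OF j] by (auto simp: kron_index)
qed auto

lemma kron_add_left:
  assumes "A \<in> carrier_mat m n" "A' \<in> carrier_mat m n"
  shows "kron (A + A') B = kron A B + kron A' B"
  using assms by (intro eq_matI) (auto simp: kron_index div_mod_less algebra_simps dest: div_mod_less)

lemma kron_add_right:
  assumes "B \<in> carrier_mat m n" "B' \<in> carrier_mat m n"
  shows "kron A (B + B') = kron A B + kron A B'"
  using assms by (intro eq_matI) (auto simp: kron_index div_mod_less algebra_simps dest: div_mod_less)

lemma kron_minus_left:
  assumes "A \<in> carrier_mat m n" "A' \<in> carrier_mat m n"
  shows "kron (A - A') B = kron A B - kron A' B"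
  using assms by (intro eq_matI) (auto simp: kron_index div_mod_less algebra_simps dest: div_mod_less)

lemma kron_minus_right:
  assumes "B \<in> carrier_mat m n" "B' \<in> carrier_mat m n"
  shows "kron A (B - B') = kron A B - kron A B'"
  using assms by (intro eq_matI) (auto simp: kron_index div_mod_less algebra_simps dest: div_mod_less)

lemma kron_smult_left: "kron (c \<cdot>\<^sub>m A) B = c \<cdot>\<^sub>m kron A B"
  by (intro eq_matI) (simp_all add: kron_index div_mod_less)

lemma kron_smult_right: "kron A (c \<cdot>\<^sub>m B) = c \<cdot>\<^sub>m kron A B"
  by (intro eq_matI) (simp_all add: kron_index div_mod_less)

lemma kron_assoc: "kron (kron A B) C = kron A (kron B C)"
proof (rule eq_matI)
  fix i j assume "i < dim_row (kron A (kron B C))" "j < dim_col (kron A (kron B C))"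
  hence i: "i < dim_row A * dim_row B * dim_row C" "i < dim_row A * (dim_row B * dim_row C)"
    and j: "j < dim_col A * dim_col B * dim_col C" "j < dim_col A * (dim_col B * dim_col C)"
    by (auto simp: mult.assoc)
  have e: "k div r div p = k div (p * r)" "k mod (p * r) div r = k div r mod p"
    "k mod (p * r) mod r = k mod r" if "k < l * (p * r)" for k p r l :: nat
  proof -
    have "r > 0" using that by (cases r) auto
    thus "k div r div p = k div (p * r)" "k mod (p * r) div r = k div r mod p"
      "k mod (p * r) mod r = k mod r"
      by (auto simp: div_mult2_eq[symmetric] mult.commute[of p r] mod_mult2_eq)
  qed
  show "kron (kron A B) C $$ (i, j) = kron A (kron B C) $$ (i, j)"
    using i j div_mod_less[OF i(1)] div_mod_less[OF i(2)] div_mod_less[OF j(1)] div_mod_less[OF j(2)]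
    by (simp add: kron_index e[OF i(2)] e[OF j(2)] mult.assoc)
qed (auto simp: mult.assoc)

lemma kron_unit_left: "kron (1\<^sub>m 1) A = A"
  by (rule eq_matI) (auto simp: kron_index)

lemma kron_unit_right: "kron A (1\<^sub>m 1) = A"
  by (rule eq_matI) (auto simp: kron_index)

lemma kron_zero_left: "kron (0\<^sub>m a b) A = 0\<^sub>m (a * dim_row A) (b * dim_col A)"
  by (rule eq_matI) (simp_all add: kron_index div_mod_less)

lemma kron_zero_right: "kron A (0\<^sub>m a b) = 0\<^sub>m (dim_row A * a) (dim_col A * b)"
  by (rule eq_matI) (simp_all add: kron_index div_mod_less)

lemma sl2_closed [simp]:
  "A \<in> sl2 \<Longrightarrow> B \<in> sl2 \<Longrightarrow> A + B \<in> sl2" "A \<in> sl2 \<Longrightarrow> c \<cdot>\<^sub>m A \<in> sl2"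
proof -
  show "A \<in> sl2 \<Longrightarrow> B \<in> sl2 \<Longrightarrow> A + B \<in> sl2" by (auto simp: sl2_def algebra_simps add_eq_0_iff)
  show "A \<in> sl2 \<Longrightarrow> c \<cdot>\<^sub>m A \<in> sl2" by (auto simp: sl2_def distrib_left[symmetric])
qed

lemma bracket_sl2 [simp]: "A \<in> sl2 \<Longrightarrow> B \<in> sl2 \<Longrightarrow> bracket A B \<in> sl2"
  by (auto simp: sl2_def bracket_def scalar_prod_def numeral_2_eq_2 algebra_simps)

lemma sl2_module_carrier: "V \<in> sl2_modules \<Longrightarrow> A \<in> sl2 \<Longrightarrow> snd V A \<in> carrier_mat (fst V) (fst V)"
  by (auto simp: sl2_modules_def)

lemma sl2_module_add: "V \<in> sl2_modules \<Longrightarrow> A \<in> sl2 \<Longrightarrow> B \<in> sl2 \<Longrightarrow> snd V (A + B) = snd V A + snd V B"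
  and sl2_module_smult: "V \<in> sl2_modules \<Longrightarrow> A \<in> sl2 \<Longrightarrow> snd V (c \<cdot>\<^sub>m A) = c \<cdot>\<^sub>m snd V A"
  and sl2_module_bracket: "V \<in> sl2_modules \<Longrightarrow> A \<in> sl2 \<Longrightarrow> B \<in> sl2 \<Longrightarrow>
    snd V (bracket A B) = bracket (snd V A) (snd V B)"
  by (auto simp: sl2_modules_def)

lemma sl2_module_ext: "V \<in> sl2_modules \<Longrightarrow> A \<notin> sl2 \<Longrightarrow> snd V A = undefined"
  by (auto simp: sl2_modules_def PiE_def extensional_def)

lemma fst_tensor [simp]: "fst (tensor_module V W) = fst V * fst W"
  by (simp add: tensor_module_def)

lemma snd_tensor: "A \<in> sl2 \<Longrightarrow> snd (tensor_module V W) A =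
  kron (snd V A) (1\<^sub>m (fst W)) + kron (1\<^sub>m (fst V)) (snd W A)"
  by (simp add: tensor_module_def)

lemma tensor_bracket:
  assumes "a \<in> carrier_mat m m" "b \<in> carrier_mat m m" "c \<in> carrier_mat n n" "d \<in> carrier_mat n n"
  shows "bracket (kron a (1\<^sub>m n) + kron (1\<^sub>m m) c) (kron b (1\<^sub>m n) + kron (1\<^sub>m m) d) =
    kron (bracket a b) (1\<^sub>m n) + kron (1\<^sub>m m) (bracket c d)"
proof -
  let ?N = "m * n"
  have p: "kron a (1\<^sub>m n) \<in> carrier_mat ?N ?N" "kron b (1\<^sub>m n) \<in> carrier_mat ?N ?N"
    "kron (1\<^sub>m m) c \<in> carrier_mat ?N ?N" "kron (1\<^sub>m m) d \<in> carrier_mat ?N ?N"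
    using assms by auto
  have e: "kron a (1\<^sub>m n) * kron b (1\<^sub>m n) = kron (a * b) (1\<^sub>m n)"
    "kron b (1\<^sub>m n) * kron a (1\<^sub>m n) = kron (b * a) (1\<^sub>m n)"
    "kron (1\<^sub>m m) c * kron (1\<^sub>m m) d = kron (1\<^sub>m m) (c * d)"
    "kron (1\<^sub>m m) d * kron (1\<^sub>m m) c = kron (1\<^sub>m m) (d * c)"
    "kron a (1\<^sub>m n) * kron (1\<^sub>m m) d = kron a d" "kron (1\<^sub>m m) d * kron a (1\<^sub>m n) = kron a d"
    "kron b (1\<^sub>m n) * kron (1\<^sub>m m) c = kron b c" "kron (1\<^sub>m m) c * kron b (1\<^sub>m n) = kron b c"
    using assms by (auto simp: kron_mult[symmetric, where a=m and b=m and c=m and p=n and q=n and r=n])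
  have q: "kron (a * b) (1\<^sub>m n) \<in> carrier_mat ?N ?N" "kron (b * a) (1\<^sub>m n) \<in> carrier_mat ?N ?N"
    "kron (1\<^sub>m m) (c * d) \<in> carrier_mat ?N ?N" "kron (1\<^sub>m m) (d * c) \<in> carrier_mat ?N ?N"
    "kron a d \<in> carrier_mat ?N ?N" "kron b c \<in> carrier_mat ?N ?N"
    using assms by auto
  have "bracket (kron a (1\<^sub>m n) + kron (1\<^sub>m m) c) (kron b (1\<^sub>m n) + kron (1\<^sub>m m) d) =
    (kron (a * b) (1\<^sub>m n) + kron b c + (kron a d + kron (1\<^sub>m m) (c * d)))
    - (kron (b * a) (1\<^sub>m n) + kron a d + (kron b c + kron (1\<^sub>m m) (d * c)))"
    unfolding bracket_def using p
    by (simp add: add_mult_distrib_mat[of _ ?N ?N] mult_add_distrib_mat[of _ ?N ?N] e)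
  also have "\<dots> = (kron (a * b) (1\<^sub>m n) - kron (b * a) (1\<^sub>m n)) + (kron (1\<^sub>m m) (c * d) - kron (1\<^sub>m m) (d * c))"
  proof -
    have "(P + Q + (R + S)) - (T + R + (Q + U)) = (P - T) + (S - U)"
      if "P \<in> carrier_mat ?N ?N" "Q \<in> carrier_mat ?N ?N" "R \<in> carrier_mat ?N ?N"
        "S \<in> carrier_mat ?N ?N" "T \<in> carrier_mat ?N ?N" "U \<in> carrier_mat ?N ?N"
      for P Q R S T U :: "complex mat"
      using that by (intro eq_matI) (auto simp: algebra_simps)
    thus ?thesis using q by blast
  qed
  also have "\<dots> = kron (bracket a b) (1\<^sub>m n) + kron (1\<^sub>m m) (bracket c d)"
  proof -
    have "a * b \<in> carrier_mat m m" "b * a \<in> carrier_mat m m" "c * d \<in> carrier_mat n n" "d * c \<in> carrier_mat n n"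
      using assms by auto
    thus ?thesis unfolding bracket_def using q
      by (simp add: kron_minus_left[of _ m m] kron_minus_right[of _ n n])
  qed
  finally show ?thesis .
qed

lemma tensor_module_closed [simp]:
  assumes V: "V \<in> sl2_modules" and W: "W \<in> sl2_modules"
  shows "tensor_module V W \<in> sl2_modules"
proof -
  note c = sl2_module_carrier[OF V] sl2_module_carrier[OF W]
  have "snd (tensor_module V W) \<in> sl2 \<rightarrow>\<^sub>E carrier_mat (fst V * fst W) (fst V * fst W)"
    using c by (auto simp: tensor_module_def)
  moreover have "snd (tensor_module V W) (A + B) = snd (tensor_module V W) A + snd (tensor_module V W) B"
    if A: "A \<in> sl2" and B: "B \<in> sl2" for A B
  proof -
    have "kron (snd V A) (1\<^sub>m (fst W)) \<in> carrier_mat (fst V * fst W) (fst V * fst W)"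
      "kron (snd V B) (1\<^sub>m (fst W)) \<in> carrier_mat (fst V * fst W) (fst V * fst W)"
      "kron (1\<^sub>m (fst V)) (snd W A) \<in> carrier_mat (fst V * fst W) (fst V * fst W)"
      "kron (1\<^sub>m (fst V)) (snd W B) \<in> carrier_mat (fst V * fst W) (fst V * fst W)"
      using c A B by auto
    thus ?thesis using c[OF A] c[OF B] A B
      by (simp add: snd_tensor sl2_module_add[OF V] sl2_module_add[OF W]
        kron_add_left[of _ "fst V" "fst V"] kron_add_right[of _ "fst W" "fst W"], intro eq_matI, auto)
  qed
  moreover have "snd (tensor_module V W) (k \<cdot>\<^sub>m A) = k \<cdot>\<^sub>m snd (tensor_module V W) A"
    if A: "A \<in> sl2" for A k
  proof -
    have "kron (snd V A) (1\<^sub>m (fst W)) \<in> carrier_mat (fst V * fst W) (fst V * fst W)"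
      "kron (1\<^sub>m (fst V)) (snd W A) \<in> carrier_mat (fst V * fst W) (fst V * fst W)"
      using c A by auto
    thus ?thesis using A
      by (simp add: snd_tensor sl2_module_smult[OF V] sl2_module_smult[OF W]
        kron_smult_left kron_smult_right add_smult_distrib_left_mat[of _ "fst V * fst W" "fst V * fst W"])
  qed
  moreover have "snd (tensor_module V W) (bracket A B) =
    bracket (snd (tensor_module V W) A) (snd (tensor_module V W) B)"
    if A: "A \<in> sl2" and B: "B \<in> sl2" for A B
    using A B tensor_bracket[OF c(1)[OF A] c(1)[OF B] c(2)[OF A] c(2)[OF B]]
    by (simp add: snd_tensor sl2_module_bracket[OF V] sl2_module_bracket[OF W])
  ultimately show ?thesis
    unfolding sl2_modules_def using fst_tensor[of V W] by (cases "tensor_module V W") auto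
qed

lemma trivial_module_closed [simp]: "trivial_module \<in> sl2_modules"
  by (auto simp: sl2_modules_def trivial_module_def) (auto simp: bracket_def)

lemma L1_closed: "L1 \<in> sl2_modules"
  by (auto simp: sl2_modules_def L1_def) (auto simp: sl2_def)

lemma tensor_module_assoc [simp]:
  assumes U: "U \<in> sl2_modules" and V: "V \<in> sl2_modules" and W: "W \<in> sl2_modules"
  shows "tensor_module (tensor_module U V) W = tensor_module U (tensor_module V W)"
proof (rule prod_eqI)
  show "snd (tensor_module (tensor_module U V) W) = snd (tensor_module U (tensor_module V W))"
  proof
    fix A show "snd (tensor_module (tensor_module U V) W) A = snd (tensor_module U (tensor_module V W)) A"
    proof (cases "A \<in> sl2")
      case A: True
      note c = sl2_module_carrier[OF U A] sl2_module_carrier[OF V A] sl2_module_carrier[OF W A]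
      let ?u = "fst U" and ?v = "fst V" and ?w = "fst W"
      have k: "kron (snd U A) (1\<^sub>m ?v) \<in> carrier_mat (?u * ?v) (?u * ?v)"
        "kron (1\<^sub>m ?u) (snd V A) \<in> carrier_mat (?u * ?v) (?u * ?v)"
        "kron (snd V A) (1\<^sub>m ?w) \<in> carrier_mat (?v * ?w) (?v * ?w)"
        "kron (1\<^sub>m ?v) (snd W A) \<in> carrier_mat (?v * ?w) (?v * ?w)"
        using c by auto
      have k': "kron (snd U A) (1\<^sub>m (?v * ?w)) \<in> carrier_mat (?u * (?v * ?w)) (?u * (?v * ?w))"
        "kron (1\<^sub>m ?u) (kron (snd V A) (1\<^sub>m ?w)) \<in> carrier_mat (?u * (?v * ?w)) (?u * (?v * ?w))"
        "kron (1\<^sub>m ?u) (kron (1\<^sub>m ?v) (snd W A)) \<in> carrier_mat (?u * (?v * ?w)) (?u * (?v * ?w))"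
        using k c by auto
      show ?thesis using A
        by (simp add: snd_tensor kron_add_left[OF k(1,2)] kron_add_right[OF k(3,4)]
          kron_assoc kron_one[symmetric] assoc_add_mat[OF k'[folded kron_one]] del: kron_one)
    qed (simp add: tensor_module_def)
  qed
qed (simp add: mult.assoc)

lemma tensor_trivial [simp]:
  assumes V: "V \<in> sl2_modules"
  shows "tensor_module trivial_module V = V" "tensor_module V trivial_module = V"
proof -
  have "snd (tensor_module trivial_module V) A = snd V A \<and> snd (tensor_module V trivial_module) A = snd V A" for A
  proof (cases "A \<in> sl2")
    case True
    with sl2_module_carrier[OF V True] show ?thesis
      by (auto simp: snd_tensor) (auto simp: trivial_module_def kron_unit_left[simplified]
        kron_unit_right[simplified] kron_zero_left kron_zero_right)
  qed (auto simp: tensor_module_def sl2_module_ext[OF V])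
  thus "tensor_module trivial_module V = V" "tensor_module V trivial_module = V"
    by (auto intro!: prod_eqI simp: trivial_module_def)
qed

lemma sl2_cat_simps [simp]:
  "Obj sl2_cat = sl2_modules" "Arr sl2_cat = sl2_homs" "Dom sl2_cat (V, W, T) = V"
  "Cod sl2_cat (V, W, T) = W" "Ident sl2_cat V = (V, V, 1\<^sub>m (fst V))"
  "Comp sl2_cat (V', W', T') (V, W, T) = (V, W', T' * T)"
  "Plus sl2_cat (V, W, T) (V', W', T') = (V, W, T + T')"
  "Scale sl2_cat c (V, W, T) = (V, W, c \<cdot>\<^sub>m T)"
  "Null sl2_cat V W = (V, W, 0\<^sub>m (fst W) (fst V))"
  "tens_obj sl2_cat = tensor_module"
  "tens_arr sl2_cat (V, W, T) (V', W', T') = (tensor_module V V', tensor_module W W', kron T T')"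
  "tens_unit sl2_cat = trivial_module"
  "associator sl2_cat U V W = (tensor_module (tensor_module U V) W, tensor_module U (tensor_module V W),
       1\<^sub>m (fst U * fst V * fst W))"
  "lunit sl2_cat V = (tensor_module trivial_module V, V, 1\<^sub>m (fst V))"
  "runit sl2_cat V = (tensor_module V trivial_module, V, 1\<^sub>m (fst V))"
  by (simp_all add: sl2_cat_def)

lemma Hom_sl2_cat: "f \<in> Hom sl2_cat V W \<longleftrightarrow> V \<in> sl2_modules \<and> W \<in> sl2_modules \<and>
  (\<exists>T. f = (V, W, T) \<and> T \<in> carrier_mat (fst W) (fst V) \<and> (\<forall>A \<in> sl2. T * snd V A = snd W A * T))"
  by (cases f) (auto simp: Hom_def sl2_homs_def)

lemma Hom_sl2_catE:
  assumes "f \<in> Hom sl2_cat V W"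
  obtains T where "f = (V, W, T)" "T \<in> carrier_mat (fst W) (fst V)" "V \<in> sl2_modules" "W \<in> sl2_modules"
    "\<And>A. A \<in> sl2 \<Longrightarrow> T * snd V A = snd W A * T"
  using assms by (auto simp: Hom_sl2_cat)

lemma Hom_sl2_catI:
  assumes "T \<in> carrier_mat (fst W) (fst V)" "V \<in> sl2_modules" "W \<in> sl2_modules"
    "\<And>A. A \<in> sl2 \<Longrightarrow> T * snd V A = snd W A * T"
  shows "(V, W, T) \<in> Hom sl2_cat V W"
  using assms by (auto simp: Hom_sl2_cat)

lemma sl2_comp:
  assumes "f \<in> Hom sl2_cat U V" "g \<in> Hom sl2_cat V W"
  shows "Comp sl2_cat g f \<in> Hom sl2_cat U W"
proof -
  from assms(1) obtain S where S: "f = (U, V, S)" "S \<in> carrier_mat (fst V) (fst U)"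
    "U \<in> sl2_modules" "V \<in> sl2_modules" "\<And>A. A \<in> sl2 \<Longrightarrow> S * snd U A = snd V A * S"
    by (auto elim: Hom_sl2_catE)
  from assms(2) obtain T where T: "g = (V, W, T)" "T \<in> carrier_mat (fst W) (fst V)"
    "W \<in> sl2_modules" "\<And>A. A \<in> sl2 \<Longrightarrow> T * snd V A = snd W A * T"
    by (auto elim: Hom_sl2_catE)
  have "T * S * snd U A = snd W A * (T * S)" if A: "A \<in> sl2" for A
    by (simp add: assoc_mult_mat[OF T(2) S(2) sl2_module_carrier[OF S(3) A]] S(5)[OF A]
      assoc_mult_mat[OF T(2) sl2_module_carrier[OF S(4) A] S(2), symmetric] T(4)[OF A]
      assoc_mult_mat[OF sl2_module_carrier[OF T(3) A] T(2) S(2)])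
  thus ?thesis using S T by (auto intro!: Hom_sl2_catI)
qed

lemma sl2_plus:
  assumes "f \<in> Hom sl2_cat U V" "g \<in> Hom sl2_cat U V"
  shows "Plus sl2_cat g f \<in> Hom sl2_cat U V"
proof -
  from assms(1) obtain S where S: "f = (U, V, S)" "S \<in> carrier_mat (fst V) (fst U)"
    "U \<in> sl2_modules" "V \<in> sl2_modules" "\<And>A. A \<in> sl2 \<Longrightarrow> S * snd U A = snd V A * S"
    by (auto elim: Hom_sl2_catE)
  from assms(2) obtain T where T: "g = (U, V, T)" "T \<in> carrier_mat (fst V) (fst U)"
    "\<And>A. A \<in> sl2 \<Longrightarrow> T * snd U A = snd V A * T"
    by (auto elim: Hom_sl2_catE)
  have "(T + S) * snd U A = snd V A * (T + S)" if A: "A \<in> sl2" for A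
    by (simp add: add_mult_distrib_mat[OF T(2) S(2) sl2_module_carrier[OF S(3) A]]
      mult_add_distrib_mat[OF sl2_module_carrier[OF S(4) A] T(2) S(2)] S(5)[OF A] T(3)[OF A])
  thus ?thesis using S T by (auto intro!: Hom_sl2_catI)
qed

lemma sl2_scale:
  assumes "f \<in> Hom sl2_cat U V"
  shows "Scale sl2_cat c f \<in> Hom sl2_cat U V"
proof -
  from assms(1) obtain S where S: "f = (U, V, S)" "S \<in> carrier_mat (fst V) (fst U)"
    "U \<in> sl2_modules" "V \<in> sl2_modules" "\<And>A. A \<in> sl2 \<Longrightarrow> S * snd U A = snd V A * S"
    by (auto elim: Hom_sl2_catE)
  have "c \<cdot>\<^sub>m S * snd U A = snd V A * (c \<cdot>\<^sub>m S)" if A: "A \<in> sl2" for A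
    by (simp add: mult_smult_assoc_mat[OF S(2) sl2_module_carrier[OF S(3) A]]
      mult_smult_distrib[OF sl2_module_carrier[OF S(4) A] S(2)] S(5)[OF A])
  thus ?thesis using S by (auto intro!: Hom_sl2_catI)
qed

lemma sl2_ident: "V \<in> sl2_modules \<Longrightarrow> (V, V, 1\<^sub>m (fst V)) \<in> Hom sl2_cat V V"
  by (rule Hom_sl2_catI) (auto dest: sl2_module_carrier)

lemma sl2_null: "V \<in> sl2_modules \<Longrightarrow> W \<in> sl2_modules \<Longrightarrow>
  (V, W, 0\<^sub>m (fst W) (fst V)) \<in> Hom sl2_cat V W"
  by (rule Hom_sl2_catI)
    (auto simp: left_mult_zero_mat[OF sl2_module_carrier] right_mult_zero_mat[OF sl2_module_carrier])

lemma sl2_tens: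
  assumes "f \<in> Hom sl2_cat U U'" "g \<in> Hom sl2_cat V V'"
  shows "tens_arr sl2_cat f g \<in> Hom sl2_cat (tensor_module U V) (tensor_module U' V')"
proof -
  from assms(1) obtain S where S: "f = (U, U', S)" "S \<in> carrier_mat (fst U') (fst U)"
    "U \<in> sl2_modules" "U' \<in> sl2_modules" "\<And>A. A \<in> sl2 \<Longrightarrow> S * snd U A = snd U' A * S"
    by (auto elim: Hom_sl2_catE)
  from assms(2) obtain T where T: "g = (V, V', T)" "T \<in> carrier_mat (fst V') (fst V)"
    "V \<in> sl2_modules" "V' \<in> sl2_modules" "\<And>A. A \<in> sl2 \<Longrightarrow> T * snd V A = snd V' A * T"
    by (auto elim: Hom_sl2_catE)
  have "kron S T * snd (tensor_module U V) A = snd (tensor_module U' V') A * kron S T" if A: "A \<in> sl2" for A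
  proof -
    note c = sl2_module_carrier[OF S(3) A] sl2_module_carrier[OF S(4) A]
      sl2_module_carrier[OF T(3) A] sl2_module_carrier[OF T(4) A]
    let ?M = "fst U * fst V" and ?N = "fst U' * fst V'"
    have k: "kron S T \<in> carrier_mat ?N ?M" "kron (snd U A) (1\<^sub>m (fst V)) \<in> carrier_mat ?M ?M"
      "kron (1\<^sub>m (fst U)) (snd V A) \<in> carrier_mat ?M ?M"
      "kron (snd U' A) (1\<^sub>m (fst V')) \<in> carrier_mat ?N ?N"
      "kron (1\<^sub>m (fst U')) (snd V' A) \<in> carrier_mat ?N ?N"
      using c S T by auto
    have "kron S T * snd (tensor_module U V) A = kron (S * snd U A) T + kron S (T * snd V A)"
      using c S(2) T(2) A
      by (simp add: snd_tensor mult_add_distrib_mat[OF k(1-3)]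
        kron_mult[OF S(2) c(1) T(2), of "1\<^sub>m (fst V)" "fst V", simplified, symmetric]
        kron_mult[OF S(2) _ T(2) c(3), of "1\<^sub>m (fst U)" "fst U", simplified, symmetric])
    also have "\<dots> = snd (tensor_module U' V') A * kron S T"
      using c S(2,5) T(2,5) A
      by (simp add: snd_tensor add_mult_distrib_mat[OF k(4,5,1)]
        kron_mult[OF c(2) S(2) _ T(2), of "1\<^sub>m (fst V')" "fst V'", simplified, symmetric]
        kron_mult[OF _ S(2) c(4) T(2), of "1\<^sub>m (fst U')" "fst U'", simplified, symmetric])
    finally show ?thesis .
  qed
  thus ?thesis using S T by (auto intro!: Hom_sl2_catI)
qed

lemma sl2_vectorspace:
  assumes V: "V \<in> sl2_modules" and W: "W \<in> sl2_modules"
  shows "vectorspace class_ring (hom_space sl2_cat V W)"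
proof -
  have s [simp]: "carrier (hom_space sl2_cat V W) = Hom sl2_cat V W"
    "add (hom_space sl2_cat V W) = Plus sl2_cat"
    "zero (hom_space sl2_cat V W) = (V, W, 0\<^sub>m (fst W) (fst V))"
    "module.smult (hom_space sl2_cat V W) = Scale sl2_cat"
    by (auto simp: hom_space_def)
  have ab: "abelian_group (hom_space sl2_cat V W)"
  proof (rule abelian_groupI, goal_cases)
    case (1 f g) thus ?case by (auto intro: sl2_plus)
  next
    case 2 thus ?case by (simp add: sl2_null[OF V W])
  next
    case (3 f g h) thus ?case by (auto elim!: Hom_sl2_catE)
  next
    case (4 f g) thus ?case by (auto elim!: Hom_sl2_catE simp: comm_add_mat)
  next
    case (5 f) thus ?case by (auto elim!: Hom_sl2_catE)
  next
    case (6 f)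
    hence "Scale sl2_cat (-1) f \<in> Hom sl2_cat V W" by (auto intro: sl2_scale)
    moreover have "Plus sl2_cat (Scale sl2_cat (-1) f) f = (V, W, 0\<^sub>m (fst W) (fst V))"
      using 6 by (auto elim!: Hom_sl2_catE intro!: eq_matI)
    ultimately show ?case by auto
  qed
  have f: "field (class_ring :: complex ring)" 
    by (unfold_locales)
  have "module class_ring (hom_space sl2_cat V W)"
  proof (rule moduleI, goal_cases)
    case 1 show ?case using f by (simp add: field_def domain_def)
  next
    case 2 show ?case by (rule ab)
  next
    case (3 a x) thus ?case by (auto intro: sl2_scale)
  next
    case (4 a b x) thus ?case by (auto elim!: Hom_sl2_catE simp: add_smult_distrib_right_mat)
  next
    case (5 a x y) thus ?case by (auto elim!: Hom_sl2_catE simp: add_smult_distrib_left_mat)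
  next
    case (6 a b x) thus ?case by (auto elim!: Hom_sl2_catE intro!: eq_matI)
  next
    case (7 x) thus ?case by (auto elim!: Hom_sl2_catE intro!: eq_matI)
  qed
  thus ?thesis using f by (simp add: vectorspace_def)
qed

lemma sl2_iso_ident:
  assumes "V \<in> sl2_modules" "V = W" "n = fst V"
  shows "iso_in sl2_cat (V, W, 1\<^sub>m n) V W"
  using sl2_ident[OF assms(1)] assms unfolding iso_in_def by (auto intro!: bexI)

theorem linear_monoidal_category_sl2_cat: "linear_monoidal_category sl2_cat"
proof (intro linear_monoidal_category.intro linear_category.intro linear_monoidal_category_axioms.intro, goal_cases)
  case (1 f) thus ?case by (cases f) (auto simp: sl2_homs_def)
next
  case (2 X) thus ?case by (simp add: sl2_ident)
next
  case 3 thus ?case by (rule sl2_comp)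
next
  case 4 thus ?case by (auto elim!: Hom_sl2_catE)
next
  case 5 thus ?case by (auto elim!: Hom_sl2_catE)
next
  case 6 thus ?case by (auto elim!: Hom_sl2_catE simp: assoc_mult_mat)
next
  case 7 thus ?case by (simp add: sl2_vectorspace)
next
  case 8 thus ?case by (auto elim!: Hom_sl2_catE simp: add_mult_distrib_mat)
next
  case 9 thus ?case by (auto elim!: Hom_sl2_catE simp: mult_add_distrib_mat)
next
  case 10 thus ?case by (auto elim!: Hom_sl2_catE simp: mult_smult_assoc_mat)
next
  case 11 thus ?case by (auto elim!: Hom_sl2_catE simp: mult_smult_distrib)
next
  case 12 show ?case by simp
next
  case 13 thus ?case by simp
next
  case 14 thus ?case using sl2_tens by simp
next
  case 15 thus ?case by simp
next
  case 16 thus ?case by (auto elim!: Hom_sl2_catE simp: kron_mult)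
next
  case 17 thus ?case by (auto elim!: Hom_sl2_catE simp: kron_add_left)
next
  case 18 thus ?case by (auto elim!: Hom_sl2_catE simp: kron_add_right)
next
  case 19 thus ?case by (auto elim!: Hom_sl2_catE simp: kron_smult_left)
next
  case 20 thus ?case by (auto elim!: Hom_sl2_catE simp: kron_smult_right)
next
  case 21 thus ?case by (auto intro!: sl2_iso_ident)
next
  case (22 f U U' g V V' h W W')
  from 22(1) obtain R where R: "f = (U, U', R)" "R \<in> carrier_mat (fst U') (fst U)"
    "U \<in> sl2_modules" "U' \<in> sl2_modules" by (auto elim: Hom_sl2_catE)
  from 22(2) obtain S where S: "g = (V, V', S)" "S \<in> carrier_mat (fst V') (fst V)"
    "V \<in> sl2_modules" "V' \<in> sl2_modules" by (auto elim: Hom_sl2_catE)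
  from 22(3) obtain T where T: "h = (W, W', T)" "T \<in> carrier_mat (fst W') (fst W)"
    "W \<in> sl2_modules" "W' \<in> sl2_modules" by (auto elim: Hom_sl2_catE)
  have "kron R (kron S T) \<in> carrier_mat (fst U' * fst V' * fst W') (fst U * fst V * fst W)"
    using R S T by (simp add: mult.assoc)
  thus ?case using R S T by (simp add: kron_assoc)
next
  case 23 thus ?case by (auto intro!: sl2_iso_ident)
next
  case 24 thus ?case by (auto elim!: Hom_sl2_catE simp: kron_unit_left[simplified] trivial_module_def)
next
  case 25 thus ?case by (auto intro!: sl2_iso_ident)
next
  case 26 thus ?case by (auto elim!: Hom_sl2_catE simp: kron_unit_right[simplified] trivial_module_def)
next
  case 27 thus ?case by (simp add: mult.assoc)
next
  case 28 thus ?case by (simp add: trivial_module_def)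
qed

end

theory Submission
  imports Defs "Jordan_Normal_Form.Spectral_Radius"
begin

text \<open>Let \<open>X 0, X 1, \<dots>\<close> be the indecomposables of \<open>M\<close>. The module \<open>L(1)\<close> is self-dual, so it acts by a self-adjoint
  functor \<open>D\<close>. A map \<open>f\<close> between indecomposables is in the radical of \<open>M\<close> unless it is an isomorphism. If \<open>D\<close> did not
  preserve the radical, then some \<open>D f\<close> would have an invertible component \<open>X k \<rightarrow> X k\<close>; by adjunction this
  component is a partial trace of a radical endomorphism of \<open>D (X k)\<close>, and as the chain has no multiplicities, an
  induction on \<open>k\<close> shows that such a partial trace is not invertible. Since \<open>L(1)\<close> generates the monoidal
  category, the radical is an invariant ideal, so it vanishes by simple transitivity. Hence \<open>M\<close> is semisimple,
  and comparing the chain with the Clebsch--Gordan rule shows that \<open>V \<mapsto> V \<star> X 0\<close> sends \<open>L(k)\<close> to \<open>X k\<close> and is an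
  equivalence from the category of \<open>sl\<^sub>2\<close>-modules. The same holds for \<open>N\<close>.\<close>

section \<open>Arrows of a linear category\<close>

text \<open>That the radical is invariant is not formal: an additive functor can send a radical map
  to one with an invertible component. The matrix entries between the neighbours of
  \<open>X k\<close> are excluded by two different arguments. For an entry
  \<open>f : X a -> X a\<close>, multiplicity one and the fact that endomorphisms are scalars modulo
  the radical turn \<open>p (D f) q = 1\<close> into "\<open>p D(1 - c f)\<close> is radical", and
  \<open>1 - c f\<close> is invertible. For an entry between \<open>X m\<close> and
  \<open>X (m + 2)\<close>, bending it with the unit or the counit moves the question from
  \<open>X (m + 1)\<close> down to \<open>X m\<close>. This descent needs a place to stop:
  \<open>X 0\<close> has only one neighbour, so no entry of the second kind occurs there. The
  semisimple comparison also needs both biproduct rules of the monoidal category in explicit form,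
  which is why complete reducibility and the Clebsch-Gordan maps are built from matrices. The
  equivalence from \<open>M\<close> to \<open>N\<close> is a quasi-inverse of one orbit functor
  followed by the other; its module structure is lifted along full faithfulness of the orbit
  functor.\<close>

definition inv_arr :: "('o, 'a, 'z) lincat_scheme \<Rightarrow> 'a \<Rightarrow> 'a" where
  "inv_arr M f = (SOME g. g \<in> Hom M (Cod M f) (Dom M f) \<and>
    g \<cdot>\<^bsub>M\<^esub> f = Ident M (Dom M f) \<and> f \<cdot>\<^bsub>M\<^esub> g = Ident M (Cod M f))"

text \<open>Domain and codomain are read off the arrow itself, so that typing conditions become
  equations on \<open>Dom\<close> and \<open>Cod\<close> which can be discharged by rewriting,
  without guessing objects.\<close>

definition iso_arr :: "('o, 'a, 'z) lincat_scheme \<Rightarrow> 'a \<Rightarrow> bool" where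
  "iso_arr M f \<longleftrightarrow> iso_in M f (Dom M f) (Cod M f)"

lemma in_Hom: "f \<in> Hom M X Y \<longleftrightarrow> f \<in> Arr M \<and> Dom M f = X \<and> Cod M f = Y"
  by (auto simp: Hom_def)

lemma iso_in_iff: "iso_in M f X Y \<longleftrightarrow> iso_arr M f \<and> Dom M f = X \<and> Cod M f = Y"
  by (auto simp: iso_arr_def iso_in_def in_Hom)

lemma iso_arrD:
  assumes "iso_arr M f"
  shows "f \<in> Arr M" "inv_arr M f \<in> Arr M" "Dom M (inv_arr M f) = Cod M f"
    "Cod M (inv_arr M f) = Dom M f" "inv_arr M f \<cdot>\<^bsub>M\<^esub> f = Ident M (Dom M f)"
    "f \<cdot>\<^bsub>M\<^esub> inv_arr M f = Ident M (Cod M f)"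
proof -
  have "\<exists>g. g \<in> Hom M (Cod M f) (Dom M f) \<and>
    g \<cdot>\<^bsub>M\<^esub> f = Ident M (Dom M f) \<and> f \<cdot>\<^bsub>M\<^esub> g = Ident M (Cod M f)"
    using assms by (auto simp: iso_arr_def iso_in_def)
  from someI_ex[OF this] assms
  show "f \<in> Arr M" "inv_arr M f \<in> Arr M" "Dom M (inv_arr M f) = Cod M f"
    "Cod M (inv_arr M f) = Dom M f" "inv_arr M f \<cdot>\<^bsub>M\<^esub> f = Ident M (Dom M f)"
    "f \<cdot>\<^bsub>M\<^esub> inv_arr M f = Ident M (Cod M f)"
    unfolding inv_arr_def[symmetric] by (auto simp: in_Hom iso_arr_def iso_in_def)
qed

lemma iso_arrI:
  assumes "f \<in> Arr M" "g \<in> Arr M" "Dom M g = Cod M f" "Cod M g = Dom M f"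
    "g \<cdot>\<^bsub>M\<^esub> f = Ident M (Dom M f)" "f \<cdot>\<^bsub>M\<^esub> g = Ident M (Cod M f)"
  shows "iso_arr M f"
  using assms unfolding iso_arr_def iso_in_def Bex_def in_Hom by blast

context linear_category
begin

lemma dom_obj [simp]: "f \<in> Arr M \<Longrightarrow> Dom M f \<in> Obj M"
  and cod_obj [simp]: "f \<in> Arr M \<Longrightarrow> Cod M f \<in> Obj M"
  using dom_cod by auto

lemma ident_arr [simp]: "X \<in> Obj M \<Longrightarrow> Ident M X \<in> Arr M" "X \<in> Obj M \<Longrightarrow> Dom M (Ident M X) = X"
  "X \<in> Obj M \<Longrightarrow> Cod M (Ident M X) = X"
  using ident_in_hom by (auto simp: in_Hom)

lemma comp_arr [simp]:
  assumes "f \<in> Arr M" "g \<in> Arr M" "Dom M g = Cod M f"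
  shows "g \<cdot> f \<in> Arr M" "Dom M (g \<cdot> f) = Dom M f" "Cod M (g \<cdot> f) = Cod M g"
  using comp_in_hom[of f "Dom M f" "Cod M f" g "Cod M g"] assms by (auto simp: in_Hom)

lemma comp_identR [simp]: "f \<in> Arr M \<Longrightarrow> Dom M f = X \<Longrightarrow> f \<cdot> Ident M X = f"
  and comp_identL [simp]: "f \<in> Arr M \<Longrightarrow> Cod M f = X \<Longrightarrow> Ident M X \<cdot> f = f"
  using comp_ident_right comp_ident_left by (auto simp: in_Hom)

lemma assoc [simp]:
  assumes "f \<in> Arr M" "g \<in> Arr M" "h \<in> Arr M" "Dom M g = Cod M f" "Dom M h = Cod M g"
  shows "(h \<cdot> g) \<cdot> f = h \<cdot> (g \<cdot> f)"
  using assms by (intro comp_assoc) (auto simp: in_Hom)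

lemma hom_module: "X \<in> Obj M \<Longrightarrow> Y \<in> Obj M \<Longrightarrow> Module.module class_ring (hom_space M X Y)"
  using hom_vectorspace by (auto simp: vectorspace_def)

lemma hom_group: "X \<in> Obj M \<Longrightarrow> Y \<in> Obj M \<Longrightarrow> abelian_group (hom_space M X Y)"
  using hom_module by (auto simp: Module.module_def)

lemma hom_space_simps [simp]: "carrier (hom_space M X Y) = Hom M X Y"
  "add (hom_space M X Y) = Plus M" "zero (hom_space M X Y) = Null M X Y"
  "module.smult (hom_space M X Y) = Scale M"
  by (simp_all add: hom_space_def)

lemma null_arr [simp]: 
  assumes "X \<in> Obj M" "Y \<in> Obj M"
  shows "Null M X Y \<in> Arr M" "Dom M (Null M X Y) = X" "Cod M (Null M X Y) = Y"
  using abelian_groupE(2)[OF hom_group[OF assms]] by (auto simp: in_Hom)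

lemma plus_arr [simp]:
  assumes "f \<in> Arr M" "g \<in> Arr M" "Dom M f = Dom M g" "Cod M f = Cod M g"
  shows "f \<boxplus> g \<in> Arr M" "Dom M (f \<boxplus> g) = Dom M g" "Cod M (f \<boxplus> g) = Cod M g"
  using abelian_groupE(1)[OF hom_group[of "Dom M g" "Cod M g"], of f g] assms by (auto simp: in_Hom)

lemma scale_arr [simp]:
  assumes "f \<in> Arr M"
  shows "Scale M c f \<in> Arr M" "Dom M (Scale M c f) = Dom M f" "Cod M (Scale M c f) = Cod M f"
  using module.smult_closed[OF hom_module[of "Dom M f" "Cod M f"], of c f] assms
  by (auto simp: in_Hom class_ring_simps)

lemma plus_assoc [simp]:
  assumes "f \<in> Arr M" "g \<in> Arr M" "h \<in> Arr M" "Dom M f = Dom M g" "Cod M f = Cod M g"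
    "Dom M g = Dom M h" "Cod M g = Cod M h"
  shows "(f \<boxplus> g) \<boxplus> h = f \<boxplus> (g \<boxplus> h)"
  using abelian_groupE(3)[OF hom_group[of "Dom M h" "Cod M h"], of f g h] assms by (auto simp: in_Hom)

lemma plus_comm:
  assumes "f \<in> Arr M" "g \<in> Arr M" "Dom M f = Dom M g" "Cod M f = Cod M g"
  shows "f \<boxplus> g = g \<boxplus> f"
  using abelian_groupE(4)[OF hom_group[of "Dom M g" "Cod M g"], of f g] assms by (auto simp: in_Hom)

lemma plus_left_comm:
  assumes "f \<in> Arr M" "g \<in> Arr M" "h \<in> Arr M" "Dom M f = Dom M g" "Cod M f = Cod M g"
    "Dom M g = Dom M h" "Cod M g = Cod M h"
  shows "f \<boxplus> (g \<boxplus> h) = g \<boxplus> (f \<boxplus> h)"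
  using assms plus_assoc[of f g h] plus_assoc[of g f h] plus_comm[of f g] by simp

lemma plus_null [simp]:
  assumes "f \<in> Arr M" "Dom M f = X" "Cod M f = Y"
  shows "Null M X Y \<boxplus> f = f" "f \<boxplus> Null M X Y = f"
proof -
  show "Null M X Y \<boxplus> f = f"
    using abelian_groupE(5)[OF hom_group[of "Dom M f" "Cod M f"], of f] assms by (auto simp: in_Hom)
  thus "f \<boxplus> Null M X Y = f" using plus_comm[of f "Null M X Y"] assms by auto
qed

lemma scale_plus [simp]:
  assumes "f \<in> Arr M" "g \<in> Arr M" "Dom M f = Dom M g" "Cod M f = Cod M g"
  shows "Scale M c (f \<boxplus> g) = Scale M c f \<boxplus> Scale M c g"
  using module.smult_r_distr[OF hom_module[of "Dom M g" "Cod M g"], of c f g] assms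
  by (auto simp: in_Hom class_ring_simps)

lemma scale_add:
  assumes "f \<in> Arr M"
  shows "Scale M (a + b) f = Scale M a f \<boxplus> Scale M b f"
  using module.smult_l_distr[OF hom_module[of "Dom M f" "Cod M f"], of a b f] assms
  by (auto simp: in_Hom class_ring_simps)

lemma scale_scale [simp]:
  assumes "f \<in> Arr M"
  shows "Scale M a (Scale M b f) = Scale M (a * b) f"
  using module.smult_assoc1[OF hom_module[of "Dom M f" "Cod M f"], of a b f] assms
  by (auto simp: in_Hom class_ring_simps)

lemma scale_one [simp]:
  assumes "f \<in> Arr M"
  shows "Scale M 1 f = f"
  using module.smult_one[OF hom_module[of "Dom M f" "Cod M f"], of f] assms
  by (auto simp: in_Hom class_ring_simps)

lemma scale_zero [simp]:
  assumes "f \<in> Arr M"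
  shows "Scale M 0 f = Null M (Dom M f) (Cod M f)"
proof -
  interpret Module.module class_ring "hom_space M (Dom M f) (Cod M f)" by (rule hom_module) (use assms in auto)
  show ?thesis using smult_l_null[of f] assms by (simp add: in_Hom class_ring_simps)
qed

lemma plus_cancel:
  assumes "f \<boxplus> g = f \<boxplus> h" "f \<in> Arr M" "g \<in> Arr M" "h \<in> Arr M" "Dom M f = Dom M h" "Cod M f = Cod M h"
    "Dom M g = Dom M h" "Cod M g = Cod M h"
  shows "g = h"
proof -
  have "(Scale M (-1) f \<boxplus> f) \<boxplus> g = (Scale M (-1) f \<boxplus> f) \<boxplus> h"
    using assms(2-) by (simp add: assms(1))
  moreover have "Scale M (-1) f \<boxplus> f = Null M (Dom M h) (Cod M h)"
    using scale_zero[of f] scale_add[of f "-1" 1] assms(2-) by simp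
  ultimately show ?thesis using assms(2-) by simp
qed

lemma scale_null [simp]:
  assumes "X \<in> Obj M" "Y \<in> Obj M"
  shows "Scale M c (Null M X Y) = Null M X Y"
proof -
  have "Scale M c (Scale M 0 (Null M X Y)) = Scale M (c * 0) (Null M X Y)"
    by (rule scale_scale) (use assms in simp)
  thus ?thesis using assms by (simp del: scale_scale)
qed

lemma plus_compR [simp]:
  assumes "f \<in> Arr M" "g \<in> Arr M" "h \<in> Arr M" "Dom M g = Dom M h" "Cod M g = Cod M h" "Dom M h = Cod M f"
  shows "(g \<boxplus> h) \<cdot> f = g \<cdot> f \<boxplus> h \<cdot> f"
  using assms by (intro comp_plus_left) (auto simp: in_Hom)

lemma plus_compL [simp]:
  assumes "f \<in> Arr M" "g \<in> Arr M" "h \<in> Arr M" "Dom M g = Dom M h" "Cod M g = Cod M h" "Dom M f = Cod M h"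
  shows "f \<cdot> (g \<boxplus> h) = f \<cdot> g \<boxplus> f \<cdot> h"
  using assms by (intro comp_plus_right) (auto simp: in_Hom)

lemma scale_compR [simp]:
  assumes "f \<in> Arr M" "g \<in> Arr M" "Dom M g = Cod M f"
  shows "Scale M c g \<cdot> f = Scale M c (g \<cdot> f)"
  using assms by (intro comp_scale_left) (auto simp: in_Hom)

lemma scale_compL [simp]:
  assumes "f \<in> Arr M" "g \<in> Arr M" "Dom M g = Cod M f"
  shows "g \<cdot> Scale M c f = Scale M c (g \<cdot> f)"
  using assms by (intro comp_scale_right) (auto simp: in_Hom)

lemma null_compR [simp]:
  assumes "f \<in> Arr M" "Cod M f = X" "Y \<in> Obj M"
  shows "Null M X Y \<cdot> f = Null M (Dom M f) Y"
  using scale_compR[of f "Null M X Y" 0] assms by auto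

lemma null_compL [simp]:
  assumes "f \<in> Arr M" "Dom M f = Y" "X \<in> Obj M"
  shows "f \<cdot> Null M X Y = Null M X (Cod M f)"
  using scale_compL[of "Null M X Y" f 0] assms by auto

definition minus :: "'a \<Rightarrow> 'a \<Rightarrow> 'a"  (infixl \<open>\<boxminus>\<close> 65) where
  "f \<boxminus> g = f \<boxplus> Scale M (-1) g"

lemma plus_neg [simp]:
  assumes "f \<in> Arr M"
  shows "f \<boxplus> Scale M (-1) f = Null M (Dom M f) (Cod M f)" "Scale M (-1) f \<boxplus> f = Null M (Dom M f) (Cod M f)"
  using scale_add[of f 1 "-1"] scale_add[of f "-1" 1] assms by auto

lemma minus_arr [simp]:
  assumes "f \<in> Arr M" "g \<in> Arr M" "Dom M f = Dom M g" "Cod M f = Cod M g"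
  shows "f \<boxminus> g \<in> Arr M" "Dom M (f \<boxminus> g) = Dom M g" "Cod M (f \<boxminus> g) = Cod M g"
  using assms by (auto simp: minus_def)

lemma minus_compR [simp]:
  assumes "f \<in> Arr M" "g \<in> Arr M" "h \<in> Arr M" "Dom M g = Dom M h" "Cod M g = Cod M h" "Dom M h = Cod M f"
  shows "(g \<boxminus> h) \<cdot> f = g \<cdot> f \<boxminus> h \<cdot> f"
  using assms by (simp add: minus_def)

lemma minus_compL [simp]:
  assumes "f \<in> Arr M" "g \<in> Arr M" "h \<in> Arr M" "Dom M g = Dom M h" "Cod M g = Cod M h" "Dom M f = Cod M h"
  shows "f \<cdot> (g \<boxminus> h) = f \<cdot> g \<boxminus> f \<cdot> h"
  using assms by (simp add: minus_def)

lemma minus_self [simp]: "f \<in> Arr M \<Longrightarrow> f \<boxminus> f = Null M (Dom M f) (Cod M f)"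
  by (simp add: minus_def)

lemma plus_minus [simp]:
  assumes "f \<in> Arr M" "g \<in> Arr M" "Dom M f = Dom M g" "Cod M f = Cod M g"
  shows "g \<boxplus> (f \<boxminus> g) = f"
  using assms plus_left_comm[of g f "Scale M (-1) g"] by (simp add: minus_def)

lemma minus_null [simp]:
  assumes "f \<in> Arr M" "Dom M f = X" "Cod M f = Y"
  shows "f \<boxminus> Null M X Y = f"
  using assms by (auto simp: minus_def)

lemma minus_eq_null:
  assumes "f \<boxminus> g = Null M X Y" "f \<in> Arr M" "g \<in> Arr M" "Dom M f = X" "Cod M f = Y" "Dom M g = X" "Cod M g = Y"
  shows "f = g"
  using plus_minus[of f g] assms(2-) by (simp add: assms(1))

lemma iso_ident [simp]: "X \<in> Obj M \<Longrightarrow> iso_arr M (Ident M X)"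
  by (rule iso_arrI[of _ _ "Ident M X"]) auto

text \<open>Composites are kept nested to the right, so an equation for \<open>g \<cdot> f\<close>
  no longer matches inside a longer composite; this form applies it there.\<close>

lemma reassoc:
  assumes "g \<cdot> f = h" "f \<in> Arr M" "g \<in> Arr M" "k \<in> Arr M" "Dom M g = Cod M f" "Cod M k = Dom M f"
  shows "g \<cdot> (f \<cdot> k) = h \<cdot> k"
  using assms(2-) by (simp flip: assms(1))

lemma inv_reassoc [simp]:
  assumes "iso_arr M f" "k \<in> Arr M"
  shows "Cod M k = Dom M f \<Longrightarrow> inv_arr M f \<cdot> (f \<cdot> k) = k" "Cod M k = Cod M f \<Longrightarrow> f \<cdot> (inv_arr M f \<cdot> k) = k"
proof -
  note [simp] = iso_arrD[OF assms(1)] assms(2)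
  show "inv_arr M f \<cdot> (f \<cdot> k) = k" if "Cod M k = Dom M f"
    using reassoc[of "inv_arr M f" f "Ident M (Dom M f)" k] that by simp
  show "f \<cdot> (inv_arr M f \<cdot> k) = k" if "Cod M k = Cod M f"
    using reassoc[of f "inv_arr M f" "Ident M (Cod M f)" k] that by simp
qed

lemma iso_comp:
  assumes "iso_arr M f" "iso_arr M g" "Dom M g = Cod M f"
  shows "iso_arr M (g \<cdot> f)"
proof (rule iso_arrI[of _ _ "inv_arr M f \<cdot> inv_arr M g"])
  note [simp] = iso_arrD[OF assms(1)] iso_arrD[OF assms(2)] assms(3)
  show "(inv_arr M f \<cdot> inv_arr M g) \<cdot> (g \<cdot> f) = Ident M (Dom M (g \<cdot> f))"
    "(g \<cdot> f) \<cdot> (inv_arr M f \<cdot> inv_arr M g) = Ident M (Cod M (g \<cdot> f))"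
    using assms by simp_all
qed (use iso_arrD[OF assms(1)] iso_arrD[OF assms(2)] assms(3) in auto)

lemma iso_inv: "iso_arr M f \<Longrightarrow> iso_arr M (inv_arr M f)"
  by (rule iso_arrI[of _ _ f]) (auto simp: iso_arrD)

lemma iso_cancelL:
  assumes "f \<cdot> g = f \<cdot> h" "iso_arr M f" "g \<in> Arr M" "h \<in> Arr M" "Cod M g = Dom M f" "Cod M h = Dom M f"
  shows "g = h"
  using inv_reassoc(1)[OF assms(2), of g] inv_reassoc(1)[OF assms(2), of h] assms by metis

lemma iso_cancelR:
  assumes "g \<cdot> f = h \<cdot> f" "iso_arr M f" "g \<in> Arr M" "h \<in> Arr M" "Dom M g = Cod M f" "Dom M h = Cod M f"
  shows "g = h"
proof -
  note D = iso_arrD[OF assms(2)]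
  have "(g \<cdot> f) \<cdot> inv_arr M f = g" "(h \<cdot> f) \<cdot> inv_arr M f = h"
    using assms(3-) by (simp_all add: D)
  thus ?thesis using assms(1) by metis
qed

end

section \<open>Biproducts of two objects and local endomorphism rings\<close>

definition biprod :: "('o, 'a, 'z) lincat_scheme \<Rightarrow> 'o \<Rightarrow> 'o \<Rightarrow> 'o \<Rightarrow> 'a \<Rightarrow> 'a \<Rightarrow> 'a \<Rightarrow> 'a \<Rightarrow> bool" where
  "biprod M S X Y i p i' p' \<longleftrightarrow> S \<in> Obj M \<and> X \<in> Obj M \<and> Y \<in> Obj M \<and>
    i \<in> Hom M X S \<and> p \<in> Hom M S X \<and> i' \<in> Hom M Y S \<and> p' \<in> Hom M S Y \<and>
    p \<cdot>\<^bsub>M\<^esub> i = Ident M X \<and> p' \<cdot>\<^bsub>M\<^esub> i' = Ident M Y \<and> (i \<cdot>\<^bsub>M\<^esub> p) \<boxplus>\<^bsub>M\<^esub> (i' \<cdot>\<^bsub>M\<^esub> p') = Ident M S"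

context linear_category
begin

lemma plus_eq_null:
  assumes "f \<boxplus> g = Null M X Y" "f \<in> Arr M" "g \<in> Arr M" "Dom M f = X" "Cod M f = Y" "Dom M g = X" "Cod M g = Y"
  shows "f = Scale M (-1) g"
proof -
  have "g \<boxplus> f = g \<boxplus> Scale M (-1) g" using assms(2-) plus_comm[of f g] by (simp add: assms(1))
  thus ?thesis by (rule plus_cancel) (use assms(2-) in simp_all)
qed

lemma biprodD:
  assumes "biprod M S X Y i p i' p'"
  shows "S \<in> Obj M" "X \<in> Obj M" "Y \<in> Obj M" "i \<in> Arr M" "p \<in> Arr M" "i' \<in> Arr M" "p' \<in> Arr M"
    "Dom M i = X" "Cod M i = S" "Dom M p = S" "Cod M p = X"
    "Dom M i' = Y" "Cod M i' = S" "Dom M p' = S" "Cod M p' = Y"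
    "p \<cdot> i = Ident M X" "p' \<cdot> i' = Ident M Y" "(i \<cdot> p) \<boxplus> (i' \<cdot> p') = Ident M S"
  using assms by (auto simp: biprod_def in_Hom)

lemma biprod_swap:
  assumes "biprod M S X Y i p i' p'"
  shows "biprod M S Y X i' p' i p"
proof -
  note [simp] = biprodD[OF assms]
  have "(i' \<cdot> p') \<boxplus> (i \<cdot> p) = Ident M S" using plus_comm[of "i' \<cdot> p'" "i \<cdot> p"] by simp
  thus ?thesis by (simp add: biprod_def in_Hom)
qed

text \<open>The mixed composites need not be postulated: composing \<open>i p + i' p' = 1\<close>
  with \<open>p\<close> on the left gives \<open>p + p i' p' = p\<close>, and composing with
  \<open>i'\<close> on the right isolates \<open>p i'\<close>.\<close>

lemma biprod_cross:
  assumes "biprod M S X Y i p i' p'"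
  shows "p \<cdot> i' = Null M Y X"
proof -
  note [simp] = biprodD[OF assms]
  have "p \<cdot> (i \<cdot> p \<boxplus> i' \<cdot> p') = p" by (simp del: plus_compL)
  moreover have "p \<cdot> (i \<cdot> p \<boxplus> i' \<cdot> p') = p \<boxplus> p \<cdot> (i' \<cdot> p')"
    using reassoc[of p i "Ident M X" p] by (simp del: biprodD(18)[OF assms])
  ultimately have "p \<boxplus> p \<cdot> (i' \<cdot> p') = p \<boxplus> Null M S X" by simp
  hence "p \<cdot> (i' \<cdot> p') = Null M S X" by (rule plus_cancel) auto
  hence "(p \<cdot> (i' \<cdot> p')) \<cdot> i' = Null M S X \<cdot> i'" by simp
  thus ?thesis by simp
qed

lemma biprod_expand:
  assumes "biprod M S X Y i p i' p'"
  shows "f \<in> Arr M \<Longrightarrow> Cod M f = S \<Longrightarrow> i \<cdot> (p \<cdot> f) \<boxplus> i' \<cdot> (p' \<cdot> f) = f"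
    "f \<in> Arr M \<Longrightarrow> Dom M f = S \<Longrightarrow> f \<cdot> (i \<cdot> p) \<boxplus> f \<cdot> (i' \<cdot> p') = f"
proof -
  note [simp] = biprodD(1-15)[OF assms] and e = biprodD(18)[OF assms]
  show "i \<cdot> (p \<cdot> f) \<boxplus> i' \<cdot> (p' \<cdot> f) = f" if "f \<in> Arr M" "Cod M f = S"
  proof -
    have "(i \<cdot> p \<boxplus> i' \<cdot> p') \<cdot> f = f" using that by (simp add: e del: plus_compR)
    thus ?thesis using that by simp
  qed
  show "f \<cdot> (i \<cdot> p) \<boxplus> f \<cdot> (i' \<cdot> p') = f" if "f \<in> Arr M" "Dom M f = S"
  proof -
    have "f \<cdot> (i \<cdot> p \<boxplus> i' \<cdot> p') = f" using that by (simp add: e del: plus_compL)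
    thus ?thesis using that by simp
  qed
qed

lemma finsum_hom_0: "X \<in> Obj M \<Longrightarrow> Y \<in> Obj M \<Longrightarrow> finsum (hom_space M X Y) f {..<0::nat} = Null M X Y"
  using abelian_monoid.finsum_empty[of "hom_space M X Y" f] hom_group[of X Y]
  by (simp add: abelian_group_def)

lemma finsum_hom_Suc:
  assumes "X \<in> Obj M" "Y \<in> Obj M" "\<And>i. i \<le> n \<Longrightarrow> f i \<in> Hom M X Y"
  shows "finsum (hom_space M X Y) f {..<Suc n} = f n \<boxplus> finsum (hom_space M X Y) f {..<n}"
  using abelian_monoid.finsum_insert[of "hom_space M X Y" "{..<n}" n f] hom_group[of X Y] assms
  by (auto simp: abelian_group_def lessThan_Suc)

lemma finsum_hom_2:
  assumes "X \<in> Obj M" "Y \<in> Obj M" "f 0 \<in> Hom M X Y" "f 1 \<in> Hom M X Y"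
  shows "finsum (hom_space M X Y) f {..<2::nat} = f 0 \<boxplus> f 1"
proof -
  have "finsum (hom_space M X Y) f {..<Suc 1} = f 1 \<boxplus> finsum (hom_space M X Y) f {..<Suc 0}"
    using finsum_hom_Suc[of X Y 1 f] assms by (force simp: le_Suc_eq)
  also have "finsum (hom_space M X Y) f {..<Suc 0} = f 0 \<boxplus> finsum (hom_space M X Y) f {..<0}"
    using assms by (intro finsum_hom_Suc) auto
  finally show ?thesis using assms finsum_hom_0[of X Y f] by (simp add: in_Hom plus_comm numeral_2_eq_2)
qed

lemma direct_sum_2:
  "direct_sum M S [X, Y] \<longleftrightarrow> (\<exists>i p i' p'. biprod M S X Y i p i' p')" (is "?L \<longleftrightarrow> ?R")
proof
  assume ?L
  hence o: "S \<in> Obj M" "X \<in> Obj M" "Y \<in> Obj M" by (auto simp: direct_sum_def)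
  from \<open>?L\<close> obtain \<iota> \<pi> where
    h: "\<forall>i < length [X, Y]. \<iota> i \<in> Hom M ([X, Y] ! i) S \<and> \<pi> i \<in> Hom M S ([X, Y] ! i)"
    and k: "\<forall>i < length [X, Y]. \<forall>j < length [X, Y].
        \<pi> i \<cdot> \<iota> j = (if i = j then Ident M ([X, Y] ! i) else Null M ([X, Y] ! j) ([X, Y] ! i))"
    and s': "finsum (hom_space M S S) (\<lambda>i. \<iota> i \<cdot> \<pi> i) {..<length [X, Y]} = Ident M S"
    unfolding direct_sum_def by blast
  from s' have s: "finsum (hom_space M S S) (\<lambda>i. \<iota> i \<cdot> \<pi> i) {..<2} = Ident M S"
    by (simp add: numeral_2_eq_2)
  from h k have h0: "\<iota> 0 \<in> Hom M X S" "\<pi> 0 \<in> Hom M S X" and h1: "\<iota> 1 \<in> Hom M Y S" "\<pi> 1 \<in> Hom M S Y"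
    and k: "\<pi> 0 \<cdot> \<iota> 0 = Ident M X" "\<pi> 1 \<cdot> \<iota> 1 = Ident M Y" by force+
  have "finsum (hom_space M S S) (\<lambda>i. \<iota> i \<cdot> \<pi> i) {..<2} = \<iota> 0 \<cdot> \<pi> 0 \<boxplus> \<iota> 1 \<cdot> \<pi> 1"
    using o h0 h1 by (intro finsum_hom_2) (auto simp: in_Hom)
  hence "\<iota> 0 \<cdot> \<pi> 0 \<boxplus> \<iota> 1 \<cdot> \<pi> 1 = Ident M S" unfolding s by (rule sym)
  with o h0 h1 k have "biprod M S X Y (\<iota> 0) (\<pi> 0) (\<iota> 1) (\<pi> 1)" unfolding biprod_def by blast
  thus ?R by blast
next
  assume ?R
  then obtain i p i' p' where b: "biprod M S X Y i p i' p'" by blast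
  note [simp] = biprodD[OF b] biprod_cross[OF b] biprod_cross[OF biprod_swap[OF b]]
  define \<iota> where "\<iota> = (\<lambda>n::nat. if n = 0 then i else i')"
  define \<pi> where "\<pi> = (\<lambda>n::nat. if n = 0 then p else p')"
  have "finsum (hom_space M S S) (\<lambda>i. \<iota> i \<cdot> \<pi> i) {..<2} = \<iota> 0 \<cdot> \<pi> 0 \<boxplus> \<iota> 1 \<cdot> \<pi> 1"
    by (intro finsum_hom_2) (auto simp: in_Hom \<iota>_def \<pi>_def)
  also have "\<dots> = Ident M S" by (simp add: \<iota>_def \<pi>_def)
  finally show ?L unfolding direct_sum_def
    by (intro conjI exI[of _ \<iota>] exI[of _ \<pi>])
      (auto simp: \<iota>_def \<pi>_def in_Hom less_Suc_eq numeral_2_eq_2)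
qed

lemma local_iff:
  "local_endomorphisms M X \<longleftrightarrow> X \<in> Obj M \<and> Ident M X \<noteq> Null M X X \<and>
    (\<forall>f g. f \<in> Arr M \<longrightarrow> Dom M f = X \<longrightarrow> Cod M f = X \<longrightarrow> g \<in> Arr M \<longrightarrow> Dom M g = X \<longrightarrow> Cod M g = X \<longrightarrow>
      \<not> iso_arr M f \<longrightarrow> \<not> iso_arr M g \<longrightarrow> \<not> iso_arr M (f \<boxplus> g))"
  unfolding local_endomorphisms_def zero_object_def iso_in_iff Ball_def in_Hom by auto

text \<open>One of \<open>e\<close> and \<open>1 - e\<close> is invertible, since their sum is.
  Cancelling it from \<open>e e = e\<close> or from \<open>(1 - e) e = 0\<close> leaves
  \<open>e = 1\<close> or \<open>e = 0\<close>.\<close>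

lemma local_idem:
  assumes X: "local_endomorphisms M X" and e: "e \<in> Arr M" "Dom M e = X" "Cod M e = X" "e \<cdot> e = e"
  shows "e = Null M X X \<or> e = Ident M X"
proof -
  from X have [simp]: "X \<in> Obj M" by (simp add: local_iff)
  let ?f = "Ident M X \<boxminus> e"
  have "iso_arr M (e \<boxplus> ?f)" using e by simp
  moreover have "?f \<in> Arr M" "Dom M ?f = X" "Cod M ?f = X" using e by auto
  ultimately consider "iso_arr M e" | "iso_arr M ?f" using X e unfolding local_iff by metis
  thus ?thesis
  proof cases
    case 1
    from iso_cancelL[OF _ 1, of e "Ident M X"] e show ?thesis by auto
  next
    case 2
    from iso_cancelL[OF _ 2, of e "Null M X X"] e show ?thesis by auto
  qed
qed

lemma null_not_iso:
  assumes "X \<in> Obj M" "Ident M X \<noteq> Null M X X"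
  shows "\<not> iso_arr M (Null M X X)"
  using iso_arrD(5)[of M "Null M X X"] iso_arrD(2-4)[of M "Null M X X"] assms by auto

text \<open>If \<open>u\<close> is the inverse of \<open>b a\<close>, then \<open>a u b\<close> is
  an idempotent of the local object \<open>Y\<close>. It is not zero because \<open>X\<close> is
  not, so it is the identity, and this supplies the missing one-sided inverses of \<open>a\<close>
  and \<open>b\<close>.\<close>

lemma local_iso_factor:
  assumes X: "X \<in> Obj M" "Ident M X \<noteq> Null M X X" and Y: "local_endomorphisms M Y"
    and a: "a \<in> Arr M" "Dom M a = X" "Cod M a = Y" and b: "b \<in> Arr M" "Dom M b = Y" "Cod M b = X"
    and iso: "iso_arr M (b \<cdot> a)"
  shows "iso_arr M a" "iso_arr M b"
proof -
  let ?u = "inv_arr M (b \<cdot> a)"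
  note u = iso_arrD[OF iso]
  note [simp] = X(1) a b u(2)
  have [simp]: "Y \<in> Obj M" using Y by (simp add: local_iff)
  have [simp]: "Dom M ?u = X" "Cod M ?u = X" "?u \<cdot> (b \<cdot> a) = Ident M X" "b \<cdot> (a \<cdot> ?u) = Ident M X"
    using u(3-6) by simp_all
  have [simp]: "b \<cdot> (a \<cdot> (?u \<cdot> k)) = k" if "k \<in> Arr M" "Cod M k = X" for k
    using reassoc[of "b \<cdot> a" ?u "Ident M X" k] that by simp
  let ?e = "a \<cdot> (?u \<cdot> b)"
  have "?e \<cdot> ?e = ?e" by simp
  with local_idem[OF Y, of ?e] consider "?e = Null M Y Y" | "?e = Ident M Y" by auto
  hence e: "?e = Ident M Y"
  proof cases
    case 1
    have "Ident M X = (?u \<cdot> b) \<cdot> ?e \<cdot> a" by simp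
    also have "\<dots> = Null M X X" unfolding 1 by simp
    finally show ?thesis using X by simp
  qed
  show "iso_arr M a" by (rule iso_arrI[of _ _ "?u \<cdot> b"]) (simp_all add: e)
  show "iso_arr M b" by (rule iso_arrI[of _ _ "a \<cdot> ?u"]) (simp_all add: e)
qed

end

section \<open>The radical, tested on a family of pairwise non-isomorphic local objects\<close>

locale indec_family = linear_category M for M :: "('o, 'a, 'z) lincat_scheme" (structure) +
  fixes X :: "nat \<Rightarrow> 'o"
  assumes local_X: "local_endomorphisms M (X i)"
    and noniso_X: "isomorphic M (X i) (X j) \<Longrightarrow> i = j"
    and scalar_X: "f \<in> Hom M (X i) (X i) \<Longrightarrow> \<exists>c. \<not> iso_arr M (f \<boxminus> Scale M c (Ident M (X i)))"
begin

lemma X_obj [simp]: "X i \<in> Obj M" and X_nonzero: "Ident M (X i) \<noteq> Null M (X i) (X i)"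
  using local_X by (auto simp: local_iff)

lemma local_sum:
  assumes "f \<in> Arr M" "Dom M f = X i" "Cod M f = X i" "g \<in> Arr M" "Dom M g = X i" "Cod M g = X i"
    "\<not> iso_arr M f" "\<not> iso_arr M g"
  shows "\<not> iso_arr M (f \<boxplus> g)"
  using local_X[of i] assms unfolding local_iff by auto

lemma X_factor:
  assumes "a \<in> Arr M" "Dom M a = X i" "Cod M a = X j" "b \<in> Arr M" "Dom M b = X j" "Cod M b = X i"
    "iso_arr M (b \<cdot> a)"
  shows "i = j" "iso_arr M a" "iso_arr M b"
proof -
  show *: "iso_arr M a" "iso_arr M b"
    using local_iso_factor[OF X_obj X_nonzero local_X assms] by auto
  show "i = j" using noniso_X[of i j] * assms unfolding isomorphic_def iso_in_iff by blast
qed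

text \<open>When every object is a sum of members of the family this is the Jacobson radical. In the
  tested form, closure under composition is immediate, and closure under addition is locality of the
  rings \<open>End (X i)\<close>.\<close>

definition rad :: "'a set" where
  "rad = {f \<in> Arr M. \<forall>i p q. p \<in> Arr M \<and> q \<in> Arr M \<and> Dom M p = Cod M f \<and> Cod M p = X i \<and>
    Dom M q = X i \<and> Cod M q = Dom M f \<longrightarrow> \<not> iso_arr M (p \<cdot> (f \<cdot> q))}"

lemma radD:
  assumes "f \<in> rad" "p \<in> Arr M" "q \<in> Arr M" "Dom M p = Cod M f" "Cod M p = X i"
    "Dom M q = X i" "Cod M q = Dom M f"
  shows "\<not> iso_arr M (p \<cdot> (f \<cdot> q))"
  using assms by (auto simp: rad_def)

lemma rad_arr [simp]: "f \<in> rad \<Longrightarrow> f \<in> Arr M" by (simp add: rad_def)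

lemma radI:
  assumes "f \<in> Arr M" "\<And>i p q. p \<in> Arr M \<Longrightarrow> q \<in> Arr M \<Longrightarrow> Dom M p = Cod M f \<Longrightarrow> Cod M p = X i \<Longrightarrow>
    Dom M q = X i \<Longrightarrow> Cod M q = Dom M f \<Longrightarrow> \<not> iso_arr M (p \<cdot> (f \<cdot> q))"
  shows "f \<in> rad"
  using assms unfolding rad_def by blast

lemma rad_compL:
  assumes "f \<in> rad" "g \<in> Arr M" "Dom M g = Cod M f"
  shows "g \<cdot> f \<in> rad"
proof (rule radI)
  fix i p q assume "p \<in> Arr M" "q \<in> Arr M" "Dom M p = Cod M (g \<cdot> f)" "Cod M p = X i"
    "Dom M q = X i" "Cod M q = Dom M (g \<cdot> f)"
  thus "\<not> iso_arr M (p \<cdot> (g \<cdot> f \<cdot> q))" using radD[OF assms(1), of "p \<cdot> g" q i] assms by simp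
qed (use assms in simp)

lemma rad_compR:
  assumes "f \<in> rad" "g \<in> Arr M" "Dom M f = Cod M g"
  shows "f \<cdot> g \<in> rad"
proof (rule radI)
  fix i p q assume "p \<in> Arr M" "q \<in> Arr M" "Dom M p = Cod M (f \<cdot> g)" "Cod M p = X i"
    "Dom M q = X i" "Cod M q = Dom M (f \<cdot> g)"
  thus "\<not> iso_arr M (p \<cdot> (f \<cdot> g \<cdot> q))" using radD[OF assms(1), of p "g \<cdot> q" i] assms by simp
qed (use assms in simp)

lemma rad_plus:
  assumes "f \<in> rad" "g \<in> rad" "Dom M f = Dom M g" "Cod M f = Cod M g"
  shows "f \<boxplus> g \<in> rad"
proof (rule radI)
  fix i p q assume h: "p \<in> Arr M" "q \<in> Arr M" "Dom M p = Cod M (f \<boxplus> g)" "Cod M p = X i"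
    "Dom M q = X i" "Cod M q = Dom M (f \<boxplus> g)"
  with assms have "\<not> iso_arr M (p \<cdot> (f \<cdot> q))" "\<not> iso_arr M (p \<cdot> (g \<cdot> q))"
    using radD[of f p q i] radD[of g p q i] by auto
  hence "\<not> iso_arr M (p \<cdot> (f \<cdot> q) \<boxplus> p \<cdot> (g \<cdot> q))"
    by (intro local_sum) (use h assms in auto)
  thus "\<not> iso_arr M (p \<cdot> ((f \<boxplus> g) \<cdot> q))" using h assms by simp
qed (use assms in auto)

lemma rad_null: "A \<in> Obj M \<Longrightarrow> B \<in> Obj M \<Longrightarrow> Null M A B \<in> rad"
  by (rule radI) (auto simp: null_not_iso X_nonzero)

lemma rad_scale: "f \<in> rad \<Longrightarrow> Scale M c f \<in> rad"
  using rad_compL[of f "Scale M c (Ident M (Cod M f))"] by simp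

lemma rad_not_iso:
  assumes "f \<in> rad" "Dom M f = X i" "Cod M f = X i"
  shows "\<not> iso_arr M f"
  using radD[OF assms(1), of "Ident M (X i)" "Ident M (X i)" i] assms by simp

text \<open>An invertible composite \<open>X k -> X i -> X j -> X k\<close> forces all its factors
  to be invertible and all indices to be equal, because the objects are local and pairwise
  non-isomorphic.\<close>

lemma radI_X:
  assumes f: "f \<in> Arr M" "Dom M f = X i" "Cod M f = X j" and "i = j \<Longrightarrow> \<not> iso_arr M f"
  shows "f \<in> rad"
proof (rule radI[OF f(1)])
  fix k p q assume h: "p \<in> Arr M" "q \<in> Arr M" "Dom M p = Cod M f" "Cod M p = X k"
    "Dom M q = X k" "Cod M q = Dom M f"
  show "\<not> iso_arr M (p \<cdot> (f \<cdot> q))"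
  proof
    assume iso: "iso_arr M (p \<cdot> (f \<cdot> q))"
    from X_factor[of "f \<cdot> q" k j p] iso h f have 1: "k = j" "iso_arr M (f \<cdot> q)" by auto
    from X_factor[of q k i "p \<cdot> f"] iso h f have "k = i" by auto
    with 1 X_factor[of q k k f] h f have "iso_arr M f" by auto
    with assms(4) \<open>k = i\<close> 1 show False by auto
  qed
qed

text \<open>An indecomposable occurring once in a biproduct splits off through any retraction onto it with a
  complement that has no summand isomorphic to it.\<close>

lemma mult_one:
  assumes b: "biprod M S (X k) Y i p i' p'"
    and Y: "\<And>u v. u \<in> Hom M (X k) Y \<Longrightarrow> v \<in> Hom M Y (X k) \<Longrightarrow> \<not> iso_arr M (v \<cdot> u)"
    and q: "q \<in> Arr M" "Dom M q = X k" "Cod M q = S" and g: "g \<in> Arr M" "Dom M g = S" "Cod M g = X k"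
    and gq: "g \<cdot> q = Ident M (X k)"
    and r: "r \<in> Arr M" "Dom M r = S" "Cod M r = X k" and r': "r' \<in> Arr M" "Dom M r' = X k" "Cod M r' = S"
  shows "\<not> iso_arr M (r \<cdot> ((Ident M S \<boxminus> q \<cdot> g) \<cdot> r'))"
proof -
  note [simp] = biprodD[OF b] q g r r'
  have *: "\<not> iso_arr M (v \<cdot> u)" if "u \<in> Arr M" "Dom M u = X k" "Cod M u = Y" "v \<in> Arr M" "Dom M v = Y" "Cod M v = X k"
    for u v using that Y by (simp add: in_Hom)
  define e where "e = Ident M S \<boxminus> q \<cdot> g"
  have [simp]: "e \<in> Arr M" "Dom M e = S" "Cod M e = S" by (simp_all add: e_def)
  have "g \<cdot> (i \<cdot> (p \<cdot> q)) \<boxplus> g \<cdot> (i' \<cdot> (p' \<cdot> q)) = g \<cdot> (i \<cdot> (p \<cdot> q) \<boxplus> i' \<cdot> (p' \<cdot> q))" by simp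
  also have "\<dots> = Ident M (X k)" by (subst biprod_expand(1)[OF b]) (simp_all add: gq)
  finally have "iso_arr M (g \<cdot> (i \<cdot> (p \<cdot> q)) \<boxplus> g \<cdot> (i' \<cdot> (p' \<cdot> q)))" by simp
  \<comment> \<open>The part of \<open>g q = 1\<close> that passes through \<open>Y\<close> is not
    invertible, so by locality the part through \<open>X k\<close> is, and its factor
    \<open>p q\<close> with it.\<close>
  hence "iso_arr M (g \<cdot> (i \<cdot> (p \<cdot> q)))"
    using local_sum[of "g \<cdot> (i \<cdot> (p \<cdot> q))" k "g \<cdot> (i' \<cdot> (p' \<cdot> q))"] *[of "p' \<cdot> q" "g \<cdot> i'"] by auto
  with X_factor(2)[of "p \<cdot> q" k k "g \<cdot> i"] have iso: "iso_arr M (p \<cdot> q)" by auto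
  let ?u = "inv_arr M (p \<cdot> q)"
  have [simp]: "?u \<in> Arr M" "Dom M ?u = X k" "Cod M ?u = X k" "p \<cdot> (q \<cdot> ?u) = Ident M (X k)"
    using iso_arrD[OF iso] by auto
  have eq0: "e \<cdot> q = Null M (X k) S" using gq by (simp add: e_def)
  have "(i \<cdot> (p \<cdot> q) \<boxplus> i' \<cdot> (p' \<cdot> q)) \<cdot> ?u = q \<cdot> ?u"
    by (subst biprod_expand(1)[OF b]) simp_all
  hence "i \<boxplus> i' \<cdot> (p' \<cdot> (q \<cdot> ?u)) = q \<cdot> ?u" by simp
  hence "e \<cdot> (i \<boxplus> i' \<cdot> (p' \<cdot> (q \<cdot> ?u))) = (e \<cdot> q) \<cdot> ?u" by simp
  hence "e \<cdot> i \<boxplus> e \<cdot> (i' \<cdot> (p' \<cdot> (q \<cdot> ?u))) = Null M (X k) S"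
    unfolding eq0 by simp
  \<comment> \<open>Since \<open>e\<close> kills \<open>q\<close>, on the summand \<open>X k\<close>
    it agrees with a map that enters through \<open>Y\<close>. Every \<open>r e r'\<close> therefore
    factors through \<open>Y\<close>.\<close>
  hence ei: "e \<cdot> i = Scale M (-1) (e \<cdot> (i' \<cdot> (p' \<cdot> (q \<cdot> ?u))))"
    by (rule plus_eq_null) simp_all
  have "r \<cdot> (e \<cdot> r') = r \<cdot> ((e \<cdot> (i \<cdot> p) \<boxplus> e \<cdot> (i' \<cdot> p')) \<cdot> r')"
    by (subst biprod_expand(2)[OF b]) simp_all
  also have "\<dots> = r \<cdot> ((e \<cdot> i) \<cdot> (p \<cdot> r')) \<boxplus> r \<cdot> (e \<cdot> (i' \<cdot> (p' \<cdot> r')))"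
    by simp
  also have "\<dots> = (r \<cdot> (e \<cdot> i')) \<cdot> (Scale M (-1) (p' \<cdot> (q \<cdot> (?u \<cdot> (p \<cdot> r')))) \<boxplus> (p' \<cdot> r'))"
    unfolding ei by simp
  finally show ?thesis
    using *[of "Scale M (-1) (p' \<cdot> (q \<cdot> (?u \<cdot> (p \<cdot> r')))) \<boxplus> p' \<cdot> r'" "r \<cdot> (e \<cdot> i')"]
    unfolding e_def[symmetric] by simp
qed

end

section \<open>The radical is stable under a self-adjoint functor of type $A_\infty$\<close>

text \<open>\<open>D\<close> is the self-adjoint functor with unit \<open>\<eta>\<close> and counit
  \<open>\<epsilon>\<close>. The zero summand in \<open>chain_0\<close> gives the start of the chain
  the same two-term shape as the other nodes, so that one trace argument serves them all.\<close>

locale self_adjoint_chain = indec_family M X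
  for M :: "('o, 'a, 'z) lincat_scheme" (structure) and X :: "nat \<Rightarrow> 'o" +
  fixes Do :: "'o \<Rightarrow> 'o" and Da :: "'a \<Rightarrow> 'a" and \<eta> :: "'o \<Rightarrow> 'a" and \<epsilon> :: "'o \<Rightarrow> 'a"
  assumes D_obj [simp]: "A \<in> Obj M \<Longrightarrow> Do A \<in> Obj M"
    and D_arr [simp]: "f \<in> Arr M \<Longrightarrow> Da f \<in> Arr M" "f \<in> Arr M \<Longrightarrow> Dom M (Da f) = Do (Dom M f)"
      "f \<in> Arr M \<Longrightarrow> Cod M (Da f) = Do (Cod M f)"
    and D_ident [simp]: "A \<in> Obj M \<Longrightarrow> Da (Ident M A) = Ident M (Do A)"
    and D_comp [simp]: "f \<in> Arr M \<Longrightarrow> g \<in> Arr M \<Longrightarrow> Dom M g = Cod M f \<Longrightarrow> Da (g \<cdot> f) = Da g \<cdot> Da f"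
    and D_plus [simp]: "f \<in> Arr M \<Longrightarrow> g \<in> Arr M \<Longrightarrow> Dom M f = Dom M g \<Longrightarrow> Cod M f = Cod M g \<Longrightarrow>
      Da (f \<boxplus> g) = Da f \<boxplus> Da g"
    and D_scale [simp]: "f \<in> Arr M \<Longrightarrow> Da (Scale M c f) = Scale M c (Da f)"
    and eta_arr [simp]: "A \<in> Obj M \<Longrightarrow> \<eta> A \<in> Arr M" "A \<in> Obj M \<Longrightarrow> Dom M (\<eta> A) = A"
      "A \<in> Obj M \<Longrightarrow> Cod M (\<eta> A) = Do (Do A)"
    and eps_arr [simp]: "A \<in> Obj M \<Longrightarrow> \<epsilon> A \<in> Arr M" "A \<in> Obj M \<Longrightarrow> Dom M (\<epsilon> A) = Do (Do A)"
      "A \<in> Obj M \<Longrightarrow> Cod M (\<epsilon> A) = A"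
    and eta_natural: "f \<in> Arr M \<Longrightarrow> Da (Da f) \<cdot> \<eta> (Dom M f) = \<eta> (Cod M f) \<cdot> f"
    and eps_natural: "f \<in> Arr M \<Longrightarrow> \<epsilon> (Cod M f) \<cdot> Da (Da f) = f \<cdot> \<epsilon> (Dom M f)"
    and zigzag: "A \<in> Obj M \<Longrightarrow> \<epsilon> (Do A) \<cdot> Da (\<eta> A) = Ident M (Do A)"
      "A \<in> Obj M \<Longrightarrow> Da (\<epsilon> A) \<cdot> \<eta> (Do A) = Ident M (Do A)"
    and chain_0: "\<exists>Y i p i' p'. zero_object M Y \<and> biprod M (Do (X 0)) (X 1) Y i p i' p'"
    and chain_Suc: "\<exists>i p i' p'. biprod M (Do (X (Suc k))) (X k) (X (Suc (Suc k))) i p i' p'"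
begin

lemma D_null [simp]: "A \<in> Obj M \<Longrightarrow> B \<in> Obj M \<Longrightarrow> Da (Null M A B) = Null M (Do A) (Do B)"
  using D_scale[of "Null M A B" 0] by simp

lemma D_minus [simp]: "f \<in> Arr M \<Longrightarrow> g \<in> Arr M \<Longrightarrow> Dom M f = Dom M g \<Longrightarrow> Cod M f = Cod M g \<Longrightarrow>
    Da (f \<boxminus> g) = Da f \<boxminus> Da g"
  by (simp add: minus_def)

lemma eps_natural_assoc:
  assumes "f \<in> Arr M" "g \<in> Arr M" "Cod M g = Do (Do (Dom M f))"
  shows "\<epsilon> (Cod M f) \<cdot> (Da (Da f) \<cdot> g) = f \<cdot> (\<epsilon> (Dom M f) \<cdot> g)"
  using reassoc[OF eps_natural[OF assms(1)], of g] assms by simp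

lemma zigzag_assoc:
  assumes "A \<in> Obj M" "g \<in> Arr M" "Cod M g = Do A"
  shows "\<epsilon> (Do A) \<cdot> (Da (\<eta> A) \<cdot> g) = g" "Da (\<epsilon> A) \<cdot> (\<eta> (Do A) \<cdot> g) = g"
  using reassoc[OF zigzag(1)[OF assms(1)], of g] reassoc[OF zigzag(2)[OF assms(1)], of g] assms by simp_all

definition adjacent :: "nat \<Rightarrow> nat \<Rightarrow> bool" where
  "adjacent a k \<longleftrightarrow> a = Suc k \<or> k = Suc a"

text \<open>Multiplicity one: the complement of \<open>X k\<close> in \<open>D (X a)\<close> is zero
  or another member of the family, so no invertible endomorphism of \<open>X k\<close> passes
  through it.\<close>

lemma adjacent_biprod:
  assumes "adjacent a k"
  obtains Y i p i' p' where "biprod M (Do (X a)) (X k) Y i p i' p'"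
    "\<And>u v. u \<in> Hom M (X k) Y \<Longrightarrow> v \<in> Hom M Y (X k) \<Longrightarrow> \<not> iso_arr M (v \<cdot> u)"
proof (cases a)
  case 0
  then obtain Y i p i' p' where Y: "zero_object M Y" "biprod M (Do (X a)) (X k) Y i p i' p'"
    using assms chain_0 unfolding adjacent_def by auto
  have "\<not> iso_arr M (v \<cdot> u)" if "u \<in> Hom M (X k) Y" "v \<in> Hom M Y (X k)" for u v
  proof -
    have "v \<cdot> u = v \<cdot> (Ident M Y \<cdot> u)" using that by (simp add: in_Hom)
    also have "\<dots> = Null M (X k) (X k)" using that Y by (simp add: in_Hom zero_object_def)
    finally show ?thesis by (simp add: null_not_iso X_nonzero)
  qed
  thus ?thesis using Y that by blast
next
  case (Suc b)
  obtain i p i' p' where b: "biprod M (Do (X a)) (X b) (X (Suc a)) i p i' p'"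
    using chain_Suc[of b] Suc by blast
  from assms Suc consider "k = b" | "k = Suc a" by (auto simp: adjacent_def)
  thus ?thesis
  proof cases
    case 1
    have "\<not> iso_arr M (v \<cdot> u)" if "u \<in> Hom M (X k) (X (Suc a))" "v \<in> Hom M (X (Suc a)) (X k)" for u v
      using X_factor(1)[of u k "Suc a" v] that 1 Suc by (auto simp: in_Hom)
    thus ?thesis using that b 1 by blast
  next
    case 2
    have "\<not> iso_arr M (v \<cdot> u)" if "u \<in> Hom M (X k) (X b)" "v \<in> Hom M (X b) (X k)" for u v
      using X_factor(1)[of u k b v] that 2 Suc by (auto simp: in_Hom)
    thus ?thesis using that biprod_swap[OF b] 2 by blast
  qed
qed

text \<open>The absence of multiplicities enters here. Once one copy of \<open>X k\<close> is split
  off \<open>D (X a)\<close>, what remains contains no \<open>X k\<close>, so everything between it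
  and \<open>X k\<close> is radical.\<close>

lemma complement_rad:
  assumes "adjacent a k"
    and q: "q \<in> Arr M" "Dom M q = X k" "Cod M q = Do (X a)" and g: "g \<in> Arr M" "Dom M g = Do (X a)" "Cod M g = X k"
    and gq: "g \<cdot> q = Ident M (X k)"
  shows "h \<in> Arr M \<Longrightarrow> Dom M h = Do (X a) \<Longrightarrow> Cod M h = X k \<Longrightarrow> h \<cdot> (Ident M (Do (X a)) \<boxminus> q \<cdot> g) \<in> rad"
    and "h' \<in> Arr M \<Longrightarrow> Dom M h' = X k \<Longrightarrow> Cod M h' = Do (X a) \<Longrightarrow> (Ident M (Do (X a)) \<boxminus> q \<cdot> g) \<cdot> h' \<in> rad"
proof -
  define e where "e = Ident M (Do (X a)) \<boxminus> q \<cdot> g"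
  have e [simp]: "e \<in> Arr M" "Dom M e = Do (X a)" "Cod M e = Do (X a)" using q g by (simp_all add: e_def)
  obtain Y i p i' p' where b: "biprod M (Do (X a)) (X k) Y i p i' p'"
    and Y: "\<And>u v. u \<in> Hom M (X k) Y \<Longrightarrow> v \<in> Hom M Y (X k) \<Longrightarrow> \<not> iso_arr M (v \<cdot> u)"
    using adjacent_biprod[OF assms(1)] by metis
  have *: "\<not> iso_arr M (r \<cdot> (e \<cdot> r'))" if "r \<in> Arr M" "Dom M r = Do (X a)" "Cod M r = X k"
    "r' \<in> Arr M" "Dom M r' = X k" "Cod M r' = Do (X a)" for r r'
    unfolding e_def by (rule mult_one[OF b Y q g gq]) (use that in auto)
  show "h \<cdot> (Ident M (Do (X a)) \<boxminus> q \<cdot> g) \<in> rad" if h: "h \<in> Arr M" "Dom M h = Do (X a)" "Cod M h = X k"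
    unfolding e_def[symmetric]
  proof (rule radI)
    fix l u v assume uv: "u \<in> Arr M" "v \<in> Arr M" "Dom M u = Cod M (h \<cdot> e)" "Cod M u = X l"
      "Dom M v = X l" "Cod M v = Dom M (h \<cdot> e)"
    show "\<not> iso_arr M (u \<cdot> (h \<cdot> e \<cdot> v))"
    proof
      assume iso: "iso_arr M (u \<cdot> (h \<cdot> e \<cdot> v))"
      with X_factor(1)[of "h \<cdot> e \<cdot> v" l k u] uv h have "l = k" by auto
      with *[of "u \<cdot> h" v] uv h iso show False by simp
    qed
  qed (use h in simp)
  show "(Ident M (Do (X a)) \<boxminus> q \<cdot> g) \<cdot> h' \<in> rad" if h: "h' \<in> Arr M" "Dom M h' = X k" "Cod M h' = Do (X a)"
    unfolding e_def[symmetric]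
  proof (rule radI)
    fix l u v assume uv: "u \<in> Arr M" "v \<in> Arr M" "Dom M u = Cod M (e \<cdot> h')" "Cod M u = X l"
      "Dom M v = X l" "Cod M v = Dom M (e \<cdot> h')"
    show "\<not> iso_arr M (u \<cdot> (e \<cdot> h' \<cdot> v))"
    proof
      assume iso: "iso_arr M (u \<cdot> (e \<cdot> h' \<cdot> v))"
      with X_factor(1)[of v l k "u \<cdot> (e \<cdot> h')"] uv h have "l = k" by auto
      with *[of u "h' \<cdot> v"] uv h iso show False by simp
    qed
  qed (use h in simp)
qed

text \<open>Stability of the radical is localized at one \<open>X k\<close>, because the induction
  runs along the chain.\<close>

definition stable_at :: "nat \<Rightarrow> bool" where
  "stable_at k \<longleftrightarrow> (\<forall>f\<in>rad. \<forall>p q. p \<in> Arr M \<longrightarrow> q \<in> Arr M \<longrightarrow> Dom M p = Do (Cod M f) \<longrightarrow> Cod M p = X k \<longrightarrow>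
    Dom M q = X k \<longrightarrow> Cod M q = Do (Dom M f) \<longrightarrow> \<not> iso_arr M (p \<cdot> (Da f \<cdot> q)))"

text \<open>If \<open>p (D f) q = 1\<close>, then \<open>p\<close> equals \<open>p q p (D f)\<close>
  up to the radical. Writing \<open>p q = c + n\<close> with a scalar \<open>c\<close> and
  \<open>n\<close> radical shows that \<open>p D(1 - c f)\<close> is radical. As
  \<open>1 - c f\<close> is invertible, \<open>p\<close> itself is radical, and then
  \<open>p (D f) q\<close> cannot be the identity.\<close>

lemma stable_same:
  assumes ak: "adjacent a k" and f: "f \<in> rad" "Dom M f = X a" "Cod M f = X a"
    and p: "p \<in> Arr M" "Dom M p = Do (X a)" "Cod M p = X k"
    and q: "q \<in> Arr M" "Dom M q = X k" "Cod M q = Do (X a)"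
  shows "p \<cdot> (Da f \<cdot> q) \<noteq> Ident M (X k)"
proof
  assume 1: "p \<cdot> (Da f \<cdot> q) = Ident M (X k)"
  note [simp] = rad_arr[OF f(1)] f(2,3) p q
  define r where "r = p \<cdot> (Ident M (Do (X a)) \<boxminus> q \<cdot> (p \<cdot> Da f))"
  have r: "r \<in> rad" "Dom M r = Do (X a)" "Cod M r = X k"
    unfolding r_def by (intro complement_rad(1)[OF ak]) (use 1 in simp_all)
  note [simp] = rad_arr[OF r(1)] r(2,3)
  have pq: "p = p \<cdot> (q \<cdot> (p \<cdot> Da f)) \<boxplus> r" unfolding r_def by simp
  obtain c where c: "\<not> iso_arr M (p \<cdot> q \<boxminus> Scale M c (Ident M (X k)))"
    using scalar_X[of "p \<cdot> q" k] by (auto simp: in_Hom)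
  define n where "n = p \<cdot> q \<boxminus> Scale M c (Ident M (X k))"
  have n [simp]: "n \<in> Arr M" "Dom M n = X k" "Cod M n = X k" by (simp_all add: n_def)
  have nrad: "n \<in> rad" by (rule radI_X) (use c in \<open>auto simp: n_def\<close>)
  have "p \<cdot> q = Scale M c (Ident M (X k)) \<boxplus> n" unfolding n_def by simp
  hence "(p \<cdot> q) \<cdot> (p \<cdot> Da f) = Scale M c (p \<cdot> Da f) \<boxplus> n \<cdot> (p \<cdot> Da f)"
    by (simp del: assoc)
  hence "p \<cdot> (q \<cdot> (p \<cdot> Da f)) = Scale M c (p \<cdot> Da f) \<boxplus> n \<cdot> (p \<cdot> Da f)" by simp
  with pq have p_eq: "p = Scale M c (p \<cdot> Da f) \<boxplus> (n \<cdot> (p \<cdot> Da f) \<boxplus> r)" by simp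
  define s where "s = n \<cdot> (p \<cdot> Da f) \<boxplus> r"
  have s: "s \<in> rad" "Dom M s = Do (X a)" "Cod M s = X k"
    unfolding s_def using nrad r by (auto intro!: rad_plus rad_compR)
  note [simp] = rad_arr[OF s(1)] s(2,3)
  have "p \<boxminus> Scale M c (p \<cdot> Da f) = s"
  proof (rule plus_cancel[of "Scale M c (p \<cdot> Da f)"])
    show "Scale M c (p \<cdot> Da f) \<boxplus> (p \<boxminus> Scale M c (p \<cdot> Da f)) = Scale M c (p \<cdot> Da f) \<boxplus> s"
      using p_eq[symmetric] by (simp add: s_def)
  qed simp_all
  hence ps: "p \<cdot> Da (Ident M (X a) \<boxminus> Scale M c f) = s" by simp
  define t where "t = Ident M (X a) \<boxminus> Scale M c f"
  have [simp]: "t \<in> Arr M" "Dom M t = X a" "Cod M t = X a" by (simp_all add: t_def)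
  \<comment> \<open>\<open>c f\<close> is radical and \<open>c f + t = 1\<close>, so locality makes
    \<open>t\<close> invertible.\<close>
  have "iso_arr M t"
  proof (rule ccontr)
    assume "\<not> iso_arr M t"
    moreover have "\<not> iso_arr M (Scale M c f)" using rad_not_iso[OF rad_scale[OF f(1)]] by simp
    ultimately have "\<not> iso_arr M (Scale M c f \<boxplus> t)" by (intro local_sum[of _ a]) auto
    thus False by (simp add: t_def)
  qed
  note t = iso_arrD[OF this]
  have [simp]: "inv_arr M t \<in> Arr M" "Dom M (inv_arr M t) = X a" "Cod M (inv_arr M t) = X a"
    using t by simp_all
  have "Da t \<cdot> Da (inv_arr M t) = Ident M (Do (X a))"
    using D_comp[of "inv_arr M t" t] t by simp
  hence "(p \<cdot> Da t) \<cdot> Da (inv_arr M t) = p" by simp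
  hence "s \<cdot> Da (inv_arr M t) = p" using ps by (simp add: t_def)
  moreover have "s \<cdot> Da (inv_arr M t) \<in> rad" by (rule rad_compR[OF s(1)]) simp_all
  ultimately have "p \<in> rad" by simp
  hence "p \<cdot> (Da f \<cdot> q) \<in> rad" by (rule rad_compR) simp_all
  with rad_not_iso[of "p \<cdot> (Da f \<cdot> q)" k] 1 show False by simp
qed

text \<open>The inclusion \<open>j\<close> of \<open>X m\<close> into \<open>D (X (Suc m))\<close>
  is bent to \<open>u : D (X m) -> X (Suc m)\<close>. If \<open>p (D f) q = 1\<close>, then
  \<open>u\<close> is \<open>u q p (D f)\<close> up to a radical map \<open>r\<close>. Bending back,
  the first term passes through \<open>f : X m -> X (m + 2)\<close> by naturality of the unit, and
  the second is covered by \<open>stable_at m\<close>. Neither is invertible, but their sum is the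
  identity of \<open>X m\<close>.\<close>

lemma stable_up:
  assumes m: "stable_at m" and f: "f \<in> rad" "Dom M f = X m" "Cod M f = X (Suc (Suc m))"
    and p: "p \<in> Arr M" "Dom M p = Do (X (Suc (Suc m)))" "Cod M p = X (Suc m)"
    and q: "q \<in> Arr M" "Dom M q = X (Suc m)" "Cod M q = Do (X m)"
  shows "p \<cdot> (Da f \<cdot> q) \<noteq> Ident M (X (Suc m))"
proof
  assume 1: "p \<cdot> (Da f \<cdot> q) = Ident M (X (Suc m))"
  note [simp] = rad_arr[OF f(1)] f(2,3) p q
  obtain j w i' p' where b: "biprod M (Do (X (Suc m))) (X m) (X (Suc (Suc m))) j w i' p'"
    using chain_Suc by blast
  note [simp] = biprodD(4,5,8-11)[OF b]
  define u where "u = \<epsilon> (X (Suc m)) \<cdot> Da j"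
  have [simp]: "u \<in> Arr M" "Dom M u = Do (X m)" "Cod M u = X (Suc m)" by (simp_all add: u_def)
  have "Da u \<cdot> \<eta> (X m) = j"
    using eta_natural[of j] zigzag_assoc(2)[of "X (Suc m)" j] by (simp add: u_def)
  hence wu: "w \<cdot> (Da u \<cdot> \<eta> (X m)) = Ident M (X m)" using biprodD(16)[OF b] by simp
  define r where "r = u \<cdot> (Ident M (Do (X m)) \<boxminus> q \<cdot> (p \<cdot> Da f))"
  have r: "r \<in> rad" unfolding r_def by (intro complement_rad(1)[of m "Suc m"]) (use 1 in \<open>simp_all add: adjacent_def\<close>)
  have [simp]: "r \<in> Arr M" "Dom M r = Do (X m)" "Cod M r = X (Suc m)" by (simp_all add: r_def)
  have "u = u \<cdot> (q \<cdot> (p \<cdot> Da f)) \<boxplus> r" unfolding r_def by simp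
  hence "w \<cdot> (Da u \<cdot> \<eta> (X m)) = w \<cdot> (Da (u \<cdot> (q \<cdot> (p \<cdot> Da f)) \<boxplus> r) \<cdot> \<eta> (X m))" by metis
  also have "\<dots> = w \<cdot> (Da u \<cdot> (Da q \<cdot> (Da p \<cdot> (Da (Da f) \<cdot> \<eta> (X m))))) \<boxplus> w \<cdot> (Da r \<cdot> \<eta> (X m))" by simp
  also have "Da (Da f) \<cdot> \<eta> (X m) = \<eta> (X (Suc (Suc m))) \<cdot> f" using eta_natural[of f] by simp
  finally have iso: "iso_arr M (w \<cdot> (Da u \<cdot> (Da q \<cdot> (Da p \<cdot> (\<eta> (X (Suc (Suc m))) \<cdot> f)))) \<boxplus> w \<cdot> (Da r \<cdot> \<eta> (X m)))"
    unfolding wu by (metis X_obj iso_ident)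
  have "\<not> iso_arr M ((w \<cdot> (Da u \<cdot> (Da q \<cdot> (Da p \<cdot> (\<eta> (X (Suc (Suc m)))))))) \<cdot> f)"
    using X_factor(1)[of f m "Suc (Suc m)" "w \<cdot> (Da u \<cdot> (Da q \<cdot> (Da p \<cdot> (\<eta> (X (Suc (Suc m)))))))"] by auto
  moreover have "\<not> iso_arr M (w \<cdot> (Da r \<cdot> \<eta> (X m)))"
    using m r unfolding stable_at_def by simp
  ultimately show False using iso local_sum[of "w \<cdot> (Da u \<cdot> (Da q \<cdot> (Da p \<cdot> (\<eta> (X (Suc (Suc m))) \<cdot> f))))" m "w \<cdot> (Da r \<cdot> \<eta> (X m))"]
    by simp
qed

text \<open>The mirror image of \<open>stable_up\<close>: the projection \<open>w\<close> onto
  \<open>X m\<close> is bent with the unit, the complementary projector acts after \<open>u\<close>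
  instead of before it, and naturality of the counit extracts \<open>f\<close>.\<close>

lemma stable_down:
  assumes m: "stable_at m" and f: "f \<in> rad" "Dom M f = X (Suc (Suc m))" "Cod M f = X m"
    and p: "p \<in> Arr M" "Dom M p = Do (X m)" "Cod M p = X (Suc m)"
    and q: "q \<in> Arr M" "Dom M q = X (Suc m)" "Cod M q = Do (X (Suc (Suc m)))"
  shows "p \<cdot> (Da f \<cdot> q) \<noteq> Ident M (X (Suc m))"
proof
  assume 1: "p \<cdot> (Da f \<cdot> q) = Ident M (X (Suc m))"
  note [simp] = rad_arr[OF f(1)] f(2,3) p q
  obtain j w i' p' where b: "biprod M (Do (X (Suc m))) (X m) (X (Suc (Suc m))) j w i' p'"
    using chain_Suc by blast
  note [simp] = biprodD(4,5,8-11)[OF b]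
  define u where "u = Da w \<cdot> \<eta> (X (Suc m))"
  have [simp]: "u \<in> Arr M" "Dom M u = X (Suc m)" "Cod M u = Do (X m)" by (simp_all add: u_def)
  have "\<epsilon> (X m) \<cdot> Da u = w"
    using eps_natural_assoc[of w "Da (\<eta> (X (Suc m)))"] zigzag(1)[of "X (Suc m)"] by (simp add: u_def)
  hence "(\<epsilon> (X m) \<cdot> Da u) \<cdot> j = Ident M (X m)" using biprodD(16)[OF b] by metis
  hence wu: "\<epsilon> (X m) \<cdot> (Da u \<cdot> j) = Ident M (X m)" by simp
  define r where "r = (Ident M (Do (X m)) \<boxminus> (Da f \<cdot> q) \<cdot> p) \<cdot> u"
  have r: "r \<in> rad" unfolding r_def using 1 by (intro complement_rad(2)[of m "Suc m"]) (auto simp: adjacent_def)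
  have [simp]: "r \<in> Arr M" "Dom M r = X (Suc m)" "Cod M r = Do (X m)" by (simp_all add: r_def)
  have "u = Da f \<cdot> (q \<cdot> (p \<cdot> u)) \<boxplus> r" unfolding r_def by simp
  hence "\<epsilon> (X m) \<cdot> (Da u \<cdot> j) = \<epsilon> (X m) \<cdot> (Da (Da f \<cdot> (q \<cdot> (p \<cdot> u)) \<boxplus> r) \<cdot> j)" by metis
  also have "\<dots> = \<epsilon> (X m) \<cdot> (Da (Da f) \<cdot> (Da q \<cdot> (Da p \<cdot> (Da u \<cdot> j)))) \<boxplus> \<epsilon> (X m) \<cdot> (Da r \<cdot> j)" by simp
  also have "\<epsilon> (X m) \<cdot> (Da (Da f) \<cdot> (Da q \<cdot> (Da p \<cdot> (Da u \<cdot> j)))) = f \<cdot> (\<epsilon> (X (Suc (Suc m))) \<cdot> (Da q \<cdot> (Da p \<cdot> (Da u \<cdot> j))))"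
    using eps_natural_assoc[of f "Da q \<cdot> (Da p \<cdot> (Da u \<cdot> j))"] by simp
  finally have iso: "iso_arr M (f \<cdot> (\<epsilon> (X (Suc (Suc m))) \<cdot> (Da q \<cdot> (Da p \<cdot> (Da u \<cdot> j)))) \<boxplus> \<epsilon> (X m) \<cdot> (Da r \<cdot> j))"
    unfolding wu by (metis X_obj iso_ident)
  have "\<not> iso_arr M (f \<cdot> (\<epsilon> (X (Suc (Suc m))) \<cdot> (Da q \<cdot> (Da p \<cdot> (Da u \<cdot> j)))))"
    using X_factor(1)[of "\<epsilon> (X (Suc (Suc m))) \<cdot> (Da q \<cdot> (Da p \<cdot> (Da u \<cdot> j)))" m "Suc (Suc m)" f] by auto
  moreover have "\<not> iso_arr M (\<epsilon> (X m) \<cdot> (Da r \<cdot> j))"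
    using m r unfolding stable_at_def by simp
  ultimately show False using iso local_sum[of "f \<cdot> (\<epsilon> (X (Suc (Suc m))) \<cdot> (Da q \<cdot> (Da p \<cdot> (Da u \<cdot> j))))" m "\<epsilon> (X m) \<cdot> (Da r \<cdot> j)"]
    by simp
qed

text \<open>By adjunction \<open>p \<cdot> Da f \<cdot> q\<close> is the partial trace \<open>\<epsilon> \<cdot> Da s \<cdot> \<eta>\<close> of a radical endomorphism
  \<open>s\<close> of \<open>Do (X k)\<close>, so only the matrix entries of \<open>s\<close> between the two summands of \<open>Do (X k)\<close> matter.\<close>

lemma stable_atI:
  assumes b: "biprod M (Do (X k)) A B i p i' p'"
    and nonsplit: "\<And>Y Z f g h. Y \<in> {A, B} \<Longrightarrow> Z \<in> {A, B} \<Longrightarrow> f \<in> rad \<Longrightarrow> f \<in> Hom M Y Z \<Longrightarrow>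
      g \<in> Hom M (Do Z) (X k) \<Longrightarrow> h \<in> Hom M (X k) (Do Y) \<Longrightarrow> \<not> iso_arr M (g \<cdot> (Da f \<cdot> h))"
  shows "stable_at k"
  unfolding stable_at_def
proof (intro ballI allI impI)
  fix f g h assume f: "f \<in> rad" and gh: "g \<in> Arr M" "h \<in> Arr M" "Dom M g = Do (Cod M f)" "Cod M g = X k"
    "Dom M h = X k" "Cod M h = Do (Dom M f)"
  note [simp] = rad_arr[OF f] gh biprodD(1-15)[OF b]
  \<comment> \<open>\<open>s\<close> is \<open>f\<close> with its outer legs bent: \<open>g\<close>
    and \<open>h\<close> are transposed, so that an arbitrary \<open>f\<close> is replaced by an
    endomorphism of \<open>D (X k)\<close>, an object with a known decomposition.\<close>
  define s where "s = (Da g \<cdot> \<eta> (Cod M f)) \<cdot> (f \<cdot> (\<epsilon> (Dom M f) \<cdot> Da h))"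
  have s: "s \<in> rad" unfolding s_def by (intro rad_compL rad_compR f) simp_all
  have [simp]: "s \<in> Arr M" "Dom M s = Do (X k)" "Cod M s = Do (X k)" by (simp_all add: s_def)
  define T where "T = (\<lambda>x. \<epsilon> (X k) \<cdot> (Da x \<cdot> \<eta> (X k)))"
  have T_arr: "T x \<in> Arr M" "Dom M (T x) = X k" "Cod M (T x) = X k"
    if "x \<in> Arr M" "Dom M x = Do (X k)" "Cod M x = Do (X k)" for x
    using that by (simp_all add: T_def)
  have T_plus: "T (x \<boxplus> y) = T x \<boxplus> T y"
    if "x \<in> Arr M" "Dom M x = Do (X k)" "Cod M x = Do (X k)" "y \<in> Arr M" "Dom M y = Do (X k)" "Cod M y = Do (X k)" for x y
    using that by (simp_all add: T_def)
  have "T s = (\<epsilon> (X k) \<cdot> (Da (Da g) \<cdot> (Da (\<eta> (Cod M f)) \<cdot> (Da f \<cdot> (Da (\<epsilon> (Dom M f)) \<cdot> (Da (Da h) \<cdot> \<eta> (X k)))))))"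
    by (simp add: T_def s_def)
  \<comment> \<open>Naturality of counit and unit moves \<open>g\<close> and \<open>h\<close> to the
    outside; the two zigzag identities cancel what is left around \<open>D f\<close>.\<close>
  also have "\<dots> = g \<cdot> (Da f \<cdot> h)"
    using eta_natural[of h] eps_natural_assoc[of g "Da (\<eta> (Cod M f)) \<cdot> (Da f \<cdot> h)"] 
    by (simp add: zigzag_assoc)
  finally have Ts: "T s = g \<cdot> (Da f \<cdot> h)" .
  \<comment> \<open>A corner \<open>v t u\<close> has trace
    \<open>(\<epsilon> (D v)) (D t) ((D u) \<eta>)\<close>, which is again a component of
    \<open>D\<close> of a radical map, now between the two summands.\<close>
  have entry: "\<not> iso_arr M (T (v \<cdot> (t \<cdot> u)))" 
    if "t \<in> rad" "t \<in> Hom M Y Z" "Y \<in> {A, B}" "Z \<in> {A, B}" "u \<in> Hom M (Do (X k)) Y" "v \<in> Hom M Z (Do (X k))" for t u v Y Z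
  proof -
    have "T (v \<cdot> (t \<cdot> u)) = (\<epsilon> (X k) \<cdot> Da v) \<cdot> (Da t \<cdot> (Da u \<cdot> \<eta> (X k)))"
      using that by (simp add: T_def in_Hom)
    thus ?thesis using nonsplit[OF that(3,4,1,2), of "\<epsilon> (X k) \<cdot> Da v" "Da u \<cdot> \<eta> (X k)"] that by (simp add: in_Hom)
  qed
  have "s = i \<cdot> (p \<cdot> s) \<boxplus> i' \<cdot> (p' \<cdot> s)" using biprod_expand(1)[OF b, of s] by simp
  also have "p \<cdot> s = p \<cdot> (s \<cdot> (i \<cdot> p)) \<boxplus> p \<cdot> (s \<cdot> (i' \<cdot> p'))"
    using biprod_expand(2)[OF b, of "p \<cdot> s"] by simp
  also have "p' \<cdot> s = p' \<cdot> (s \<cdot> (i \<cdot> p)) \<boxplus> p' \<cdot> (s \<cdot> (i' \<cdot> p'))"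
    using biprod_expand(2)[OF b, of "p' \<cdot> s"] by simp
  finally have "s = (i \<cdot> ((p \<cdot> (s \<cdot> i)) \<cdot> p) \<boxplus> i \<cdot> ((p \<cdot> (s \<cdot> i')) \<cdot> p')) \<boxplus>
      (i' \<cdot> ((p' \<cdot> (s \<cdot> i)) \<cdot> p) \<boxplus> i' \<cdot> ((p' \<cdot> (s \<cdot> i')) \<cdot> p'))" by simp
  hence "T s = T ((i \<cdot> ((p \<cdot> (s \<cdot> i)) \<cdot> p) \<boxplus> i \<cdot> ((p \<cdot> (s \<cdot> i')) \<cdot> p')) \<boxplus>
      (i' \<cdot> ((p' \<cdot> (s \<cdot> i)) \<cdot> p) \<boxplus> i' \<cdot> ((p' \<cdot> (s \<cdot> i')) \<cdot> p')))" by metis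
  also have "\<dots> = (T (i \<cdot> ((p \<cdot> (s \<cdot> i)) \<cdot> p)) \<boxplus> T (i \<cdot> ((p \<cdot> (s \<cdot> i')) \<cdot> p'))) \<boxplus>
      (T (i' \<cdot> ((p' \<cdot> (s \<cdot> i)) \<cdot> p)) \<boxplus> T (i' \<cdot> ((p' \<cdot> (s \<cdot> i')) \<cdot> p')))"
    by (simp add: T_plus T_arr)
  also have "\<not> iso_arr M \<dots>"
  proof -
    have r: "p \<cdot> (s \<cdot> i) \<in> rad" "p \<cdot> (s \<cdot> i') \<in> rad" "p' \<cdot> (s \<cdot> i) \<in> rad" "p' \<cdot> (s \<cdot> i') \<in> rad"
      by (intro rad_compL rad_compR s, simp_all)+
    have "\<not> iso_arr M (T (i \<cdot> ((p \<cdot> (s \<cdot> i)) \<cdot> p)))" by (rule entry[where Y=A and Z=A, OF r(1)]) (simp_all add: in_Hom)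
    moreover have "\<not> iso_arr M (T (i \<cdot> ((p \<cdot> (s \<cdot> i')) \<cdot> p')))" by (rule entry[where Y=B and Z=A, OF r(2)]) (simp_all add: in_Hom)
    moreover have "\<not> iso_arr M (T (i' \<cdot> ((p' \<cdot> (s \<cdot> i)) \<cdot> p)))" by (rule entry[where Y=A and Z=B, OF r(3)]) (simp_all add: in_Hom)
    moreover have "\<not> iso_arr M (T (i' \<cdot> ((p' \<cdot> (s \<cdot> i')) \<cdot> p')))" by (rule entry[where Y=B and Z=B, OF r(4)]) (simp_all add: in_Hom)
    ultimately show ?thesis by (intro local_sum[where i=k]) (simp_all add: T_arr)
  qed
  finally show "\<not> iso_arr M (g \<cdot> (Da f \<cdot> h))" unfolding Ts .
qed

text \<open>Absorbs the inverse of an invertible component into its left factor; the results about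
  single entries are stated for components equal to the identity.\<close>

lemma normalize:
  assumes "iso_arr M (g \<cdot> (Da f \<cdot> h))" "f \<in> Arr M" "g \<in> Arr M" "h \<in> Arr M" "Dom M g = Do (Cod M f)"
    "Cod M h = Do (Dom M f)" "Cod M g = X k" "Dom M h = X k"
  shows "(inv_arr M (g \<cdot> (Da f \<cdot> h)) \<cdot> g) \<cdot> (Da f \<cdot> h) = Ident M (X k)"
    "inv_arr M (g \<cdot> (Da f \<cdot> h)) \<cdot> g \<in> Arr M" "Dom M (inv_arr M (g \<cdot> (Da f \<cdot> h)) \<cdot> g) = Dom M g"
    "Cod M (inv_arr M (g \<cdot> (Da f \<cdot> h)) \<cdot> g) = X k"
  using iso_arrD[OF assms(1)] assms(2-) by simp_all

text \<open>At \<open>0\<close> the only entry between non-zero summands is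
  \<open>X 1 -> X 1\<close>. At \<open>Suc m\<close> the two diagonal entries need no induction
  hypothesis, and the two off-diagonal ones descend to \<open>m\<close>.\<close>

lemma stable: "stable_at k"
proof (induction k)
  case 0
  obtain Y i p i' p' where Y: "zero_object M Y" and b: "biprod M (Do (X 0)) (X 1) Y i p i' p'"
    using chain_0 by blast
  show ?case
  proof (rule stable_atI[OF b])
    fix A B f g h assume AB: "A \<in> {X 1, Y}" "B \<in> {X 1, Y}" and f: "f \<in> rad" "f \<in> Hom M A B"
      and g: "g \<in> Hom M (Do B) (X 0)" and h: "h \<in> Hom M (X 0) (Do A)"
    have [simp]: "A \<in> Obj M" "B \<in> Obj M" using AB biprodD(2,3)[OF b] by auto
    show "\<not> iso_arr M (g \<cdot> (Da f \<cdot> h))"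
    proof (cases "A = X 1 \<and> B = X 1")
      case True
      show ?thesis
      proof
        assume "iso_arr M (g \<cdot> (Da f \<cdot> h))"
        from normalize[OF this, of 0] stable_same[of 1 0 f _ h] True f g h
        show False by (auto simp: in_Hom adjacent_def)
      qed
    next
      case False
      hence "zero_object M A \<or> zero_object M B" using AB Y by auto
      hence "Ident M A = Null M A A \<or> Ident M B = Null M B B" by (auto simp: zero_object_def)
      moreover have "f = Ident M B \<cdot> f" "f = f \<cdot> Ident M A" using f by (auto simp: in_Hom)
      ultimately have "f = Null M A B" using f by (metis in_Hom null_compL null_compR \<open>A \<in> Obj M\<close> \<open>B \<in> Obj M\<close>)
      thus ?thesis using g h by (simp add: in_Hom null_not_iso X_nonzero)
    qed
  qed
next
  case (Suc m)
  obtain i p i' p' where b: "biprod M (Do (X (Suc m))) (X m) (X (Suc (Suc m))) i p i' p'"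
    using chain_Suc by blast
  show ?case
  proof (rule stable_atI[OF b])
    fix A B f g h assume AB: "A \<in> {X m, X (Suc (Suc m))}" "B \<in> {X m, X (Suc (Suc m))}" and f: "f \<in> rad" "f \<in> Hom M A B"
      and g: "g \<in> Hom M (Do B) (X (Suc m))" and h: "h \<in> Hom M (X (Suc m)) (Do A)"
    show "\<not> iso_arr M (g \<cdot> (Da f \<cdot> h))"
    proof
      assume "iso_arr M (g \<cdot> (Da f \<cdot> h))"
      note n = normalize[OF this, of "Suc m"]
      from AB consider "A = X m" "B = X m" | "A = X (Suc (Suc m))" "B = X (Suc (Suc m))"
        | "A = X m" "B = X (Suc (Suc m))" | "A = X (Suc (Suc m))" "B = X m" by blast
      thus False
      proof cases
        case 1 thus ?thesis using n stable_same[of m "Suc m" f _ h] f g h by (auto simp: in_Hom adjacent_def)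
      next
        case 2 thus ?thesis using n stable_same[of "Suc (Suc m)" "Suc m" f _ h] f g h by (auto simp: in_Hom adjacent_def)
      next
        case 3 thus ?thesis using n stable_up[OF Suc, of f _ h] f g h by (auto simp: in_Hom)
      next
        case 4 thus ?thesis using n stable_down[OF Suc, of f _ h] f g h by (auto simp: in_Hom)
      qed
    qed
  qed
qed

theorem rad_stable: "f \<in> rad \<Longrightarrow> Da f \<in> rad"
  by (rule radI) (use stable in \<open>auto simp: stable_at_def\<close>)

end

section \<open>Indecomposable objects\<close>

context linear_category
begin

lemma local_iso_transport:
  assumes Y: "local_endomorphisms M Y" and g: "iso_arr M g" "Dom M g = Y" "Cod M g = X"
  shows "local_endomorphisms M X"
proof -
  note [simp] = iso_arrD[OF g(1)] g(2,3)
  have [simp]: "X \<in> Obj M" "Y \<in> Obj M" using cod_obj[of g] dom_obj[of g] by simp_all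
  let ?c = "\<lambda>f. inv_arr M g \<cdot> (f \<cdot> g)"
  have conj: "iso_arr M (?c f) \<longleftrightarrow> iso_arr M f" if f: "f \<in> Arr M" "Dom M f = X" "Cod M f = X" for f
  proof
    assume c: "iso_arr M (?c f)"
    have "iso_arr M (g \<cdot> (?c f \<cdot> inv_arr M g))"
      by (rule iso_comp[OF iso_comp[OF iso_inv[OF g(1)] c] g(1)]) (use f in simp_all)
    thus "iso_arr M f" using f g(1) by simp
  next
    assume "iso_arr M f" thus "iso_arr M (?c f)" using f by (intro iso_comp g iso_inv) simp_all
  qed
  have "Ident M X \<noteq> Null M X X"
  proof
    assume "Ident M X = Null M X X"
    hence "inv_arr M g \<cdot> (Ident M X \<cdot> g) = inv_arr M g \<cdot> (Null M X X \<cdot> g)" by simp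
    thus False using Y by (simp add: local_iff)
  qed
  moreover have "\<not> iso_arr M (f \<boxplus> h)" if f: "f \<in> Arr M" "Dom M f = X" "Cod M f = X"
    and h: "h \<in> Arr M" "Dom M h = X" "Cod M h = X" and n: "\<not> iso_arr M f" "\<not> iso_arr M h" for f h
  proof -
    have "\<not> iso_arr M (?c f \<boxplus> ?c h)" using Y f h n conj[OF f] conj[OF h] unfolding local_iff by auto
    thus ?thesis using conj[of "f \<boxplus> h"] f h by simp
  qed
  ultimately show ?thesis unfolding local_iff by simp
qed

text \<open>A Krull-Schmidt decomposition of a non-zero object has a first summand, with local
  endomorphism ring. The complementary idempotent splits, and indecomposability makes its image
  zero, so the summand is everything.\<close>

lemma indecomposable_local:
  assumes "idempotent_split M" "krull_schmidt M" and X: "indecomposable M X"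
  shows "local_endomorphisms M X"
proof -
  from X have [simp]: "X \<in> Obj M" and nz: "Ident M X \<noteq> Null M X X"
    by (auto simp: indecomposable_def zero_object_def)
  from assms(2) obtain Xs where Xs: "direct_sum M X Xs" and loc: "\<And>Y. Y \<in> set Xs \<Longrightarrow> local_endomorphisms M Y"
    unfolding krull_schmidt_def by force
  from Xs obtain \<iota> \<pi> where
    h: "\<forall>i < length Xs. \<iota> i \<in> Hom M (Xs ! i) X \<and> \<pi> i \<in> Hom M X (Xs ! i)"
    and k: "\<forall>i < length Xs. \<forall>j < length Xs.
        \<pi> i \<cdot> \<iota> j = (if i = j then Ident M (Xs ! i) else Null M (Xs ! j) (Xs ! i))"
    and s: "finsum (hom_space M X X) (\<lambda>i. \<iota> i \<cdot> \<pi> i) {..<length Xs} = Ident M X"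
    unfolding direct_sum_def by blast
  have n: "0 < length Xs"
  proof (rule ccontr)
    assume "\<not> 0 < length Xs"
    thus False using s nz finsum_hom_0[of X X "\<lambda>i. \<iota> i \<cdot> \<pi> i"] by simp
  qed
  define Y where "Y = Xs ! 0"
  have Y: "local_endomorphisms M Y" using loc n by (auto simp: Y_def)
  hence [simp]: "Y \<in> Obj M" by (simp add: local_iff)
  have [simp]: "\<iota> 0 \<in> Arr M" "Dom M (\<iota> 0) = Y" "Cod M (\<iota> 0) = X" "\<pi> 0 \<in> Arr M" "Dom M (\<pi> 0) = X" "Cod M (\<pi> 0) = Y"
    using h n by (auto simp: in_Hom Y_def)
  have pi: "\<pi> 0 \<cdot> \<iota> 0 = Ident M Y" using k n by (simp add: Y_def)
  have [simp]: "\<pi> 0 \<cdot> (\<iota> 0 \<cdot> \<pi> 0) = \<pi> 0" using reassoc[OF pi, of "\<pi> 0"] by simp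
  define e where "e = Ident M X \<boxminus> \<iota> 0 \<cdot> \<pi> 0"
  have [simp]: "e \<in> Arr M" "Dom M e = X" "Cod M e = X" by (simp_all add: e_def)
  have "e \<cdot> e = e" by (simp add: e_def)
  then obtain Y' p i where Y': "Y' \<in> Obj M" "p \<in> Hom M X Y'" "i \<in> Hom M Y' X" "i \<cdot> p = e" "p \<cdot> i = Ident M Y'"
    using assms(1) unfolding idempotent_split_def
    by (metis \<open>X \<in> Obj M\<close> \<open>e \<in> Arr M\<close> \<open>Dom M e = X\<close> \<open>Cod M e = X\<close> in_Hom)
  have "biprod M X Y Y' (\<iota> 0) (\<pi> 0) i p"
    unfolding biprod_def using Y' pi by (simp add: in_Hom) (simp add: e_def)
  hence "zero_object M Y \<or> zero_object M Y'" using X direct_sum_2 unfolding indecomposable_def by blast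
  moreover have "\<not> zero_object M Y" using Y by (simp add: local_iff zero_object_def)
  ultimately have "Ident M Y' = Null M Y' Y'" by (simp add: zero_object_def)
  moreover have "i \<cdot> (Ident M Y' \<cdot> p) = e" using Y' by (simp add: in_Hom)
  ultimately have "e = Null M X X" using Y' by (simp add: in_Hom)
  hence "Ident M X = \<iota> 0 \<cdot> \<pi> 0" unfolding e_def by (rule minus_eq_null) simp_all
  hence "iso_arr M (\<iota> 0)" using pi by (intro iso_arrI[of _ _ "\<pi> 0"]) simp_all
  thus ?thesis using local_iso_transport[OF Y] by simp
qed

section \<open>Endomorphisms are scalars modulo non-units\<close>

definition peval :: "'o \<Rightarrow> 'a \<Rightarrow> complex poly \<Rightarrow> 'a" where
  "peval X f p = fold_coeffs (\<lambda>a g. Scale M a (Ident M X) \<boxplus> f \<cdot> g) p (Null M X X)"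

context
  fixes X f assumes f [simp]: "X \<in> Obj M" "f \<in> Arr M" "Dom M f = X" "Cod M f = X"
begin

lemma peval_0 [simp]: "peval X f 0 = Null M X X"
  by (simp add: peval_def)

lemma peval_pCons [simp]: "peval X f (pCons a p) = Scale M a (Ident M X) \<boxplus> f \<cdot> peval X f p"
  by (cases "a = 0 \<and> p = 0") (auto simp: peval_def)

lemma peval_arr [simp]: "peval X f p \<in> Arr M" "Dom M (peval X f p) = X" "Cod M (peval X f p) = X"
  by (induction p) simp_all

lemma peval_add: "peval X f (p + q) = peval X f p \<boxplus> peval X f q"
  by (induction p q rule: poly_induct2) (simp_all add: scale_add plus_left_comm)

lemma peval_smult: "peval X f (smult c p) = Scale M c (peval X f p)"
  by (induction p) simp_all

lemma peval_root: "peval X f ([:- c, 1:] * q) = (f \<boxminus> Scale M c (Ident M X)) \<cdot> peval X f q"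
proof -
  have "[:- c, 1:] * q = smult (- c) q + pCons 0 q" by simp
  thus ?thesis by (simp only: peval_add peval_smult) (simp add: minus_def plus_comm)
qed

text \<open>Some root \<open>c\<close> of the polynomial must be an eigenvalue: while
  \<open>f - c\<close> is invertible it can be cancelled and the degree drops, and a non-zero
  constant cannot annihilate a non-zero object.\<close>

lemma peval_eq_0:
  assumes "peval X f p = Null M X X" "p \<noteq> 0" "Ident M X \<noteq> Null M X X"
  shows "\<exists>c. \<not> iso_arr M (f \<boxminus> Scale M c (Ident M X))"
  using assms
proof (induction "degree p" arbitrary: p)
  case 0
  then obtain a where p: "p = [:a:]" by (metis degree_eq_zeroE)
  with 0 have a: "a \<noteq> 0" "Scale M a (Ident M X) = Null M X X" by auto
  hence "Scale M (inverse a) (Scale M a (Ident M X)) = Null M X X" by (simp del: scale_scale)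
  moreover have "Scale M (inverse a) (Scale M a (Ident M X)) = Ident M X" using a(1) by simp
  ultimately show ?case using 0(4) by metis
next
  case (Suc n)
  obtain c where "poly p c = 0"
    using fundamental_theorem_of_algebra[of p] Suc(2) by (auto simp: constant_degree)
  then obtain q where q: "p = [:- c, 1:] * q" by (auto simp: poly_eq_0_iff_dvd dvd_def)
  show ?case
  proof (cases "iso_arr M (f \<boxminus> Scale M c (Ident M X))")
    case True
    have "(f \<boxminus> Scale M c (Ident M X)) \<cdot> peval X f q = (f \<boxminus> Scale M c (Ident M X)) \<cdot> Null M X X"
      using Suc(3) unfolding q peval_root by simp
    hence "peval X f q = Null M X X" by (rule iso_cancelL[OF _ True]) simp_all
    moreover have "q \<noteq> 0" using Suc(4) q by auto
    moreover have "degree p = degree [:- c, 1:] + degree q"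
      unfolding q using \<open>q \<noteq> 0\<close> by (intro degree_mult_eq) auto
    hence "n = degree q" using Suc(2) by simp
    ultimately show ?thesis using Suc(1) assms(3) by blast
  qed blast
qed

lemma peval_sum:
  assumes "finite A"
  shows "peval X f (\<Sum>v\<in>A. monom (a v) (g v)) =
    finsum (hom_space M X X) (\<lambda>v. Scale M (a v) (peval X f (monom 1 (g v)))) A"
  using assms
proof (induction A)
  case empty
  show ?case by (simp add: abelian_monoid.finsum_empty[OF abelian_group.axioms(1)[OF hom_group[of X X]]])
next
  case (insert v A)
  have "peval X f (monom (a v) (g v)) = Scale M (a v) (peval X f (monom 1 (g v)))"
    by (simp flip: peval_smult add: smult_monom)
  thus ?case using insert hom_group[of X X]
    by (subst abelian_monoid.finsum_insert) (auto simp: abelian_group_def in_Hom peval_add)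
qed

text \<open>Finite dimension of \<open>End X\<close> makes the powers of \<open>f\<close> linearly
  dependent, so a non-zero polynomial annihilates \<open>f\<close>. Together with locality this says
  that \<open>End X\<close> modulo its radical is the field of complex numbers.\<close>

lemma scalar_part:
  assumes fd: "vectorspace.fin_dim class_ring (hom_space M X X)" and nz: "Ident M X \<noteq> Null M X X"
  shows "\<exists>c. \<not> iso_arr M (f \<boxminus> Scale M c (Ident M X))"
proof -
  interpret V: vectorspace class_ring "hom_space M X X" by (rule hom_vectorspace) simp_all
  define pw where "pw = (\<lambda>i. peval X f (monom 1 i))"
  define n where "n = V.dim"
  have "\<exists>p. p \<noteq> 0 \<and> peval X f p = Null M X X"
  \<comment> \<open>Linear dependence of a set speaks of distinct vectors only, so a repetition
    among the powers is treated apart; it yields a difference of two monomials.\<close>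
  proof (cases "inj_on pw {..n}")
    case False
    then obtain i j where ij: "i \<noteq> j" "pw i = pw j" by (auto simp: inj_on_def)
    let ?p = "monom 1 i + smult (-1) (monom (1::complex) j)"
    have "peval X f ?p = Null M X X"
      using ij by (simp only: peval_add peval_smult) (simp add: pw_def)
    moreover have "coeff ?p i \<noteq> 0" using ij by simp
    hence "?p \<noteq> 0" by (metis coeff_0)
    ultimately show ?thesis by blast
  next
    case True
    hence "card (pw ` {..n}) > V.dim" by (simp add: card_image n_def)
    have pw_Hom: "pw i \<in> Hom M X X" for i by (simp add: pw_def in_Hom)
    hence sub: "pw ` {..n} \<subseteq> carrier (hom_space M X X)" by auto
    with \<open>card (pw ` {..n}) > V.dim\<close> have "V.lin_dep (pw ` {..n})" using V.li_le_dim[OF fd, of "pw ` {..n}"] by fastforce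
    from V.finite_lin_dep[OF _ this sub] obtain a v where
      a: "V.lincomb a (pw ` {..n}) = Null M X X" "v \<in> pw ` {..n}" "a v \<noteq> 0"
      by (auto simp: class_ring_simps)
    define g where "g = inv_into {..n} pw"
    have g: "g (pw i) = i" if "i \<le> n" for i using True that by (simp add: g_def)
    let ?p = "\<Sum>w \<in> pw ` {..n}. monom (a w) (g w)"
    have "peval X f ?p = finsum (hom_space M X X) (\<lambda>w. Scale M (a w) (pw (g w))) (pw ` {..n})"
      by (subst peval_sum) (simp_all add: pw_def)
    also have "\<dots> = V.lincomb a (pw ` {..n})"
      unfolding V.lincomb_def by (rule V.finsum_cong2) (use pw_Hom in \<open>auto simp: g in_Hom\<close>)
    finally have "peval X f ?p = Null M X X" using a by simp
    moreover have "coeff ?p (g v) = (\<Sum>w \<in> pw ` {..n}. if w = v then a w else 0)"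
      unfolding coeff_sum using a(2) by (intro sum.cong) (auto simp: g)
    hence "coeff ?p (g v) = a v" using a(2) by simp
    hence "?p \<noteq> 0" using a(3) by (metis coeff_0)
    ultimately show ?thesis by blast
  qed
  thus ?thesis using peval_eq_0 nz by blast
qed

end

text \<open>Split idempotents and Krull-Schmidt supply locality, finite-dimensional hom-spaces over
  the complex numbers supply the scalar part.\<close>

lemma indec_familyI:
  assumes "locally_finitary M" "\<And>i. indecomposable M (X i)" "\<And>i j. isomorphic M (X i) (X j) \<Longrightarrow> i = j"
  shows "indec_family M X"
proof
  fix i j f
  from assms have fin: "idempotent_split M" "krull_schmidt M"
    and fd: "\<And>X Y. X \<in> Obj M \<Longrightarrow> Y \<in> Obj M \<Longrightarrow> vectorspace.fin_dim class_ring (hom_space M X Y)"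
    by (auto simp: locally_finitary_def)
  show loc: "local_endomorphisms M (X i)" using indecomposable_local[OF fin] assms(2) .
  show "isomorphic M (X i) (X j) \<Longrightarrow> i = j" by fact
  assume f: "f \<in> Hom M (X i) (X i)"
  have X: "X i \<in> Obj M" "Ident M (X i) \<noteq> Null M (X i) (X i)" using loc by (simp_all add: local_iff)
  show "\<exists>c. \<not> iso_arr M (f \<boxminus> Scale M c (Ident M (X i)))"
    by (rule scalar_part[OF X(1) _ _ _ fd[OF X(1) X(1)] X(2)]) (use f in \<open>simp_all add: in_Hom\<close>)
qed

end

section \<open>Linear algebra\<close>

text \<open>A basis \<open>b\<close> of the range of \<open>B\<close> is built by adding the columns one at a time, with the dual functionals
  \<open>x\<close> kept alongside.\<close>

lemma range_factor_fun:
  fixes B :: "nat \<Rightarrow> nat \<Rightarrow> complex" and n :: nat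
  shows "\<exists>r b x. (\<forall>a<r. \<forall>a'<r. (\<Sum>i<n. x a i * b a' i) = (if a = a' then 1 else (0::complex))) \<and>
    (\<forall>l<m. \<forall>i<n. B l i = (\<Sum>a<r. (\<Sum>k<n. x a k * B l k) * b a i)) \<and>
    (\<forall>a<(r::nat). \<exists>c. \<forall>i<n. b a i = (\<Sum>l<m. c l * B l i))"
proof (induction m)
  case 0
  show ?case by (rule exI[of _ 0]) auto
next
  case (Suc m)
  then obtain r :: nat and b x :: "nat \<Rightarrow> nat \<Rightarrow> complex" where
    dual': "\<forall>a<r. \<forall>a'<r. (\<Sum>i<n. x a i * b a' i) = (if a = a' then 1 else 0)"
    and ex': "\<forall>l<m. \<forall>i<n. B l i = (\<Sum>a<r. (\<Sum>k<n. x a k * B l k) * b a i)"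
    and c': "\<forall>a<r. \<exists>c. \<forall>i<n. b a i = (\<Sum>l<m. c l * B l i)" by blast
  note dual = dual'[rule_format] and ex = ex'[rule_format]
  have "\<forall>a. \<exists>c. a < r \<longrightarrow> (\<forall>i<n. b a i = (\<Sum>l<m. c l * B l i))" using c' by blast
  from choice[OF this] obtain c where c: "\<And>a i. a < r \<Longrightarrow> i < n \<Longrightarrow> b a i = (\<Sum>l<m. c a l * B l i)" by blast
  define v where "v = (\<lambda>i. B m i - (\<Sum>a<r. (\<Sum>k<n. x a k * B m k) * b a i))"
  show ?case
  proof (cases "\<forall>i<n. v i = 0")
    case True
    have "\<forall>l<Suc m. \<forall>i<n. B l i = (\<Sum>a<r. (\<Sum>k<n. x a k * B l k) * b a i)"
    proof (intro allI impI)
      fix l i assume "l < Suc m" "i < n"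
      show "B l i = (\<Sum>a<r. (\<Sum>k<n. x a k * B l k) * b a i)"
      proof (cases "l = m")
        case l: True
        have "v i = 0" using True \<open>i < n\<close> by blast
        thus ?thesis unfolding v_def l by (simp only: right_minus_eq)
      qed (use \<open>l < Suc m\<close> \<open>i < n\<close> in \<open>intro ex, auto\<close>)
    qed
    moreover have "\<exists>c. \<forall>i<n. b a i = (\<Sum>l<Suc m. c l * B l i)" if "a < r" for a
      by (rule exI[of _ "(c a)(m := 0)"]) (use c[OF that] in simp)
    ultimately show ?thesis using dual by blast
  next
    case False
    then obtain j where j: "j < n" "v j \<noteq> 0" by blast
    \<comment> \<open>The coordinate functional at a place where \<open>v\<close> does not vanish,
      scaled to take the value 1 on \<open>v\<close> and corrected by the old functionals so as to
      kill the old basis. Since the old functionals kill \<open>v\<close>, duality persists.\<close>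
    define y where "y = (\<lambda>k. (if k = j then 1 / v j else 0) - (\<Sum>a<r. b a j / v j * x a k))"
    have y: "(\<Sum>k<n. y k * u k) = u j / v j - (\<Sum>a<r. b a j / v j * (\<Sum>k<n. x a k * u k))" for u
    proof -
      have "(\<Sum>k<n. y k * u k) = (\<Sum>k<n. (if k = j then u k / v j else 0)) - (\<Sum>k<n. \<Sum>a<r. b a j / v j * (x a k * u k))"
        unfolding y_def sum_subtractf[symmetric]
        by (intro sum.cong) (auto simp: left_diff_distrib sum_distrib_right mult.assoc)
      also have "(\<Sum>k<n. \<Sum>a<r. b a j / v j * (x a k * u k)) = (\<Sum>a<r. b a j / v j * (\<Sum>k<n. x a k * u k))"
        by (subst sum.swap) (simp add: sum_distrib_left)
      finally show ?thesis using j by simp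
    qed
    have xlin: "(\<Sum>k<n. x a k * (\<Sum>a'<r. g a' * b a' k)) = g a" if "a < r" for a g
    proof -
      have "(\<Sum>k<n. x a k * (\<Sum>a'<r. g a' * b a' k)) = (\<Sum>a'<r. g a' * (\<Sum>k<n. x a k * b a' k))"
        by (simp add: sum_distrib_left mult.left_commute) (rule sum.swap)
      also have "\<dots> = (\<Sum>a'<r. if a = a' then g a' else 0)" using that by (intro sum.cong) (auto simp: dual)
      finally show ?thesis using that by simp
    qed
    have xv: "(\<Sum>k<n. x a k * v k) = 0" if "a < r" for a
      unfolding v_def right_diff_distrib sum_subtractf using xlin[OF that, of "\<lambda>a. \<Sum>k<n. x a k * B m k"] by simp
    have yb: "(\<Sum>k<n. y k * b a k) = 0" if "a < r" for a
    proof -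
      have "(\<Sum>a'<r. b a' j / v j * (\<Sum>k<n. x a' k * b a k)) = (\<Sum>a'<r. if a' = a then b a' j / v j else 0)"
        using that by (intro sum.cong) (auto simp: dual)
      thus ?thesis using that by (simp add: y)
    qed
    have yv: "(\<Sum>k<n. y k * v k) = 1" using j xv by (simp add: y)
    have ylin: "(\<Sum>k<n. y k * (\<Sum>a<r. g a * b a k)) = 0" for g
    proof -
      have "(\<Sum>k<n. y k * (\<Sum>a<r. g a * b a k)) = (\<Sum>a<r. g a * (\<Sum>k<n. y k * b a k))"
        by (simp add: sum_distrib_left mult.left_commute) (rule sum.swap)
      thus ?thesis by (simp add: yb)
    qed
    have yB: "(\<Sum>k<n. y k * B l k) = 0" if "l < m" for l
    proof -
      have "(\<Sum>k<n. y k * B l k) = (\<Sum>k<n. y k * (\<Sum>a<r. (\<Sum>i<n. x a i * B l i) * b a k))"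
        by (rule sum.cong[OF refl], subst ex[OF that]) auto
      thus ?thesis by (simp only: ylin)
    qed
    have "(\<Sum>k<n. y k * B m k) = (\<Sum>k<n. y k * (v k + (\<Sum>a<r. (\<Sum>i<n. x a i * B m i) * b a k)))"
      by (simp add: v_def)
    hence yBm: "(\<Sum>k<n. y k * B m k) = 1" by (simp only: distrib_left sum.distrib ylin yv add_0_right)
    define b' x' where "b' = b(r := v)" and "x' = x(r := y)"
    have "(\<Sum>i<n. x' a i * b' a' i) = (if a = a' then 1 else 0)" if "a < Suc r" "a' < Suc r" for a a'
      using that dual xv yb yv by (auto simp: less_Suc_eq b'_def x'_def)
    moreover have "B l i = (\<Sum>a<Suc r. (\<Sum>k<n. x' a k * B l k) * b' a i)" if "l < Suc m" "i < n" for l i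
    proof (cases "l = m")
      case True
      have "(\<Sum>a<Suc r. (\<Sum>k<n. x' a k * B l k) * b' a i) = (\<Sum>a<r. (\<Sum>k<n. x a k * B m k) * b a i) + v i"
        using True yBm by (simp add: b'_def x'_def)
      thus ?thesis using True by (simp add: v_def)
    next
      case False
      hence l: "l < m" using that by simp
      have "(\<Sum>a<Suc r. (\<Sum>k<n. x' a k * B l k) * b' a i) = (\<Sum>a<r. (\<Sum>k<n. x a k * B l k) * b a i)"
        using yB[OF l] by (simp add: b'_def x'_def)
      with ex[OF l that(2)] show ?thesis by (rule trans[OF _ sym])
    qed
    moreover have "\<exists>d. \<forall>i<n. b' a i = (\<Sum>l<Suc m. d l * B l i)" if "a < Suc r" for a
    proof (cases "a = r")
      case True
      define d where "d = (\<lambda>l. if l = m then 1 else - (\<Sum>a<r. (\<Sum>k<n. x a k * B m k) * c a l))"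
      have "v i = (\<Sum>l<Suc m. d l * B l i)" if "i < n" for i
      proof -
        have "(\<Sum>a<r. (\<Sum>k<n. x a k * B m k) * b a i) = (\<Sum>a<r. (\<Sum>k<n. x a k * B m k) * (\<Sum>l<m. c a l * B l i))"
          using c that by (intro sum.cong) auto
        also have "\<dots> = (\<Sum>l<m. (\<Sum>a<r. (\<Sum>k<n. x a k * B m k) * c a l) * B l i)"
          by (simp add: sum_distrib_left sum_distrib_right mult.assoc) (rule sum.swap)
        finally show ?thesis by (simp add: v_def d_def sum_negf)
      qed
      thus ?thesis using True by (auto simp: b'_def)
    next
      case False
      hence "a < r" using that by simp
      thus ?thesis using False by (intro exI[of _ "(c a)(m := 0)"]) (use c[OF \<open>a < r\<close>] in \<open>simp add: b'_def\<close>)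
    qed
    ultimately show ?thesis by blast
  qed
qed

text \<open>A rank factorization: the columns of \<open>i\<close> are a basis of the range of
  \<open>B\<close>, \<open>p\<close> is a left inverse of \<open>i\<close>, and
  \<open>i = B * c\<close> records that \<open>i\<close> does not leave that range.\<close>

lemma range_factor:
  fixes B :: "complex mat"
  assumes B: "B \<in> carrier_mat n m"
  obtains r i p c where "i \<in> carrier_mat n r" "p \<in> carrier_mat r n" "c \<in> carrier_mat m r"
    "p * i = 1\<^sub>m r" "i * (p * B) = B" "i = B * c"
proof -
  obtain r :: nat and b x :: "nat \<Rightarrow> nat \<Rightarrow> complex" where
    dual': "\<forall>a<r. \<forall>a'<r. (\<Sum>i<n. x a i * b a' i) = (if a = a' then 1 else 0)"
    and ex': "\<forall>l<m. \<forall>i<n. B $$ (i, l) = (\<Sum>a<r. (\<Sum>k<n. x a k * B $$ (k, l)) * b a i)"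
    and c': "\<forall>a<r. \<exists>c. \<forall>i<n. b a i = (\<Sum>l<m. c l * B $$ (i, l))"
    using range_factor_fun[of n m "\<lambda>l i. B $$ (i, l)"] by blast
  note dual = dual'[rule_format] and ex = ex'[rule_format]
  have "\<forall>a. \<exists>c. a < r \<longrightarrow> (\<forall>i<n. b a i = (\<Sum>l<m. c l * B $$ (i, l)))" using c' by blast
  from choice[OF this] obtain c where c: "\<And>a i. a < r \<Longrightarrow> i < n \<Longrightarrow> b a i = (\<Sum>l<m. c a l * B $$ (i, l))" by blast
  define i where "i = mat n r (\<lambda>(j, a). b a j)"
  define p where "p = mat r n (\<lambda>(a, j). x a j)"
  define d where "d = mat m r (\<lambda>(l, a). c a l)"
  have cr: "i \<in> carrier_mat n r" "p \<in> carrier_mat r n" "d \<in> carrier_mat m r" by (auto simp: i_def p_def d_def)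
  have pi: "p * i = 1\<^sub>m r"
    by (rule eq_matI) (auto simp: i_def p_def scalar_prod_def dual simp flip: lessThan_atLeast0)
  have "i * (p * B) = B"
  proof (rule eq_matI)
    fix j l assume "j < dim_row B" "l < dim_col B"
    with B have jl: "j < n" "l < m" by auto
    thus "(i * (p * B)) $$ (j, l) = B $$ (j, l)"
      using B ex[OF jl(2,1)] by (auto simp: i_def p_def scalar_prod_def mult.commute simp flip: lessThan_atLeast0)
  qed (use B in \<open>auto simp: i_def p_def\<close>)
  moreover have "i = B * d"
    by (rule eq_matI) (use B c in \<open>auto simp: i_def d_def scalar_prod_def mult.commute simp flip: lessThan_atLeast0\<close>)
  ultimately show ?thesis using that cr pi by blast
qed

text \<open>The matrix \<open>1 - i p\<close> kills exactly the range of \<open>B\<close>, hence not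
  \<open>v\<close>. A row on which this shows, suitably scaled, is the separating
  functional.\<close>

lemma fredholm:
  fixes B :: "complex mat"
  assumes B: "B \<in> carrier_mat n m" and v: "v \<in> carrier_vec n" and nv: "\<And>w. w \<in> carrier_vec m \<Longrightarrow> B *\<^sub>v w \<noteq> v"
  obtains y where "y \<in> carrier_vec n" "transpose_mat B *\<^sub>v y = 0\<^sub>v m" "y \<bullet> v = 1"
proof -
  obtain r i p c where f: "i \<in> carrier_mat n r" "p \<in> carrier_mat r n" "c \<in> carrier_mat m r"
    "i * (p * B) = B" "i = B * c" using range_factor[OF B] by metis
  define Q where "Q = 1\<^sub>m n - i * p"
  have ip: "i * p \<in> carrier_mat n n" and Q: "Q \<in> carrier_mat n n" using f(1,2) by (auto simp: Q_def)
  have "Q *\<^sub>v v \<noteq> 0\<^sub>v n"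
  proof
    assume "Q *\<^sub>v v = 0\<^sub>v n"
    hence "v - (i * p) *\<^sub>v v = 0\<^sub>v n" using minus_mult_distrib_mat_vec[OF one_carrier_mat ip v] v by (simp add: Q_def)
    hence "v = (i * p) *\<^sub>v v" using ip v by (intro eq_vecI) (auto simp: vec_eq_iff simp del: index_mult_mat_vec)
    also have "\<dots> = i *\<^sub>v (p *\<^sub>v v)" using assoc_mult_mat_vec[OF f(1,2) v] .
    also have "\<dots> = B *\<^sub>v (c *\<^sub>v (p *\<^sub>v v))" unfolding f(5) using f(2) v by (intro assoc_mult_mat_vec[OF B f(3)]) auto
    finally show False using nv[of "c *\<^sub>v (p *\<^sub>v v)"] f v by auto
  qed
  then obtain j where j: "j < n" "(Q *\<^sub>v v) $ j \<noteq> 0" using Q v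
    by (metis carrier_vecD dim_mult_mat_vec carrier_matD(1) eq_vecI index_zero_vec(1,2))
  define s where "s = (Q *\<^sub>v v) $ j"
  have QB: "Q * B = 0\<^sub>m n m"
    using minus_mult_distrib_mat[OF one_carrier_mat ip B] assoc_mult_mat[OF f(1,2) B] f(4) B by (simp add: Q_def)
  define y where "y = (1 / s) \<cdot>\<^sub>v row Q j"
  have y: "y \<in> carrier_vec n" using Q j by (auto simp: y_def)
  moreover have "transpose_mat B *\<^sub>v y = 0\<^sub>v m"
  proof (rule eq_vecI)
    fix l assume l: "l < dim_vec (0\<^sub>v m)"
    have "row Q j \<bullet> col B l = (Q * B) $$ (j, l)" using l j Q B by auto
    also have "\<dots> = 0" using QB l j by simp
    finally have "col B l \<bullet> row Q j = 0" using l j Q B comm_scalar_prod[of "col B l" n "row Q j"] by auto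
    thus "(transpose_mat B *\<^sub>v y) $ l = 0\<^sub>v m $ l" using l j Q B by (simp add: y_def)
  qed (use B in auto)
  moreover have "y \<bullet> v = 1" using j Q v by (simp add: y_def s_def[symmetric]) (simp add: s_def)
  ultimately show ?thesis using that by blast
qed

text \<open>\<open>Q\<close> is the identity on its own range, so \<open>p Q\<close> is still a left
  inverse of \<open>i\<close>, and it satisfies \<open>i (p Q) = Q\<close>.\<close>

lemma idempotent_factor:
  fixes Q :: "complex mat"
  assumes Q: "Q \<in> carrier_mat n n" "Q * Q = Q"
  obtains r i p where "i \<in> carrier_mat n r" "p \<in> carrier_mat r n" "p * i = 1\<^sub>m r" "i * p = Q"
proof -
  obtain r i p c where f: "i \<in> carrier_mat n r" "p \<in> carrier_mat r n" "c \<in> carrier_mat n r"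
    "p * i = 1\<^sub>m r" "i * (p * Q) = Q" "i = Q * c" using range_factor[OF Q(1)] by metis
  have "Q * i = i" using assoc_mult_mat[OF Q(1) Q(1) f(3)] unfolding f(6) Q(2) by simp
  hence "(p * Q) * i = 1\<^sub>m r" using assoc_mult_mat[OF f(2) Q(1) f(1)] f(4) by simp
  thus ?thesis using that[of i r "p * Q"] f(1,2,5) Q by auto
qed

section \<open>Highest weight vectors\<close>

text \<open>The relations \<open>[E, F] = H\<close>, \<open>[H, E] = 2 E\<close> and
  \<open>[H, F] = -2 F\<close>, each solved for the product that has to be reordered. An sl2-module
  on \<open>n\<close>-space amounts to such a triple.\<close>

locale sl2_triple =
  fixes n :: nat and E F H :: "complex mat"
  assumes carrier [simp]: "E \<in> carrier_mat n n" "F \<in> carrier_mat n n" "H \<in> carrier_mat n n"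
    and EF: "E * F = F * E + H" and HE: "H * E = E * H + 2 \<cdot>\<^sub>m E" and HF: "H * F = F * H + (-2) \<cdot>\<^sub>m F"
begin

lemma dim_vecs [simp]: "u \<in> carrier_vec n \<Longrightarrow> dim_vec u = n" "dim_vec (E *\<^sub>v u) = n" "dim_vec (F *\<^sub>v u) = n" "dim_vec (H *\<^sub>v u) = n"
  using carrier_matD(1)[OF carrier(1)] carrier_matD(1)[OF carrier(2)] carrier_matD(1)[OF carrier(3)] by auto

lemma mult_carrier [simp]: "A \<in> carrier_mat n n \<Longrightarrow> u \<in> carrier_vec n \<Longrightarrow> A *\<^sub>v u \<in> carrier_vec n"
  by (rule mult_mat_vec_carrier)

lemma mult_lin: 
  assumes "(A :: complex mat) \<in> carrier_mat n n" "u \<in> carrier_vec n" "w \<in> carrier_vec n"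
  shows "A *\<^sub>v (a \<cdot>\<^sub>v u + b \<cdot>\<^sub>v w) = a \<cdot>\<^sub>v (A *\<^sub>v u) + b \<cdot>\<^sub>v (A *\<^sub>v w)"
  using mult_add_distrib_mat_vec[OF assms(1), of "a \<cdot>\<^sub>v u" "b \<cdot>\<^sub>v w"] mult_mat_vec[OF assms(1,2)] mult_mat_vec[OF assms(1,3)]
    assms(2,3) by simp

lemma mult_zero [simp]: "(A :: complex mat) \<in> carrier_mat n n \<Longrightarrow> A *\<^sub>v 0\<^sub>v n = 0\<^sub>v n"
  by (intro eq_vecI) auto

lemma smult_mult: "(A :: complex mat) \<in> carrier_mat n n \<Longrightarrow> u \<in> carrier_vec n \<Longrightarrow> (c \<cdot>\<^sub>m A) *\<^sub>v u = c \<cdot>\<^sub>v (A *\<^sub>v u)"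
  by (intro eq_vecI) (auto simp: smult_scalar_prod_distrib[of _ n])

lemma EF_vec: "u \<in> carrier_vec n \<Longrightarrow> E *\<^sub>v (F *\<^sub>v u) = F *\<^sub>v (E *\<^sub>v u) + H *\<^sub>v u"
  and HE_vec: "u \<in> carrier_vec n \<Longrightarrow> H *\<^sub>v (E *\<^sub>v u) = E *\<^sub>v (H *\<^sub>v u) + 2 \<cdot>\<^sub>v (E *\<^sub>v u)"
  and HF_vec: "u \<in> carrier_vec n \<Longrightarrow> H *\<^sub>v (F *\<^sub>v u) = F *\<^sub>v (H *\<^sub>v u) + (-2) \<cdot>\<^sub>v (F *\<^sub>v u)"
proof -
  assume u: "u \<in> carrier_vec n"
  have a: "(A * B) *\<^sub>v u = A *\<^sub>v (B *\<^sub>v u)" if "A \<in> carrier_mat n n" "B \<in> carrier_mat n n" for A B :: "complex mat"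
    using assoc_mult_mat_vec[OF that u] .
  have p: "(A + B) *\<^sub>v u = A *\<^sub>v u + B *\<^sub>v u" if "A \<in> carrier_mat n n" "B \<in> carrier_mat n n" for A B :: "complex mat"
    using add_mult_distrib_mat_vec[OF that u] .
  have m: "A * B \<in> carrier_mat n n" if "A \<in> carrier_mat n n" "B \<in> carrier_mat n n" for A B :: "complex mat"
    using mult_carrier_mat[OF that] .
  have "(E * F) *\<^sub>v u = (F * E + H) *\<^sub>v u" "(H * E) *\<^sub>v u = (E * H + 2 \<cdot>\<^sub>m E) *\<^sub>v u"
    "(H * F) *\<^sub>v u = (F * H + (-2) \<cdot>\<^sub>m F) *\<^sub>v u" by (simp_all only: EF HE HF)
  thus "E *\<^sub>v (F *\<^sub>v u) = F *\<^sub>v (E *\<^sub>v u) + H *\<^sub>v u"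
    "H *\<^sub>v (E *\<^sub>v u) = E *\<^sub>v (H *\<^sub>v u) + 2 \<cdot>\<^sub>v (E *\<^sub>v u)"
    "H *\<^sub>v (F *\<^sub>v u) = F *\<^sub>v (H *\<^sub>v u) + (-2) \<cdot>\<^sub>v (F *\<^sub>v u)"
    by (simp_all only: a p m carrier smult_mult u smult_carrier_mat)
qed

definition low :: "nat \<Rightarrow> complex vec \<Rightarrow> complex vec" where
  "low j v = ((*\<^sub>v) F ^^ j) v"

lemma low_0 [simp]: "low 0 v = v" and low_Suc: "low (Suc j) v = F *\<^sub>v low j v"
  by (simp_all add: low_def)

lemma low_carrier [simp]: "v \<in> carrier_vec n \<Longrightarrow> low j v \<in> carrier_vec n"
  by (induction j) (auto simp: low_Suc)

text \<open>The generalized form, for a Jordan block of size at most two in the eigenvalue \<open>\<mu>\<close> of \<open>H\<close>, is used to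
  show that such blocks are trivial; the case \<open>v = 0\<close> is the usual action on a highest weight module.\<close>

lemma ladder:
  assumes vw: "v \<in> carrier_vec n" "w \<in> carrier_vec n" and v: "E *\<^sub>v w = 0\<^sub>v n"
    "H *\<^sub>v v = \<mu> \<cdot>\<^sub>v v" and w: "H *\<^sub>v w = \<mu> \<cdot>\<^sub>v w + 1 \<cdot>\<^sub>v v"
  shows "H *\<^sub>v low j w = (\<mu> - 2 * of_nat j) \<cdot>\<^sub>v low j w + 1 \<cdot>\<^sub>v low j v"
    and "E *\<^sub>v low (Suc j) w = (of_nat (Suc j) * (\<mu> - of_nat j)) \<cdot>\<^sub>v low j w + of_nat (Suc j) \<cdot>\<^sub>v low j v"
proof -
  show *: "H *\<^sub>v low j w = (\<mu> - 2 * of_nat j) \<cdot>\<^sub>v low j w + 1 \<cdot>\<^sub>v low j v" for j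
  proof (induction j)
    case (Suc j)
    show ?case using vw
      by (simp only: low_Suc HF_vec low_carrier Suc mult_lin carrier)
        (intro eq_vecI, auto simp: algebra_simps simp del: index_mult_mat_vec)
  qed (use w in simp)
  show "E *\<^sub>v low (Suc j) w = (of_nat (Suc j) * (\<mu> - of_nat j)) \<cdot>\<^sub>v low j w + of_nat (Suc j) \<cdot>\<^sub>v low j v"
  proof (induction j)
    case 0
    show ?case using vw v w by (simp add: low_Suc EF_vec)
  next
    case (Suc j)
    show ?case
      by (subst low_Suc, subst EF_vec, use vw in simp, subst Suc, subst mult_lin, use vw in simp_all, simp add: * vw flip: low_Suc)
        (intro eq_vecI, auto simp: vw algebra_simps simp del: index_mult_mat_vec)
  qed
qed

lemma finite_eigenvalues: "finite {\<mu>. \<exists>u \<in> carrier_vec n. u \<noteq> 0\<^sub>v n \<and> H *\<^sub>v u = \<mu> \<cdot>\<^sub>v u}"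
  using card_finite_spectrum(1)[OF carrier(3)]
  by (rule rev_finite_subset) (use carrier_matD(1)[OF carrier(3)] in \<open>auto simp: spectrum_def eigenvalue_def eigenvector_def\<close>)

text \<open>The numbers \<open>\<mu> - 2 j\<close> are pairwise distinct, but a matrix has only
  finitely many eigenvalues.\<close>

lemma eigen_chain_ends:
  assumes "\<And>j. u j \<in> carrier_vec n" "\<And>j. H *\<^sub>v u j = (\<mu> - 2 * of_nat j) \<cdot>\<^sub>v u j"
  obtains j where "u j = 0\<^sub>v n"
proof (rule ccontr)
  assume "\<not> thesis"
  hence "\<And>j. u j \<noteq> 0\<^sub>v n" using that by blast
  hence "range (\<lambda>j::nat. \<mu> - 2 * of_nat j) \<subseteq> {\<mu>. \<exists>u \<in> carrier_vec n. u \<noteq> 0\<^sub>v n \<and> H *\<^sub>v u = \<mu> \<cdot>\<^sub>v u}"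
    using assms by blast
  from finite_subset[OF this finite_eigenvalues] have "finite (range (\<lambda>j::nat. \<mu> - 2 * of_nat j))" .
  moreover have "inj (\<lambda>j::nat. \<mu> - 2 * of_nat j)" by (auto simp: inj_on_def)
  ultimately show False using finite_imageD infinite_UNIV_nat by blast
qed

text \<open>The chain of the vectors \<open>F^j v\<close> ends. If \<open>F^k v\<close> is its last
  non-zero term, then \<open>0 = E F^(k+1) v = (k+1) (\<mu> - k) F^k v\<close> forces
  \<open>\<mu> = k\<close>.\<close>

lemma highest_weight:
  assumes v: "v \<in> carrier_vec n" "v \<noteq> 0\<^sub>v n" "E *\<^sub>v v = 0\<^sub>v n" "H *\<^sub>v v = \<mu> \<cdot>\<^sub>v v"
  obtains k where "\<mu> = of_nat k" "low (Suc k) v = 0\<^sub>v n" "low k v \<noteq> 0\<^sub>v n"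
    "\<And>j. H *\<^sub>v low j v = (\<mu> - 2 * of_nat j) \<cdot>\<^sub>v low j v"
    "\<And>j. E *\<^sub>v low (Suc j) v = (of_nat (Suc j) * (\<mu> - of_nat j)) \<cdot>\<^sub>v low j v"
proof -
  have z: "low j (0\<^sub>v n) = 0\<^sub>v n" for j by (induction j) (auto simp: low_Suc)
  have Hz: "H *\<^sub>v 0\<^sub>v n = \<mu> \<cdot>\<^sub>v 0\<^sub>v n" by (simp, intro eq_vecI) auto
  have Hv: "H *\<^sub>v v = \<mu> \<cdot>\<^sub>v v + 1 \<cdot>\<^sub>v 0\<^sub>v n" using v by (intro eq_vecI) (auto simp del: index_mult_mat_vec)
  \<comment> \<open>The ladder with the zero vector as eigenvector and \<open>v\<close> in the place
    of the generalized one.\<close>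
  note l = ladder[OF zero_carrier_vec v(1,3) Hz Hv]
  have h: "H *\<^sub>v low j v = (\<mu> - 2 * of_nat j) \<cdot>\<^sub>v low j v" for j
    using l(1)[of j] v(1) unfolding z by (simp add: z)
  have e: "E *\<^sub>v low (Suc j) v = (of_nat (Suc j) * (\<mu> - of_nat j)) \<cdot>\<^sub>v low j v" for j
    using l(2)[of j] v(1) unfolding z by (simp, intro eq_vecI) auto
  obtain m where m: "low m v = 0\<^sub>v n" using eigen_chain_ends[of "\<lambda>j. low j v" \<mu>] h v(1) by auto
  define m0 where "m0 = (LEAST m. low m v = 0\<^sub>v n)"
  have m0: "low m0 v = 0\<^sub>v n" unfolding m0_def by (rule LeastI[of _ m]) (rule m)
  with v obtain k where k: "m0 = Suc k" by (cases m0) auto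
  have nz: "low k v \<noteq> 0\<^sub>v n" using not_less_Least[of k "\<lambda>m. low m v = 0\<^sub>v n"] k unfolding m0_def by simp
  then obtain i where i: "i < n" "low k v $ i \<noteq> 0" using v(1) by (metis dim_vecs(1) eq_vecI index_zero_vec low_carrier)
  have "(of_nat (Suc k) * (\<mu> - of_nat k)) \<cdot>\<^sub>v low k v = E *\<^sub>v 0\<^sub>v n" using e[of k] m0 unfolding k by metis
  also have "\<dots> = 0\<^sub>v n" by simp
  finally have "((of_nat (Suc k) * (\<mu> - of_nat k)) \<cdot>\<^sub>v low k v) $ i = 0" using i by simp
  hence "\<mu> = of_nat k" using i v(1) by (auto simp del: of_nat_Suc)
  thus ?thesis using that m0 k nz h e by blast
qed

text \<open>With \<open>\<mu> = k\<close> one gets \<open>E F^(k+1) w = (k+1) F^k v\<close>, which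
  is not zero. Further up the coefficient \<open>(j+1) (\<mu> - j)\<close> does not vanish again, so
  \<open>F^j w\<close> is non-zero for all \<open>j > k\<close>. There \<open>F^j v = 0\<close>, so
  these vectors are true eigenvectors, for infinitely many eigenvalues.\<close>

lemma no_jordan_block:
  assumes v: "v \<in> carrier_vec n" "v \<noteq> 0\<^sub>v n" "E *\<^sub>v v = 0\<^sub>v n" "H *\<^sub>v v = \<mu> \<cdot>\<^sub>v v"
    and w: "w \<in> carrier_vec n" "E *\<^sub>v w = 0\<^sub>v n"
  shows "H *\<^sub>v w \<noteq> \<mu> \<cdot>\<^sub>v w + 1 \<cdot>\<^sub>v v"
proof
  assume Hw: "H *\<^sub>v w = \<mu> \<cdot>\<^sub>v w + 1 \<cdot>\<^sub>v v"
  obtain k where k: "\<mu> = of_nat k" "low (Suc k) v = 0\<^sub>v n" "low k v \<noteq> 0\<^sub>v n" using highest_weight[OF v] by metis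
  note l = ladder[OF v(1) w v(4) Hw]
  have vz: "low (Suc k + j) v = 0\<^sub>v n" for j by (induction j) (use k in \<open>auto simp: low_Suc[of "k + _"] low_Suc[of "Suc _"]\<close>)
  have nz: "low (Suc k + j) w \<noteq> 0\<^sub>v n" for j
  proof (induction j)
    case 0
    obtain i where i: "i < n" "low k v $ i \<noteq> 0" using k(3) v(1) by (metis dim_vecs(1) eq_vecI index_zero_vec low_carrier)
    show ?case
    proof
      assume "low (Suc k + 0) w = 0\<^sub>v n"
      hence "(0\<^sub>v n :: complex vec) = (of_nat (Suc k) * (\<mu> - of_nat k)) \<cdot>\<^sub>v low k w + of_nat (Suc k) \<cdot>\<^sub>v low k v"
        using l(2)[of k] by simp
      hence "(0\<^sub>v n :: complex vec) $ i = ((of_nat (Suc k) * (\<mu> - of_nat k)) \<cdot>\<^sub>v low k w + of_nat (Suc k) \<cdot>\<^sub>v low k v) $ i" by simp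
      thus False using i v(1) w(1) k(1) by (simp del: of_nat_Suc)
    qed
  next
    case (Suc j)
    then obtain i where i: "i < n" "low (Suc k + j) w $ i \<noteq> 0" using w(1) by (metis dim_vecs(1) eq_vecI index_zero_vec low_carrier)
    show ?case
    proof
      assume "low (Suc k + Suc j) w = 0\<^sub>v n"
      hence "(0\<^sub>v n :: complex vec) = (of_nat (Suc (Suc k + j)) * (\<mu> - of_nat (Suc k + j))) \<cdot>\<^sub>v low (Suc k + j) w + of_nat (Suc (Suc k + j)) \<cdot>\<^sub>v 0\<^sub>v n"
        using l(2)[of "Suc k + j"] by (simp only: vz add_Suc_right) simp
      hence "(0\<^sub>v n :: complex vec) $ i = ((of_nat (Suc (Suc k + j)) * (\<mu> - of_nat (Suc k + j))) \<cdot>\<^sub>v low (Suc k + j) w + of_nat (Suc (Suc k + j)) \<cdot>\<^sub>v 0\<^sub>v n) $ i" by simp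
      hence "of_nat (Suc (Suc k + j)) * (of_nat k - of_nat (Suc k + j)) = (0::complex)" using i w(1) k(1) by (simp del: of_nat_Suc)
      hence "of_nat k = (of_nat (Suc k + j) :: complex)" by (simp del: of_nat_Suc)
      thus False by (simp only: of_nat_eq_iff)
    qed
  qed
  have "H *\<^sub>v low (Suc k + j) w = (\<mu> - 2 * of_nat (Suc k) - 2 * of_nat j) \<cdot>\<^sub>v low (Suc k + j) w" for j
    using l(1)[of "Suc k + j"] w(1) unfolding vz by (simp add: algebra_simps)
  from eigen_chain_ends[of "\<lambda>j. low (Suc k + j) w", OF _ this] nz w(1) show False by auto
qed

end

lemma (in sl2_triple) mat_dims [simp]:
  "dim_row E = n" "dim_col E = n" "dim_row F = n" "dim_col F = n" "dim_row H = n" "dim_col H = n"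
  using carrier_matD[OF carrier(1)] carrier_matD[OF carrier(2)] carrier_matD[OF carrier(3)] by auto

text \<open>Transposition reverses products; exchanging \<open>E\<close> and \<open>F\<close>
  restores the signs. Results about highest weight vectors thereby apply to covectors.\<close>

lemma (in sl2_triple) transpose_triple: "sl2_triple n (transpose_mat F) (transpose_mat E) (transpose_mat H)"
proof
  note t = transpose_mult[of _ n n _ n, symmetric] transpose_add[of _ n n, symmetric]
  have m: "A * B \<in> carrier_mat n n" if "A \<in> carrier_mat n n" "B \<in> carrier_mat n n" for A B :: "complex mat"
    using mult_carrier_mat[OF that] .
  have s: "c \<cdot>\<^sub>m transpose_mat A = transpose_mat (c \<cdot>\<^sub>m A)" for c and A :: "complex mat" by (rule eq_matI) auto
  have "E * H = H * E + (-2) \<cdot>\<^sub>m E"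
    by (subst HE, rule eq_matI) (auto simp del: index_mult_mat(1))
  moreover have "F * H = H * F + 2 \<cdot>\<^sub>m F"
    by (subst HF, rule eq_matI) (auto simp del: index_mult_mat(1))
  ultimately show "transpose_mat F * transpose_mat E = transpose_mat E * transpose_mat F + transpose_mat H"
    "transpose_mat H * transpose_mat F = transpose_mat F * transpose_mat H + 2 \<cdot>\<^sub>m transpose_mat F"
    "transpose_mat H * transpose_mat E = transpose_mat E * transpose_mat H + (-2) \<cdot>\<^sub>m transpose_mat E"
    by (simp_all only: t s carrier m smult_carrier_mat EF)
qed auto

text \<open>The covector exists because \<open>H\<close> has no Jordan block of size two in its dominant eigenvalue.\<close>

lemma (in sl2_triple) dominant_pair:
  assumes "n > 0"
  obtains \<mu> v y where "v \<in> carrier_vec n" "y \<in> carrier_vec n" "v \<noteq> 0\<^sub>v n" "y \<noteq> 0\<^sub>v n" "y \<bullet> v = 1"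
    "E *\<^sub>v v = 0\<^sub>v n" "H *\<^sub>v v = \<mu> \<cdot>\<^sub>v v"
    "transpose_mat F *\<^sub>v y = 0\<^sub>v n" "transpose_mat H *\<^sub>v y = \<mu> \<cdot>\<^sub>v y"
proof -
  interpret T: sl2_triple n "transpose_mat F" "transpose_mat E" "transpose_mat H" by (rule transpose_triple)
  define S where "S = spectrum H"
  have S: "finite S" "S \<noteq> {}" unfolding S_def
    using card_finite_spectrum(1)[OF carrier(3)] spectrum_non_empty[OF carrier(3) assms] by auto
  have ST: "spectrum (transpose_mat H) = S" unfolding S_def spectrum_def
    using eigenvalue_root_char_poly[OF carrier(3)] eigenvalue_root_char_poly[OF T.carrier(3)] char_poly_transpose_mat[OF carrier(3)]
    by auto
  \<comment> \<open>With maximal real part, \<open>\<mu> + 2\<close> is not an eigenvalue, so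
    \<open>E\<close> has nowhere to raise a vector of weight \<open>\<mu>\<close>, and the transpose
    of \<open>F\<close> has nowhere to raise a covector.\<close>
  obtain \<mu> where \<mu>: "\<mu> \<in> S" "\<And>\<nu>. \<nu> \<in> S \<Longrightarrow> Re \<nu> \<le> Re \<mu>"
  proof -
    have "Max (Re ` S) \<in> Re ` S" using S by (intro Max_in) auto
    then obtain \<mu> where "\<mu> \<in> S" "Re \<mu> = Max (Re ` S)" by auto
    moreover have "Re \<nu> \<le> Max (Re ` S)" if "\<nu> \<in> S" for \<nu> using S that by (intro Max_ge) auto
    ultimately show ?thesis using that by metis
  qed
  hence not: "\<mu> + 2 \<notin> S" by fastforce
  have nE: "u = 0\<^sub>v n" if "u \<in> carrier_vec n" "H *\<^sub>v u = (\<mu> + 2) \<cdot>\<^sub>v u" for u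
    using not that carrier_matD(1)[OF carrier(3)] unfolding S_def spectrum_def eigenvalue_def eigenvector_def by auto
  have nT: "u = 0\<^sub>v n" if "u \<in> carrier_vec n" "transpose_mat H *\<^sub>v u = (\<mu> + 2) \<cdot>\<^sub>v u" for u
    using not that carrier_matD(1)[OF T.carrier(3)] unfolding ST[symmetric] spectrum_def eigenvalue_def eigenvector_def by auto
  from \<mu>(1) obtain v where v: "v \<in> carrier_vec n" "v \<noteq> 0\<^sub>v n" "H *\<^sub>v v = \<mu> \<cdot>\<^sub>v v"
    using carrier_matD(1)[OF carrier(3)] unfolding S_def spectrum_def eigenvalue_def eigenvector_def by auto
  have Ev: "E *\<^sub>v v = 0\<^sub>v n"
  proof (rule nE)
    show "H *\<^sub>v (E *\<^sub>v v) = (\<mu> + 2) \<cdot>\<^sub>v (E *\<^sub>v v)"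
      unfolding HE_vec[OF v(1)] v(3) mult_mat_vec[OF carrier(1) v(1)]
      by (intro eq_vecI) (auto simp: algebra_simps simp del: index_mult_mat_vec)
  qed (use v in simp)
  define B where "B = H - \<mu> \<cdot>\<^sub>m 1\<^sub>m n"
  have B: "B \<in> carrier_mat n n" unfolding B_def by (intro minus_carrier_mat smult_carrier_mat one_carrier_mat)
  have Bw: "B *\<^sub>v w = H *\<^sub>v w - \<mu> \<cdot>\<^sub>v w" if "w \<in> carrier_vec n" for w
    unfolding B_def using that by (subst minus_mult_distrib_mat_vec[of _ n n]) (simp_all add: smult_mult)
  have BTw: "transpose_mat B *\<^sub>v w = transpose_mat H *\<^sub>v w - \<mu> \<cdot>\<^sub>v w" if "w \<in> carrier_vec n" for w
  proof -
    have "transpose_mat B = transpose_mat H - \<mu> \<cdot>\<^sub>m 1\<^sub>m n" unfolding B_def by (rule eq_matI) auto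
    thus ?thesis using that by (simp add: minus_mult_distrib_mat_vec[of _ n n] smult_mult)
  qed
  \<comment> \<open>A preimage \<open>w\<close> of \<open>v\<close> under \<open>H - \<mu>\<close>
    would have \<open>E w\<close> of weight \<open>\<mu> + 2\<close>, hence zero, and so form an
    excluded Jordan block with \<open>v\<close>.\<close>
  have nB: "B *\<^sub>v w \<noteq> v" if w: "w \<in> carrier_vec n" for w
  proof
    assume "B *\<^sub>v w = v"
    hence Hw: "H *\<^sub>v w = \<mu> \<cdot>\<^sub>v w + 1 \<cdot>\<^sub>v v" unfolding Bw[OF w] using w
      by (intro eq_vecI) (auto simp del: index_mult_mat_vec)
    have "H *\<^sub>v (E *\<^sub>v w) = (\<mu> + 2) \<cdot>\<^sub>v (E *\<^sub>v w)"
      unfolding HE_vec[OF w] Hw mult_lin[OF carrier(1) w v(1)] Ev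
      by (intro eq_vecI) (auto simp: algebra_simps simp del: index_mult_mat_vec)
    hence "E *\<^sub>v w = 0\<^sub>v n" using w by (intro nE) simp_all
    with no_jordan_block[OF v(1,2) Ev v(3) w] Hw show False by simp
  qed
  obtain y where y: "y \<in> carrier_vec n" "transpose_mat B *\<^sub>v y = 0\<^sub>v n" "y \<bullet> v = 1"
    using fredholm[OF B v(1) nB] by blast
  have Hy: "transpose_mat H *\<^sub>v y = \<mu> \<cdot>\<^sub>v y"
  proof (rule eq_vecI)
    fix i assume "i < dim_vec (\<mu> \<cdot>\<^sub>v y)"
    hence i: "i < n" using y(1) by simp
    have "(transpose_mat H *\<^sub>v y - \<mu> \<cdot>\<^sub>v y) $ i = 0" unfolding BTw[OF y(1), symmetric] y(2) using i by simp
    thus "(transpose_mat H *\<^sub>v y) $ i = (\<mu> \<cdot>\<^sub>v y) $ i" using i y(1) by (simp del: index_mult_mat_vec)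
  qed (use y(1) in auto)
  have "transpose_mat F *\<^sub>v y = 0\<^sub>v n"
  proof (rule nT)
    show "transpose_mat H *\<^sub>v (transpose_mat F *\<^sub>v y) = (\<mu> + 2) \<cdot>\<^sub>v (transpose_mat F *\<^sub>v y)"
      unfolding T.HE_vec[OF y(1)] Hy mult_mat_vec[OF T.carrier(1) y(1)]
      by (intro eq_vecI) (auto simp: algebra_simps simp del: index_mult_mat_vec)
  qed (use y in simp)
  moreover have "y \<noteq> 0\<^sub>v n" using y(3) v(1) by auto
  ultimately show ?thesis using that v Ev y(1,3) Hy by blast
qed

section \<open>The simple modules\<close>

definition e\<^sub>0 :: "complex mat" where "e\<^sub>0 = mat 2 2 (\<lambda>(i, j). if i = 0 \<and> j = 1 then 1 else 0)"
definition f\<^sub>0 :: "complex mat" where "f\<^sub>0 = mat 2 2 (\<lambda>(i, j). if i = 1 \<and> j = 0 then 1 else 0)"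
definition h\<^sub>0 :: "complex mat" where "h\<^sub>0 = mat 2 2 (\<lambda>(i, j). if i = j then (if i = 0 then 1 else -1) else 0)"

lemma efh_sl2 [simp]: "e\<^sub>0 \<in> sl2" "f\<^sub>0 \<in> sl2" "h\<^sub>0 \<in> sl2"
  by (auto simp: sl2_def e\<^sub>0_def f\<^sub>0_def h\<^sub>0_def)

lemma less_2: "i < 2 \<longleftrightarrow> i = 0 \<or> i = (1::nat)" by auto

lemma efh_bracket: "bracket e\<^sub>0 f\<^sub>0 = h\<^sub>0" "bracket h\<^sub>0 e\<^sub>0 = 2 \<cdot>\<^sub>m e\<^sub>0" "bracket h\<^sub>0 f\<^sub>0 = (-2) \<cdot>\<^sub>m f\<^sub>0"
  by (rule eq_matI; auto simp: bracket_def e\<^sub>0_def f\<^sub>0_def h\<^sub>0_def scalar_prod_def less_2 numeral_2_eq_2)+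

lemma sl2_expand: "A \<in> sl2 \<Longrightarrow> A = A $$ (0, 0) \<cdot>\<^sub>m h\<^sub>0 + (A $$ (0, 1) \<cdot>\<^sub>m e\<^sub>0 + A $$ (1, 0) \<cdot>\<^sub>m f\<^sub>0)"
  by (rule eq_matI) (auto simp: sl2_def e\<^sub>0_def f\<^sub>0_def h\<^sub>0_def less_2 add_eq_0_iff)

lemma sl2_module_expand:
  assumes V: "V \<in> sl2_modules" and A: "A \<in> sl2"
  shows "snd V A = A $$ (0, 0) \<cdot>\<^sub>m snd V h\<^sub>0 + (A $$ (0, 1) \<cdot>\<^sub>m snd V e\<^sub>0 + A $$ (1, 0) \<cdot>\<^sub>m snd V f\<^sub>0)"
  by (subst (1) sl2_expand[OF A]) (simp add: sl2_module_add[OF V] sl2_module_smult[OF V])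

lemma sl2_module_triple:
  assumes V: "V \<in> sl2_modules"
  shows "sl2_triple (fst V) (snd V e\<^sub>0) (snd V f\<^sub>0) (snd V h\<^sub>0)"
proof
  note c [simp] = sl2_module_carrier[OF V efh_sl2(1)] sl2_module_carrier[OF V efh_sl2(2)] sl2_module_carrier[OF V efh_sl2(3)]
  show "snd V e\<^sub>0 \<in> carrier_mat (fst V) (fst V)" "snd V f\<^sub>0 \<in> carrier_mat (fst V) (fst V)" "snd V h\<^sub>0 \<in> carrier_mat (fst V) (fst V)"
    by (fact c)+
  have move: "X = Y + Z" if "X - Y = Z" "X \<in> carrier_mat (fst V) (fst V)" "Y \<in> carrier_mat (fst V) (fst V)" for X Y Z :: "complex mat"
    unfolding that(1)[symmetric] by (rule eq_matI) (use that(2,3) in auto)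
  have m: "A * B \<in> carrier_mat (fst V) (fst V)" if "A \<in> carrier_mat (fst V) (fst V)" "B \<in> carrier_mat (fst V) (fst V)" for A B :: "complex mat"
    using mult_carrier_mat[OF that] .
  have "bracket (snd V e\<^sub>0) (snd V f\<^sub>0) = snd V h\<^sub>0" "bracket (snd V h\<^sub>0) (snd V e\<^sub>0) = 2 \<cdot>\<^sub>m snd V e\<^sub>0"
    "bracket (snd V h\<^sub>0) (snd V f\<^sub>0) = (-2) \<cdot>\<^sub>m snd V f\<^sub>0"
    by (simp_all add: sl2_module_bracket[OF V, symmetric] efh_bracket sl2_module_smult[OF V])
  thus "snd V e\<^sub>0 * snd V f\<^sub>0 = snd V f\<^sub>0 * snd V e\<^sub>0 + snd V h\<^sub>0"
    "snd V h\<^sub>0 * snd V e\<^sub>0 = snd V e\<^sub>0 * snd V h\<^sub>0 + 2 \<cdot>\<^sub>m snd V e\<^sub>0"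
    "snd V h\<^sub>0 * snd V f\<^sub>0 = snd V f\<^sub>0 * snd V h\<^sub>0 + (-2) \<cdot>\<^sub>m snd V f\<^sub>0"
    unfolding bracket_def by (auto intro!: move m)
qed

text \<open>The entries of \<open>A\<close> used here are its coordinates in the basis
  \<open>h\<^sub>0\<close>, \<open>e\<^sub>0\<close>, \<open>f\<^sub>0\<close> of sl2, so this is
  the linear extension of the triple.\<close>

definition triple_module :: "nat \<Rightarrow> complex mat \<Rightarrow> complex mat \<Rightarrow> complex mat \<Rightarrow> sl2_module" where
  "triple_module n E F H = (n, \<lambda>A \<in> sl2. A $$ (0, 0) \<cdot>\<^sub>m H + (A $$ (0, 1) \<cdot>\<^sub>m E + A $$ (1, 0) \<cdot>\<^sub>m F))"

context sl2_triple
begin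

text \<open>Bilinear expansion into nine products; with it the bracket relation for arbitrary
  elements of sl2 reduces to the three commutators.\<close>

lemma triple_mult:
  assumes "X1 \<in> carrier_mat n n" "X2 \<in> carrier_mat n n" "X3 \<in> carrier_mat n n"
    "Y1 \<in> carrier_mat n n" "Y2 \<in> carrier_mat n n" "Y3 \<in> carrier_mat n n" "i < n" "j < n"
  shows "((a1 \<cdot>\<^sub>m X1 + (a2 \<cdot>\<^sub>m X2 + a3 \<cdot>\<^sub>m X3)) * (b1 \<cdot>\<^sub>m Y1 + (b2 \<cdot>\<^sub>m Y2 + b3 \<cdot>\<^sub>m Y3))) $$ (i, j) =
    a1 * b1 * (X1 * Y1) $$ (i, j) + a1 * b2 * (X1 * Y2) $$ (i, j) + a1 * b3 * (X1 * Y3) $$ (i, j) +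
    a2 * b1 * (X2 * Y1) $$ (i, j) + a2 * b2 * (X2 * Y2) $$ (i, j) + a2 * b3 * (X2 * Y3) $$ (i, j) +
    a3 * b1 * (X3 * Y1) $$ (i, j) + a3 * b2 * (X3 * Y2) $$ (i, j) + a3 * b3 * (X3 * (Y3 :: complex mat)) $$ (i, j)"
proof -
  have d: "dim_row X1 = n" "dim_col X1 = n" "dim_row X2 = n" "dim_col X2 = n" "dim_row X3 = n" "dim_col X3 = n"
    "dim_row Y1 = n" "dim_col Y1 = n" "dim_row Y2 = n" "dim_col Y2 = n" "dim_row Y3 = n" "dim_col Y3 = n"
    using assms(1-6) by (blast dest: carrier_matD)+
  have "((a1 \<cdot>\<^sub>m X1 + (a2 \<cdot>\<^sub>m X2 + a3 \<cdot>\<^sub>m X3)) * (b1 \<cdot>\<^sub>m Y1 + (b2 \<cdot>\<^sub>m Y2 + b3 \<cdot>\<^sub>m Y3))) $$ (i, j) =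
    (\<Sum>k = 0..<n. (a1 * X1 $$ (i, k) + (a2 * X2 $$ (i, k) + a3 * X3 $$ (i, k))) *
      (b1 * Y1 $$ (k, j) + (b2 * Y2 $$ (k, j) + b3 * Y3 $$ (k, j))))"
    using assms(7,8) by (simp add: scalar_prod_def d)
  also have "\<dots> = (\<Sum>k = 0..<n. a1 * b1 * (X1 $$ (i, k) * Y1 $$ (k, j)) + a1 * b2 * (X1 $$ (i, k) * Y2 $$ (k, j))
    + a1 * b3 * (X1 $$ (i, k) * Y3 $$ (k, j)) + a2 * b1 * (X2 $$ (i, k) * Y1 $$ (k, j)) + a2 * b2 * (X2 $$ (i, k) * Y2 $$ (k, j))
    + a2 * b3 * (X2 $$ (i, k) * Y3 $$ (k, j)) + a3 * b1 * (X3 $$ (i, k) * Y1 $$ (k, j)) + a3 * b2 * (X3 $$ (i, k) * Y2 $$ (k, j))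
    + a3 * b3 * (X3 $$ (i, k) * Y3 $$ (k, j)))"
    by (rule sum.cong) (simp_all add: algebra_simps)
  finally show ?thesis
    using assms(7,8) by (simp add: scalar_prod_def d sum.distrib sum_distrib_left)
qed

lemma triple_module_closed: "triple_module n E F H \<in> sl2_modules"
proof -
  define \<rho> where "\<rho> = (\<lambda>A :: complex mat. A $$ (0, 0) \<cdot>\<^sub>m H + (A $$ (0, 1) \<cdot>\<^sub>m E + A $$ (1, 0) \<cdot>\<^sub>m F))"
  have c: "\<rho> A \<in> carrier_mat n n" for A by (simp add: \<rho>_def)
  have "\<rho> (A + B) = \<rho> A + \<rho> B" if "A \<in> sl2" "B \<in> sl2" for A B
    using that unfolding \<rho>_def by (intro eq_matI) (auto simp: sl2_def algebra_simps)
  moreover have "\<rho> (k \<cdot>\<^sub>m A) = k \<cdot>\<^sub>m \<rho> A" if "A \<in> sl2" for A k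
    using that unfolding \<rho>_def by (intro eq_matI) (auto simp: sl2_def algebra_simps)
  moreover have "\<rho> (bracket A B) = bracket (\<rho> A) (\<rho> B)" if AB: "A \<in> sl2" "B \<in> sl2" for A B
  proof (rule eq_matI)
    fix i j assume "i < dim_row (bracket (\<rho> A) (\<rho> B))" "j < dim_col (bracket (\<rho> A) (\<rho> B))"
    hence ij: "i < n" "j < n" using carrier_matD[OF c[of A]] carrier_matD[OF c[of B]] by (auto simp: bracket_def)
    have e: "(E * F) $$ (i, j) = (F * E) $$ (i, j) + H $$ (i, j)" "(H * E) $$ (i, j) = (E * H) $$ (i, j) + 2 * E $$ (i, j)"
      "(H * F) $$ (i, j) = (F * H) $$ (i, j) - 2 * F $$ (i, j)"
      unfolding EF HE HF using ij by (simp_all add: )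
    have A11: "A $$ (Suc 0, Suc 0) = - A $$ (0, 0)" "B $$ (Suc 0, Suc 0) = - B $$ (0, 0)"
      using AB by (auto simp: sl2_def add_eq_0_iff2)
    have "bracket (\<rho> A) (\<rho> B) $$ (i, j) = (\<rho> A * \<rho> B) $$ (i, j) - (\<rho> B * \<rho> A) $$ (i, j)"
      using c[of A] c[of B] ij by (simp add: bracket_def del: index_mult_mat(1))
    also have "\<dots> = \<rho> (bracket A B) $$ (i, j)"
      unfolding \<rho>_def
      by (subst (1 2) triple_mult, simp_all only: carrier ij)
        (use AB ij in \<open>simp add: e bracket_def sl2_def scalar_prod_def numeral_2_eq_2 A11 algebra_simps del: index_mult_mat(1)\<close>,
         use AB in \<open>simp add: sl2_def scalar_prod_def numeral_2_eq_2 A11 algebra_simps\<close>)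
    finally show "\<rho> (bracket A B) $$ (i, j) = bracket (\<rho> A) (\<rho> B) $$ (i, j)" by simp
  qed (use carrier_matD[OF c[of A]] carrier_matD[OF c[of B]] carrier_matD[OF c[of "bracket A B"]] in \<open>auto simp: bracket_def\<close>)
  ultimately show ?thesis using c unfolding sl2_modules_def triple_module_def \<rho>_def[symmetric] by auto
qed

lemma triple_module_simps [simp]: "fst (triple_module n E F H) = n" "snd (triple_module n E F H) e\<^sub>0 = E"
  "snd (triple_module n E F H) f\<^sub>0 = F" "snd (triple_module n E F H) h\<^sub>0 = H"
proof -
  show "fst (triple_module n E F H) = n" "snd (triple_module n E F H) e\<^sub>0 = E"
    "snd (triple_module n E F H) f\<^sub>0 = F" "snd (triple_module n E F H) h\<^sub>0 = H"
    by (simp_all add: triple_module_def) (rule eq_matI; auto simp: e\<^sub>0_def f\<^sub>0_def h\<^sub>0_def)+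
qed

end

lemma intertwinerI:
  assumes V: "V \<in> sl2_modules" and W: "W \<in> sl2_modules" and T: "T \<in> carrier_mat (fst W) (fst V)"
    and c: "T * snd V e\<^sub>0 = snd W e\<^sub>0 * T" "T * snd V f\<^sub>0 = snd W f\<^sub>0 * T" "T * snd V h\<^sub>0 = snd W h\<^sub>0 * T"
  shows "(V, W, T) \<in> Hom sl2_cat V W"
proof (rule Hom_sl2_catI[OF T V W])
  fix A assume A: "A \<in> sl2"
  note cV = sl2_module_carrier[OF V efh_sl2(1)] sl2_module_carrier[OF V efh_sl2(2)] sl2_module_carrier[OF V efh_sl2(3)]
  note cW = sl2_module_carrier[OF W efh_sl2(1)] sl2_module_carrier[OF W efh_sl2(2)] sl2_module_carrier[OF W efh_sl2(3)]
  have "T * snd V A = A $$ (0, 0) \<cdot>\<^sub>m (T * snd V h\<^sub>0) + (A $$ (0, 1) \<cdot>\<^sub>m (T * snd V e\<^sub>0) + A $$ (1, 0) \<cdot>\<^sub>m (T * snd V f\<^sub>0))"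
    unfolding sl2_module_expand[OF V A] using cV
    by (simp add: mult_add_distrib_mat[OF T, of _ "fst V"] mult_smult_distrib[OF T, of _ "fst V"])
  also have "\<dots> = snd W A * T"
    unfolding sl2_module_expand[OF W A] c using cW
    by (simp add: add_mult_distrib_mat[OF _ _ T, of _ "fst W"] mult_smult_assoc_mat[OF _ T, of _ "fst W"])
  finally show "T * snd V A = snd W A * T" .
qed

text \<open>The simple module of dimension \<open>k + 1\<close>: homogeneous polynomials of degree \<open>k\<close> in \<open>x, y\<close> with basis
  \<open>x\<^sup>k\<^sup>-\<^sup>j y\<^sup>j\<close>, where \<open>e = x \<partial>\<^sub>y\<close>, \<open>f = y \<partial>\<^sub>x\<close> and \<open>h = x \<partial>\<^sub>x - y \<partial>\<^sub>y\<close>.\<close>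

definition Es :: "nat \<Rightarrow> complex mat" where
  "Es k = mat (Suc k) (Suc k) (\<lambda>(i, j). if j = Suc i then of_nat j else 0)"
definition Fs :: "nat \<Rightarrow> complex mat" where
  "Fs k = mat (Suc k) (Suc k) (\<lambda>(i, j). if i = Suc j then of_nat k - of_nat j else 0)"
definition Hs :: "nat \<Rightarrow> complex mat" where
  "Hs k = mat (Suc k) (Suc k) (\<lambda>(i, j). if i = j then of_nat k - 2 * of_nat j else 0)"

lemma efh_simple_carrier [simp]: "Es k \<in> carrier_mat (Suc k) (Suc k)" "Fs k \<in> carrier_mat (Suc k) (Suc k)"
  "Hs k \<in> carrier_mat (Suc k) (Suc k)"
  by (auto simp: Es_def Fs_def Hs_def)

lemma efh_simple_dim [simp]: "dim_row (Es k) = Suc k" "dim_col (Es k) = Suc k" "dim_row (Fs k) = Suc k" "dim_col (Fs k) = Suc k"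
  "dim_row (Hs k) = Suc k" "dim_col (Hs k) = Suc k"
  by (auto simp: Es_def Fs_def Hs_def)

lemma efh_index: "i < Suc k \<Longrightarrow> j < Suc k \<Longrightarrow> Es k $$ (i, j) = (if j = Suc i then of_nat j else 0)"
  "i < Suc k \<Longrightarrow> j < Suc k \<Longrightarrow> Fs k $$ (i, j) = (if i = Suc j then of_nat k - of_nat j else 0)"
  "i < Suc k \<Longrightarrow> j < Suc k \<Longrightarrow> Hs k $$ (i, j) = (if i = j then of_nat k - 2 * of_nat j else 0)"
  by (auto simp: Es_def Fs_def Hs_def)

lemma sum_single: "(\<And>l. l \<noteq> a \<Longrightarrow> g l = 0) \<Longrightarrow> (\<Sum>l = 0..<n. g l) = (if a < n then g a else (0::complex))"
  for a n :: nat
proof -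
  assume g: "\<And>l. l \<noteq> a \<Longrightarrow> g l = 0"
  have "(\<Sum>l = 0..<n. g l) = (\<Sum>l = 0..<n. if l = a then g l else 0)" by (rule sum.cong) (use g in auto)
  thus ?thesis by simp
qed

lemma simple_left:
  assumes X: "dim_row X = Suc k" and ij: "i < Suc k" "j < dim_col X"
  shows "(Es k * X) $$ (i, j) = (if i < k then of_nat (Suc i) * X $$ (Suc i, j) else 0)"
    "(Fs k * X) $$ (i, j) = (if i > 0 then (of_nat (Suc k) - of_nat i) * X $$ (i - 1, j) else 0)"
    "(Hs k * X) $$ (i, j) = (of_nat k - 2 * of_nat i) * X $$ (i, j)"
proof -
  have "(Es k * X) $$ (i, j) = (\<Sum>l = 0..<Suc k. (if l = Suc i then of_nat l else 0) * X $$ (l, j))"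
    using X ij by (simp add: scalar_prod_def Es_def)
  also have "\<dots> = (if Suc i < Suc k then of_nat (Suc i) * X $$ (Suc i, j) else 0)"
    by (subst sum_single[of "Suc i"]) auto
  finally show "(Es k * X) $$ (i, j) = (if i < k then of_nat (Suc i) * X $$ (Suc i, j) else 0)" by simp
  have "(Fs k * X) $$ (i, j) = (\<Sum>l = 0..<Suc k. (if i = Suc l then of_nat k - of_nat l else 0) * X $$ (l, j))"
    using X ij by (simp add: scalar_prod_def Fs_def)
  also have "\<dots> = (if i > 0 then (of_nat (Suc k) - of_nat i) * X $$ (i - 1, j) else 0)"
    using ij by (subst sum_single[of "i - 1"]) (auto simp: gr0_conv_Suc)
  finally show "(Fs k * X) $$ (i, j) = (if i > 0 then (of_nat (Suc k) - of_nat i) * X $$ (i - 1, j) else 0)" .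
  have "(Hs k * X) $$ (i, j) = (\<Sum>l = 0..<Suc k. (if i = l then of_nat k - 2 * of_nat l else 0) * X $$ (l, j))"
    using X ij by (simp add: scalar_prod_def Hs_def)
  also have "\<dots> = (of_nat k - 2 * of_nat i) * X $$ (i, j)"
    using ij by (subst sum_single[of i]) auto
  finally show "(Hs k * X) $$ (i, j) = (of_nat k - 2 * of_nat i) * X $$ (i, j)" .
qed

lemma simple_right:
  assumes X: "dim_col X = Suc k" and ij: "i < dim_row X" "j < Suc k"
  shows "(X * Es k) $$ (i, j) = (if j > 0 then of_nat j * X $$ (i, j - 1) else 0)"
    "(X * Fs k) $$ (i, j) = (if j < k then (of_nat k - of_nat j) * X $$ (i, Suc j) else 0)"
    "(X * Hs k) $$ (i, j) = (of_nat k - 2 * of_nat j) * X $$ (i, j)"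
proof -
  have "(X * Es k) $$ (i, j) = (\<Sum>l = 0..<Suc k. X $$ (i, l) * (if j = Suc l then of_nat j else 0))"
    using X ij by (simp add: scalar_prod_def Es_def)
  also have "\<dots> = (if j > 0 then of_nat j * X $$ (i, j - 1) else 0)"
    using ij by (subst sum_single[of "j - 1"]) (auto simp: gr0_conv_Suc)
  finally show "(X * Es k) $$ (i, j) = (if j > 0 then of_nat j * X $$ (i, j - 1) else 0)" .
  have "(X * Fs k) $$ (i, j) = (\<Sum>l = 0..<Suc k. X $$ (i, l) * (if l = Suc j then of_nat k - of_nat j else 0))"
    using X ij by (simp add: scalar_prod_def Fs_def)
  also have "\<dots> = (if Suc j < Suc k then (of_nat k - of_nat j) * X $$ (i, Suc j) else 0)"
    by (subst sum_single[of "Suc j"]) auto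
  finally show "(X * Fs k) $$ (i, j) = (if j < k then (of_nat k - of_nat j) * X $$ (i, Suc j) else 0)" by simp
  have "(X * Hs k) $$ (i, j) = (\<Sum>l = 0..<Suc k. X $$ (i, l) * (if l = j then of_nat k - 2 * of_nat j else 0))"
    using X ij by (simp add: scalar_prod_def Hs_def)
  also have "\<dots> = (of_nat k - 2 * of_nat j) * X $$ (i, j)"
    using ij by (subst sum_single[of j]) auto
  finally show "(X * Hs k) $$ (i, j) = (of_nat k - 2 * of_nat j) * X $$ (i, j)" .
qed

lemma simple_triple: "sl2_triple (Suc k) (Es k) (Fs k) (Hs k)"
proof
  have EF: "(Es k * Fs k) $$ (i, j) = (if i = j then of_nat (Suc i) * (of_nat k - of_nat i) else 0)" if "i < Suc k" "j < Suc k" for i j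
    using that by (simp add: simple_left efh_index del: index_mult_mat(1))
  have FE: "(Fs k * Es k) $$ (i, j) = (if i = j then of_nat i * (of_nat (Suc k) - of_nat i) else 0)" if "i < Suc k" "j < Suc k" for i j
    using that by (cases j) (simp_all add: simple_right efh_index del: index_mult_mat(1))
  show "Es k * Fs k = Fs k * Es k + Hs k"
    by (rule eq_matI) (auto simp: EF FE efh_index algebra_simps simp del: index_mult_mat(1))
  have HE: "(Hs k * Es k) $$ (i, j) = (Es k * Hs k + 2 \<cdot>\<^sub>m Es k) $$ (i, j)" if "i < Suc k" "j < Suc k" for i j
    using that by (cases j) (simp_all add: simple_left simple_right efh_index algebra_simps del: index_mult_mat(1))
  show "Hs k * Es k = Es k * Hs k + 2 \<cdot>\<^sub>m Es k" by (rule eq_matI) (simp_all only: HE efh_simple_dim index_mult_mat(2,3) index_add_mat(2,3) index_smult_mat(2,3))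
  have HF: "(Hs k * Fs k) $$ (i, j) = (Fs k * Hs k + (-2) \<cdot>\<^sub>m Fs k) $$ (i, j)" if "i < Suc k" "j < Suc k" for i j
    using that by (simp add: simple_left simple_right efh_index algebra_simps del: index_mult_mat(1))
  show "Hs k * Fs k = Fs k * Hs k + (-2) \<cdot>\<^sub>m Fs k" by (rule eq_matI) (simp_all only: HF efh_simple_dim index_mult_mat(2,3) index_add_mat(2,3) index_smult_mat(2,3))
qed auto

definition simple_module :: "nat \<Rightarrow> sl2_module" where
  "simple_module k = triple_module (Suc k) (Es k) (Fs k) (Hs k)"

lemma simple_module_simps [simp]: "simple_module k \<in> sl2_modules" "fst (simple_module k) = Suc k"
  "snd (simple_module k) e\<^sub>0 = Es k" "snd (simple_module k) f\<^sub>0 = Fs k" "snd (simple_module k) h\<^sub>0 = Hs k"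
  using sl2_triple.triple_module_closed[OF simple_triple] sl2_triple.triple_module_simps[OF simple_triple]
  by (simp_all add: simple_module_def)

text \<open>An equality and not just an isomorphism, so that the tensor unit itself starts the
  family of simple modules; \<open>L1\<close> is its next member in the same sense.\<close>

lemma simple_module_0: "simple_module 0 = trivial_module"
  unfolding simple_module_def triple_module_def trivial_module_def
  by (auto simp: Es_def Fs_def Hs_def fun_eq_iff restrict_def intro!: eq_matI)

lemma simple_module_1: "simple_module 1 = L1"
  unfolding simple_module_def triple_module_def L1_def
  by (auto simp: Es_def Fs_def Hs_def fun_eq_iff restrict_def sl2_def less_2 add_eq_0_iff add_eq_0_iff2 less_Suc_eq intro!: eq_matI)

text \<open>The \<open>E\<close> equation leaves only the corner of the first column: a highest
  weight vector goes to a highest weight vector. The \<open>H\<close> equation kills the corner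
  unless \<open>k = l\<close>. The \<open>F\<close> equation determines each further column from the
  previous one, since its coefficients \<open>k - j\<close> do not vanish.\<close>

lemma simple_intertwiner:
  assumes T: "T \<in> carrier_mat (Suc l) (Suc k)" and E: "T * Es k = Es l * T" and F: "T * Fs k = Fs l * T" and H: "T * Hs k = Hs l * T"
  shows "k \<noteq> l \<Longrightarrow> T = 0\<^sub>m (Suc l) (Suc k)" "k = l \<Longrightarrow> T = T $$ (0, 0) \<cdot>\<^sub>m 1\<^sub>m (Suc k)"
proof -
  define c where "c = T $$ (0, 0)"
  have d: "dim_row T = Suc l" "dim_col T = Suc k" using T by auto
  have col0: "T $$ (i, 0) = 0" if i: "0 < i" "i < Suc l" for i
  proof -
    have "(T * Es k) $$ (i - 1, 0) = (Es l * T) $$ (i - 1, 0)" unfolding E ..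
    thus ?thesis using i by (cases i) (simp_all add: simple_left simple_right d del: index_mult_mat(1) of_nat_Suc)
  qed
  have "(T * Hs k) $$ (0, 0) = (Hs l * T) $$ (0, 0)" unfolding H ..
  hence "(of_nat k - of_nat l) * c = 0" by (simp add: simple_left simple_right d c_def algebra_simps del: index_mult_mat(1))
  hence kl: "k = l \<or> c = 0" by auto
  have T_eq: "T $$ (i, j) = (if i = j then c else 0)" if "i < Suc l" "j < Suc k" for i j
    using that
  proof (induction j arbitrary: i)
    case 0 thus ?case using col0[of i] by (auto simp: c_def)
  next
    case (Suc j)
    have "(T * Fs k) $$ (i, j) = (Fs l * T) $$ (i, j)" unfolding F ..
    hence "(of_nat k - of_nat j) * T $$ (i, Suc j) = (if i > 0 then (of_nat (Suc l) - of_nat i) * T $$ (i - 1, j) else 0)"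
      using Suc.prems by (simp add: simple_left simple_right d del: index_mult_mat(1))
    also have "\<dots> = (if i = Suc j then (of_nat k - of_nat j) * c else 0)"
      using Suc.IH[of "i - 1"] Suc.prems kl by auto
    finally have "(of_nat k - of_nat j) * (T $$ (i, Suc j) - (if i = Suc j then c else 0)) = 0"
      by (auto simp: algebra_simps)
    moreover have "of_nat k - of_nat j \<noteq> (0 :: complex)" using Suc.prems by (simp flip: of_nat_diff)
    ultimately show ?case by simp
  qed
  show "T = 0\<^sub>m (Suc l) (Suc k)" if "k \<noteq> l"
    by (rule eq_matI) (use T_eq kl that d in auto)
  show "T = T $$ (0, 0) \<cdot>\<^sub>m 1\<^sub>m (Suc k)" if "k = l"
    unfolding c_def[symmetric] by (rule eq_matI) (use T_eq that d in auto)
qed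

lemma schur:
  assumes f: "f \<in> Hom sl2_cat (simple_module k) (simple_module l)"
  shows "k \<noteq> l \<Longrightarrow> f = Null sl2_cat (simple_module k) (simple_module l)"
    "k = l \<Longrightarrow> \<exists>c. f = Scale sl2_cat c (Ident sl2_cat (simple_module k))"
proof -
  from f obtain T where T: "f = (simple_module k, simple_module l, T)" "T \<in> carrier_mat (Suc l) (Suc k)"
    and i: "\<And>A. A \<in> sl2 \<Longrightarrow> T * snd (simple_module k) A = snd (simple_module l) A * T" by (auto elim!: Hom_sl2_catE)
  have "T * Es k = Es l * T" "T * Fs k = Fs l * T" "T * Hs k = Hs l * T"
    using i[of e\<^sub>0] i[of f\<^sub>0] i[of h\<^sub>0] by simp_all
  note s = simple_intertwiner[OF T(2) this]
  show "f = Null sl2_cat (simple_module k) (simple_module l)" if "k \<noteq> l" using s(1)[OF that] T by simp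
  show "\<exists>c. f = Scale sl2_cat c (Ident sl2_cat (simple_module k))" if "k = l" using s(2)[OF that] T that by auto
qed

text \<open>From a dominant pair, the vector \<open>v\<close> generates a copy of the simple module
  under \<open>F\<close>, and the covector \<open>y\<close> generates the rows of a projection under
  the transpose of \<open>E\<close>. Both chains have the same length because \<open>v\<close> and
  \<open>y\<close> share the eigenvalue. The composite \<open>b a\<close> is an intertwiner of a
  simple module, hence a scalar, and \<open>y \<bullet> v = 1\<close> makes it the identity.\<close>

lemma (in sl2_triple) simple_retract:
  assumes "n > 0"
  obtains k a b where "a \<in> carrier_mat n (Suc k)" "b \<in> carrier_mat (Suc k) n" "b * a = 1\<^sub>m (Suc k)"
    "a * Es k = E * a" "a * Fs k = F * a" "a * Hs k = H * a"
    "b * E = Es k * b" "b * F = Fs k * b" "b * H = Hs k * b"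
proof -
  interpret T: sl2_triple n "transpose_mat F" "transpose_mat E" "transpose_mat H" by (rule transpose_triple)
  obtain \<mu> v y where v: "v \<in> carrier_vec n" "v \<noteq> 0\<^sub>v n" "E *\<^sub>v v = 0\<^sub>v n" "H *\<^sub>v v = \<mu> \<cdot>\<^sub>v v"
    and y: "y \<in> carrier_vec n" "y \<noteq> 0\<^sub>v n" "transpose_mat F *\<^sub>v y = 0\<^sub>v n" "transpose_mat H *\<^sub>v y = \<mu> \<cdot>\<^sub>v y"
    and yv: "y \<bullet> v = 1" using dominant_pair[OF assms] by metis
  from highest_weight[OF v] obtain k where k: "\<mu> = of_nat k" "low (Suc k) v = 0\<^sub>v n"
    and Hv: "\<And>j. H *\<^sub>v low j v = (\<mu> - 2 * of_nat j) \<cdot>\<^sub>v low j v"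
    and Ev: "\<And>j. E *\<^sub>v low (Suc j) v = (of_nat (Suc j) * (\<mu> - of_nat j)) \<cdot>\<^sub>v low j v" by metis
  from T.highest_weight[OF y] obtain k' where k': "\<mu> = of_nat k'" "T.low (Suc k') y = 0\<^sub>v n"
    and Hy: "\<And>j. transpose_mat H *\<^sub>v T.low j y = (\<mu> - 2 * of_nat j) \<cdot>\<^sub>v T.low j y"
    and Fy: "\<And>j. transpose_mat F *\<^sub>v T.low (Suc j) y = (of_nat (Suc j) * (\<mu> - of_nat j)) \<cdot>\<^sub>v T.low j y" by metis
  have [simp]: "k' = k" using k(1) k'(1) by simp
  define x where "x = (\<lambda>j. low j v)"
  define z where "z = (\<lambda>j. T.low j y)"
  have xc [simp]: "x j \<in> carrier_vec n" "z j \<in> carrier_vec n" for j using v(1) y(1) by (auto simp: x_def z_def)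
  have xd [simp]: "dim_vec (x j) = n" "dim_vec (z j) = n" for j using xc[of j] by (blast dest: carrier_vecD)+
  have xz: "x (Suc k) = 0\<^sub>v n" "z (Suc k) = 0\<^sub>v n" using k k' by (simp_all add: x_def z_def)
  have Fx: "F *\<^sub>v x j = x (Suc j)" and Ez: "transpose_mat E *\<^sub>v z j = z (Suc j)" for j
    by (simp_all add: x_def z_def low_Suc T.low_Suc)
  have Hx: "H *\<^sub>v x j = (of_nat k - 2 * of_nat j) \<cdot>\<^sub>v x j" and Hz: "transpose_mat H *\<^sub>v z j = (of_nat k - 2 * of_nat j) \<cdot>\<^sub>v z j" for j
    using Hv Hy k(1) by (simp_all add: x_def z_def)
  have Ex: "E *\<^sub>v x j = (if j = 0 then 0\<^sub>v n else (of_nat j * (of_nat (Suc k) - of_nat j)) \<cdot>\<^sub>v x (j - 1))" for j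
    using Ev[of "j - 1"] v(3) k(1) by (cases j) (auto simp: x_def)
  have Fz: "transpose_mat F *\<^sub>v z j = (if j = 0 then 0\<^sub>v n else (of_nat j * (of_nat (Suc k) - of_nat j)) \<cdot>\<^sub>v z (j - 1))" for j
    using Fy[of "j - 1"] y(3) k(1) by (cases j) (auto simp: z_def)
  \<comment> \<open>In the polynomial model \<open>F^j x^k = (k!/(k-j)!) x^(k-j) y^j\<close> and
    \<open>E^j (x^(k-j) y^j) = j! x^k\<close>. The factors thus make column \<open>j\<close> of
    \<open>a\<close> the image of the \<open>j\<close>-th basis vector, and row \<open>j\<close> of
    \<open>b\<close> the matching coordinate.\<close>
  define a where "a = mat n (Suc k) (\<lambda>(i, j). fact (k - j) / fact k * x j $ i)"
  define b where "b = mat (Suc k) n (\<lambda>(j, i). z j $ i / fact j)"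
  have da [simp]: "dim_row a = n" "dim_col a = Suc k" "dim_row b = Suc k" "dim_col b = n" by (auto simp: a_def b_def)
  have ae: "a $$ (i, j) = fact (k - j) / fact k * x j $ i" if "i < n" "j < Suc k" for i j using that by (simp add: a_def)
  have be: "b $$ (j, i) = z j $ i / fact j" if "i < n" "j < Suc k" for i j using that by (simp add: b_def)
  have Xa: "(X * a) $$ (i, j) = fact (k - j) / fact k * (X *\<^sub>v x j) $ i"
    if "X \<in> carrier_mat n n" "i < n" "j < Suc k" for X i j
  proof -
    have "(X * a) $$ (i, j) = (\<Sum>l = 0..<n. X $$ (i, l) * (fact (k - j) / fact k * x j $ l))"
      using that by (auto simp: scalar_prod_def ae)
    thus ?thesis using that by (simp add: scalar_prod_def sum_distrib_left mult_ac)
  qed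
  have bX: "(b * X) $$ (j, i) = (transpose_mat X *\<^sub>v z j) $ i / fact j"
    if "X \<in> carrier_mat n n" "i < n" "j < Suc k" for X i j
  proof -
    have "(b * X) $$ (j, i) = (\<Sum>l = 0..<n. z j $ l / fact j * X $$ (l, i))"
      using that by (auto simp: scalar_prod_def be)
    thus ?thesis using that by (simp add: scalar_prod_def sum_divide_distrib mult_ac)
  qed
  have fk: "fact (Suc k - j) = (fact (k - j) * (of_nat (Suc k) - of_nat j) :: complex)" if "j < Suc k" for j
  proof -
    have "Suc k - j = Suc (k - j)" using that by auto
    thus ?thesis using that by (simp add: of_nat_diff[of j "Suc k", symmetric] del: of_nat_Suc)
  qed
  have aE: "a * Es k = E * a"
    by (rule eq_matI) (auto simp: simple_right Xa Ex ae fk simp del: index_mult_mat(1) of_nat_Suc)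
  have aF: "a * Fs k = F * a"
  proof (rule eq_matI)
    fix i j assume "i < dim_row (F * a)" "j < dim_col (F * a)"
    hence ij: "i < n" "j < Suc k" by auto
    show "(a * Fs k) $$ (i, j) = (F * a) $$ (i, j)"
    proof (cases "j < k")
      case True
      thus ?thesis using ij fk[of "Suc j"] by (simp add: simple_right Xa Fx ae del: index_mult_mat(1))
    next
      case False
      hence "j = k" using ij by simp
      thus ?thesis using ij xz by (simp add: simple_right Xa Fx ae del: index_mult_mat(1))
    qed
  qed auto
  have aH: "a * Hs k = H * a"
    by (rule eq_matI) (auto simp: simple_right Xa Hx ae simp del: index_mult_mat(1))
  have bE: "b * E = Es k * b"
  proof (rule eq_matI)
    fix j i assume "j < dim_row (Es k * b)" "i < dim_col (Es k * b)"
    hence ij: "i < n" "j < Suc k" by auto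
    show "(b * E) $$ (j, i) = (Es k * b) $$ (j, i)"
    proof (cases "j < k")
      case True
      thus ?thesis using ij by (simp add: simple_left bX Ez be del: index_mult_mat(1) of_nat_Suc)
    next
      case False
      hence "j = k" using ij by simp
      thus ?thesis using ij xz by (simp add: simple_left bX Ez be del: index_mult_mat(1))
    qed
  qed auto
  have bF: "b * F = Fs k * b"
  proof (rule eq_matI)
    fix j i assume "j < dim_row (Fs k * b)" "i < dim_col (Fs k * b)"
    hence ij: "i < n" "j < Suc k" by auto
    show "(b * F) $$ (j, i) = (Fs k * b) $$ (j, i)"
      using ij by (cases j) (simp_all add: simple_left bX Fz be del: index_mult_mat(1) of_nat_Suc)
  qed auto
  have bH: "b * H = Hs k * b"
    by (rule eq_matI) (auto simp: simple_left bX Hz be simp del: index_mult_mat(1))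
  have ba: "b * a \<in> carrier_mat (Suc k) (Suc k)" by (auto simp: a_def b_def)
  have c: "a \<in> carrier_mat n (Suc k)" "b \<in> carrier_mat (Suc k) n" by (auto simp: a_def b_def)
  have comm: "(b * a) * Y = Y * (b * a)" if "X \<in> carrier_mat n n" "Y \<in> carrier_mat (Suc k) (Suc k)" "a * Y = X * a" "b * X = Y * b" for X Y
    by (simp add: assoc_mult_mat[OF c(2,1) that(2)] that(3) assoc_mult_mat[OF c(2) that(1) c(1), symmetric] that(4)
      assoc_mult_mat[OF that(2) c(2,1)])
  have "b * a = (b * a) $$ (0, 0) \<cdot>\<^sub>m 1\<^sub>m (Suc k)"
    using comm[OF carrier(1) efh_simple_carrier(1) aE bE] comm[OF carrier(2) efh_simple_carrier(2) aF bF]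
      comm[OF carrier(3) efh_simple_carrier(3) aH bH] by (intro simple_intertwiner(2)[OF ba]) simp_all
  moreover have "(b * a) $$ (0, 0) = z 0 \<bullet> x 0"
    using xd[of 0] by (auto simp: scalar_prod_def ae be intro!: sum.cong)
  hence "(b * a) $$ (0, 0) = 1" using yv by (simp add: z_def x_def)
  ultimately have "b * a = 1\<^sub>m (Suc k)" by auto
  thus ?thesis using that[OF c _ aE aF aH bE bF bH] by blast
qed

section \<open>Biproducts of modules\<close>

lemma biprod_sl2I:
  assumes "(X, S, i) \<in> Hom sl2_cat X S" "(S, X, p) \<in> Hom sl2_cat S X" "(Y, S, i') \<in> Hom sl2_cat Y S" "(S, Y, p') \<in> Hom sl2_cat S Y"
    "p * i = 1\<^sub>m (fst X)" "p' * i' = 1\<^sub>m (fst Y)" "i * p + i' * p' = 1\<^sub>m (fst S)"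
  shows "biprod sl2_cat S X Y (X, S, i) (S, X, p) (Y, S, i') (S, Y, p')"
  using assms by (auto simp: biprod_def Hom_sl2_cat)

lemma HomD:
  assumes "(V, W, T) \<in> Hom sl2_cat V W"
  shows "V \<in> sl2_modules" "W \<in> sl2_modules" "T \<in> carrier_mat (fst W) (fst V)"
    "T * snd V e\<^sub>0 = snd W e\<^sub>0 * T" "T * snd V f\<^sub>0 = snd W f\<^sub>0 * T" "T * snd V h\<^sub>0 = snd W h\<^sub>0 * T"
  using assms by (auto simp: Hom_sl2_cat)

lemma trace_comm_sum:
  fixes A B :: "complex mat"
  assumes "A \<in> carrier_mat n r" "B \<in> carrier_mat r n"
  shows "(\<Sum>i<n. (A * B) $$ (i, i)) = (\<Sum>j<r. (B * A) $$ (j, j))"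
proof -
  have "(\<Sum>i<n. (A * B) $$ (i, i)) = (\<Sum>i<n. \<Sum>j<r. A $$ (i, j) * B $$ (j, i))"
    using assms by (auto simp: scalar_prod_def lessThan_atLeast0 intro!: sum.cong)
  also have "\<dots> = (\<Sum>j<r. \<Sum>i<n. B $$ (j, i) * A $$ (i, j))"
    by (subst sum.swap) (simp add: mult.commute)
  also have "\<dots> = (\<Sum>j<r. (B * A) $$ (j, j))"
    using assms by (auto simp: scalar_prod_def lessThan_atLeast0 intro!: sum.cong)
  finally show ?thesis .
qed

text \<open>The complement lives on the range of the idempotent \<open>Q = 1 - a b\<close>. Since
  \<open>Q\<close> commutes with the action, the compression \<open>cj X = p X i\<close> of
  operators to that range respects products, so it turns the triple of \<open>V\<close> into another
  triple.\<close>

lemma retract_splits: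
  assumes a: "(W, V, a) \<in> Hom sl2_cat W V" and b: "(V, W, b) \<in> Hom sl2_cat V W" and ba: "b * a = 1\<^sub>m (fst W)"
  obtains V' i p where "biprod sl2_cat V W V' (W, V, a) (V, W, b) (V', V, i) (V, V', p)" "fst V = fst W + fst V'"
proof -
  define n m where "n = fst V" and "m = fst W"
  note V = HomD(2)[OF a] and W = HomD(1)[OF a]
  have ca: "a \<in> carrier_mat n m" and cb: "b \<in> carrier_mat m n" using HomD(3)[OF a] HomD(3)[OF b] by (auto simp: n_def m_def)
  have cab: "a * b \<in> carrier_mat n n" using ca cb by auto
  define Q where "Q = 1\<^sub>m n - a * b"
  have cQ: "Q \<in> carrier_mat n n" unfolding Q_def by (rule minus_carrier_mat[OF cab])
  have "(a * b) * (a * b) = a * ((b * a) * b)"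
    using assoc_mult_mat[OF ca cb cab] assoc_mult_mat[OF cb ca cb] by simp
  hence abab: "(a * b) * (a * b) = a * b" using cb by (simp add: ba m_def)
  have "Q * Q = 1\<^sub>m n * Q - (a * b) * Q" by (subst (1) Q_def) (rule minus_mult_distrib_mat[OF one_carrier_mat cab cQ])
  also have "(a * b) * Q = (a * b) * 1\<^sub>m n - (a * b) * (a * b)" unfolding Q_def
    by (rule mult_minus_distrib_mat[OF cab one_carrier_mat cab])
  also have "\<dots> = 0\<^sub>m n n" unfolding abab right_mult_one_mat[OF cab] by (rule minus_r_inv_mat[OF cab])
  finally have QQ: "Q * Q = Q" using cQ by (simp) (rule eq_matI, auto)
  obtain r i p where ip: "i \<in> carrier_mat n r" "p \<in> carrier_mat r n" "p * i = 1\<^sub>m r" "i * p = Q"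
    using idempotent_factor[OF cQ QQ] by metis
  have pQ: "p * Q = p" using assoc_mult_mat[OF ip(2,1,2)] ip by simp
  have Qi: "Q * i = i" using assoc_mult_mat[OF ip(1,2,1)] ip by simp
  interpret sl2_triple n "snd V e\<^sub>0" "snd V f\<^sub>0" "snd V h\<^sub>0" unfolding n_def by (rule sl2_module_triple[OF V])
  have cW: "snd W x \<in> carrier_mat m m" if "x \<in> sl2" for x using sl2_module_carrier[OF W that] by (simp add: m_def)
  have commute: "X * Q = Q * X" if X: "X \<in> carrier_mat n n" "a * Y = X * a" "b * X = Y * b" "Y \<in> carrier_mat m m" for X Y
  proof -
    have "X * (a * b) = (a * b) * X"
      by (simp add: assoc_mult_mat[OF X(1) ca cb, symmetric] X(2)[symmetric] assoc_mult_mat[OF ca X(4) cb]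
        X(3)[symmetric] assoc_mult_mat[OF ca cb X(1)])
    thus ?thesis unfolding Q_def
      by (simp add: mult_minus_distrib_mat[OF X(1) one_carrier_mat cab] minus_mult_distrib_mat[OF one_carrier_mat cab X(1)]
        right_mult_one_mat[OF X(1)] left_mult_one_mat[OF X(1)])
  qed
  define cj where "cj = (\<lambda>X. p * (X * i))"
  define good where "good = (\<lambda>X. X \<in> carrier_mat n n \<and> X * Q = Q * X)"
  have good: "good (snd V e\<^sub>0)" "good (snd V f\<^sub>0)" "good (snd V h\<^sub>0)"
    unfolding good_def using commute[OF carrier(1) HomD(4)[OF a] HomD(4)[OF b] cW]
      commute[OF carrier(2) HomD(5)[OF a] HomD(5)[OF b] cW] commute[OF carrier(3) HomD(6)[OF a] HomD(6)[OF b] cW] by auto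
  have cj_carrier [simp]: "cj X \<in> carrier_mat r r" if "X \<in> carrier_mat n n" for X using that ip by (auto simp: cj_def)
  have i_cj: "i * cj X = X * i" if "good X" for X
  proof -
    have X: "X \<in> carrier_mat n n" "X * Q = Q * X" using that by (auto simp: good_def)
    have Xi: "X * i \<in> carrier_mat n r" using X ip by auto
    have "i * cj X = Q * (X * i)" unfolding cj_def using assoc_mult_mat[OF ip(1,2) Xi] ip by simp
    also have "\<dots> = X * (Q * i)" using assoc_mult_mat[OF cQ X(1) ip(1)] assoc_mult_mat[OF X(1) cQ ip(1)] X(2) by simp
    finally show ?thesis by (simp add: Qi)
  qed
  have cj_p: "cj X * p = p * X" if "good X" for X
  proof -
    have X: "X \<in> carrier_mat n n" "X * Q = Q * X" using that by (auto simp: good_def)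
    have Xi: "X * i \<in> carrier_mat n r" using X ip by auto
    have "cj X * p = p * (X * Q)" unfolding cj_def
      using assoc_mult_mat[OF ip(2) Xi ip(2)] assoc_mult_mat[OF X(1) ip(1,2)] ip by simp
    also have "\<dots> = (p * Q) * X" using assoc_mult_mat[OF ip(2) cQ X(1)] X(2) by simp
    finally show ?thesis by (simp add: pQ)
  qed
  have cj_mult: "cj X * cj Y = cj (X * Y)" if "good X" "good Y" for X Y
  proof -
    have X: "X \<in> carrier_mat n n" "Y \<in> carrier_mat n n" using that by (auto simp: good_def)
    have Yi: "Y * i \<in> carrier_mat n r" using X ip by auto
    have "cj X * cj Y = cj X * (p * (Y * i))" by (simp only: cj_def)
    also have "\<dots> = (cj X * p) * (Y * i)" using assoc_mult_mat[OF cj_carrier[OF X(1)] ip(2) Yi] by simp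
    also have "\<dots> = p * (X * (Y * i))" using assoc_mult_mat[OF ip(2) X(1) Yi] cj_p[OF that(1)] by simp
    also have "\<dots> = cj (X * Y)" unfolding cj_def using assoc_mult_mat[OF X ip(1)] by simp
    finally show ?thesis .
  qed
  have cj_add: "cj (X + Y) = cj X + cj Y" if "X \<in> carrier_mat n n" "Y \<in> carrier_mat n n" for X Y
    unfolding cj_def add_mult_distrib_mat[OF that ip(1)]
    by (rule mult_add_distrib_mat[OF ip(2) mult_carrier_mat[OF that(1) ip(1)] mult_carrier_mat[OF that(2) ip(1)]])
  have cj_smult: "cj (c \<cdot>\<^sub>m X) = c \<cdot>\<^sub>m cj X" if "X \<in> carrier_mat n n" for X c
    unfolding cj_def mult_smult_assoc_mat[OF that ip(1)]
    by (rule mult_smult_distrib[OF ip(2) mult_carrier_mat[OF that ip(1)]])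
  define E F H where "E = cj (snd V e\<^sub>0)" and "F = cj (snd V f\<^sub>0)" and "H = cj (snd V h\<^sub>0)"
  have mc: "A * B \<in> carrier_mat n n" if "A \<in> carrier_mat n n" "B \<in> carrier_mat n n" for A B :: "complex mat"
    using mult_carrier_mat[OF that] .
  interpret V': sl2_triple r E F H
  proof
    show "E * F = F * E + H" unfolding E_def F_def H_def
      by (simp only: cj_mult good EF) (simp only: cj_add carrier mc cj_mult good)
    show "H * E = E * H + 2 \<cdot>\<^sub>m E" unfolding E_def F_def H_def
      by (simp only: cj_mult good HE) (simp only: cj_add carrier mc cj_smult smult_carrier_mat)
    show "H * F = F * H + (-2) \<cdot>\<^sub>m F" unfolding E_def F_def H_def
      by (simp only: cj_mult good HF) (simp only: cj_add carrier mc cj_smult smult_carrier_mat)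
  qed (simp_all add: E_def F_def H_def)
  define V' where "V' = triple_module r E F H"
  have V': "V' \<in> sl2_modules" "fst V' = r" "snd V' e\<^sub>0 = E" "snd V' f\<^sub>0 = F" "snd V' h\<^sub>0 = H"
    using V'.triple_module_closed V'.triple_module_simps by (simp_all add: V'_def)
  have "(V', V, i) \<in> Hom sl2_cat V' V"
    by (rule intertwinerI) (use V V' ip i_cj good in \<open>simp_all add: n_def E_def F_def H_def\<close>)
  moreover have "(V, V', p) \<in> Hom sl2_cat V V'"
    by (rule intertwinerI) (use V V' ip cj_p good in \<open>simp_all add: n_def E_def F_def H_def\<close>)
  moreover have abip: "a * b + i * p = 1\<^sub>m n" unfolding ip(4) Q_def
    by (rule eq_matI) (use carrier_matD[OF ca] carrier_matD[OF cb] in \<open>auto simp del: index_mult_mat(1)\<close>)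
  ultimately have "biprod sl2_cat V W V' (W, V, a) (V, W, b) (V', V, i) (V, V', p)"
    using a b ba ip V' by (intro biprod_sl2I) (simp_all add: n_def)
  \<comment> \<open>Dimensions are compared by taking the trace of \<open>a b + i p = 1\<close>,
    with \<open>b a\<close> and \<open>p i\<close> being identity matrices.\<close>
  moreover have "n = m + r"
  proof -
    have "of_nat n = (\<Sum>j<n. (1\<^sub>m n :: complex mat) $$ (j, j))" by simp
    also have "\<dots> = (\<Sum>j<n. (a * b) $$ (j, j)) + (\<Sum>j<n. (i * p) $$ (j, j))"
      unfolding abip[symmetric] using cab ip cQ by (simp add: sum.distrib ip(4) del: index_mult_mat(1))
    also have "\<dots> = of_nat (m + r)"
      unfolding trace_comm_sum[OF ca cb] trace_comm_sum[OF ip(1,2)] ba ip(3) by (simp add: m_def)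
    finally show ?thesis by (simp only: of_nat_eq_iff)
  qed
  ultimately show ?thesis using that V' by (auto simp: n_def m_def)
qed

text \<open>Stated as a single splitting with a complement of smaller dimension, because all later
  uses are inductions on the dimension.\<close>

theorem complete_reducibility:
  assumes V: "V \<in> sl2_modules" and "fst V > 0"
  obtains k V' i p i' p' where "biprod sl2_cat V (simple_module k) V' i p i' p'" "fst V' < fst V"
proof -
  interpret sl2_triple "fst V" "snd V e\<^sub>0" "snd V f\<^sub>0" "snd V h\<^sub>0" by (rule sl2_module_triple[OF V])
  obtain k a b where "a \<in> carrier_mat (fst V) (Suc k)" "b \<in> carrier_mat (Suc k) (fst V)" "b * a = 1\<^sub>m (Suc k)"
    "a * Es k = snd V e\<^sub>0 * a" "a * Fs k = snd V f\<^sub>0 * a" "a * Hs k = snd V h\<^sub>0 * a"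
    "b * snd V e\<^sub>0 = Es k * b" "b * snd V f\<^sub>0 = Fs k * b" "b * snd V h\<^sub>0 = Hs k * b"
    using simple_retract[OF assms(2)] by metis
  hence "(simple_module k, V, a) \<in> Hom sl2_cat (simple_module k) V" "(V, simple_module k, b) \<in> Hom sl2_cat V (simple_module k)"
    "b * a = 1\<^sub>m (fst (simple_module k))" by (auto intro!: intertwinerI V)
  from retract_splits[OF this] that show ?thesis by (metis less_add_same_cancel2 simple_module_simps(2) zero_less_Suc)
qed

lemma zero_module:
  obtains Z where "zero_object sl2_cat Z"
proof -
  interpret sl2_triple 0 "0\<^sub>m 0 0" "0\<^sub>m 0 0" "0\<^sub>m 0 0" by unfold_locales (auto intro!: eq_matI)
  have "zero_object sl2_cat (triple_module 0 (0\<^sub>m 0 0) (0\<^sub>m 0 0) (0\<^sub>m 0 0))"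
    unfolding zero_object_def using triple_module_closed by (auto intro!: eq_matI)
  thus ?thesis using that by blast
qed

lemma zero_dim: "V \<in> sl2_modules \<Longrightarrow> fst V = 0 \<Longrightarrow> zero_object sl2_cat V"
  by (auto simp: zero_object_def intro!: eq_matI)

text \<open>The block diagonal triple. The coordinate inclusions and projections intertwine every
  block diagonal matrix with its blocks, which settles \<open>E\<close>, \<open>F\<close> and
  \<open>H\<close> by one computation.\<close>

lemma block_sum:
  assumes V: "V \<in> sl2_modules" and W: "W \<in> sl2_modules"
  obtains S i p i' p' where "biprod sl2_cat S V W i p i' p'"
proof -
  define n m where "n = fst V" and "m = fst W"
  interpret V: sl2_triple n "snd V e\<^sub>0" "snd V f\<^sub>0" "snd V h\<^sub>0" unfolding n_def by (rule sl2_module_triple[OF V])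
  interpret W: sl2_triple m "snd W e\<^sub>0" "snd W f\<^sub>0" "snd W h\<^sub>0" unfolding m_def by (rule sl2_module_triple[OF W])
  define bl where "bl = (\<lambda>X Y :: complex mat. four_block_mat X (0\<^sub>m n m) (0\<^sub>m m n) Y)"
  have bl_carrier: "bl X Y \<in> carrier_mat (n + m) (n + m)" if "X \<in> carrier_mat n n" "Y \<in> carrier_mat m m" for X Y
    using that by (auto simp: bl_def)
  have bl_mult: "bl X Y * bl X' Y' = bl (X * X') (Y * Y')"
    if c: "X \<in> carrier_mat n n" "Y \<in> carrier_mat m m" "X' \<in> carrier_mat n n" "Y' \<in> carrier_mat m m" for X Y X' Y'
    unfolding bl_def
    by (subst mult_four_block_mat[OF c(1) zero_carrier_mat zero_carrier_mat c(2) c(3) zero_carrier_mat zero_carrier_mat c(4)])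
      (use c mult_carrier_mat[OF c(1,3)] mult_carrier_mat[OF c(2,4)] in simp)
  have bl_add: "bl X Y + bl X' Y' = bl (X + X') (Y + Y')"
    if c: "X \<in> carrier_mat n n" "Y \<in> carrier_mat m m" "X' \<in> carrier_mat n n" "Y' \<in> carrier_mat m m" for X Y X' Y'
    unfolding bl_def using c by (intro eq_matI) (auto simp: )
  have bl_smult: "c \<cdot>\<^sub>m bl X Y = bl (c \<cdot>\<^sub>m X) (c \<cdot>\<^sub>m Y)"
    if "X \<in> carrier_mat n n" "Y \<in> carrier_mat m m" for X Y c
    unfolding bl_def using that by (intro eq_matI) auto
  define E F H where "E = bl (snd V e\<^sub>0) (snd W e\<^sub>0)" and "F = bl (snd V f\<^sub>0) (snd W f\<^sub>0)" and "H = bl (snd V h\<^sub>0) (snd W h\<^sub>0)"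
  have mc: "A * B \<in> carrier_mat l l" if "A \<in> carrier_mat l l" "B \<in> carrier_mat l l" for A B :: "complex mat" and l
    using mult_carrier_mat[OF that] .
  interpret S: sl2_triple "n + m" E F H
  proof
    show "E * F = F * E + H" "H * E = E * H + 2 \<cdot>\<^sub>m E" "H * F = F * H + (-2) \<cdot>\<^sub>m F" unfolding E_def F_def H_def
      by (simp_all only: bl_mult bl_add bl_smult V.carrier W.carrier mc smult_carrier_mat V.EF W.EF V.HE W.HE V.HF W.HF)
  qed (simp_all add: E_def F_def H_def bl_carrier)
  define S where "S = triple_module (n + m) E F H"
  have S: "S \<in> sl2_modules" "fst S = n + m" "snd S e\<^sub>0 = E" "snd S f\<^sub>0 = F" "snd S h\<^sub>0 = H"
    using S.triple_module_closed S.triple_module_simps by (simp_all add: S_def)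
  define i where "i = mat (n + m) n (\<lambda>(i, j). if i = j then 1 else (0::complex))"
  define p where "p = mat n (n + m) (\<lambda>(i, j). if i = j then 1 else (0::complex))"
  define i' where "i' = mat (n + m) m (\<lambda>(i, j). if i = n + j then 1 else (0::complex))"
  define p' where "p' = mat m (n + m) (\<lambda>(i, j). if j = n + i then 1 else (0::complex))"
  have c: "i \<in> carrier_mat (n + m) n" "p \<in> carrier_mat n (n + m)" "i' \<in> carrier_mat (n + m) m" "p' \<in> carrier_mat m (n + m)"
    by (auto simp: i_def p_def i'_def p'_def)
  note d = c[THEN carrier_matD(1)] c[THEN carrier_matD(2)]
  have left: "(i * X) $$ (l, j) = (if l < n then X $$ (l, j) else 0)" if "dim_row X = n" "l < n + m" "j < dim_col X" for X l j
  proof -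
    have "(i * X) $$ (l, j) = (\<Sum>a = 0..<n. (if l = a then 1 else 0) * X $$ (a, j))" using that by (simp add: i_def scalar_prod_def)
    also have "\<dots> = (if l < n then X $$ (l, j) else 0)" by (subst sum_single[of l]) auto
    finally show ?thesis .
  qed
  have left': "(i' * X) $$ (l, j) = (if l < n then 0 else X $$ (l - n, j))" if "dim_row X = m" "l < n + m" "j < dim_col X" for X l j
  proof -
    have "(i' * X) $$ (l, j) = (\<Sum>a = 0..<m. (if l = n + a then 1 else 0) * X $$ (a, j))" using that by (simp add: i'_def scalar_prod_def)
    also have "\<dots> = (if l < n then 0 else X $$ (l - n, j))" using that by (subst sum_single[of "l - n"]) auto
    finally show ?thesis .
  qed
  have pleft: "(p * X) $$ (l, j) = X $$ (l, j)" if "dim_row X = n + m" "l < n" "j < dim_col X" for X l j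
  proof -
    have "(p * X) $$ (l, j) = (\<Sum>a = 0..<n + m. (if l = a then 1 else 0) * X $$ (a, j))" using that by (simp add: p_def scalar_prod_def)
    also have "\<dots> = X $$ (l, j)" using that by (subst sum_single[of l]) auto
    finally show ?thesis .
  qed
  have pleft': "(p' * X) $$ (l, j) = X $$ (n + l, j)" if "dim_row X = n + m" "l < m" "j < dim_col X" for X l j
  proof -
    have "(p' * X) $$ (l, j) = (\<Sum>a = 0..<n + m. (if a = n + l then 1 else 0) * X $$ (a, j))" using that by (simp add: p'_def scalar_prod_def)
    also have "\<dots> = X $$ (n + l, j)" using that by (subst sum_single[of "n + l"]) auto
    finally show ?thesis .
  qed
  have right: "(X * i) $$ (l, j) = X $$ (l, j)" if "dim_col X = n + m" "l < dim_row X" "j < n" for X l j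
  proof -
    have "(X * i) $$ (l, j) = (\<Sum>a = 0..<n + m. X $$ (l, a) * (if a = j then 1 else 0))" using that by (simp add: i_def scalar_prod_def)
    also have "\<dots> = X $$ (l, j)" using that by (subst sum_single[of j]) auto
    finally show ?thesis .
  qed
  have right': "(X * i') $$ (l, j) = X $$ (l, n + j)" if "dim_col X = n + m" "l < dim_row X" "j < m" for X l j
  proof -
    have "(X * i') $$ (l, j) = (\<Sum>a = 0..<n + m. X $$ (l, a) * (if a = n + j then 1 else 0))" using that by (simp add: i'_def scalar_prod_def)
    also have "\<dots> = X $$ (l, n + j)" using that by (subst sum_single[of "n + j"]) auto
    finally show ?thesis .
  qed
  have pright: "(X * p) $$ (l, j) = (if j < n then X $$ (l, j) else 0)" if "dim_col X = n" "l < dim_row X" "j < n + m" for X l j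
  proof -
    have "(X * p) $$ (l, j) = (\<Sum>a = 0..<n. X $$ (l, a) * (if a = j then 1 else 0))" using that by (simp add: p_def scalar_prod_def)
    also have "\<dots> = (if j < n then X $$ (l, j) else 0)" by (subst sum_single[of j]) auto
    finally show ?thesis .
  qed
  have pright': "(X * p') $$ (l, j) = (if j < n then 0 else X $$ (l, j - n))" if "dim_col X = m" "l < dim_row X" "j < n + m" for X l j
  proof -
    have "(X * p') $$ (l, j) = (\<Sum>a = 0..<m. X $$ (l, a) * (if j = n + a then 1 else 0))" using that by (simp add: p'_def scalar_prod_def)
    also have "\<dots> = (if j < n then 0 else X $$ (l, j - n))" using that by (subst sum_single[of "j - n"]) auto
    finally show ?thesis .
  qed
  have inter: "i * X = bl X Y * i" "p * bl X Y = X * p" "i' * Y = bl X Y * i'" "p' * bl X Y = Y * p'"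
    if "X \<in> carrier_mat n n" "Y \<in> carrier_mat m m" for X Y
  proof -
    have [simp]: "dim_row X = n" "dim_col X = n" "dim_row Y = m" "dim_col Y = m" "dim_row (bl X Y) = n + m" "dim_col (bl X Y) = n + m"
      using that bl_carrier[OF that] by auto
    have ble: "bl X Y $$ (l, j) = (if l < n then (if j < n then X $$ (l, j) else 0) else if j < n then 0 else Y $$ (l - n, j - n))"
      if "l < n + m" "j < n + m" for l j using that by (auto simp: bl_def)
    show "i * X = bl X Y * i" "p * bl X Y = X * p" "i' * Y = bl X Y * i'" "p' * bl X Y = Y * p'"
      by (rule eq_matI; auto simp: d ble left left' right right' pleft pleft' pright pright' simp del: index_mult_mat(1))+
  qed
  have "(V, S, i) \<in> Hom sl2_cat V S" "(S, V, p) \<in> Hom sl2_cat S V" "(W, S, i') \<in> Hom sl2_cat W S" "(S, W, p') \<in> Hom sl2_cat S W"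
    by (intro intertwinerI V W S; use c inter in \<open>simp add: S E_def F_def H_def flip: n_def m_def\<close>)+
  moreover have "p * i = 1\<^sub>m n" "p' * i' = 1\<^sub>m m" "i * p + i' * p' = 1\<^sub>m (n + m)"
  proof -
    have e: "i $$ (l, j) = (if l = j then 1 else 0)" if "l < n + m" "j < n" for l j using that by (simp add: i_def)
    have e': "i' $$ (l, j) = (if l = n + j then 1 else 0)" if "l < n + m" "j < m" for l j using that by (simp add: i'_def)
    have f: "p $$ (l, j) = (if l = j then 1 else 0)" if "j < n + m" "l < n" for l j using that by (simp add: p_def)
    have f': "p' $$ (l, j) = (if j = n + l then 1 else 0)" if "j < n + m" "l < m" for l j using that by (simp add: p'_def)
    show "p * i = 1\<^sub>m n" "p' * i' = 1\<^sub>m m" "i * p + i' * p' = 1\<^sub>m (n + m)"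
      by (rule eq_matI; auto simp: d e e' f f' left left' pleft pleft' simp del: index_mult_mat(1))+
  qed
  ultimately have "biprod sl2_cat S V W (V, S, i) (S, V, p) (W, S, i') (S, W, p')"
    by (intro biprod_sl2I) (simp_all add: S flip: n_def m_def)
  thus ?thesis using that by blast
qed

section \<open>The Clebsch--Gordan rule\<close>

text \<open>\<open>row_map N\<close> is \<open>\<Sum>\<^sub>a e\<^sub>a\<^sup>* \<otimes> N a\<close> on \<open>\<complex>\<^sup>2 \<otimes> \<complex>\<^sup>q\<close> and \<open>col_map N\<close> is \<open>\<Sum>\<^sub>a e\<^sub>a \<otimes> N a\<close>.\<close>

definition row_map :: "nat \<Rightarrow> nat \<Rightarrow> (nat \<Rightarrow> complex mat) \<Rightarrow> complex mat" where
  "row_map p q N = mat p (2 * q) (\<lambda>(i, c). N (c div q) $$ (i, c mod q))"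

definition col_map :: "nat \<Rightarrow> nat \<Rightarrow> (nat \<Rightarrow> complex mat) \<Rightarrow> complex mat" where
  "col_map q p N = mat (2 * q) p (\<lambda>(c, i). N (c div q) $$ (c mod q, i))"

lemma row_col_dim [simp]: "dim_row (row_map p q N) = p" "dim_col (row_map p q N) = 2 * q"
  "dim_row (col_map q p N) = 2 * q" "dim_col (col_map q p N) = p"
  by (simp_all add: row_map_def col_map_def)

lemma sum_2: "(\<Sum>a<2::nat. f a) = f 0 + (f 1 :: complex)"
  by (simp add: numeral_2_eq_2)

lemma tensor_entry:
  assumes "X \<in> carrier_mat 2 2" "Y \<in> carrier_mat q q" "c < 2 * q" "c' < 2 * q"
  shows "(kron X (1\<^sub>m q) + kron (1\<^sub>m 2) Y) $$ (c, c') =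
    X $$ (c div q, c' div q) * (if c mod q = c' mod q then 1 else 0) + (if c div q = c' div q then 1 else 0) * Y $$ (c mod q, c' mod q)"
  using assms div_mod_less[of c 2 q] div_mod_less[of c' 2 q] by (simp add: kron_index)

text \<open>On \<open>e_a \<otimes> w\<close> the tensor product action is a sum of \<open>X\<close>
  moving the index \<open>a\<close> and \<open>Y\<close> moving the vector \<open>w\<close>. Read
  for each \<open>a\<close>, equivariance of the row is the hypothesis \<open>h\<close>.\<close>

lemma row_map_tensor:
  assumes N: "\<And>a. N a \<in> carrier_mat p q" and X: "X \<in> carrier_mat 2 2" and Y: "Y \<in> carrier_mat q q" and Z: "Z \<in> carrier_mat p p"
    and h: "\<And>a i j. a < 2 \<Longrightarrow> i < p \<Longrightarrow> j < q \<Longrightarrow>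
      (Z * N a) $$ (i, j) = (N a * Y) $$ (i, j) + (N 0 $$ (i, j) * X $$ (0, a) + N 1 $$ (i, j) * X $$ (1, a))"
  shows "row_map p q N * (kron X (1\<^sub>m q) + kron (1\<^sub>m 2) Y) = Z * row_map p q N"
proof (rule eq_matI)
  fix i c assume "i < dim_row (Z * row_map p q N)" "c < dim_col (Z * row_map p q N)"
  hence i: "i < p" and c: "c < 2 * q" using Z by auto
  note ac = div_mod_less[OF c]
  let ?a = "c div q" and ?j = "c mod q"
  have "(row_map p q N * (kron X (1\<^sub>m q) + kron (1\<^sub>m 2) Y)) $$ (i, c) =
    (\<Sum>l<2 * q. row_map p q N $$ (i, l) * (kron X (1\<^sub>m q) + kron (1\<^sub>m 2) Y) $$ (l, c))"
    using X Y i c by (auto simp: scalar_prod_def lessThan_atLeast0 intro!: sum.cong)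
  also have "\<dots> = (\<Sum>l<2 * q. (\<lambda>b m. N b $$ (i, m) * (X $$ (b, ?a) * (if m = ?j then 1 else 0) + (if b = ?a then 1 else 0) * Y $$ (m, ?j))) (l div q) (l mod q))"
    by (rule sum.cong) (use i c tensor_entry[OF X Y _ c] in \<open>simp_all add: row_map_def\<close>)
  also have "\<dots> = (\<Sum>b<2. \<Sum>m<q. N b $$ (i, m) * (X $$ (b, ?a) * (if m = ?j then 1 else 0) + (if b = ?a then 1 else 0) * Y $$ (m, ?j)))"
    by (rule sum_lex)
  also have "\<dots> = (\<Sum>b<2. N b $$ (i, ?j) * X $$ (b, ?a) + (if b = ?a then (\<Sum>m<q. N b $$ (i, m) * Y $$ (m, ?j)) else 0))"
  proof (rule sum.cong[OF refl])
    fix b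
    have "(\<Sum>m<q. N b $$ (i, m) * (X $$ (b, ?a) * (if m = ?j then 1 else 0) + (if b = ?a then 1 else 0) * Y $$ (m, ?j))) =
      (\<Sum>m<q. if m = ?j then N b $$ (i, m) * X $$ (b, ?a) else 0) + (\<Sum>m<q. if b = ?a then N b $$ (i, m) * Y $$ (m, ?j) else 0)"
      unfolding sum.distrib[symmetric] by (rule sum.cong) (simp_all add: distrib_left)
    thus "(\<Sum>m<q. N b $$ (i, m) * (X $$ (b, ?a) * (if m = ?j then 1 else 0) + (if b = ?a then 1 else 0) * Y $$ (m, ?j))) =
      N b $$ (i, ?j) * X $$ (b, ?a) + (if b = ?a then (\<Sum>m<q. N b $$ (i, m) * Y $$ (m, ?j)) else 0)" using ac by simp
  qed
  also have "\<dots> = (\<Sum>m<q. N ?a $$ (i, m) * Y $$ (m, ?j)) + (N 0 $$ (i, ?j) * X $$ (0, ?a) + N 1 $$ (i, ?j) * X $$ (1, ?a))"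
    unfolding sum.distrib sum_2[of "\<lambda>b. N b $$ (i, ?j) * X $$ (b, ?a)"] using ac by simp
  also have "(\<Sum>m<q. N ?a $$ (i, m) * Y $$ (m, ?j)) = (N ?a * Y) $$ (i, ?j)"
    using ac N[of ?a] Y i by (auto simp: scalar_prod_def lessThan_atLeast0)
  also have "(N ?a * Y) $$ (i, ?j) + (N 0 $$ (i, ?j) * X $$ (0, ?a) + N 1 $$ (i, ?j) * X $$ (1, ?a)) = (Z * N ?a) $$ (i, ?j)" by (rule h[OF _ i, symmetric]) (use ac in simp_all)
  also have "\<dots> = (Z * row_map p q N) $$ (i, c)"
    using ac N[of ?a] Z i c by (auto simp: scalar_prod_def row_map_def intro!: sum.cong)
  finally show "(row_map p q N * (kron X (1\<^sub>m q) + kron (1\<^sub>m 2) Y)) $$ (i, c) = (Z * row_map p q N) $$ (i, c)" .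
qed (use X Y Z in auto)

lemma col_map_tensor:
  assumes N: "\<And>a. N a \<in> carrier_mat q p" and X: "X \<in> carrier_mat 2 2" and Y: "Y \<in> carrier_mat q q" and Z: "Z \<in> carrier_mat p p"
    and h: "\<And>a i j. a < 2 \<Longrightarrow> i < p \<Longrightarrow> j < q \<Longrightarrow>
      (N a * Z) $$ (j, i) = (Y * N a) $$ (j, i) + (X $$ (a, 0) * N 0 $$ (j, i) + X $$ (a, 1) * N 1 $$ (j, i))"
  shows "col_map q p N * Z = (kron X (1\<^sub>m q) + kron (1\<^sub>m 2) Y) * col_map q p N"
proof (rule eq_matI)
  fix c i assume "c < dim_row ((kron X (1\<^sub>m q) + kron (1\<^sub>m 2) Y) * col_map q p N)" "i < dim_col ((kron X (1\<^sub>m q) + kron (1\<^sub>m 2) Y) * col_map q p N)"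
  hence i: "i < p" and c: "c < 2 * q" using Y by auto
  note ac = div_mod_less[OF c]
  let ?a = "c div q" and ?j = "c mod q"
  have "((kron X (1\<^sub>m q) + kron (1\<^sub>m 2) Y) * col_map q p N) $$ (c, i) =
    (\<Sum>l<2 * q. (kron X (1\<^sub>m q) + kron (1\<^sub>m 2) Y) $$ (c, l) * col_map q p N $$ (l, i))"
    using X Y i c by (auto simp: scalar_prod_def lessThan_atLeast0 intro!: sum.cong)
  also have "\<dots> = (\<Sum>l<2 * q. (\<lambda>b m. (X $$ (?a, b) * (if ?j = m then 1 else 0) + (if ?a = b then 1 else 0) * Y $$ (?j, m)) * N b $$ (m, i)) (l div q) (l mod q))"
    by (rule sum.cong) (use i c tensor_entry[OF X Y c] in \<open>simp_all add: col_map_def\<close>)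
  also have "\<dots> = (\<Sum>b<2. \<Sum>m<q. (X $$ (?a, b) * (if ?j = m then 1 else 0) + (if ?a = b then 1 else 0) * Y $$ (?j, m)) * N b $$ (m, i))"
    by (rule sum_lex)
  also have "\<dots> = (\<Sum>b<2. X $$ (?a, b) * N b $$ (?j, i) + (if b = ?a then (\<Sum>m<q. Y $$ (?j, m) * N b $$ (m, i)) else 0))"
  proof (rule sum.cong[OF refl])
    fix b
    have "(\<Sum>m<q. (X $$ (?a, b) * (if ?j = m then 1 else 0) + (if ?a = b then 1 else 0) * Y $$ (?j, m)) * N b $$ (m, i)) =
      (\<Sum>m<q. if m = ?j then X $$ (?a, b) * N b $$ (m, i) else 0) + (\<Sum>m<q. if b = ?a then Y $$ (?j, m) * N b $$ (m, i) else 0)"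
      unfolding sum.distrib[symmetric] by (rule sum.cong) (auto simp: distrib_right)
    thus "(\<Sum>m<q. (X $$ (?a, b) * (if ?j = m then 1 else 0) + (if ?a = b then 1 else 0) * Y $$ (?j, m)) * N b $$ (m, i)) =
      X $$ (?a, b) * N b $$ (?j, i) + (if b = ?a then (\<Sum>m<q. Y $$ (?j, m) * N b $$ (m, i)) else 0)" using ac by simp
  qed
  also have "\<dots> = (\<Sum>m<q. Y $$ (?j, m) * N ?a $$ (m, i)) + (X $$ (?a, 0) * N 0 $$ (?j, i) + X $$ (?a, 1) * N 1 $$ (?j, i))"
    unfolding sum.distrib sum_2[of "\<lambda>b. X $$ (?a, b) * N b $$ (?j, i)"] using ac by simp
  also have "(\<Sum>m<q. Y $$ (?j, m) * N ?a $$ (m, i)) = (Y * N ?a) $$ (?j, i)"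
    using ac N[of ?a] Y i by (auto simp: scalar_prod_def lessThan_atLeast0)
  also have "(Y * N ?a) $$ (?j, i) + (X $$ (?a, 0) * N 0 $$ (?j, i) + X $$ (?a, 1) * N 1 $$ (?j, i)) = (N ?a * Z) $$ (?j, i)" by (rule h[OF _ i, symmetric]) (use ac in simp_all)
  also have "\<dots> = (col_map q p N * Z) $$ (c, i)"
    using ac N[of ?a] Z i c by (auto simp: scalar_prod_def col_map_def intro!: sum.cong)
  finally show "(col_map q p N * Z) $$ (c, i) = ((kron X (1\<^sub>m q) + kron (1\<^sub>m 2) Y) * col_map q p N) $$ (c, i)" by (rule sym)
qed (use X Y Z in auto)

lemma row_col:
  assumes N: "\<And>a. N a \<in> carrier_mat p q" and N': "\<And>a. N' a \<in> carrier_mat q p'" and ij: "i < p" "j < p'"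
  shows "(row_map p q N * col_map q p' N') $$ (i, j) = (N 0 * N' 0) $$ (i, j) + (N 1 * N' 1) $$ (i, j)"
proof -
  have "(row_map p q N * col_map q p' N') $$ (i, j) = (\<Sum>l<2 * q. (\<lambda>b m. N b $$ (i, m) * N' b $$ (m, j)) (l div q) (l mod q))"
    using ij by (auto simp: scalar_prod_def row_map_def col_map_def lessThan_atLeast0 intro!: sum.cong)
  also have "\<dots> = (\<Sum>b<2. \<Sum>m<q. N b $$ (i, m) * N' b $$ (m, j))" by (rule sum_lex)
  also have "\<dots> = (N 0 * N' 0) $$ (i, j) + (N 1 * N' 1) $$ (i, j)"
    unfolding sum_2 using N[of 0] N[of 1] N'[of 0] N'[of 1] ij by (auto simp: scalar_prod_def lessThan_atLeast0)
  finally show ?thesis .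
qed

lemma col_row:
  assumes N: "\<And>a. N a \<in> carrier_mat p q" and N': "\<And>a. N' a \<in> carrier_mat q p" and c: "c < 2 * q" "c' < 2 * q"
  shows "(col_map q p N' * row_map p q N) $$ (c, c') = (N' (c div q) * N (c' div q)) $$ (c mod q, c' mod q)"
  using N[of "c' div q"] N'[of "c div q"] c div_mod_less[OF c(1)] div_mod_less[OF c(2)]
  by (auto simp: scalar_prod_def row_map_def col_map_def intro!: sum.cong)

text \<open>Multiplication by and differentiation with respect to the variable \<open>x\<close> (for \<open>a = 0\<close>) or \<open>y\<close> (for \<open>a = 1\<close>),
  between the polynomials of degrees \<open>k\<close> and \<open>k + 1\<close>.\<close>

definition mult_var :: "nat \<Rightarrow> nat \<Rightarrow> complex mat" where
  "mult_var k a = mat (Suc (Suc k)) (Suc k) (\<lambda>(i, j). if i = j + a then 1 else 0)"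
definition diff_var :: "nat \<Rightarrow> nat \<Rightarrow> complex mat" where
  "diff_var k a = mat (Suc k) (Suc (Suc k)) (\<lambda>(i, j). if j = i + a then (if a = 0 then of_nat (Suc k) - of_nat j else of_nat j) else 0)"

lemma mult_diff_carrier [simp]: "mult_var k a \<in> carrier_mat (Suc (Suc k)) (Suc k)" "diff_var k a \<in> carrier_mat (Suc k) (Suc (Suc k))"
  and mult_diff_dim [simp]: "dim_row (mult_var k a) = Suc (Suc k)" "dim_col (mult_var k a) = Suc k" "dim_row (diff_var k a) = Suc k" "dim_col (diff_var k a) = Suc (Suc k)"
  by (auto simp: mult_var_def diff_var_def)

lemma mult_var_index: "i < Suc (Suc k) \<Longrightarrow> j < Suc k \<Longrightarrow> mult_var k a $$ (i, j) = (if i = j + a then 1 else 0)"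
  and diff_var_index: "i < Suc k \<Longrightarrow> j < Suc (Suc k) \<Longrightarrow>
    diff_var k a $$ (i, j) = (if j = i + a then (if a = 0 then of_nat (Suc k) - of_nat j else of_nat j) else 0)"
  by (auto simp: mult_var_def diff_var_def)

lemma mult_var_left:
  assumes "dim_row X = Suc k" "i < Suc (Suc k)" "j < dim_col X" "a < 2"
  shows "(mult_var k a * X) $$ (i, j) = (if a \<le> i \<and> i - a < Suc k then X $$ (i - a, j) else 0)"
proof -
  have "(mult_var k a * X) $$ (i, j) = (\<Sum>l = 0..<Suc k. (if i = l + a then 1 else 0) * X $$ (l, j))"
    using assms by (auto simp: scalar_prod_def mult_var_def intro!: sum.cong)
  also have "\<dots> = (if a \<le> i \<and> i - a < Suc k then X $$ (i - a, j) else 0)"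
    by (subst sum_single[of "i - a"]) auto
  finally show ?thesis .
qed

lemma diff_var_left:
  assumes "dim_row X = Suc (Suc k)" "i < Suc k" "j < dim_col X" "a < 2"
  shows "(diff_var k a * X) $$ (i, j) = (if a = 0 then of_nat (Suc k) - of_nat i else of_nat (Suc i)) * X $$ (i + a, j)"
proof -
  have "(diff_var k a * X) $$ (i, j) = (\<Sum>l = 0..<Suc (Suc k). (if l = i + a then (if a = 0 then of_nat (Suc k) - of_nat l else of_nat l) else 0) * X $$ (l, j))"
    using assms by (auto simp: scalar_prod_def diff_var_def intro!: sum.cong)
  also have "\<dots> = (if a = 0 then of_nat (Suc k) - of_nat i else of_nat (Suc i)) * X $$ (i + a, j)"
    using assms by (subst sum_single[of "i + a"]) (auto simp: less_2)
  finally show ?thesis .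
qed

lemma efh\<^sub>0_index: "i < 2 \<Longrightarrow> j < 2 \<Longrightarrow> e\<^sub>0 $$ (i, j) = (if i = 0 \<and> j = 1 then 1 else 0)"
  "i < 2 \<Longrightarrow> j < 2 \<Longrightarrow> f\<^sub>0 $$ (i, j) = (if i = 1 \<and> j = 0 then 1 else 0)"
  "i < 2 \<Longrightarrow> j < 2 \<Longrightarrow> h\<^sub>0 $$ (i, j) = (if i = j then (if i = 0 then 1 else -1) else 0)"
  by (auto simp: e\<^sub>0_def f\<^sub>0_def h\<^sub>0_def)

lemma efh\<^sub>0_carrier [simp]: "e\<^sub>0 \<in> carrier_mat 2 2" "f\<^sub>0 \<in> carrier_mat 2 2" "h\<^sub>0 \<in> carrier_mat 2 2"
  by (auto simp: e\<^sub>0_def f\<^sub>0_def h\<^sub>0_def)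

lemma tensor_L1: "x \<in> sl2 \<Longrightarrow> fst V = q \<Longrightarrow> snd (tensor_module L1 V) x = kron x (1\<^sub>m q) + kron (1\<^sub>m 2) (snd V x)"
  by (simp add: snd_tensor L1_def)

lemma fst_L1 [simp]: "fst L1 = 2" by (simp add: L1_def)

text \<open>Multiplying a linear form with a polynomial of degree \<open>k\<close> is equivariant
  because sl2 acts by derivations.\<close>

lemma mult_intertwiner:
  "(tensor_module L1 (simple_module k), simple_module (Suc k), row_map (Suc (Suc k)) (Suc k) (mult_var k))
    \<in> Hom sl2_cat (tensor_module L1 (simple_module k)) (simple_module (Suc k))"
proof (rule intertwinerI)
  show "row_map (Suc (Suc k)) (Suc k) (mult_var k) * snd (tensor_module L1 (simple_module k)) e\<^sub>0 = snd (simple_module (Suc k)) e\<^sub>0 * row_map (Suc (Suc k)) (Suc k) (mult_var k)"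
    by (subst tensor_L1, simp, simp, simp,
        (rule row_map_tensor; auto simp: simple_left simple_right mult_var_index efh\<^sub>0_index less_2 algebra_simps simp del: index_mult_mat(1); auto simp: less_Suc_eq algebra_simps))
  show "row_map (Suc (Suc k)) (Suc k) (mult_var k) * snd (tensor_module L1 (simple_module k)) f\<^sub>0 = snd (simple_module (Suc k)) f\<^sub>0 * row_map (Suc (Suc k)) (Suc k) (mult_var k)"
    by (subst tensor_L1, simp, simp, simp,
        (rule row_map_tensor; auto simp: simple_left simple_right mult_var_index efh\<^sub>0_index less_2 algebra_simps simp del: index_mult_mat(1); auto simp: less_Suc_eq algebra_simps))
  show "row_map (Suc (Suc k)) (Suc k) (mult_var k) * snd (tensor_module L1 (simple_module k)) h\<^sub>0 = snd (simple_module (Suc k)) h\<^sub>0 * row_map (Suc (Suc k)) (Suc k) (mult_var k)"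
    by (subst tensor_L1, simp, simp, simp,
        (rule row_map_tensor; auto simp: simple_left simple_right mult_var_index efh\<^sub>0_index less_2 algebra_simps simp del: index_mult_mat(1); auto simp: less_Suc_eq algebra_simps))
qed (auto simp: L1_closed row_map_def)

text \<open>The map \<open>P \<mapsto> x \<otimes> P_x + y \<otimes> P_y\<close>, a section of
  multiplication up to the degree. Equivariance says that the two partial derivatives transform like
  the dual of the variables.\<close>

lemma polarization_intertwiner:
  "(simple_module (Suc k), tensor_module L1 (simple_module k), col_map (Suc k) (Suc (Suc k)) (diff_var k))
    \<in> Hom sl2_cat (simple_module (Suc k)) (tensor_module L1 (simple_module k))"
proof (rule intertwinerI)
  show "col_map (Suc k) (Suc (Suc k)) (diff_var k) * snd (simple_module (Suc k)) e\<^sub>0 = snd (tensor_module L1 (simple_module k)) e\<^sub>0 * col_map (Suc k) (Suc (Suc k)) (diff_var k)"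
    by (subst tensor_L1, simp, simp, simp,
        (rule col_map_tensor; auto simp: simple_left simple_right diff_var_index efh\<^sub>0_index less_2 algebra_simps simp del: index_mult_mat(1); auto simp: less_Suc_eq algebra_simps))
  show "col_map (Suc k) (Suc (Suc k)) (diff_var k) * snd (simple_module (Suc k)) f\<^sub>0 = snd (tensor_module L1 (simple_module k)) f\<^sub>0 * col_map (Suc k) (Suc (Suc k)) (diff_var k)"
    by (subst tensor_L1, simp, simp, simp,
        (rule col_map_tensor; auto simp: simple_left simple_right diff_var_index efh\<^sub>0_index less_2 algebra_simps simp del: index_mult_mat(1); auto simp: less_Suc_eq algebra_simps))
  show "col_map (Suc k) (Suc (Suc k)) (diff_var k) * snd (simple_module (Suc k)) h\<^sub>0 = snd (tensor_module L1 (simple_module k)) h\<^sub>0 * col_map (Suc k) (Suc (Suc k)) (diff_var k)"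
    by (subst tensor_L1, simp, simp, simp,
        (rule col_map_tensor; auto simp: simple_left simple_right diff_var_index efh\<^sub>0_index less_2 algebra_simps simp del: index_mult_mat(1); auto simp: less_Suc_eq algebra_simps))
qed (auto simp: L1_closed col_map_def)

text \<open>The same maps for the symplectically dual variables \<open>y, -x\<close>, which give the inclusion and the projection of
  the other summand.\<close>

definition mult_alt :: "nat \<Rightarrow> nat \<Rightarrow> complex mat" where "mult_alt k a = (if a = 0 then mult_var k 1 else (-1) \<cdot>\<^sub>m mult_var k 0)"
definition diff_alt :: "nat \<Rightarrow> nat \<Rightarrow> complex mat" where "diff_alt k a = (if a = 0 then diff_var k 1 else (-1) \<cdot>\<^sub>m diff_var k 0)"

lemma alt_carrier [simp]: "mult_alt k a \<in> carrier_mat (Suc (Suc k)) (Suc k)" "diff_alt k a \<in> carrier_mat (Suc k) (Suc (Suc k))"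
  and alt_dim [simp]: "dim_row (mult_alt k a) = Suc (Suc k)" "dim_col (mult_alt k a) = Suc k" "dim_row (diff_alt k a) = Suc k" "dim_col (diff_alt k a) = Suc (Suc k)"
  by (auto simp: mult_alt_def diff_alt_def)

lemma alt_index: "i < Suc (Suc k) \<Longrightarrow> j < Suc k \<Longrightarrow> mult_alt k a $$ (i, j) = (if a = 0 then (if i = Suc j then 1 else 0) else (if i = j then -1 else 0))"
  "i < Suc k \<Longrightarrow> j < Suc (Suc k) \<Longrightarrow>
    diff_alt k a $$ (i, j) = (if a = 0 then (if j = Suc i then of_nat j else 0) else (if j = i then of_nat j - of_nat (Suc k) else 0))"
  by (auto simp: mult_alt_def diff_alt_def mult_var_index diff_var_index)

text \<open>The map \<open>P \<mapsto> x \<otimes> y P - y \<otimes> x P\<close>, multiplication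
  with the invariant alternating tensor of the two variables.\<close>

lemma wedge_intertwiner:
  "(simple_module k, tensor_module L1 (simple_module (Suc k)), col_map (Suc (Suc k)) (Suc k) (mult_alt k))
    \<in> Hom sl2_cat (simple_module k) (tensor_module L1 (simple_module (Suc k)))"
proof (rule intertwinerI)
  show "col_map (Suc (Suc k)) (Suc k) (mult_alt k) * snd (simple_module k) e\<^sub>0 = snd (tensor_module L1 (simple_module (Suc k))) e\<^sub>0 * col_map (Suc (Suc k)) (Suc k) (mult_alt k)"
    by (subst tensor_L1, simp, simp, simp,
        (rule col_map_tensor; auto simp: simple_left simple_right alt_index efh\<^sub>0_index less_2 algebra_simps simp del: index_mult_mat(1); auto simp: less_Suc_eq algebra_simps))
  show "col_map (Suc (Suc k)) (Suc k) (mult_alt k) * snd (simple_module k) f\<^sub>0 = snd (tensor_module L1 (simple_module (Suc k))) f\<^sub>0 * col_map (Suc (Suc k)) (Suc k) (mult_alt k)"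
    by (subst tensor_L1, simp, simp, simp,
        (rule col_map_tensor; auto simp: simple_left simple_right alt_index efh\<^sub>0_index less_2 algebra_simps simp del: index_mult_mat(1); auto simp: less_Suc_eq algebra_simps))
  show "col_map (Suc (Suc k)) (Suc k) (mult_alt k) * snd (simple_module k) h\<^sub>0 = snd (tensor_module L1 (simple_module (Suc k))) h\<^sub>0 * col_map (Suc (Suc k)) (Suc k) (mult_alt k)"
    by (subst tensor_L1, simp, simp, simp,
        (rule col_map_tensor; auto simp: simple_left simple_right alt_index efh\<^sub>0_index less_2 algebra_simps simp del: index_mult_mat(1); auto simp: less_Suc_eq algebra_simps))
qed (auto simp: L1_closed col_map_def)

text \<open>The map \<open>x \<otimes> P \<mapsto> P_y\<close>,
  \<open>y \<otimes> P \<mapsto> - P_x\<close>, which contracts with the invariant symplectic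
  form.\<close>

lemma contraction_intertwiner:
  "(tensor_module L1 (simple_module (Suc k)), simple_module k, row_map (Suc k) (Suc (Suc k)) (diff_alt k))
    \<in> Hom sl2_cat (tensor_module L1 (simple_module (Suc k))) (simple_module k)"
proof (rule intertwinerI)
  show "row_map (Suc k) (Suc (Suc k)) (diff_alt k) * snd (tensor_module L1 (simple_module (Suc k))) e\<^sub>0 = snd (simple_module k) e\<^sub>0 * row_map (Suc k) (Suc (Suc k)) (diff_alt k)"
    by (subst tensor_L1, simp, simp, simp,
        (rule row_map_tensor; auto simp: simple_left simple_right alt_index efh\<^sub>0_index less_2 algebra_simps simp del: index_mult_mat(1); auto simp: less_Suc_eq algebra_simps))
  show "row_map (Suc k) (Suc (Suc k)) (diff_alt k) * snd (tensor_module L1 (simple_module (Suc k))) f\<^sub>0 = snd (simple_module k) f\<^sub>0 * row_map (Suc k) (Suc (Suc k)) (diff_alt k)"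
    by (subst tensor_L1, simp, simp, simp,
        (rule row_map_tensor; auto simp: simple_left simple_right alt_index efh\<^sub>0_index less_2 algebra_simps simp del: index_mult_mat(1); auto simp: less_Suc_eq algebra_simps))
  show "row_map (Suc k) (Suc (Suc k)) (diff_alt k) * snd (tensor_module L1 (simple_module (Suc k))) h\<^sub>0 = snd (simple_module k) h\<^sub>0 * row_map (Suc k) (Suc (Suc k)) (diff_alt k)"
    by (subst tensor_L1, simp, simp, simp,
        (rule row_map_tensor; auto simp: simple_left simple_right alt_index efh\<^sub>0_index less_2 algebra_simps simp del: index_mult_mat(1); auto simp: less_Suc_eq algebra_simps))
qed (auto simp: L1_closed row_map_def)

lemma alt_left:
  "dim_row X = Suc k \<Longrightarrow> i < Suc (Suc k) \<Longrightarrow> j < dim_col X \<Longrightarrow>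
    (mult_alt k a * X) $$ (i, j) = (if a = 0 then (if i > 0 then X $$ (i - 1, j) else 0) else (if i < Suc k then - X $$ (i, j) else 0))"
  "dim_row X = Suc (Suc k) \<Longrightarrow> i < Suc k \<Longrightarrow> j < dim_col X \<Longrightarrow>
    (diff_alt k a * X) $$ (i, j) = (if a = 0 then of_nat (Suc i) * X $$ (Suc i, j) else (of_nat i - of_nat (Suc k)) * X $$ (i, j))"
proof -
  assume X: "dim_row X = Suc k" "i < Suc (Suc k)" "j < dim_col X"
  have "X \<in> carrier_mat (Suc k) (dim_col X)" using X by (intro carrier_matI) simp_all
  from mult_smult_assoc_mat[OF mult_diff_carrier(1) this]
  have "((-1) \<cdot>\<^sub>m mult_var k 0 * X) $$ (i, j) = ((-1) \<cdot>\<^sub>m (mult_var k 0 * X)) $$ (i, j)" by simp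
  also have "\<dots> = - (mult_var k 0 * X) $$ (i, j)" using X by (subst index_smult_mat) simp_all
  finally have m: "((-1) \<cdot>\<^sub>m mult_var k 0 * X) $$ (i, j) = - (mult_var k 0 * X) $$ (i, j)" .
  show "(mult_alt k a * X) $$ (i, j) = (if a = 0 then (if i > 0 then X $$ (i - 1, j) else 0) else (if i < Suc k then - X $$ (i, j) else 0))"
    by (cases "a = 0") (use X in \<open>simp_all add: mult_alt_def m mult_var_left del: index_mult_mat(1)\<close>)
next
  assume X: "dim_row X = Suc (Suc k)" "i < Suc k" "j < dim_col X"
  have "X \<in> carrier_mat (Suc (Suc k)) (dim_col X)" using X by (intro carrier_matI) simp_all
  from mult_smult_assoc_mat[OF mult_diff_carrier(2) this]
  have "((-1) \<cdot>\<^sub>m diff_var k 0 * X) $$ (i, j) = ((-1) \<cdot>\<^sub>m (diff_var k 0 * X)) $$ (i, j)" by simp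
  also have "\<dots> = - (diff_var k 0 * X) $$ (i, j)" using X by (subst index_smult_mat) simp_all
  finally have m: "((-1) \<cdot>\<^sub>m diff_var k 0 * X) $$ (i, j) = - (diff_var k 0 * X) $$ (i, j)" .
  show "(diff_alt k a * X) $$ (i, j) = (if a = 0 then of_nat (Suc i) * X $$ (Suc i, j) else (of_nat i - of_nat (Suc k)) * X $$ (i, j))"
    by (cases "a = 0") (use X in \<open>simp_all add: diff_alt_def m diff_var_left algebra_simps del: index_mult_mat(1)\<close>)
qed

text \<open>Euler's identity. Multiplication after polarization is the degree \<open>k + 2\<close>,
  and contraction after the wedge map is \<open>(x P)_x + (y P)_y = (k + 2) P\<close>. The constant
  \<open>c\<close> is the same on both summands, so one factor \<open>1 / c\<close> normalizes both
  projections.\<close>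

theorem clebsch_gordan:
  "\<exists>i p i' p'. biprod sl2_cat (tensor_module L1 (simple_module (Suc k))) (simple_module (Suc (Suc k))) (simple_module k) i p i' p'"
proof -
  define q where "q = Suc (Suc k)"
  define c :: complex where "c = of_nat (Suc (Suc k))"
  have c: "c \<noteq> 0" unfolding c_def by (simp del: of_nat_Suc)
  define \<mu> where "\<mu> = row_map (Suc q) q (mult_var (Suc k))"
  define \<delta> where "\<delta> = col_map q (Suc q) (diff_var (Suc k))"
  define \<alpha> where "\<alpha> = col_map q (Suc k) (mult_alt k)"
  define \<beta> where "\<beta> = row_map (Suc k) q (diff_alt k)"
  have cr: "\<mu> \<in> carrier_mat (Suc q) (2 * q)" "\<delta> \<in> carrier_mat (2 * q) (Suc q)" "\<alpha> \<in> carrier_mat (2 * q) (Suc k)" "\<beta> \<in> carrier_mat (Suc k) (2 * q)"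
    by (auto simp: \<mu>_def \<delta>_def \<alpha>_def \<beta>_def)
  note d = cr[THEN carrier_matD(1)] cr[THEN carrier_matD(2)]
  let ?S = "tensor_module L1 (simple_module (Suc k))"
  have hom: "(simple_module (Suc (Suc k)), ?S, \<delta>) \<in> Hom sl2_cat (simple_module (Suc (Suc k))) ?S"
    "(?S, simple_module (Suc (Suc k)), (1 / c) \<cdot>\<^sub>m \<mu>) \<in> Hom sl2_cat ?S (simple_module (Suc (Suc k)))"
    "(simple_module k, ?S, \<alpha>) \<in> Hom sl2_cat (simple_module k) ?S"
    "(?S, simple_module k, (1 / c) \<cdot>\<^sub>m \<beta>) \<in> Hom sl2_cat ?S (simple_module k)"
    using polarization_intertwiner[of "Suc k"] sl2_scale[OF mult_intertwiner[of "Suc k"], of "1 / c"]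
      wedge_intertwiner[of k] sl2_scale[OF contraction_intertwiner[of k], of "1 / c"]
    unfolding \<mu>_def \<delta>_def \<alpha>_def \<beta>_def q_def sl2_cat_simps by simp_all
  have "\<mu> * \<delta> = c \<cdot>\<^sub>m 1\<^sub>m (Suc q)"
  proof (rule eq_matI)
    fix i j assume "i < dim_row (c \<cdot>\<^sub>m 1\<^sub>m (Suc q))" "j < dim_col (c \<cdot>\<^sub>m 1\<^sub>m (Suc q))"
    hence ij: "i < Suc q" "j < Suc q" by auto
    have "(\<mu> * \<delta>) $$ (i, j) = (mult_var (Suc k) 0 * diff_var (Suc k) 0) $$ (i, j) + (mult_var (Suc k) 1 * diff_var (Suc k) 1) $$ (i, j)"
      unfolding \<mu>_def \<delta>_def using ij by (intro row_col) (simp_all add: q_def)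
    thus "(\<mu> * \<delta>) $$ (i, j) = (c \<cdot>\<^sub>m 1\<^sub>m (Suc q)) $$ (i, j)"
      using ij by (cases i) (auto simp: mult_var_left diff_var_index q_def c_def less_Suc_eq simp del: index_mult_mat(1))
  qed (simp_all add: d)
  hence 1: "(1 / c) \<cdot>\<^sub>m \<mu> * \<delta> = 1\<^sub>m (Suc q)" using c by (simp add: mult_smult_assoc_mat[OF cr(1,2)]) (rule eq_matI, auto)
  have "\<beta> * \<alpha> = c \<cdot>\<^sub>m 1\<^sub>m (Suc k)"
  proof (rule eq_matI)
    fix i j assume "i < dim_row (c \<cdot>\<^sub>m 1\<^sub>m (Suc k))" "j < dim_col (c \<cdot>\<^sub>m 1\<^sub>m (Suc k))"
    hence ij: "i < Suc k" "j < Suc k" by auto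
    have "(\<beta> * \<alpha>) $$ (i, j) = (diff_alt k 0 * mult_alt k 0) $$ (i, j) + (diff_alt k 1 * mult_alt k 1) $$ (i, j)"
      unfolding \<beta>_def \<alpha>_def using ij by (intro row_col) (simp_all add: q_def)
    thus "(\<beta> * \<alpha>) $$ (i, j) = (c \<cdot>\<^sub>m 1\<^sub>m (Suc k)) $$ (i, j)"
      using ij by (auto simp: alt_left alt_index c_def simp del: index_mult_mat(1))
  qed (simp_all add: d)
  hence 2: "(1 / c) \<cdot>\<^sub>m \<beta> * \<alpha> = 1\<^sub>m (Suc k)" using c by (simp add: mult_smult_assoc_mat[OF cr(4,3)]) (rule eq_matI, auto)
  have e: "(\<delta> * \<mu>) $$ (l, m) + (\<alpha> * \<beta>) $$ (l, m) = (if l = m then c else 0)" if lm: "l < 2 * q" "m < 2 * q" for l m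
  proof -
    note lm' = div_mod_less[OF lm(1)] div_mod_less[OF lm(2)]
    have eq: "l = m \<longleftrightarrow> l div q = m div q \<and> l mod q = m mod q" by (metis div_mult_mod_eq)
    \<comment> \<open>The commutation relations of variables and derivatives. For
      \<open>a = b\<close> the two products add up to the degree \<open>k + 1\<close> plus 1; for
      \<open>a \<noteq> b\<close> they cancel.\<close>
    have 1: "(diff_var (Suc k) a * mult_var (Suc k) b) $$ (i, j) + (mult_alt k a * diff_alt k b) $$ (i, j) = (if a = b \<and> i = j then c else 0)"
      if "a < 2" "b < 2" "i < q" "j < q" for a b i j
    proof -
      from that have ij: "i < Suc (Suc k)" "j < Suc (Suc k)" by (simp_all add: q_def)
      have ab: "a = 0 \<or> a = 1" "b = 0 \<or> b = 1" using that by auto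
      have D: "(diff_var (Suc k) a * mult_var (Suc k) b) $$ (i, j) = (if a = 0 then of_nat (Suc (Suc k)) - of_nat i else of_nat (Suc i)) * (if i + a = j + b then 1 else 0)"
        using ij that by (subst diff_var_left) (auto simp: mult_var_index)
      have M: "(mult_alt k a * diff_alt k b) $$ (i, j) = (if a = 0 then (if i > 0 then diff_alt k b $$ (i - 1, j) else 0) else (if i < Suc k then - diff_alt k b $$ (i, j) else 0))"
        using ij by (subst alt_left) auto
      show ?thesis
      proof (cases "i = Suc k")
        case True
        thus ?thesis unfolding D M using ab ij by (elim disjE) (auto simp: alt_index c_def)
      next
        case False
        hence i: "i < Suc k" using ij by simp
        show ?thesis
        proof (cases i)
          case 0
          show ?thesis unfolding D M unfolding 0 using ab ij(2) by (elim disjE) (auto simp: alt_index c_def)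
        next
          case (Suc i')
          have i': "i' < k" using i Suc by simp
          show ?thesis unfolding D M unfolding Suc using ab ij(2) i' by (elim disjE) (auto simp: alt_index c_def)
        qed
      qed
    qed
    have "(\<delta> * \<mu>) $$ (l, m) + (\<alpha> * \<beta>) $$ (l, m) =
      (diff_var (Suc k) (l div q) * mult_var (Suc k) (m div q)) $$ (l mod q, m mod q) + (mult_alt k (l div q) * diff_alt k (m div q)) $$ (l mod q, m mod q)"
      unfolding \<mu>_def \<delta>_def \<alpha>_def \<beta>_def by (subst (1 2) col_row) (use lm in \<open>simp_all add: q_def\<close>)
    thus ?thesis using 1 lm' eq by simp
  qed
  have "\<delta> * ((1 / c) \<cdot>\<^sub>m \<mu>) + \<alpha> * ((1 / c) \<cdot>\<^sub>m \<beta>) = 1\<^sub>m (2 * q)"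
    unfolding mult_smult_distrib[OF cr(2,1)] mult_smult_distrib[OF cr(3,4)]
    by (rule eq_matI) (use c e in \<open>auto simp: d add_divide_distrib[symmetric] simp del: index_mult_mat(1)\<close>)
  with hom 1 2 have "biprod sl2_cat ?S (simple_module (Suc (Suc k))) (simple_module k) (simple_module (Suc (Suc k)), ?S, \<delta>)
      (?S, simple_module (Suc (Suc k)), (1 / c) \<cdot>\<^sub>m \<mu>) (simple_module k, ?S, \<alpha>) (?S, simple_module k, (1 / c) \<cdot>\<^sub>m \<beta>)"
    by (intro biprod_sl2I) (simp_all add: q_def)
  thus ?thesis by blast
qed

text \<open>The invariant form on \<open>L1\<close> is antisymmetric, whence the sign in
  \<open>v\<close>: with the cup \<open>x \<otimes> y - y \<otimes> x\<close>, the cap has to send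
  \<open>x \<otimes> y\<close> to \<open>-1\<close> and \<open>y \<otimes> x\<close> to
  \<open>1\<close> for the snake identities to hold with sign \<open>+\<close>.\<close>

lemma cup_cap:
  obtains cup cap where "cup \<in> Hom sl2_cat trivial_module (tensor_module L1 L1)" "cap \<in> Hom sl2_cat (tensor_module L1 L1) trivial_module"
    "Comp sl2_cat (tens_arr sl2_cat cap (Ident sl2_cat L1)) (tens_arr sl2_cat (Ident sl2_cat L1) cup) = Ident sl2_cat L1"
    "Comp sl2_cat (tens_arr sl2_cat (Ident sl2_cat L1) cap) (tens_arr sl2_cat cup (Ident sl2_cat L1)) = Ident sl2_cat L1"
proof -
  define u where "u = col_map 2 1 (mult_alt 0)"
  define v where "v = (-1) \<cdot>\<^sub>m row_map 1 2 (diff_alt 0)"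
  have L: "simple_module (Suc 0) = L1" using simple_module_1 by simp
  have cup: "(trivial_module, tensor_module L1 L1, u) \<in> Hom sl2_cat trivial_module (tensor_module L1 L1)"
    using wedge_intertwiner[of 0] unfolding L simple_module_0 u_def by (simp add: numeral_2_eq_2)
  have cap: "(tensor_module L1 L1, trivial_module, v) \<in> Hom sl2_cat (tensor_module L1 L1) trivial_module"
    using sl2_scale[OF contraction_intertwiner[of 0], of "-1"] unfolding L simple_module_0 v_def by (simp add: numeral_2_eq_2)
  have uv: "u \<in> carrier_mat 4 1" "v \<in> carrier_mat 1 4" by (auto simp: u_def v_def)
  have ue: "u $$ (c, 0) = (if c = 1 then 1 else if c = 2 then -1 else 0)" if "c < 4" for c
  proof -
    from that consider "c = 0" | "c = 1" | "c = 2" | "c = 3" by linarith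
    thus ?thesis by cases (simp_all add: u_def col_map_def alt_index)
  qed
  have ve: "v $$ (0, c) = (if c = 1 then -1 else if c = 2 then 1 else 0)" if "c < 4" for c
  proof -
    from that consider "c = 0" | "c = 1" | "c = 2" | "c = 3" by linarith
    thus ?thesis by cases (simp_all add: v_def row_map_def alt_index)
  qed
  have d: "dim_row u = 4" "dim_col u = 1" "dim_row v = 1" "dim_col v = 4" using uv by auto
  have sum8: "(\<Sum>l = 0..<8. f l) = f 0 + f 1 + f 2 + f 3 + f 4 + f 5 + f 6 + f (7::nat)" for f :: "nat \<Rightarrow> complex"
    by (simp add: eval_nat_numeral)
  have "kron v (1\<^sub>m 2) * kron (1\<^sub>m 2) u = 1\<^sub>m 2"
  proof (rule eq_matI)
    fix i j assume "i < dim_row (1\<^sub>m 2 :: complex mat)" "j < dim_col (1\<^sub>m 2 :: complex mat)"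
    hence ij: "i = 0 \<or> i = 1" "j = 0 \<or> j = 1" by auto
    have "(kron v (1\<^sub>m 2) * kron (1\<^sub>m 2) u) $$ (i, j) = (\<Sum>l = 0..<8. kron v (1\<^sub>m 2) $$ (i, l) * kron (1\<^sub>m 2) u $$ (l, j))"
      using ij by (auto simp: scalar_prod_def d)
    thus "(kron v (1\<^sub>m 2) * kron (1\<^sub>m 2) u) $$ (i, j) = 1\<^sub>m 2 $$ (i, j)"
      unfolding sum8 using ij by (auto simp: kron_index d ue ve)
  qed (simp_all add: d)
  moreover have "kron (1\<^sub>m 2) v * kron u (1\<^sub>m 2) = 1\<^sub>m 2"
  proof (rule eq_matI)
    fix i j assume "i < dim_row (1\<^sub>m 2 :: complex mat)" "j < dim_col (1\<^sub>m 2 :: complex mat)"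
    hence ij: "i = 0 \<or> i = 1" "j = 0 \<or> j = 1" by auto
    have "(kron (1\<^sub>m 2) v * kron u (1\<^sub>m 2)) $$ (i, j) = (\<Sum>l = 0..<8. kron (1\<^sub>m 2) v $$ (i, l) * kron u (1\<^sub>m 2) $$ (l, j))"
      using ij by (auto simp: scalar_prod_def d)
    thus "(kron (1\<^sub>m 2) v * kron u (1\<^sub>m 2)) $$ (i, j) = 1\<^sub>m 2 $$ (i, j)"
      unfolding sum8 using ij by (auto simp: kron_index d ue ve)
  qed (simp_all add: d)
  ultimately show ?thesis using that[OF cup cap] L1_closed by simp
qed

section \<open>Fully faithful and essentially surjective functors\<close>

context linear_functor
begin

lemma Fo_obj [simp]: "X \<in> Obj M \<Longrightarrow> Fo X \<in> Obj N"
  by (rule obj)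

lemma Fa_arr [simp]: "f \<in> Arr M \<Longrightarrow> Fa f \<in> Arr N" "f \<in> Arr M \<Longrightarrow> Dom N (Fa f) = Fo (Dom M f)"
  "f \<in> Arr M \<Longrightarrow> Cod N (Fa f) = Fo (Cod M f)"
  using arr[of f "Dom M f" "Cod M f"] by (auto simp: in_Hom)

lemma Fa_ident [simp]: "X \<in> Obj M \<Longrightarrow> Fa (Ident M X) = Ident N (Fo X)"
  by (rule ident)

lemma Fa_comp [simp]: "f \<in> Arr M \<Longrightarrow> g \<in> Arr M \<Longrightarrow> Dom M g = Cod M f \<Longrightarrow> Fa (g \<cdot>\<^bsub>M\<^esub> f) = Fa g \<cdot>\<^bsub>N\<^esub> Fa f"
  by (rule comp[of _ "Dom M f" "Cod M f" _ "Cod M g"]) (auto simp: in_Hom)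

lemma Fa_plus [simp]: "f \<in> Arr M \<Longrightarrow> g \<in> Arr M \<Longrightarrow> Dom M f = Dom M g \<Longrightarrow> Cod M f = Cod M g \<Longrightarrow>
  Fa (f \<boxplus>\<^bsub>M\<^esub> g) = Fa f \<boxplus>\<^bsub>N\<^esub> Fa g"
  by (rule plus[of _ "Dom M f" "Cod M f"]) (auto simp: in_Hom)

lemma Fa_scale [simp]: "f \<in> Arr M \<Longrightarrow> Fa (Scale M c f) = Scale N c (Fa f)"
  by (rule scale[of _ "Dom M f" "Cod M f"]) (auto simp: in_Hom)

lemma Fa_null [simp]: "A \<in> Obj M \<Longrightarrow> B \<in> Obj M \<Longrightarrow> Fa (Null M A B) = Null N (Fo A) (Fo B)"
  using Fa_scale[of "Null M A B" 0] by simp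

lemma Fa_iso: "iso_arr M f \<Longrightarrow> iso_arr N (Fa f)"
  using Fa_comp[of f "inv_arr M f"] Fa_comp[of "inv_arr M f" f] M.dom_obj[of f] M.cod_obj[of f]
  by (intro iso_arrI[of _ _ "Fa (inv_arr M f)"]) (simp_all add: iso_arrD del: Fa_comp)

lemma Fa_biprod:
  assumes "biprod M S X Y i p i' p'"
  shows "biprod N (Fo S) (Fo X) (Fo Y) (Fa i) (Fa p) (Fa i') (Fa p')"
proof -
  note [simp] = M.biprodD(1-15)[OF assms]
  have "Fa p \<cdot>\<^bsub>N\<^esub> Fa i = Fa (p \<cdot>\<^bsub>M\<^esub> i)" "Fa p' \<cdot>\<^bsub>N\<^esub> Fa i' = Fa (p' \<cdot>\<^bsub>M\<^esub> i')"
    "(Fa i \<cdot>\<^bsub>N\<^esub> Fa p) \<boxplus>\<^bsub>N\<^esub> (Fa i' \<cdot>\<^bsub>N\<^esub> Fa p') = Fa ((i \<cdot>\<^bsub>M\<^esub> p) \<boxplus>\<^bsub>M\<^esub> (i' \<cdot>\<^bsub>M\<^esub> p'))" by simp_all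
  thus ?thesis unfolding M.biprodD(16-18)[OF assms] biprod_def by (simp add: in_Hom M.biprodD(16-17)[OF assms])
qed

text \<open>Full faithfulness at a single pair of objects, so that it can be extended along
  biproducts. By linearity, injectivity is tested at zero only.\<close>

definition ff :: "'o \<Rightarrow> 'o \<Rightarrow> bool" where
  "ff A B \<longleftrightarrow> (\<forall>f. f \<in> Hom M A B \<longrightarrow> Fa f = Null N (Fo A) (Fo B) \<longrightarrow> f = Null M A B) \<and>
    (\<forall>g. g \<in> Hom N (Fo A) (Fo B) \<longrightarrow> (\<exists>f. f \<in> Hom M A B \<and> Fa f = g))"

lemma ff_null: "ff A B \<Longrightarrow> f \<in> Arr M \<Longrightarrow> Dom M f = A \<Longrightarrow> Cod M f = B \<Longrightarrow> Fa f = Null N (Fo A) (Fo B) \<Longrightarrow> f = Null M A B"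
  by (simp add: ff_def in_Hom)

lemma ff_full:
  assumes "ff A B" "g \<in> Arr N" "Dom N g = Fo A" "Cod N g = Fo B"
  obtains f where "f \<in> Arr M" "Dom M f = A" "Cod M f = B" "Fa f = g"
  using assms by (auto simp: ff_def in_Hom)

lemma ff_inj:
  assumes "Fa f = Fa g" "ff A B" "f \<in> Arr M" "Dom M f = A" "Cod M f = B" "g \<in> Arr M" "Dom M g = A" "Cod M g = B"
  shows "f = g"
proof -
  have "Fa (f \<boxplus>\<^bsub>M\<^esub> Scale M (-1) g) = Fa g \<boxplus>\<^bsub>N\<^esub> Scale N (-1) (Fa g)" using assms(3-) by (simp add: assms(1))
  also have "\<dots> = Null N (Fo A) (Fo B)" using assms(3-) by simp
  finally have "f \<boxplus>\<^bsub>M\<^esub> Scale M (-1) g = Null M A B" using assms(2-) by (intro ff_null) auto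
  thus ?thesis unfolding M.minus_def[symmetric] by (rule M.minus_eq_null) (use assms(3-) in auto)
qed

lemma ffI:
  assumes "\<And>f. f \<in> Arr M \<Longrightarrow> Dom M f = A \<Longrightarrow> Cod M f = B \<Longrightarrow> Fa f = Null N (Fo A) (Fo B) \<Longrightarrow> f = Null M A B"
    "\<And>g. g \<in> Arr N \<Longrightarrow> Dom N g = Fo A \<Longrightarrow> Cod N g = Fo B \<Longrightarrow> \<exists>f. f \<in> Arr M \<and> Dom M f = A \<and> Cod M f = B \<and> Fa f = g"
  shows "ff A B"
  unfolding ff_def in_Hom using assms by blast

text \<open>A linear functor preserves biproducts, and a map out of a biproduct is a pair of maps
  out of the summands, on both sides of the functor.\<close>

lemma ff_sum_left:
  assumes b: "biprod M S X Y i p i' p'" and ff: "ff X B" "ff Y B" and [simp]: "B \<in> Obj M"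
  shows "ff S B"
proof (rule ffI)
  note [simp] = M.biprodD(1-15)[OF b]
  note Fb = Fa_biprod[OF b]
  fix f assume f [simp]: "f \<in> Arr M" "Dom M f = S" "Cod M f = B" and F: "Fa f = Null N (Fo S) (Fo B)"
  have "f \<cdot>\<^bsub>M\<^esub> i = Null M X B" "f \<cdot>\<^bsub>M\<^esub> i' = Null M Y B"
    by (rule ff_null[OF ff(1)] ff_null[OF ff(2)]; simp add: F)+
  moreover have "(f \<cdot>\<^bsub>M\<^esub> i) \<cdot>\<^bsub>M\<^esub> p \<boxplus>\<^bsub>M\<^esub> (f \<cdot>\<^bsub>M\<^esub> i') \<cdot>\<^bsub>M\<^esub> p' = f" using M.biprod_expand(2)[OF b, of f] by simp
  ultimately show "f = Null M S B" by simp
next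
  note [simp] = M.biprodD(1-15)[OF b]
  note Fb = Fa_biprod[OF b]
  note [simp] = N.biprodD(1-15)[OF Fb]
  fix g assume g [simp]: "g \<in> Arr N" "Dom N g = Fo S" "Cod N g = Fo B"
  obtain f where f [simp]: "f \<in> Arr M" "Dom M f = X" "Cod M f = B" "Fa f = g \<cdot>\<^bsub>N\<^esub> Fa i"
    using ff_full[OF ff(1), of "g \<cdot>\<^bsub>N\<^esub> Fa i"] by auto
  obtain f' where f' [simp]: "f' \<in> Arr M" "Dom M f' = Y" "Cod M f' = B" "Fa f' = g \<cdot>\<^bsub>N\<^esub> Fa i'"
    using ff_full[OF ff(2), of "g \<cdot>\<^bsub>N\<^esub> Fa i'"] by auto
  have "Fa (f \<cdot>\<^bsub>M\<^esub> p \<boxplus>\<^bsub>M\<^esub> f' \<cdot>\<^bsub>M\<^esub> p') = g" using N.biprod_expand(2)[OF Fb, of g] by simp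
  thus "\<exists>f. f \<in> Arr M \<and> Dom M f = S \<and> Cod M f = B \<and> Fa f = g" by (intro exI[of _ "f \<cdot>\<^bsub>M\<^esub> p \<boxplus>\<^bsub>M\<^esub> f' \<cdot>\<^bsub>M\<^esub> p'"]) simp
qed

lemma ff_sum_right:
  assumes b: "biprod M S X Y i p i' p'" and ff: "ff A X" "ff A Y" and [simp]: "A \<in> Obj M"
  shows "ff A S"
proof (rule ffI)
  note [simp] = M.biprodD(1-15)[OF b]
  fix f assume f [simp]: "f \<in> Arr M" "Dom M f = A" "Cod M f = S" and F: "Fa f = Null N (Fo A) (Fo S)"
  have "p \<cdot>\<^bsub>M\<^esub> f = Null M A X" "p' \<cdot>\<^bsub>M\<^esub> f = Null M A Y"
    by (rule ff_null[OF ff(1)] ff_null[OF ff(2)]; simp add: F)+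
  thus "f = Null M A S" using M.biprod_expand(1)[OF b, of f] by simp
next
  note [simp] = M.biprodD(1-15)[OF b]
  note Fb = Fa_biprod[OF b]
  note [simp] = N.biprodD(1-15)[OF Fb]
  fix g assume g [simp]: "g \<in> Arr N" "Dom N g = Fo A" "Cod N g = Fo S"
  obtain f where f [simp]: "f \<in> Arr M" "Dom M f = A" "Cod M f = X" "Fa f = Fa p \<cdot>\<^bsub>N\<^esub> g"
    using ff_full[OF ff(1), of "Fa p \<cdot>\<^bsub>N\<^esub> g"] by auto
  obtain f' where f' [simp]: "f' \<in> Arr M" "Dom M f' = A" "Cod M f' = Y" "Fa f' = Fa p' \<cdot>\<^bsub>N\<^esub> g"
    using ff_full[OF ff(2), of "Fa p' \<cdot>\<^bsub>N\<^esub> g"] by auto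
  have "Fa (i \<cdot>\<^bsub>M\<^esub> f \<boxplus>\<^bsub>M\<^esub> i' \<cdot>\<^bsub>M\<^esub> f') = g" using N.biprod_expand(1)[OF Fb, of g] by simp
  thus "\<exists>f. f \<in> Arr M \<and> Dom M f = A \<and> Cod M f = S \<and> Fa f = g" by (intro exI[of _ "i \<cdot>\<^bsub>M\<^esub> f \<boxplus>\<^bsub>M\<^esub> i' \<cdot>\<^bsub>M\<^esub> f'"]) simp
qed

lemma ff_zero:
  assumes "zero_object M Z" "A \<in> Obj M"
  shows "ff Z A" "ff A Z"
proof -
  have Z [simp]: "Z \<in> Obj M" and I: "Ident M Z = Null M Z Z" using assms by (auto simp: zero_object_def)
  have [simp]: "A \<in> Obj M" by fact
  have "Fa (Ident M Z) = Null N (Fo Z) (Fo Z)" unfolding I by simp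
  hence FI: "Ident N (Fo Z) = Null N (Fo Z) (Fo Z)" by simp
  have M0: "f = Null M Z (Cod M f)" if "f \<in> Arr M" "Dom M f = Z" for f
  proof -
    have "f = f \<cdot>\<^bsub>M\<^esub> Ident M Z" using that by simp
    also have "\<dots> = Null M Z (Cod M f)" unfolding I using that by simp
    finally show ?thesis .
  qed
  have M1: "f = Null M (Dom M f) Z" if "f \<in> Arr M" "Cod M f = Z" for f
  proof -
    have "f = Ident M Z \<cdot>\<^bsub>M\<^esub> f" using that by simp
    also have "\<dots> = Null M (Dom M f) Z" unfolding I using that by simp
    finally show ?thesis .
  qed
  have N0: "g = Null N (Fo Z) (Cod N g)" if "g \<in> Arr N" "Dom N g = Fo Z" for g
  proof -
    have "g = g \<cdot>\<^bsub>N\<^esub> Ident N (Fo Z)" using that by simp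
    also have "\<dots> = Null N (Fo Z) (Cod N g)" unfolding FI using that by simp
    finally show ?thesis .
  qed
  have N1: "g = Null N (Dom N g) (Fo Z)" if "g \<in> Arr N" "Cod N g = Fo Z" for g
  proof -
    have "g = Ident N (Fo Z) \<cdot>\<^bsub>N\<^esub> g" using that by simp
    also have "\<dots> = Null N (Dom N g) (Fo Z)" unfolding FI using that by simp
    finally show ?thesis .
  qed
  show "ff Z A"
  proof (rule ffI)
    show "f = Null M Z A" if "f \<in> Arr M" "Dom M f = Z" "Cod M f = A" for f using M0[OF that(1,2)] that(3) by metis
    show "\<exists>f. f \<in> Arr M \<and> Dom M f = Z \<and> Cod M f = A \<and> Fa f = g" if "g \<in> Arr N" "Dom N g = Fo Z" "Cod N g = Fo A" for g
      by (rule exI[of _ "Null M Z A"]) (use N0[OF that(1,2)] that(3) in simp)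
  qed
  show "ff A Z"
  proof (rule ffI)
    show "f = Null M A Z" if "f \<in> Arr M" "Dom M f = A" "Cod M f = Z" for f using M1[OF that(1,3)] that(2) by metis
    show "\<exists>f. f \<in> Arr M \<and> Dom M f = A \<and> Cod M f = Z \<and> Fa f = g" if "g \<in> Arr N" "Dom N g = Fo A" "Cod N g = Fo Z" for g
      by (rule exI[of _ "Null M A Z"]) (use N1[OF that(1,3)] that(2) in simp)
  qed
qed

lemma ff_lift_iso:
  assumes ff: "\<And>A B. A \<in> Obj M \<Longrightarrow> B \<in> Obj M \<Longrightarrow> ff A B" and [simp]: "A \<in> Obj M" "B \<in> Obj M"
    and g: "iso_arr N g" "Dom N g = Fo A" "Cod N g = Fo B"
  obtains f where "iso_arr M f" "Dom M f = A" "Cod M f = B" "Fa f = g"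
proof -
  note [simp] = iso_arrD[OF g(1)] g(2,3)
  obtain f where f [simp]: "f \<in> Arr M" "Dom M f = A" "Cod M f = B" "Fa f = g"
    using ff_full[OF ff, of A B g] by auto
  obtain f' where f' [simp]: "f' \<in> Arr M" "Dom M f' = B" "Cod M f' = A" "Fa f' = inv_arr N g"
    using ff_full[OF ff, of B A "inv_arr N g"] by auto
  have "f' \<cdot>\<^bsub>M\<^esub> f = Ident M A" by (rule ff_inj[OF _ ff]) simp_all
  moreover have "f \<cdot>\<^bsub>M\<^esub> f' = Ident M B" by (rule ff_inj[OF _ ff]) simp_all
  ultimately have "iso_arr M f" by (intro iso_arrI[of _ _ f']) simp_all
  thus ?thesis using that by simp
qed

text \<open>The comparison \<open>\<theta>\<close> from \<open>F (P Y)\<close> to \<open>Y\<close>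
  and its naturality are kept in the conclusion, because the module structure of the final
  equivalence is built from them.\<close>

lemma quasi_inverse:
  assumes ff: "\<And>A B. A \<in> Obj M \<Longrightarrow> B \<in> Obj M \<Longrightarrow> ff A B"
    and es: "\<And>Y. Y \<in> Obj N \<Longrightarrow> \<exists>X. X \<in> Obj M \<and> isomorphic N (Fo X) Y"
  obtains Po Pa \<theta> where "linear_functor N M Po Pa"
    "\<And>Y. Y \<in> Obj N \<Longrightarrow> iso_arr N (\<theta> Y)" "\<And>Y. Y \<in> Obj N \<Longrightarrow> Dom N (\<theta> Y) = Fo (Po Y)" "\<And>Y. Y \<in> Obj N \<Longrightarrow> Cod N (\<theta> Y) = Y"
    "\<And>g. g \<in> Arr N \<Longrightarrow> \<theta> (Cod N g) \<cdot>\<^bsub>N\<^esub> Fa (Pa g) = g \<cdot>\<^bsub>N\<^esub> \<theta> (Dom N g)"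
proof -
  have "\<forall>Y. \<exists>X t. Y \<in> Obj N \<longrightarrow> X \<in> Obj M \<and> iso_arr N t \<and> Dom N t = Fo X \<and> Cod N t = Y"
    using es unfolding isomorphic_def iso_in_iff by blast
  then obtain Po \<theta> where P0: "\<forall>Y. Y \<in> Obj N \<longrightarrow> Po Y \<in> Obj M \<and> iso_arr N (\<theta> Y) \<and> Dom N (\<theta> Y) = Fo (Po Y) \<and> Cod N (\<theta> Y) = Y"
    by metis
  hence Po [simp]: "Po Y \<in> Obj M" and \<theta>: "iso_arr N (\<theta> Y)" and [simp]: "Dom N (\<theta> Y) = Fo (Po Y)" "Cod N (\<theta> Y) = Y"
    if "Y \<in> Obj N" for Y using that by auto
  have [simp]: "\<theta> Y \<in> Arr N" "inv_arr N (\<theta> Y) \<in> Arr N" "Dom N (inv_arr N (\<theta> Y)) = Y" "Cod N (inv_arr N (\<theta> Y)) = Fo (Po Y)"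
    "\<theta> Y \<cdot>\<^bsub>N\<^esub> inv_arr N (\<theta> Y) = Ident N Y" "inv_arr N (\<theta> Y) \<cdot>\<^bsub>N\<^esub> \<theta> Y = Ident N (Fo (Po Y))" if "Y \<in> Obj N" for Y
    using iso_arrD[OF \<theta>[OF that]] that by simp_all
  have "\<forall>g. \<exists>f. g \<in> Arr N \<longrightarrow> f \<in> Arr M \<and> Dom M f = Po (Dom N g) \<and> Cod M f = Po (Cod N g) \<and>
    Fa f = inv_arr N (\<theta> (Cod N g)) \<cdot>\<^bsub>N\<^esub> (g \<cdot>\<^bsub>N\<^esub> \<theta> (Dom N g))"
  proof
    fix g show "\<exists>f. g \<in> Arr N \<longrightarrow> f \<in> Arr M \<and> Dom M f = Po (Dom N g) \<and> Cod M f = Po (Cod N g) \<and>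
      Fa f = inv_arr N (\<theta> (Cod N g)) \<cdot>\<^bsub>N\<^esub> (g \<cdot>\<^bsub>N\<^esub> \<theta> (Dom N g))"
    proof (cases "g \<in> Arr N")
      case True
      have "ff (Po (Dom N g)) (Po (Cod N g))" using True by (intro ff) simp_all
      from ff_full[OF this, of "inv_arr N (\<theta> (Cod N g)) \<cdot>\<^bsub>N\<^esub> (g \<cdot>\<^bsub>N\<^esub> \<theta> (Dom N g))"] True show ?thesis by auto
    qed simp
  qed
  from choice[OF this] obtain Pa where Pa: "\<forall>g. g \<in> Arr N \<longrightarrow> Pa g \<in> Arr M \<and> Dom M (Pa g) = Po (Dom N g) \<and> Cod M (Pa g) = Po (Cod N g) \<and>
    Fa (Pa g) = inv_arr N (\<theta> (Cod N g)) \<cdot>\<^bsub>N\<^esub> (g \<cdot>\<^bsub>N\<^esub> \<theta> (Dom N g))" by blast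
  have Pa_arr [simp]: "Pa g \<in> Arr M" "Dom M (Pa g) = Po (Dom N g)" "Cod M (Pa g) = Po (Cod N g)"
    and FP: "Fa (Pa g) = inv_arr N (\<theta> (Cod N g)) \<cdot>\<^bsub>N\<^esub> (g \<cdot>\<^bsub>N\<^esub> \<theta> (Dom N g))" if "g \<in> Arr N" for g using Pa that by auto
  \<comment> \<open>Faithfulness reduces each functor law of \<open>Pa\<close> to an identity
    between images, where \<open>Pa g\<close> is conjugation of \<open>g\<close> by
    \<open>\<theta>\<close>.\<close>
  have uniq: "Pa g = f" if "Fa (Pa g) = Fa f" "g \<in> Arr N" "f \<in> Arr M" "Dom M f = Po (Dom N g)" "Cod M f = Po (Cod N g)" for f g
    by (rule ff_inj[OF that(1) ff]) (use that(2-) in simp_all)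
  have inv1: "\<theta> Y \<cdot>\<^bsub>N\<^esub> (inv_arr N (\<theta> Y) \<cdot>\<^bsub>N\<^esub> h) = h" if "Y \<in> Obj N" "h \<in> Arr N" "Cod N h = Y" for Y h
    using N.inv_reassoc(2)[OF \<theta>[OF that(1)] that(2)] that by simp
  show ?thesis
  proof (rule that)
    show "linear_functor N M Po Pa"
    proof
      fix f g X Y Z c
      show "X \<in> Obj N \<Longrightarrow> Po X \<in> Obj M" by simp
      show "f \<in> Hom N X Y \<Longrightarrow> Pa f \<in> Hom M (Po X) (Po Y)" by (auto simp: in_Hom)
      show "X \<in> Obj N \<Longrightarrow> Pa (Ident N X) = Ident M (Po X)"
        by (rule uniq) (simp_all add: FP)
      show "Pa (g \<cdot>\<^bsub>N\<^esub> f) = Pa g \<cdot>\<^bsub>M\<^esub> Pa f" if "f \<in> Hom N X Y" "g \<in> Hom N Y Z"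
        by (rule uniq) (use that in \<open>auto simp: FP in_Hom inv1\<close>)
      show "Pa (f \<boxplus>\<^bsub>N\<^esub> g) = Pa f \<boxplus>\<^bsub>M\<^esub> Pa g" if "f \<in> Hom N X Y" "g \<in> Hom N X Y"
        by (rule uniq) (use that in \<open>auto simp: FP in_Hom\<close>)
      show "Pa (Scale N c f) = Scale M c (Pa f)" if "f \<in> Hom N X Y"
        by (rule uniq) (use that in \<open>auto simp: FP in_Hom\<close>)
    qed
    show "iso_arr N (\<theta> Y)" "Dom N (\<theta> Y) = Fo (Po Y)" "Cod N (\<theta> Y) = Y" if "Y \<in> Obj N" for Y
      using that by (auto intro: \<theta>)
    show "\<theta> (Cod N g) \<cdot>\<^bsub>N\<^esub> Fa (Pa g) = g \<cdot>\<^bsub>N\<^esub> \<theta> (Dom N g)" if "g \<in> Arr N" for g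
      using that by (simp add: FP inv1)
  qed
qed

text \<open>The naturality isomorphism on the side of \<open>M\<close> is the lift of
  \<open>\<theta> (Fo X)\<close> along full faithfulness; its naturality is checked after applying
  the functor.\<close>

lemma equivalence:
  assumes ff: "\<And>A B. A \<in> Obj M \<Longrightarrow> B \<in> Obj M \<Longrightarrow> ff A B"
    and es: "\<And>Y. Y \<in> Obj N \<Longrightarrow> \<exists>X. X \<in> Obj M \<and> isomorphic N (Fo X) Y"
  shows "equivalence_functor M N Fo Fa"
proof -
  obtain Po Pa \<theta> where P: "linear_functor N M Po Pa"
    and \<theta>: "\<And>Y. Y \<in> Obj N \<Longrightarrow> iso_arr N (\<theta> Y)" "\<And>Y. Y \<in> Obj N \<Longrightarrow> Dom N (\<theta> Y) = Fo (Po Y)" "\<And>Y. Y \<in> Obj N \<Longrightarrow> Cod N (\<theta> Y) = Y"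
    and nat: "\<And>g. g \<in> Arr N \<Longrightarrow> \<theta> (Cod N g) \<cdot>\<^bsub>N\<^esub> Fa (Pa g) = g \<cdot>\<^bsub>N\<^esub> \<theta> (Dom N g)"
    using quasi_inverse[OF ff es] by blast
  interpret P: linear_functor N M Po Pa by (rule P)
  have "naturally_isomorphic N N (Fo \<circ> Po) (Fa \<circ> Pa) id id"
    unfolding naturally_isomorphic_def iso_in_iff using \<theta> nat by (intro exI[of _ \<theta>]) (auto simp: in_Hom)
  moreover have "\<forall>X. \<exists>t. X \<in> Obj M \<longrightarrow> iso_arr M t \<and> Dom M t = Po (Fo X) \<and> Cod M t = X \<and> Fa t = \<theta> (Fo X)"
  proof
    fix X show "\<exists>t. X \<in> Obj M \<longrightarrow> iso_arr M t \<and> Dom M t = Po (Fo X) \<and> Cod M t = X \<and> Fa t = \<theta> (Fo X)"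
    proof (cases "X \<in> Obj M")
      case True
      from ff_lift_iso[OF ff, of "Po (Fo X)" X "\<theta> (Fo X)"] True \<theta>[of "Fo X"] show ?thesis by auto
    qed simp
  qed
  then obtain \<tau> where \<tau>: "\<And>X. X \<in> Obj M \<Longrightarrow> iso_arr M (\<tau> X) \<and> Dom M (\<tau> X) = Po (Fo X) \<and> Cod M (\<tau> X) = X \<and> Fa (\<tau> X) = \<theta> (Fo X)"
    by metis
  have "\<tau> (Cod M f) \<cdot>\<^bsub>M\<^esub> Pa (Fa f) = f \<cdot>\<^bsub>M\<^esub> \<tau> (Dom M f)" if f [simp]: "f \<in> Arr M" for f
  proof (rule ff_inj[OF _ ff])
    note t = \<tau>[OF M.dom_obj[OF f]] \<tau>[OF M.cod_obj[OF f]]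
    note [simp] = t iso_arrD(1)[OF conjunct1[OF t(1)]] iso_arrD(1)[OF conjunct1[OF t(2)]]
    show "Fa (\<tau> (Cod M f) \<cdot>\<^bsub>M\<^esub> Pa (Fa f)) = Fa (f \<cdot>\<^bsub>M\<^esub> \<tau> (Dom M f))" using nat[of "Fa f"] by simp
    show "\<tau> (Cod M f) \<cdot>\<^bsub>M\<^esub> Pa (Fa f) \<in> Arr M" "Dom M (\<tau> (Cod M f) \<cdot>\<^bsub>M\<^esub> Pa (Fa f)) = Po (Fo (Dom M f))"
      "Cod M (\<tau> (Cod M f) \<cdot>\<^bsub>M\<^esub> Pa (Fa f)) = Cod M f" "f \<cdot>\<^bsub>M\<^esub> \<tau> (Dom M f) \<in> Arr M"
      "Dom M (f \<cdot>\<^bsub>M\<^esub> \<tau> (Dom M f)) = Po (Fo (Dom M f))" "Cod M (f \<cdot>\<^bsub>M\<^esub> \<tau> (Dom M f)) = Cod M f" by simp_all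
  qed simp_all
  hence "naturally_isomorphic M M (Po \<circ> Fo) (Pa \<circ> Fa) id id"
    unfolding naturally_isomorphic_def iso_in_iff using \<tau> by (intro exI[of _ \<tau>]) (auto simp: in_Hom)
  ultimately show ?thesis unfolding equivalence_functor_def using P linear_functor_axioms by blast
qed

text \<open>Conjugation with \<open>\<theta>\<close> identifies the functor after its quasi-inverse
  with the identity, so full faithfulness passes to the quasi-inverse. In this form it can be
  composed with another fully faithful functor.\<close>

lemma quasi_inverse_ff:
  assumes ff: "\<And>A B. A \<in> Obj M \<Longrightarrow> B \<in> Obj M \<Longrightarrow> ff A B"
    and P: "linear_functor N M Po Pa"
    and \<theta>: "\<And>Y. Y \<in> Obj N \<Longrightarrow> iso_arr N (\<theta> Y)" "\<And>Y. Y \<in> Obj N \<Longrightarrow> Dom N (\<theta> Y) = Fo (Po Y)" "\<And>Y. Y \<in> Obj N \<Longrightarrow> Cod N (\<theta> Y) = Y"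
    and nat: "\<And>g. g \<in> Arr N \<Longrightarrow> \<theta> (Cod N g) \<cdot>\<^bsub>N\<^esub> Fa (Pa g) = g \<cdot>\<^bsub>N\<^esub> \<theta> (Dom N g)"
  shows "Y \<in> Obj N \<Longrightarrow> Z \<in> Obj N \<Longrightarrow> linear_functor.ff N M Po Pa Y Z"
    "A \<in> Obj M \<Longrightarrow> \<exists>Y. Y \<in> Obj N \<and> isomorphic M (Po Y) A"
proof -
  interpret P: linear_functor N M Po Pa by (rule P)
  assume YZ [simp]: "Y \<in> Obj N" "Z \<in> Obj N"
  note t = iso_arrD[OF \<theta>(1)[OF YZ(1)]] \<theta>(2,3)[OF YZ(1)] iso_arrD[OF \<theta>(1)[OF YZ(2)]] \<theta>(2,3)[OF YZ(2)]
  note [simp] = t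
  show "P.ff Y Z"
  proof (rule P.ffI)
    fix g assume g [simp]: "g \<in> Arr N" "Dom N g = Y" "Cod N g = Z" and 0: "Pa g = Null M (Po Y) (Po Z)"
    have "g \<cdot>\<^bsub>N\<^esub> \<theta> Y = Null N Y Z \<cdot>\<^bsub>N\<^esub> \<theta> Y" using nat[OF g(1)] 0 by simp
    thus "g = Null N Y Z" by (rule N.iso_cancelR[OF _ \<theta>(1)]) simp_all
  next
    fix f assume f [simp]: "f \<in> Arr M" "Dom M f = Po Y" "Cod M f = Po Z"
    define g where "g = \<theta> Z \<cdot>\<^bsub>N\<^esub> (Fa f \<cdot>\<^bsub>N\<^esub> inv_arr N (\<theta> Y))"
    have g [simp]: "g \<in> Arr N" "Dom N g = Y" "Cod N g = Z" by (simp_all add: g_def)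
    have "\<theta> Z \<cdot>\<^bsub>N\<^esub> Fa (Pa g) = g \<cdot>\<^bsub>N\<^esub> \<theta> Y" using nat[OF g(1)] by simp
    also have "\<dots> = \<theta> Z \<cdot>\<^bsub>N\<^esub> Fa f" by (simp add: g_def)
    finally have "Fa (Pa g) = Fa f" by (rule N.iso_cancelL[OF _ \<theta>(1)]) simp_all
    hence "Pa g = f" by (rule ff_inj[OF _ ff]) simp_all
    thus "\<exists>g. g \<in> Arr N \<and> Dom N g = Y \<and> Cod N g = Z \<and> Pa g = f" by (intro exI[of _ g]) simp
  qed
next
  interpret P: linear_functor N M Po Pa by (rule P)
  assume A: "A \<in> Obj M"
  from ff_lift_iso[OF ff, of "Po (Fo A)" A "\<theta> (Fo A)"] A \<theta>[of "Fo A"]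
  obtain f where "iso_arr M f" "Dom M f = Po (Fo A)" "Cod M f = A" by auto
  thus "\<exists>Y. Y \<in> Obj N \<and> isomorphic M (Po Y) A" using A unfolding isomorphic_def iso_in_iff by (intro exI[of _ "Fo A"]) auto
qed

end

lemma linear_functor_comp:
  assumes "linear_functor M N Fo Fa" "linear_functor N K Go Ga"
  shows "linear_functor M K (Go \<circ> Fo) (Ga \<circ> Fa)"
proof -
  interpret F: linear_functor M N Fo Fa by fact
  interpret G: linear_functor N K Go Ga by fact
  show ?thesis by unfold_locales (auto simp: in_Hom)
qed

lemma ff_comp:
  assumes F: "linear_functor M N Fo Fa" and G: "linear_functor N K Go Ga"
    and "linear_functor.ff M N Fo Fa A B" "linear_functor.ff N K Go Ga (Fo A) (Fo B)" "A \<in> Obj M" "B \<in> Obj M"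
  shows "linear_functor.ff M K (Go \<circ> Fo) (Ga \<circ> Fa) A B"
proof -
  interpret F: linear_functor M N Fo Fa by fact
  interpret G: linear_functor N K Go Ga by fact
  interpret GF: linear_functor M K "Go \<circ> Fo" "Ga \<circ> Fa" by (rule linear_functor_comp[OF F G])
  show ?thesis
  proof (rule GF.ffI)
    fix f assume "f \<in> Arr M" "Dom M f = A" "Cod M f = B" "(Ga \<circ> Fa) f = Null K ((Go \<circ> Fo) A) ((Go \<circ> Fo) B)"
    thus "f = Null M A B" using F.ff_null[OF assms(3)] G.ff_null[OF assms(4), of "Fa f"] by simp
  next
    fix g assume "g \<in> Arr K" "Dom K g = (Go \<circ> Fo) A" "Cod K g = (Go \<circ> Fo) B"
    then obtain h where "h \<in> Arr N" "Dom N h = Fo A" "Cod N h = Fo B" "Ga h = g" using G.ff_full[OF assms(4), of g] by auto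
    then obtain f where "f \<in> Arr M" "Dom M f = A" "Cod M f = B" "Fa f = h" using F.ff_full[OF assms(3), of h] by auto
    with \<open>Ga h = g\<close> show "\<exists>f. f \<in> Arr M \<and> Dom M f = A \<and> Cod M f = B \<and> (Ga \<circ> Fa) f = g" by auto
  qed
qed

section \<open>Actions of a strict monoidal category\<close>

text \<open>The Kronecker product makes the modules into such a category. Associators of
  \<open>C\<close> thereby disappear from the pentagon, and only the constraints of the module
  categories remain.\<close>

locale strict_monoidal = linear_monoidal_category C
  for C :: "('v, 'c, 'y) moncat_scheme" (structure) +
  assumes tens_assoc: "U \<in> Obj C \<Longrightarrow> V \<in> Obj C \<Longrightarrow> W \<in> Obj C \<Longrightarrow> (U \<otimes>\<^sub>o V) \<otimes>\<^sub>o W = U \<otimes>\<^sub>o (V \<otimes>\<^sub>o W)"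
    and tens_unit_left: "V \<in> Obj C \<Longrightarrow> tens_unit C \<otimes>\<^sub>o V = V"
    and tens_unit_right: "V \<in> Obj C \<Longrightarrow> V \<otimes>\<^sub>o tens_unit C = V"
    and associator_strict: "U \<in> Obj C \<Longrightarrow> V \<in> Obj C \<Longrightarrow> W \<in> Obj C \<Longrightarrow> associator C U V W = Ident C (U \<otimes>\<^sub>o (V \<otimes>\<^sub>o W))"
    and runit_strict: "V \<in> Obj C \<Longrightarrow> runit C V = Ident C V"

locale strict_action = C: strict_monoidal C + module_category C M
  for C :: "('v, 'c, 'y) moncat_scheme"
    and M :: "('v, 'c, 'o, 'a, 'z) modcat_scheme" (structure)
begin

declare C.unit_obj [simp] C.tens_obj [simp] act_obj [simp] act_ident [simp] C.tens_ident [simp]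
  C.tens_unit_left [simp] C.tens_unit_right [simp] C.tens_assoc [simp]

lemma tens_arr' [simp]:
  "f \<in> Arr C \<Longrightarrow> g \<in> Arr C \<Longrightarrow> f \<otimes>\<^sub>a\<^bsub>C\<^esub> g \<in> Arr C"
  "f \<in> Arr C \<Longrightarrow> g \<in> Arr C \<Longrightarrow> Dom C (f \<otimes>\<^sub>a\<^bsub>C\<^esub> g) = Dom C f \<otimes>\<^sub>o\<^bsub>C\<^esub> Dom C g"
  "f \<in> Arr C \<Longrightarrow> g \<in> Arr C \<Longrightarrow> Cod C (f \<otimes>\<^sub>a\<^bsub>C\<^esub> g) = Cod C f \<otimes>\<^sub>o\<^bsub>C\<^esub> Cod C g"
  using C.tens_arr[of f "Dom C f" "Cod C f" g "Dom C g" "Cod C g"] by (auto simp: in_Hom)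

lemma act_arr' [simp]:
  "f \<in> Arr C \<Longrightarrow> g \<in> Arr M \<Longrightarrow> f \<star>\<^sub>a g \<in> Arr M"
  "f \<in> Arr C \<Longrightarrow> g \<in> Arr M \<Longrightarrow> Dom M (f \<star>\<^sub>a g) = Dom C f \<star>\<^sub>o Dom M g"
  "f \<in> Arr C \<Longrightarrow> g \<in> Arr M \<Longrightarrow> Cod M (f \<star>\<^sub>a g) = Cod C f \<star>\<^sub>o Cod M g"
  using act_arr[of f "Dom C f" "Cod C f" g "Dom M g" "Cod M g"] by (auto simp: in_Hom)

lemma interchange:
  assumes "f \<in> Arr C" "f' \<in> Arr C" "Dom C f' = Cod C f" "g \<in> Arr M" "g' \<in> Arr M" "Dom M g' = Cod M g"
  shows "(f' \<star>\<^sub>a g') \<cdot> (f \<star>\<^sub>a g) = (f' \<cdot>\<^bsub>C\<^esub> f) \<star>\<^sub>a (g' \<cdot> g)"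
  using act_comp[of f "Dom C f" "Cod C f" f' "Cod C f'" g "Dom M g" "Cod M g" g' "Cod M g'"] assms by (simp add: in_Hom)

lemma act_left_comp [simp]:
  assumes "V \<in> Obj C" "g \<in> Arr M" "g' \<in> Arr M" "Dom M g' = Cod M g"
  shows "Ident C V \<star>\<^sub>a (g' \<cdot> g) = (Ident C V \<star>\<^sub>a g') \<cdot> (Ident C V \<star>\<^sub>a g)"
  using assms by (subst interchange) simp_all

lemma act_right_comp [simp]:
  assumes "X \<in> Obj M" "f \<in> Arr C" "f' \<in> Arr C" "Dom C f' = Cod C f"
  shows "(f' \<cdot>\<^bsub>C\<^esub> f) \<star>\<^sub>a Ident M X = (f' \<star>\<^sub>a Ident M X) \<cdot> (f \<star>\<^sub>a Ident M X)"
  using assms by (subst interchange) simp_all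

lemma act_plus' [simp]:
  "f \<in> Arr C \<Longrightarrow> f' \<in> Arr C \<Longrightarrow> Dom C f = Dom C f' \<Longrightarrow> Cod C f = Cod C f' \<Longrightarrow> g \<in> Arr M \<Longrightarrow>
    (f \<boxplus>\<^bsub>C\<^esub> f') \<star>\<^sub>a g = (f \<star>\<^sub>a g) \<boxplus> (f' \<star>\<^sub>a g)"
  "f \<in> Arr C \<Longrightarrow> g \<in> Arr M \<Longrightarrow> g' \<in> Arr M \<Longrightarrow> Dom M g = Dom M g' \<Longrightarrow> Cod M g = Cod M g' \<Longrightarrow>
    f \<star>\<^sub>a (g \<boxplus> g') = (f \<star>\<^sub>a g) \<boxplus> (f \<star>\<^sub>a g')"
  using act_plus_left[of f "Dom C f'" "Cod C f'" f' g "Dom M g" "Cod M g"]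
    act_plus_right[of f "Dom C f" "Cod C f" g "Dom M g'" "Cod M g'" g'] by (auto simp: in_Hom)

lemma act_scale' [simp]:
  "f \<in> Arr C \<Longrightarrow> g \<in> Arr M \<Longrightarrow> Scale C c f \<star>\<^sub>a g = Scale M c (f \<star>\<^sub>a g)"
  "f \<in> Arr C \<Longrightarrow> g \<in> Arr M \<Longrightarrow> f \<star>\<^sub>a Scale M c g = Scale M c (f \<star>\<^sub>a g)"
  using act_scale_left[of f "Dom C f" "Cod C f" g "Dom M g" "Cod M g"]
    act_scale_right[of f "Dom C f" "Cod C f" g "Dom M g" "Cod M g"] by (auto simp: in_Hom)

lemma act_null [simp]:
  "V \<in> Obj C \<Longrightarrow> W \<in> Obj C \<Longrightarrow> g \<in> Arr M \<Longrightarrow> Null C V W \<star>\<^sub>a g = Null M (V \<star>\<^sub>o Dom M g) (W \<star>\<^sub>o Cod M g)"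
  using act_scale'(1)[of "Null C V W" g 0] by (simp del: act_scale')

lemma iso_act: 
  assumes f: "iso_arr C f" and g: "iso_arr M g"
  shows "iso_arr M (f \<star>\<^sub>a g)"
  using iso_arrD[OF f] iso_arrD[OF g] C.dom_obj[of f] C.cod_obj[of f] M.dom_obj[of g] M.cod_obj[of g]
  by (intro iso_arrI[of _ _ "inv_arr C f \<star>\<^sub>a inv_arr M g"]) (simp_all add: interchange)

lemma assoc_iso:
  assumes "V \<in> Obj C" "W \<in> Obj C" "X \<in> Obj M"
  shows "iso_arr M (act_assoc M V W X)" "act_assoc M V W X \<in> Arr M"
    "Dom M (act_assoc M V W X) = (V \<otimes>\<^sub>o\<^bsub>C\<^esub> W) \<star>\<^sub>o X" "Cod M (act_assoc M V W X) = V \<star>\<^sub>o (W \<star>\<^sub>o X)"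
    "inv_arr M (act_assoc M V W X) \<in> Arr M"
    "Cod M (inv_arr M (act_assoc M V W X)) = (V \<otimes>\<^sub>o\<^bsub>C\<^esub> W) \<star>\<^sub>o X" "Dom M (inv_arr M (act_assoc M V W X)) = V \<star>\<^sub>o (W \<star>\<^sub>o X)"
  using act_assoc_iso[OF assms] iso_arrD[of M "act_assoc M V W X"] unfolding iso_in_iff by auto

lemma unit_iso:
  assumes "X \<in> Obj M"
  shows "iso_arr M (act_unit M X)" "act_unit M X \<in> Arr M" "Dom M (act_unit M X) = tens_unit C \<star>\<^sub>o X" "Cod M (act_unit M X) = X"
    "inv_arr M (act_unit M X) \<in> Arr M" "Cod M (inv_arr M (act_unit M X)) = tens_unit C \<star>\<^sub>o X" "Dom M (inv_arr M (act_unit M X)) = X"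
  using act_unit_iso[OF assms] iso_arrD[of M "act_unit M X"] unfolding iso_in_iff by auto

declare assoc_iso [simp] unit_iso [simp]

lemma assoc_natural:
  assumes "f \<in> Arr C" "f' \<in> Arr C" "g \<in> Arr M"
  shows "act_assoc M (Cod C f) (Cod C f') (Cod M g) \<cdot> ((f \<otimes>\<^sub>a\<^bsub>C\<^esub> f') \<star>\<^sub>a g) =
    (f \<star>\<^sub>a (f' \<star>\<^sub>a g)) \<cdot> act_assoc M (Dom C f) (Dom C f') (Dom M g)"
  using assms by (intro act_assoc_natural) (auto simp: in_Hom)

lemma assoc_natural_inv:
  assumes [simp]: "f \<in> Arr C" "f' \<in> Arr C" "g \<in> Arr M"
  shows "((f \<otimes>\<^sub>a\<^bsub>C\<^esub> f') \<star>\<^sub>a g) \<cdot> inv_arr M (act_assoc M (Dom C f) (Dom C f') (Dom M g)) =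
    inv_arr M (act_assoc M (Cod C f) (Cod C f') (Cod M g)) \<cdot> (f \<star>\<^sub>a (f' \<star>\<^sub>a g))"
    (is "?F \<cdot> inv_arr M ?a = inv_arr M ?b \<cdot> ?G")
proof (rule M.iso_cancelL)
  have "(?b \<cdot> ?F) \<cdot> inv_arr M ?a = ?G" unfolding assoc_natural[OF assms]
    by (simp add: iso_arrD(6))
  thus "?b \<cdot> (?F \<cdot> inv_arr M ?a) = ?b \<cdot> (inv_arr M ?b \<cdot> ?G)" by simp
qed simp_all

lemma unit_natural:
  assumes "g \<in> Arr M"
  shows "act_unit M (Cod M g) \<cdot> (Ident C (tens_unit C) \<star>\<^sub>a g) = g \<cdot> act_unit M (Dom M g)"
  using assms by (intro act_unit_natural) (auto simp: in_Hom)

lemma unit_natural_inv: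
  assumes [simp]: "g \<in> Arr M"
  shows "(Ident C (tens_unit C) \<star>\<^sub>a g) \<cdot> inv_arr M (act_unit M (Dom M g)) = inv_arr M (act_unit M (Cod M g)) \<cdot> g"
    (is "?F \<cdot> inv_arr M ?a = inv_arr M ?b \<cdot> g")
proof (rule M.iso_cancelL)
  have "(?b \<cdot> ?F) \<cdot> inv_arr M ?a = g" unfolding unit_natural[OF assms] by (simp add: iso_arrD(6))
  thus "?b \<cdot> (?F \<cdot> inv_arr M ?a) = ?b \<cdot> (inv_arr M ?b \<cdot> g)" by simp
qed simp_all

lemma pentagon:
  assumes [simp]: "U \<in> Obj C" "V \<in> Obj C" "W \<in> Obj C" "X \<in> Obj M"
  shows "act_assoc M U V (W \<star>\<^sub>o X) \<cdot> act_assoc M (U \<otimes>\<^sub>o\<^bsub>C\<^esub> V) W X =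
    (Ident C U \<star>\<^sub>a act_assoc M V W X) \<cdot> act_assoc M U (V \<otimes>\<^sub>o\<^bsub>C\<^esub> W) X"
proof -
  have "associator C U V W \<star>\<^sub>a Ident M X = Ident M ((U \<otimes>\<^sub>o\<^bsub>C\<^esub> (V \<otimes>\<^sub>o\<^bsub>C\<^esub> W)) \<star>\<^sub>o X)"
    by (simp add: C.associator_strict)
  thus ?thesis using act_pentagon[OF assms] by simp
qed

lemma unit_right:
  assumes [simp]: "V \<in> Obj C" "X \<in> Obj M"
  shows "(Ident C V \<star>\<^sub>a act_unit M X) \<cdot> act_assoc M V (tens_unit C) X = Ident M (V \<star>\<^sub>o X)"
  using act_triangle[OF assms] by (simp add: C.runit_strict)

text \<open>By naturality \<open>f\<close> is conjugate to the action of the tensor unit on it under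
  the invertible arrows \<open>act_unit\<close>.\<close>

lemma unit_faithful:
  assumes "Ident C (tens_unit C) \<star>\<^sub>a f = Ident C (tens_unit C) \<star>\<^sub>a g"
    "f \<in> Arr M" "g \<in> Arr M" "Dom M f = Dom M g" "Cod M f = Cod M g"
  shows "f = g"
proof (rule M.iso_cancelR)
  show "f \<cdot> act_unit M (Dom M g) = g \<cdot> act_unit M (Dom M g)"
    using unit_natural[of f] unit_natural[of g] assms by metis
qed (use assms in simp_all)

text \<open>The other unit coherence follows from the pentagon and the triangle, as in any monoidal category.\<close>

lemma unit_left:
  assumes [simp]: "V \<in> Obj C" "X \<in> Obj M"
  shows "act_unit M (V \<star>\<^sub>o X) \<cdot> act_assoc M (tens_unit C) V X = Ident M (V \<star>\<^sub>o X)"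
proof (rule unit_faithful)
  let ?I = "tens_unit C" and ?a = "act_assoc M (tens_unit C) V X"
  have "act_assoc M ?I ?I (V \<star>\<^sub>o X) \<cdot> ?a = (Ident C ?I \<star>\<^sub>a ?a) \<cdot> ?a"
    using pentagon[of ?I ?I V X] by simp
  hence "act_assoc M ?I ?I (V \<star>\<^sub>o X) = Ident C ?I \<star>\<^sub>a ?a"
    by (rule M.iso_cancelR) simp_all
  with unit_right[of ?I "V \<star>\<^sub>o X"]
  show "Ident C ?I \<star>\<^sub>a (act_unit M (V \<star>\<^sub>o X) \<cdot> ?a) = Ident C ?I \<star>\<^sub>a Ident M (V \<star>\<^sub>o X)" by simp
qed simp_all

end

section \<open>A self-dual object acts by a self-adjoint functor\<close>

locale self_dual_action = strict_action C M
  for C :: "('v, 'c, 'y) moncat_scheme" and M :: "('v, 'c, 'o, 'a, 'z) modcat_scheme" (structure) +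
  fixes K :: 'v and cup cap :: 'c
  assumes K [simp]: "K \<in> Obj C"
    and cup: "cup \<in> Hom C (tens_unit C) (K \<otimes>\<^sub>o\<^bsub>C\<^esub> K)" and cap: "cap \<in> Hom C (K \<otimes>\<^sub>o\<^bsub>C\<^esub> K) (tens_unit C)"
    and snake: "(cap \<otimes>\<^sub>a\<^bsub>C\<^esub> Ident C K) \<cdot>\<^bsub>C\<^esub> (Ident C K \<otimes>\<^sub>a\<^bsub>C\<^esub> cup) = Ident C K"
      "(Ident C K \<otimes>\<^sub>a\<^bsub>C\<^esub> cap) \<cdot>\<^bsub>C\<^esub> (cup \<otimes>\<^sub>a\<^bsub>C\<^esub> Ident C K) = Ident C K"
begin

lemma cup_cap_arr [simp]: "cup \<in> Arr C" "Dom C cup = tens_unit C" "Cod C cup = K \<otimes>\<^sub>o\<^bsub>C\<^esub> K"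
  "cap \<in> Arr C" "Dom C cap = K \<otimes>\<^sub>o\<^bsub>C\<^esub> K" "Cod C cap = tens_unit C"
  using cup cap by (auto simp: in_Hom)

text \<open>The unit of the adjunction of the action of \<open>K\<close> with itself, not to be
  confused with the unit constraint \<open>act_unit\<close>.\<close>

definition unit_map :: "'o \<Rightarrow> 'a" where
  "unit_map X = act_assoc M K K X \<cdot> ((cup \<star>\<^sub>a Ident M X) \<cdot> inv_arr M (act_unit M X))"

definition counit_map :: "'o \<Rightarrow> 'a" where
  "counit_map X = act_unit M X \<cdot> ((cap \<star>\<^sub>a Ident M X) \<cdot> inv_arr M (act_assoc M K K X))"

lemma unit_map_arr [simp]: "X \<in> Obj M \<Longrightarrow> unit_map X \<in> Arr M" "X \<in> Obj M \<Longrightarrow> Dom M (unit_map X) = X"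
  "X \<in> Obj M \<Longrightarrow> Cod M (unit_map X) = K \<star>\<^sub>o (K \<star>\<^sub>o X)"
  and counit_map_arr [simp]: "X \<in> Obj M \<Longrightarrow> counit_map X \<in> Arr M" "X \<in> Obj M \<Longrightarrow> Dom M (counit_map X) = K \<star>\<^sub>o (K \<star>\<^sub>o X)"
  "X \<in> Obj M \<Longrightarrow> Cod M (counit_map X) = X"
  by (simp_all add: unit_map_def counit_map_def)

lemma unit_map_natural:
  assumes f [simp]: "f \<in> Arr M"
  shows "(Ident C K \<star>\<^sub>a (Ident C K \<star>\<^sub>a f)) \<cdot> unit_map (Dom M f) = unit_map (Cod M f) \<cdot> f"
proof -
  let ?X = "Dom M f" and ?Y = "Cod M f"
  have "(Ident C K \<star>\<^sub>a (Ident C K \<star>\<^sub>a f)) \<cdot> unit_map ?X =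
    ((Ident C K \<star>\<^sub>a (Ident C K \<star>\<^sub>a f)) \<cdot> act_assoc M K K ?X) \<cdot> ((cup \<star>\<^sub>a Ident M ?X) \<cdot> inv_arr M (act_unit M ?X))"
    by (simp add: unit_map_def)
  also have "\<dots> = act_assoc M K K ?Y \<cdot> (((Ident C (K \<otimes>\<^sub>o\<^bsub>C\<^esub> K) \<star>\<^sub>a f) \<cdot> (cup \<star>\<^sub>a Ident M ?X)) \<cdot> inv_arr M (act_unit M ?X))"
    using assoc_natural[of "Ident C K" "Ident C K" f, symmetric] by simp
  also have "(Ident C (K \<otimes>\<^sub>o\<^bsub>C\<^esub> K) \<star>\<^sub>a f) \<cdot> (cup \<star>\<^sub>a Ident M ?X) = (cup \<star>\<^sub>a Ident M ?Y) \<cdot> (Ident C (tens_unit C) \<star>\<^sub>a f)"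
    by (simp add: interchange)
  finally show ?thesis using unit_natural_inv[of f] by (simp add: unit_map_def)
qed

lemma counit_map_natural:
  assumes f [simp]: "f \<in> Arr M"
  shows "counit_map (Cod M f) \<cdot> (Ident C K \<star>\<^sub>a (Ident C K \<star>\<^sub>a f)) = f \<cdot> counit_map (Dom M f)"
proof -
  let ?X = "Dom M f" and ?Y = "Cod M f"
  have "counit_map ?Y \<cdot> (Ident C K \<star>\<^sub>a (Ident C K \<star>\<^sub>a f)) =
    act_unit M ?Y \<cdot> ((cap \<star>\<^sub>a Ident M ?Y) \<cdot> (inv_arr M (act_assoc M K K ?Y) \<cdot> (Ident C K \<star>\<^sub>a (Ident C K \<star>\<^sub>a f))))"
    by (simp add: counit_map_def)
  also have "\<dots> = act_unit M ?Y \<cdot> (((cap \<star>\<^sub>a Ident M ?Y) \<cdot> (Ident C (K \<otimes>\<^sub>o\<^bsub>C\<^esub> K) \<star>\<^sub>a f)) \<cdot> inv_arr M (act_assoc M K K ?X))"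
    using assoc_natural_inv[of "Ident C K" "Ident C K" f, symmetric] by simp
  also have "(cap \<star>\<^sub>a Ident M ?Y) \<cdot> (Ident C (K \<otimes>\<^sub>o\<^bsub>C\<^esub> K) \<star>\<^sub>a f) = (Ident C (tens_unit C) \<star>\<^sub>a f) \<cdot> (cap \<star>\<^sub>a Ident M ?X)"
    by (simp add: interchange)
  also have "act_unit M ?Y \<cdot> (((Ident C (tens_unit C) \<star>\<^sub>a f) \<cdot> (cap \<star>\<^sub>a Ident M ?X)) \<cdot> inv_arr M (act_assoc M K K ?X)) =
    (act_unit M ?Y \<cdot> (Ident C (tens_unit C) \<star>\<^sub>a f)) \<cdot> ((cap \<star>\<^sub>a Ident M ?X) \<cdot> inv_arr M (act_assoc M K K ?X))"
    by simp
  finally show ?thesis unfolding unit_natural[OF f] by (simp add: counit_map_def)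
qed

text \<open>The first snake identity, acting on \<open>X\<close>. The pentagon lets the associators
  pass each other, \<open>unit_right\<close> absorbs the unit constraint on the side of the cup, and
  \<open>unit_left\<close> the one on the side of the cap.\<close>

lemma zigzag_1:
  assumes X [simp]: "X \<in> Obj M"
  shows "counit_map (K \<star>\<^sub>o X) \<cdot> (Ident C K \<star>\<^sub>a unit_map X) = Ident M (K \<star>\<^sub>o X)"
proof -
  let ?I = "tens_unit C" and ?KK = "K \<otimes>\<^sub>o\<^bsub>C\<^esub> K"
  let ?u = "act_unit M (K \<star>\<^sub>o X)" and ?a = "act_assoc M K K (K \<star>\<^sub>o X)" and ?v = "inv_arr M (act_unit M X)"
  have p: "inv_arr M ?a \<cdot> ((Ident C K \<star>\<^sub>a act_assoc M K K X) \<cdot> act_assoc M K ?KK X) = act_assoc M ?KK K X"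
    unfolding pentagon[OF K K K X, symmetric] by simp
  have c: "Ident C K \<star>\<^sub>a (cup \<star>\<^sub>a Ident M X) =
    act_assoc M K ?KK X \<cdot> (((Ident C K \<otimes>\<^sub>a\<^bsub>C\<^esub> cup) \<star>\<^sub>a Ident M X) \<cdot> inv_arr M (act_assoc M K ?I X))"
  proof (rule M.iso_cancelR[of _ "act_assoc M K ?I X"])
    show "(Ident C K \<star>\<^sub>a (cup \<star>\<^sub>a Ident M X)) \<cdot> act_assoc M K ?I X =
      (act_assoc M K ?KK X \<cdot> (((Ident C K \<otimes>\<^sub>a\<^bsub>C\<^esub> cup) \<star>\<^sub>a Ident M X) \<cdot> inv_arr M (act_assoc M K ?I X))) \<cdot> act_assoc M K ?I X"
      using assoc_natural[of "Ident C K" cup "Ident M X"] by (simp add: iso_arrD(5))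
  qed simp_all
  have d: "(cap \<star>\<^sub>a Ident M (K \<star>\<^sub>o X)) \<cdot> act_assoc M ?KK K X = act_assoc M ?I K X \<cdot> ((cap \<otimes>\<^sub>a\<^bsub>C\<^esub> Ident C K) \<star>\<^sub>a Ident M X)"
    using assoc_natural[of cap "Ident C K" "Ident M X"] by simp
  have e: "inv_arr M (act_assoc M K ?I X) \<cdot> (Ident C K \<star>\<^sub>a ?v) = Ident M (K \<star>\<^sub>o X)"
  proof -
    have "(Ident C K \<star>\<^sub>a act_unit M X) \<cdot> (Ident C K \<star>\<^sub>a ?v) = Ident M (K \<star>\<^sub>o X)"
      by (simp add: interchange iso_arrD(6))
    also have "\<dots> = (Ident C K \<star>\<^sub>a act_unit M X) \<cdot> act_assoc M K ?I X" using unit_right[OF K X] by simp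
    finally have "Ident C K \<star>\<^sub>a ?v = act_assoc M K ?I X"
      by (rule M.iso_cancelL) (simp_all add: iso_act)
    thus ?thesis by (simp add: iso_arrD(5))
  qed
  have "counit_map (K \<star>\<^sub>o X) \<cdot> (Ident C K \<star>\<^sub>a unit_map X) =
    ?u \<cdot> ((cap \<star>\<^sub>a Ident M (K \<star>\<^sub>o X)) \<cdot> ((inv_arr M ?a \<cdot> ((Ident C K \<star>\<^sub>a act_assoc M K K X) \<cdot> act_assoc M K ?KK X)) \<cdot>
      (((Ident C K \<otimes>\<^sub>a\<^bsub>C\<^esub> cup) \<star>\<^sub>a Ident M X) \<cdot> (inv_arr M (act_assoc M K ?I X) \<cdot> (Ident C K \<star>\<^sub>a ?v)))))"
    by (simp add: counit_map_def unit_map_def c)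
  also have "\<dots> = ?u \<cdot> (((cap \<star>\<^sub>a Ident M (K \<star>\<^sub>o X)) \<cdot> act_assoc M ?KK K X) \<cdot> ((Ident C K \<otimes>\<^sub>a\<^bsub>C\<^esub> cup) \<star>\<^sub>a Ident M X))"
    unfolding p e by simp
  also have "\<dots> = (?u \<cdot> act_assoc M ?I K X) \<cdot> (((cap \<otimes>\<^sub>a\<^bsub>C\<^esub> Ident C K) \<cdot>\<^bsub>C\<^esub> (Ident C K \<otimes>\<^sub>a\<^bsub>C\<^esub> cup)) \<star>\<^sub>a Ident M X)"
    unfolding d by simp
  also have "\<dots> = Ident M (K \<star>\<^sub>o X)" unfolding snake unit_left[OF K X] by simp
  finally show ?thesis .
qed

text \<open>The second snake identity, with the roles of \<open>unit_left\<close> and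
  \<open>unit_right\<close> exchanged.\<close>

lemma zigzag_2:
  assumes X [simp]: "X \<in> Obj M"
  shows "(Ident C K \<star>\<^sub>a counit_map X) \<cdot> unit_map (K \<star>\<^sub>o X) = Ident M (K \<star>\<^sub>o X)"
proof -
  let ?I = "tens_unit C" and ?KK = "K \<otimes>\<^sub>o\<^bsub>C\<^esub> K"
  let ?u = "inv_arr M (act_unit M (K \<star>\<^sub>o X))" and ?a = "act_assoc M K K (K \<star>\<^sub>o X)"
  let ?b = "act_assoc M K ?KK X" and ?i = "Ident C K \<star>\<^sub>a inv_arr M (act_assoc M K K X)"
  have p: "?i \<cdot> ?a = ?b \<cdot> inv_arr M (act_assoc M ?KK K X)"
  proof (rule M.iso_cancelR[of _ "act_assoc M ?KK K X"])
    have "?i \<cdot> (?a \<cdot> act_assoc M ?KK K X) = (?i \<cdot> (Ident C K \<star>\<^sub>a act_assoc M K K X)) \<cdot> ?b"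
      unfolding pentagon[OF K K K X] by simp
    also have "?i \<cdot> (Ident C K \<star>\<^sub>a act_assoc M K K X) = Ident M (K \<star>\<^sub>o (?KK \<star>\<^sub>o X))"
      by (simp add: interchange iso_arrD(5))
    finally show "(?i \<cdot> ?a) \<cdot> act_assoc M ?KK K X = (?b \<cdot> inv_arr M (act_assoc M ?KK K X)) \<cdot> act_assoc M ?KK K X"
      by (simp add: iso_arrD(5))
  qed simp_all
  have c: "(Ident C K \<star>\<^sub>a (cap \<star>\<^sub>a Ident M X)) \<cdot> ?b = act_assoc M K ?I X \<cdot> ((Ident C K \<otimes>\<^sub>a\<^bsub>C\<^esub> cap) \<star>\<^sub>a Ident M X)"
    using assoc_natural[of "Ident C K" cap "Ident M X"] by simp
  have d: "inv_arr M (act_assoc M ?KK K X) \<cdot> (cup \<star>\<^sub>a Ident M (K \<star>\<^sub>o X)) =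
    ((cup \<otimes>\<^sub>a\<^bsub>C\<^esub> Ident C K) \<star>\<^sub>a Ident M X) \<cdot> inv_arr M (act_assoc M ?I K X)"
    using assoc_natural_inv[of cup "Ident C K" "Ident M X"] by simp
  have e: "inv_arr M (act_assoc M ?I K X) \<cdot> ?u = Ident M (K \<star>\<^sub>o X)"
  proof (rule M.iso_cancelL[of "act_unit M (K \<star>\<^sub>o X) \<cdot> act_assoc M ?I K X"])
    have "(act_unit M (K \<star>\<^sub>o X) \<cdot> act_assoc M ?I K X) \<cdot> (inv_arr M (act_assoc M ?I K X) \<cdot> ?u) = Ident M (K \<star>\<^sub>o X)"
      by (simp add: iso_arrD(6))
    thus "(act_unit M (K \<star>\<^sub>o X) \<cdot> act_assoc M ?I K X) \<cdot> (inv_arr M (act_assoc M ?I K X) \<cdot> ?u) =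
      (act_unit M (K \<star>\<^sub>o X) \<cdot> act_assoc M ?I K X) \<cdot> Ident M (K \<star>\<^sub>o X)"
      by (simp add: unit_left)
    show "iso_arr M (act_unit M (K \<star>\<^sub>o X) \<cdot> act_assoc M ?I K X)" by (simp add: unit_left)
  qed simp_all
  have "(Ident C K \<star>\<^sub>a counit_map X) \<cdot> unit_map (K \<star>\<^sub>o X) =
    (Ident C K \<star>\<^sub>a act_unit M X) \<cdot> ((Ident C K \<star>\<^sub>a (cap \<star>\<^sub>a Ident M X)) \<cdot> ((?i \<cdot> ?a) \<cdot> ((cup \<star>\<^sub>a Ident M (K \<star>\<^sub>o X)) \<cdot> ?u)))"
    by (simp add: counit_map_def unit_map_def)
  also have "\<dots> = (Ident C K \<star>\<^sub>a act_unit M X) \<cdot> (((Ident C K \<star>\<^sub>a (cap \<star>\<^sub>a Ident M X)) \<cdot> ?b) \<cdot>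
      ((inv_arr M (act_assoc M ?KK K X) \<cdot> (cup \<star>\<^sub>a Ident M (K \<star>\<^sub>o X))) \<cdot> ?u))"
    unfolding p by simp
  also have "\<dots> = ((Ident C K \<star>\<^sub>a act_unit M X) \<cdot> act_assoc M K ?I X) \<cdot>
      ((((Ident C K \<otimes>\<^sub>a\<^bsub>C\<^esub> cap) \<cdot>\<^bsub>C\<^esub> (cup \<otimes>\<^sub>a\<^bsub>C\<^esub> Ident C K)) \<star>\<^sub>a Ident M X) \<cdot> (inv_arr M (act_assoc M ?I K X) \<cdot> ?u))"
    unfolding c d by simp
  also have "\<dots> = Ident M (K \<star>\<^sub>o X)" unfolding snake unit_right[OF K X] e by simp
  finally show ?thesis .
qed

end

section \<open>Transport and cancellation of summands\<close>

context linear_category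
begin

lemma biprod_transport:
  assumes b: "biprod M S X Y i p i' p'" and g: "iso_arr M g" "Dom M g = S" "Cod M g = S'"
  shows "biprod M S' X Y (g \<cdot> i) (p \<cdot> inv_arr M g) (g \<cdot> i') (p' \<cdot> inv_arr M g)"
proof -
  note [simp] = iso_arrD[OF g(1)] g biprodD(1-17)[OF b]
  have S': "S' \<in> Obj M" using cod_obj[of g] by simp
  have "(g \<cdot> i) \<cdot> (p \<cdot> inv_arr M g) \<boxplus> (g \<cdot> i') \<cdot> (p' \<cdot> inv_arr M g) = g \<cdot> (i \<cdot> (p \<cdot> inv_arr M g) \<boxplus> i' \<cdot> (p' \<cdot> inv_arr M g))" by simp
  also have "i \<cdot> (p \<cdot> inv_arr M g) \<boxplus> i' \<cdot> (p' \<cdot> inv_arr M g) = inv_arr M g" by (rule biprod_expand(1)[OF b]) simp_all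
  finally show ?thesis using S' by (simp add: biprod_def in_Hom)
qed

lemma biprod_transport_right:
  assumes b: "biprod M S X Y i p i' p'" and g: "iso_arr M g" "Dom M g = Y" "Cod M g = Y'"
  shows "biprod M S X Y' i p (i' \<cdot> inv_arr M g) (g \<cdot> p')"
proof -
  note [simp] = iso_arrD[OF g(1)] g biprodD[OF b]
  have Y': "Y' \<in> Obj M" using cod_obj[of g] by simp
  have "(g \<cdot> p') \<cdot> (i' \<cdot> inv_arr M g) = g \<cdot> ((p' \<cdot> i') \<cdot> inv_arr M g)" by (simp del: biprodD(17)[OF b])
  also have "\<dots> = Ident M Y'" by simp
  finally have "(g \<cdot> p') \<cdot> (i' \<cdot> inv_arr M g) = Ident M Y'" .
  thus ?thesis using Y' by (simp add: biprod_def in_Hom)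
qed

end

lemma (in linear_category) biprod_zero:
  assumes Z: "zero_object M Z" and X [simp]: "X \<in> Obj M"
  shows "biprod M X X Z (Ident M X) (Ident M X) (Null M Z X) (Null M X Z)"
  using Z by (auto simp: zero_object_def biprod_def in_Hom)

text \<open>Since there are no maps between \<open>A\<close> and \<open>B\<close> and
  \<open>End A\<close> consists of scalars, the two copies of \<open>A\<close> in \<open>S\<close>
  differ by a non-zero scalar \<open>d\<close>. The complement \<open>Z\<close> of one copy is
  therefore also a complement of the other, and \<open>p2 \<cdot> iZ\<close> is invertible with
  inverse \<open>pZ \<cdot> i2\<close>.\<close>

lemma (in linear_category) cancel_summand:
  assumes b: "biprod M S Z A iZ pZ i1 p1" and c: "biprod M S B A i2 p2 j1 q1"
    and AB: "\<And>f. f \<in> Arr M \<Longrightarrow> Dom M f = A \<Longrightarrow> Cod M f = B \<Longrightarrow> f = Null M A B"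
    and BA: "\<And>f. f \<in> Arr M \<Longrightarrow> Dom M f = B \<Longrightarrow> Cod M f = A \<Longrightarrow> f = Null M B A"
    and scalar: "\<And>f. f \<in> Arr M \<Longrightarrow> Dom M f = A \<Longrightarrow> Cod M f = A \<Longrightarrow> \<exists>c. f = Scale M c (Ident M A)"
    and A: "Ident M A \<noteq> Null M A A"
  shows "isomorphic M Z B"
proof -
  note [simp] = biprodD(1-17)[OF b] biprodD(1-17)[OF c]
  have "p1 \<cdot> i2 = Null M B A" by (rule BA) simp_all
  hence 1: "iZ \<cdot> (pZ \<cdot> i2) = i2" using biprod_expand(1)[OF b, of i2] by simp
  hence ab: "p2 \<cdot> (iZ \<cdot> (pZ \<cdot> i2)) = Ident M B" by simp
  have "p2 \<cdot> i1 = Null M A B" by (rule AB) simp_all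
  hence 2: "j1 \<cdot> (q1 \<cdot> i1) = i1" using biprod_expand(1)[OF c, of i1] by simp
  obtain d where d: "q1 \<cdot> i1 = Scale M d (Ident M A)" using scalar[of "q1 \<cdot> i1"] by auto
  have i1: "i1 = Scale M d j1" using 2 unfolding d by simp
  have d0: "d \<noteq> 0"
  proof
    assume "d = 0"
    hence "i1 = Null M A S" using i1 by simp
    hence "p1 \<cdot> i1 = Null M A A" by simp
    thus False using A by simp
  qed
  have "Scale M d (pZ \<cdot> j1) = pZ \<cdot> i1" unfolding i1 by simp
  also have "\<dots> = Null M A Z" by (rule biprod_cross[OF b])
  finally have "Scale M (inverse d) (Scale M d (pZ \<cdot> j1)) = Null M A Z" by simp
  hence "pZ \<cdot> j1 = Null M A Z" using d0 by simp
  hence 3: "pZ \<cdot> (j1 \<cdot> (q1 \<cdot> iZ)) = Null M Z Z" using reassoc[of pZ j1 "Null M A Z" "q1 \<cdot> iZ"] by simp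
  have "pZ \<cdot> (i2 \<cdot> (p2 \<cdot> iZ) \<boxplus> j1 \<cdot> (q1 \<cdot> iZ)) = pZ \<cdot> iZ" by (subst biprod_expand(1)[OF c]) simp_all
  hence ba: "pZ \<cdot> (i2 \<cdot> (p2 \<cdot> iZ)) = Ident M Z" using 3 by simp
  have "iso_arr M (p2 \<cdot> iZ)" by (rule iso_arrI[of _ _ "pZ \<cdot> i2"]) (simp_all add: ab ba)
  thus ?thesis unfolding isomorphic_def iso_in_iff by (intro exI[of _ "p2 \<cdot> iZ"]) simp
qed

lemma isomorphic_isoE:
  assumes "isomorphic M X Y"
  obtains f where "iso_arr M f" "Dom M f = X" "Cod M f = Y"
  using assms by (auto simp: isomorphic_def iso_in_iff)

lemma isomorphicI: "iso_arr M f \<Longrightarrow> Dom M f = X \<Longrightarrow> Cod M f = Y \<Longrightarrow> isomorphic M X Y"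
  by (auto simp: isomorphic_def iso_in_iff)

section \<open>The radical is an invariant ideal and vanishes\<close>

locale type_A_action = self_dual_action C M K cup cap + M: indec_family M X
  for C :: "('v, 'c, 'y) moncat_scheme" and M :: "('v, 'c, 'o, 'a, 'z) modcat_scheme" (structure)
    and K :: 'v and cup cap :: 'c and X :: "nat \<Rightarrow> 'o" +
  fixes L :: "nat \<Rightarrow> 'v" and dim :: "'v \<Rightarrow> nat"
  assumes L_obj [simp]: "L k \<in> Obj C" and L_0: "L 0 = tens_unit C" and L_1: "L 1 = K"
    and L_tensor: "\<exists>i p i' p'. biprod C (K \<otimes>\<^sub>o\<^bsub>C\<^esub> L (Suc k)) (L (Suc (Suc k))) (L k) i p i' p'"
    and L_hom: "f \<in> Hom C (L i) (L j) \<Longrightarrow> i \<noteq> j \<Longrightarrow> f = Null C (L i) (L j)"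
    and L_end: "f \<in> Hom C (L i) (L i) \<Longrightarrow> \<exists>c. f = Scale C c (Ident C (L i))"
    and L_summand: "V \<in> Obj C \<Longrightarrow> zero_object C V \<or> (\<exists>k V' i p i' p'. biprod C V (L k) V' i p i' p' \<and> dim V' < dim V)"
    and sums: "V \<in> Obj C \<Longrightarrow> W \<in> Obj C \<Longrightarrow> \<exists>S i p i' p'. biprod C S V W i p i' p'"
    and zero_C: "\<exists>Z. zero_object C Z" and zero_M: "\<exists>Z. zero_object M Z"
    and K_X_0: "isomorphic M (K \<star>\<^sub>o X 0) (X 1)"
    and K_X_Suc: "direct_sum M (K \<star>\<^sub>o X (Suc k)) [X k, X (Suc (Suc k))]"
    and decomposition: "Y \<in> Obj M \<Longrightarrow> \<exists>Zs. direct_sum M Y Zs \<and> (\<forall>Z \<in> set Zs. \<exists>i. isomorphic M Z (X i))"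
    and simple: "simple_transitive C M"
begin

lemma rad_K: "f \<in> M.rad \<Longrightarrow> Ident C K \<star>\<^sub>a f \<in> M.rad"
proof -
  obtain Z where Z: "zero_object M Z" using zero_M by blast
  obtain g where g: "iso_arr M g" "Dom M g = X 1" "Cod M g = K \<star>\<^sub>o X 0"
    using isomorphic_isoE[OF K_X_0] iso_arrD M.iso_inv by metis
  interpret chain: self_adjoint_chain M X "\<lambda>Y. K \<star>\<^sub>o Y" "\<lambda>f. Ident C K \<star>\<^sub>a f" unit_map counit_map
  proof
    show "\<exists>Y i p i' p'. zero_object M Y \<and> biprod M (K \<star>\<^sub>o X 0) (X 1) Y i p i' p'"
      using M.biprod_transport[OF M.biprod_zero[OF Z M.X_obj[of 1]] g] Z by blast
    show "\<exists>i p i' p'. biprod M (K \<star>\<^sub>o X (Suc k)) (X k) (X (Suc (Suc k))) i p i' p'" for k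
      using K_X_Suc M.direct_sum_2 by blast
  qed (simp_all add: unit_map_natural counit_map_natural zigzag_1 zigzag_2)
  show "f \<in> M.rad \<Longrightarrow> Ident C K \<star>\<^sub>a f \<in> M.rad" by (rule chain.rad_stable)
qed

text \<open>The invertible associators conjugate the action of \<open>V \<otimes> W\<close> into the
  two successive actions.\<close>

lemma rad_tensor:
  assumes f: "f \<in> M.rad" and [simp]: "V \<in> Obj C" "W \<in> Obj C" and h: "Ident C V \<star>\<^sub>a (Ident C W \<star>\<^sub>a f) \<in> M.rad"
  shows "Ident C (V \<otimes>\<^sub>o\<^bsub>C\<^esub> W) \<star>\<^sub>a f \<in> M.rad"
proof -
  note [simp] = M.rad_arr[OF f]
  let ?a = "act_assoc M V W (Dom M f)" and ?b = "act_assoc M V W (Cod M f)"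
  have "?b \<cdot> (Ident C (V \<otimes>\<^sub>o\<^bsub>C\<^esub> W) \<star>\<^sub>a f) = (Ident C V \<star>\<^sub>a (Ident C W \<star>\<^sub>a f)) \<cdot> ?a"
    using assoc_natural[of "Ident C V" "Ident C W" f] by simp
  moreover have "inv_arr M ?b \<cdot> (?b \<cdot> (Ident C (V \<otimes>\<^sub>o\<^bsub>C\<^esub> W) \<star>\<^sub>a f)) = Ident C (V \<otimes>\<^sub>o\<^bsub>C\<^esub> W) \<star>\<^sub>a f"
    by simp
  ultimately have "Ident C (V \<otimes>\<^sub>o\<^bsub>C\<^esub> W) \<star>\<^sub>a f = inv_arr M ?b \<cdot> ((Ident C V \<star>\<^sub>a (Ident C W \<star>\<^sub>a f)) \<cdot> ?a)" by metis
  also have "\<dots> \<in> M.rad" by (intro M.rad_compL M.rad_compR h) simp_all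
  finally show ?thesis .
qed

text \<open>An arrow of \<open>C\<close> that passes through \<open>W\<close> acts on
  \<open>f\<close> through the action of \<open>W\<close> on \<open>f\<close>. With the maps of a
  biproduct this hands stability down to summands of \<open>W\<close>, or collects it from
  them.\<close>

lemma rad_factor:
  assumes f: "f \<in> M.rad" and h: "Ident C W \<star>\<^sub>a f \<in> M.rad"
    and [simp]: "W \<in> Obj C" "i \<in> Arr C" "p \<in> Arr C" "Dom C i = W" "Cod C p = W"
  shows "(i \<cdot>\<^bsub>C\<^esub> p) \<star>\<^sub>a f \<in> M.rad"
proof -
  note [simp] = M.rad_arr[OF f]
  have "(i \<cdot>\<^bsub>C\<^esub> p) \<star>\<^sub>a f = (i \<star>\<^sub>a Ident M (Cod M f)) \<cdot> ((Ident C W \<star>\<^sub>a f) \<cdot> (p \<star>\<^sub>a Ident M (Dom M f)))"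
    by (simp add: interchange)
  also have "\<dots> \<in> M.rad" by (intro M.rad_compL M.rad_compR h) simp_all
  finally show ?thesis .
qed

text \<open>\<open>L (m + 2)\<close> is a summand of \<open>K \<otimes> L (m + 1)\<close>, so
  stability under \<open>K\<close> spreads to every \<open>L k\<close>.\<close>

lemma rad_L:
  assumes f: "f \<in> M.rad"
  shows "Ident C (L k) \<star>\<^sub>a f \<in> M.rad"
proof (induction k rule: less_induct)
  case (less k)
  note [simp] = M.rad_arr[OF f]
  consider "k = 0" | "k = 1" | m where "k = Suc (Suc m)" by (metis One_nat_def not0_implies_Suc)
  thus ?case
  proof cases
    case 1
    have "inv_arr M (act_unit M (Cod M f)) \<cdot> (act_unit M (Cod M f) \<cdot> (Ident C (tens_unit C) \<star>\<^sub>a f)) = Ident C (tens_unit C) \<star>\<^sub>a f"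
      by simp
    hence "Ident C (L k) \<star>\<^sub>a f = inv_arr M (act_unit M (Cod M f)) \<cdot> (f \<cdot> act_unit M (Dom M f))"
      unfolding 1 L_0 unit_natural[OF M.rad_arr[OF f]] by (rule sym)
    also have "\<dots> \<in> M.rad" by (intro M.rad_compL M.rad_compR f) simp_all
    finally show ?thesis .
  next
    case 2 thus ?thesis using rad_K[OF f] L_1 by simp
  next
    case (3 m)
    obtain i p i' p' where b: "biprod C (K \<otimes>\<^sub>o\<^bsub>C\<^esub> L (Suc m)) (L k) (L m) i p i' p'" using L_tensor[of m] 3 by blast
    note [simp] = C.biprodD(1-15)[OF b]
    have "Ident C (K \<otimes>\<^sub>o\<^bsub>C\<^esub> L (Suc m)) \<star>\<^sub>a f \<in> M.rad"
      by (intro rad_tensor rad_K less f) (simp_all add: 3)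
    hence "(p \<cdot>\<^bsub>C\<^esub> i) \<star>\<^sub>a f \<in> M.rad" by (intro rad_factor[where W="K \<otimes>\<^sub>o\<^bsub>C\<^esub> L (Suc m)"] f) simp_all
    thus ?thesis unfolding C.biprodD(16)[OF b] .
  qed
qed

lemma rad_act:
  assumes f: "f \<in> M.rad"
  shows "V \<in> Obj C \<Longrightarrow> Ident C V \<star>\<^sub>a f \<in> M.rad"
proof (induction "dim V" arbitrary: V rule: less_induct)
  case less
  note [simp] = M.rad_arr[OF f] less(2)
  from L_summand[OF less(2)] show ?case
  proof (elim disjE exE conjE)
    assume "zero_object C V"
    hence I: "Ident C V = Null C V V" by (simp add: zero_object_def)
    show ?thesis unfolding I by (simp add: M.rad_null)
  next
    fix k V' i p i' p' assume b: "biprod C V (L k) V' i p i' p'" and d: "dim V' < dim V"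
    note [simp] = C.biprodD(1-15)[OF b]
    have 1: "(i \<cdot>\<^bsub>C\<^esub> p) \<star>\<^sub>a f \<in> M.rad" by (intro rad_factor[where W="L k"] f rad_L) simp_all
    have 2: "(i' \<cdot>\<^bsub>C\<^esub> p') \<star>\<^sub>a f \<in> M.rad" by (intro rad_factor[where W=V'] f less(1) d) simp_all
    have "((i \<cdot>\<^bsub>C\<^esub> p) \<star>\<^sub>a f) \<boxplus> ((i' \<cdot>\<^bsub>C\<^esub> p') \<star>\<^sub>a f) \<in> M.rad" by (intro M.rad_plus 1 2) simp_all
    moreover have "((i \<cdot>\<^bsub>C\<^esub> p) \<star>\<^sub>a f) \<boxplus> ((i' \<cdot>\<^bsub>C\<^esub> p') \<star>\<^sub>a f) = ((i \<cdot>\<^bsub>C\<^esub> p) \<boxplus>\<^bsub>C\<^esub> (i' \<cdot>\<^bsub>C\<^esub> p')) \<star>\<^sub>a f" by simp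
    ultimately show ?thesis unfolding C.biprodD(18)[OF b] by simp
  qed
qed

lemma rad_invariant: "invariant_ideal C M M.rad"
  unfolding invariant_ideal_def
proof (intro conjI ballI impI)
  show "M.rad \<subseteq> Arr M" by auto
  fix X Y assume [simp]: "X \<in> Obj M" "Y \<in> Obj M"
  have "submodule class_ring (M.rad \<inter> Hom M X Y) (hom_space M X Y)"
    by (rule submodule.intro) (use M.hom_module in \<open>auto simp: in_Hom M.rad_plus M.rad_null M.rad_scale class_ring_simps\<close>)
  thus "VectorSpace.subspace class_ring (M.rad \<inter> Hom M X Y) (hom_space M X Y)"
    unfolding VectorSpace.subspace_def using M.hom_vectorspace by simp
qed (auto intro: M.rad_compL M.rad_compR rad_act)

text \<open>The identity of \<open>X 0\<close> is not radical, so the invariant ideal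
  \<open>M.rad\<close> is not everything, and simple transitivity leaves only the zero
  ideal.\<close>

lemma rad_zero:
  assumes "f \<in> M.rad"
  shows "f = Null M (Dom M f) (Cod M f)"
proof -
  have "Ident M (X 0) \<notin> M.rad" using M.rad_not_iso[of "Ident M (X 0)" 0] by auto
  hence "M.rad \<noteq> Arr M" by force
  with simple rad_invariant have "M.rad = {Null M X Y | X Y. X \<in> Obj M \<and> Y \<in> Obj M}" unfolding simple_transitive_def by blast
  with assms show ?thesis by auto
qed

lemma X_hom:
  assumes "f \<in> Arr M" "Dom M f = X i" "Cod M f = X j" "i \<noteq> j"
  shows "f = Null M (X i) (X j)"
  using rad_zero[OF M.radI_X[OF assms(1-3)]] assms by auto

lemma X_end:
  assumes "f \<in> Arr M" "Dom M f = X i" "Cod M f = X i"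
  shows "\<exists>c. f = Scale M c (Ident M (X i))"
proof -
  obtain c where c: "\<not> iso_arr M (M.minus f (Scale M c (Ident M (X i))))"
    using M.scalar_X[of f i] assms by (auto simp: in_Hom)
  have "M.minus f (Scale M c (Ident M (X i))) \<in> M.rad" by (rule M.radI_X[of _ i i]) (use assms c in simp_all)
  from rad_zero[OF this] have "M.minus f (Scale M c (Ident M (X i))) = Null M (X i) (X i)" using assms by simp
  hence "f = Scale M c (Ident M (X i))" by (rule M.minus_eq_null) (use assms in simp_all)
  thus ?thesis by blast
qed

section \<open>The orbit functor of \<open>X 0\<close> is an equivalence\<close>

sublocale F: linear_functor C M "\<lambda>V. V \<star>\<^sub>o X 0" "\<lambda>f. f \<star>\<^sub>a Ident M (X 0)"
  by unfold_locales (auto simp: in_Hom)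

text \<open>\<open>K\<close> acting on \<open>X (m + 1)\<close> decomposes in two ways: by
  Clebsch-Gordan into \<open>X m\<close> and the orbit of \<open>L (m + 2)\<close>, and by the chain
  into \<open>X m\<close> and \<open>X (m + 2)\<close>. Cancelling \<open>X m\<close> identifies the
  remaining summands.\<close>

lemma L_X: "isomorphic M (L k \<star>\<^sub>o X 0) (X k)"
proof (induction k rule: less_induct)
  case (less k)
  consider "k = 0" | "k = 1" | m where "k = Suc (Suc m)" by (metis One_nat_def not0_implies_Suc)
  thus ?case
  proof cases
    case 1 show ?thesis unfolding 1 L_0 by (rule isomorphicI[OF unit_iso(1)[OF M.X_obj]]) simp_all
  next
    case 2 thus ?thesis using K_X_0 L_1 by simp
  next
    case (3 m)
    obtain i p i' p' where "biprod C (K \<otimes>\<^sub>o\<^bsub>C\<^esub> L (Suc m)) (L k) (L m) i p i' p'" using L_tensor[of m] 3 by blast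
    note b = F.Fa_biprod[OF this]
    obtain g where g: "iso_arr M g" "Dom M g = L m \<star>\<^sub>o X 0" "Cod M g = X m"
      using isomorphic_isoE[OF less[of m]] 3 by auto
    obtain h where h: "iso_arr M h" "Dom M h = L (Suc m) \<star>\<^sub>o X 0" "Cod M h = X (Suc m)"
      using isomorphic_isoE[OF less[of "Suc m"]] 3 by auto
    note [simp] = iso_arrD(1)[OF h(1)] h
    define t where "t = (Ident C K \<star>\<^sub>a h) \<cdot> act_assoc M K (L (Suc m)) (X 0)"
    have t: "iso_arr M t" "Dom M t = (K \<otimes>\<^sub>o\<^bsub>C\<^esub> L (Suc m)) \<star>\<^sub>o X 0" "Cod M t = K \<star>\<^sub>o X (Suc m)"
      unfolding t_def by (auto intro!: M.iso_comp iso_act)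
    obtain j q j' q' where c: "biprod M (K \<star>\<^sub>o X (Suc m)) (X m) (X k) j q j' q'"
      using K_X_Suc[of m] M.direct_sum_2 3 by blast
    have "isomorphic M (L k \<star>\<^sub>o X 0) (X k)"
    proof (rule M.cancel_summand[OF M.biprod_transport[OF M.biprod_transport_right[OF b g] t] M.biprod_swap[OF c]])
      show "f = Null M (X m) (X k)" if "f \<in> Arr M" "Dom M f = X m" "Cod M f = X k" for f using X_hom[OF that] 3 by simp
      show "f = Null M (X k) (X m)" if "f \<in> Arr M" "Dom M f = X k" "Cod M f = X m" for f using X_hom[OF that] 3 by simp
      show "\<exists>c. f = Scale M c (Ident M (X m))" if "f \<in> Arr M" "Dom M f = X m" "Cod M f = X m" for f using X_end[OF that] .
    qed (rule M.X_nonzero)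
    thus ?thesis .
  qed
qed

lemma LX_nonzero: "Ident M (L i \<star>\<^sub>o X 0) \<noteq> Null M (L i \<star>\<^sub>o X 0) (L i \<star>\<^sub>o X 0)"
proof
  assume *: "Ident M (L i \<star>\<^sub>o X 0) = Null M (L i \<star>\<^sub>o X 0) (L i \<star>\<^sub>o X 0)"
  obtain g where g: "iso_arr M g" "Dom M g = L i \<star>\<^sub>o X 0" "Cod M g = X i" using isomorphic_isoE[OF L_X] by metis
  note [simp] = iso_arrD[OF g(1)] g
  have "Ident M (X i) = g \<cdot> (Ident M (L i \<star>\<^sub>o X 0) \<cdot> inv_arr M g)" by simp
  also have "\<dots> = Null M (X i) (X i)" unfolding * by simp
  finally show False using M.X_nonzero by simp
qed

lemma LX_hom:
  assumes f [simp]: "f \<in> Arr M" "Dom M f = L i \<star>\<^sub>o X 0" "Cod M f = L j \<star>\<^sub>o X 0"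
  shows "i \<noteq> j \<Longrightarrow> f = Null M (L i \<star>\<^sub>o X 0) (L j \<star>\<^sub>o X 0)"
    "i = j \<Longrightarrow> \<exists>c. f = Scale M c (Ident M (L i \<star>\<^sub>o X 0))"
proof -
  obtain g where g: "iso_arr M g" "Dom M g = L i \<star>\<^sub>o X 0" "Cod M g = X i" using isomorphic_isoE[OF L_X] by metis
  obtain h where h: "iso_arr M h" "Dom M h = L j \<star>\<^sub>o X 0" "Cod M h = X j" using isomorphic_isoE[OF L_X] by metis
  note [simp] = iso_arrD[OF g(1)] g iso_arrD[OF h(1)] h
  have f_eq: "f = inv_arr M h \<cdot> ((h \<cdot> (f \<cdot> inv_arr M g)) \<cdot> g)" by simp
  have k: "h \<cdot> (f \<cdot> inv_arr M g) \<in> Arr M" "Dom M (h \<cdot> (f \<cdot> inv_arr M g)) = X i" "Cod M (h \<cdot> (f \<cdot> inv_arr M g)) = X j" by simp_all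
  show "f = Null M (L i \<star>\<^sub>o X 0) (L j \<star>\<^sub>o X 0)" if "i \<noteq> j"
    by (subst f_eq, subst X_hom[OF k that]) simp
  show "\<exists>c. f = Scale M c (Ident M (L i \<star>\<^sub>o X 0))" if ij: "i = j"
  proof -
    have "\<exists>c. g \<cdot> (f \<cdot> inv_arr M g) = Scale M c (Ident M (X i))" by (rule X_end) (simp_all add: ij[symmetric])
    then obtain c where c: "g \<cdot> (f \<cdot> inv_arr M g) = Scale M c (Ident M (X i))" by blast
    have "f = inv_arr M g \<cdot> ((g \<cdot> (f \<cdot> inv_arr M g)) \<cdot> g)" by (simp add: ij[symmetric])
    also have "\<dots> = Scale M c (Ident M (L i \<star>\<^sub>o X 0))" unfolding c by simp
    finally show ?thesis by blast
  qed
qed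

text \<open>On both sides the maps are zero or scalars: in \<open>C\<close> by Schur's lemma, in
  \<open>M\<close> because the radical vanishes. The functor is the identity on scalars, and the
  image of \<open>L i\<close> is not zero.\<close>

lemma ff_L: "F.ff (L i) (L j)"
proof (rule F.ffI)
  fix f assume f [simp]: "f \<in> Arr C" "Dom C f = L i" "Cod C f = L j"
    and F: "f \<star>\<^sub>a Ident M (X 0) = Null M (L i \<star>\<^sub>o X 0) (L j \<star>\<^sub>o X 0)"
  show "f = Null C (L i) (L j)"
  proof (cases "i = j")
    case True
    then obtain c where c: "f = Scale C c (Ident C (L i))" using L_end[of f i] by (auto simp: in_Hom)
    have Z: "Scale M c (Ident M (L i \<star>\<^sub>o X 0)) = Null M (L i \<star>\<^sub>o X 0) (L i \<star>\<^sub>o X 0)"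
      using F True unfolding c by simp
    have "c = 0"
    proof (rule ccontr)
      assume "c \<noteq> 0"
      hence "Ident M (L i \<star>\<^sub>o X 0) = Scale M (inverse c) (Scale M c (Ident M (L i \<star>\<^sub>o X 0)))" by simp
      also have "\<dots> = Null M (L i \<star>\<^sub>o X 0) (L i \<star>\<^sub>o X 0)" unfolding Z by simp
      finally show False using LX_nonzero by simp
    qed
    thus ?thesis unfolding c using True by simp
  qed (use L_hom in \<open>simp add: in_Hom\<close>)
next
  fix g assume g [simp]: "g \<in> Arr M" "Dom M g = L i \<star>\<^sub>o X 0" "Cod M g = L j \<star>\<^sub>o X 0"
  show "\<exists>f. f \<in> Arr C \<and> Dom C f = L i \<and> Cod C f = L j \<and> f \<star>\<^sub>a Ident M (X 0) = g"
  proof (cases "i = j")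
    case True
    obtain c where c: "g = Scale M c (Ident M (L i \<star>\<^sub>o X 0))" using LX_hom(2)[OF g True] by blast
    show ?thesis unfolding c using True by (intro exI[of _ "Scale C c (Ident C (L i))"]) simp
  next
    case False
    show ?thesis using LX_hom(1)[OF g False] by (intro exI[of _ "Null C (L i) (L j)"]) simp
  qed
qed

text \<open>Induction on the measure \<open>dim\<close>, separately in each argument, splitting off
  one simple summand at a time.\<close>

lemma ff: "V \<in> Obj C \<Longrightarrow> W \<in> Obj C \<Longrightarrow> F.ff V W"
proof -
  have *: "F.ff V (L j)" if "V \<in> Obj C" for V j
    using that
  proof (induction "dim V" arbitrary: V rule: less_induct)
    case less
    from L_summand[OF less(2)] show ?case
    proof (elim disjE exE conjE)
      fix k V' i p i' p' assume b: "biprod C V (L k) V' i p i' p'" and d: "dim V' < dim V"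
      show ?thesis by (rule F.ff_sum_left[OF b ff_L less(1)[OF d]]) (use C.biprodD[OF b] in simp_all)
    qed (use F.ff_zero less(2) in simp)
  qed
  show "V \<in> Obj C \<Longrightarrow> W \<in> Obj C \<Longrightarrow> F.ff V W"
  proof (induction "dim W" arbitrary: W rule: less_induct)
    case less
    from L_summand[OF less(3)] show ?case
    proof (elim disjE exE conjE)
      fix k V' i p i' p' assume b: "biprod C W (L k) V' i p i' p'" and d: "dim V' < dim W"
      show ?thesis by (rule F.ff_sum_right[OF b * less(1)[OF d]]) (use less(2) C.biprodD[OF b] in simp_all)
    qed (use F.ff_zero less(2) in simp)
  qed
qed

text \<open>The partial sums \<open>?S m\<close> of the summand projections are idempotents of
  \<open>Y\<close>. Each is shown to split through some orbit object, so that the induction stays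
  inside \<open>End Y\<close>; the last partial sum is the identity.\<close>

lemma essentially_surjective:
  assumes Y [simp]: "Y \<in> Obj M"
  shows "\<exists>V. V \<in> Obj C \<and> isomorphic M (V \<star>\<^sub>o X 0) Y"
proof -
  obtain Zs where Zs: "direct_sum M Y Zs" and iso: "\<And>Z. Z \<in> set Zs \<Longrightarrow> \<exists>i. isomorphic M Z (X i)" using decomposition[OF Y] by blast
  from Zs obtain \<iota> \<pi> where
    h: "\<forall>i < length Zs. \<iota> i \<in> Hom M (Zs ! i) Y \<and> \<pi> i \<in> Hom M Y (Zs ! i)"
    and k: "\<forall>i < length Zs. \<forall>j < length Zs.
        \<pi> i \<cdot> \<iota> j = (if i = j then Ident M (Zs ! i) else Null M (Zs ! j) (Zs ! i))"
    and s: "finsum (hom_space M Y Y) (\<lambda>i. \<iota> i \<cdot> \<pi> i) {..<length Zs} = Ident M Y" and Zobj: "set Zs \<subseteq> Obj M"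
    unfolding direct_sum_def by blast
  let ?S = "\<lambda>m. finsum (hom_space M Y Y) (\<lambda>i. \<iota> i \<cdot> \<pi> i) {..<m}"
  have hi: "\<iota> i \<in> Arr M" "Dom M (\<iota> i) = Zs ! i" "Cod M (\<iota> i) = Y" "\<pi> i \<in> Arr M" "Dom M (\<pi> i) = Y" "Cod M (\<pi> i) = Zs ! i" "Zs ! i \<in> Obj M"
    if "i < length Zs" for i using that h Zobj by (auto simp: in_Hom)
  have S_Suc: "?S (Suc m) = (\<iota> m \<cdot> \<pi> m) \<boxplus> ?S m" if "m < length Zs" for m
    by (rule M.finsum_hom_Suc) (use that hi in \<open>auto simp: in_Hom\<close>)
  have S: "?S m \<in> Arr M \<and> Dom M (?S m) = Y \<and> Cod M (?S m) = Y \<and>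
    (\<forall>j < length Zs. m \<le> j \<longrightarrow> ?S m \<cdot> \<iota> j = Null M (Zs ! j) Y \<and> \<pi> j \<cdot> ?S m = Null M Y (Zs ! j))" if "m \<le> length Zs" for m
    using that
  proof (induction m)
    case 0
    show ?case using M.finsum_hom_0[OF Y Y, of "\<lambda>i. \<iota> i \<cdot> \<pi> i"] hi by simp
  next
    case (Suc m)
    hence m: "m < length Zs" by simp
    have A: "?S m \<in> Arr M" "Dom M (?S m) = Y" "Cod M (?S m) = Y" using Suc by simp_all
    have "(\<iota> m \<cdot> \<pi> m) \<cdot> \<iota> j = Null M (Zs ! j) Y" "\<pi> j \<cdot> (\<iota> m \<cdot> \<pi> m) = Null M Y (Zs ! j)"
      if j: "j < length Zs" "Suc m \<le> j" for j
    proof -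
      have 1: "\<pi> m \<cdot> \<iota> j = Null M (Zs ! j) (Zs ! m)" "\<pi> j \<cdot> \<iota> m = Null M (Zs ! m) (Zs ! j)" using k m j by auto
      show "(\<iota> m \<cdot> \<pi> m) \<cdot> \<iota> j = Null M (Zs ! j) Y" using hi[OF m] hi[OF j(1)] 1 by simp
      show "\<pi> j \<cdot> (\<iota> m \<cdot> \<pi> m) = Null M Y (Zs ! j)"
        using M.reassoc[OF 1(2), of "\<pi> m"] hi[OF m] hi[OF j(1)] by simp
    qed
    note n = this
    show ?case unfolding S_Suc[OF m]
    proof (intro conjI allI impI)
      fix j assume j: "j < length Zs" "Suc m \<le> j"
      have s': "?S m \<cdot> \<iota> j = Null M (Zs ! j) Y" "\<pi> j \<cdot> ?S m = Null M Y (Zs ! j)" using Suc j by simp_all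
      show "((\<iota> m \<cdot> \<pi> m) \<boxplus> ?S m) \<cdot> \<iota> j = Null M (Zs ! j) Y"
        by (subst M.plus_compR) (use A hi[OF m] hi[OF j(1)] n(1)[OF j] s'(1) in simp_all)
      show "\<pi> j \<cdot> ((\<iota> m \<cdot> \<pi> m) \<boxplus> ?S m) = Null M Y (Zs ! j)"
        by (subst M.plus_compL) (use A hi[OF m] hi[OF j(1)] n(2)[OF j] s'(2) in simp_all)
    qed (use A hi[OF m] in simp_all)
  qed
  have "\<exists>V a b. V \<in> Obj C \<and> a \<in> Arr M \<and> Dom M a = V \<star>\<^sub>o X 0 \<and> Cod M a = Y \<and> b \<in> Arr M \<and> Dom M b = Y \<and> Cod M b = V \<star>\<^sub>o X 0 \<and>
    b \<cdot> a = Ident M (V \<star>\<^sub>o X 0) \<and> a \<cdot> b = ?S m" if "m \<le> length Zs" for m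
    using that
  proof (induction m)
    case 0
    obtain Z where Z: "zero_object C Z" using zero_C by blast
    have [simp]: "Z \<in> Obj C" and I: "Ident C Z = Null C Z Z" using Z by (auto simp: zero_object_def)
    have "Ident C Z \<star>\<^sub>a Ident M (X 0) = Null M (Z \<star>\<^sub>o X 0) (Z \<star>\<^sub>o X 0)" unfolding I by simp
    hence "Null M (Z \<star>\<^sub>o X 0) (Z \<star>\<^sub>o X 0) = Ident M (Z \<star>\<^sub>o X 0)" by simp
    thus ?case
      by (intro exI[of _ Z] exI[of _ "Null M (Z \<star>\<^sub>o X 0) Y"] exI[of _ "Null M Y (Z \<star>\<^sub>o X 0)"])
        (simp add: M.finsum_hom_0[OF Y Y, of "\<lambda>i. \<iota> i \<cdot> \<pi> i", simplified])
  next
    case (Suc m)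
    hence m: "m < length Zs" by simp
    from Suc obtain V a b where V [simp]: "V \<in> Obj C" and ab [simp]: "a \<in> Arr M" "Dom M a = V \<star>\<^sub>o X 0" "Cod M a = Y" "b \<in> Arr M" "Dom M b = Y" "Cod M b = V \<star>\<^sub>o X 0"
      and ba: "b \<cdot> a = Ident M (V \<star>\<^sub>o X 0)" and aS: "a \<cdot> b = ?S m" by force
    note [simp] = hi[OF m]
    obtain l where "isomorphic M (Zs ! m) (X l)" using iso m by force
    then obtain g where g: "iso_arr M g" "Dom M g = Zs ! m" "Cod M g = X l" by (rule isomorphic_isoE)
    obtain g' where g': "iso_arr M g'" "Dom M g' = L l \<star>\<^sub>o X 0" "Cod M g' = X l" using isomorphic_isoE[OF L_X] by metis
    define t where "t = inv_arr M g \<cdot> g'"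
    have t: "iso_arr M t" "Dom M t = L l \<star>\<^sub>o X 0" "Cod M t = Zs ! m"
      unfolding t_def using iso_arrD[OF g(1)] iso_arrD[OF g'(1)] g g' by (auto intro!: M.iso_comp M.iso_inv)
    note [simp] = iso_arrD[OF t(1)] t
    obtain T i p i' p' where c: "biprod C T V (L l) i p i' p'" using sums[of V "L l"] by auto
    note b' = F.Fa_biprod[OF c]
    let ?i = "i \<star>\<^sub>a Ident M (X 0)" and ?p = "p \<star>\<^sub>a Ident M (X 0)" and ?i' = "i' \<star>\<^sub>a Ident M (X 0)" and ?p' = "p' \<star>\<^sub>a Ident M (X 0)"
    note [simp] = C.biprodD(1-3)[OF c]
    obtain I P I' P' where bI: "biprod M (T \<star>\<^sub>o X 0) (V \<star>\<^sub>o X 0) (L l \<star>\<^sub>o X 0) I P I' P'" using b' by blast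
    note [simp] = M.biprodD(4-17)[OF bI]
    note cross = M.biprod_cross[OF bI] M.biprod_cross[OF M.biprod_swap[OF bI]]
    have Sm: "?S m \<cdot> \<iota> m = Null M (Zs ! m) Y" "\<pi> m \<cdot> ?S m = Null M Y (Zs ! m)" "?S m \<in> Arr M" "Dom M (?S m) = Y" "Cod M (?S m) = Y"
      using S[of m] m by auto
    have "b \<cdot> ((a \<cdot> b) \<cdot> \<iota> m) = Null M (Zs ! m) (V \<star>\<^sub>o X 0)" unfolding aS Sm(1) by simp
    hence bi: "b \<cdot> \<iota> m = Null M (Zs ! m) (V \<star>\<^sub>o X 0)" using M.reassoc[OF ba, of "b \<cdot> \<iota> m"] by simp
    have "(\<pi> m \<cdot> (a \<cdot> b)) \<cdot> a = Null M (V \<star>\<^sub>o X 0) (Zs ! m)" unfolding aS Sm(2) by simp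
    hence pa: "\<pi> m \<cdot> a = Null M (V \<star>\<^sub>o X 0) (Zs ! m)" using ba by simp
    have pi: "\<pi> m \<cdot> \<iota> m = Ident M (Zs ! m)" using k m by simp
    \<comment> \<open>The splitting of the next idempotent is the old one on \<open>V\<close>,
      together with \<open>\<iota> m\<close> and \<open>\<pi> m\<close> twisted by \<open>t\<close>
      on the new summand \<open>L l\<close>. The mixed terms vanish because \<open>\<iota> m\<close>
      and \<open>\<pi> m\<close> are orthogonal to \<open>?S m\<close>.\<close>
    define a' where "a' = (a \<cdot> P) \<boxplus> (\<iota> m \<cdot> (t \<cdot> P'))"
    define b'' where "b'' = (I \<cdot> b) \<boxplus> (I' \<cdot> (inv_arr M t \<cdot> \<pi> m))"
    have r: "b \<cdot> (a \<cdot> P) = P" "b \<cdot> (\<iota> m \<cdot> (t \<cdot> P')) = Null M (T \<star>\<^sub>o X 0) (V \<star>\<^sub>o X 0)"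
      "\<pi> m \<cdot> (a \<cdot> P) = Null M (T \<star>\<^sub>o X 0) (Zs ! m)" "\<pi> m \<cdot> (\<iota> m \<cdot> (t \<cdot> P')) = t \<cdot> P'"
      using M.reassoc[OF ba, of P] M.reassoc[OF bi, of "t \<cdot> P'"] M.reassoc[OF pa, of P] M.reassoc[OF pi, of "t \<cdot> P'"] by simp_all
    have "b'' \<cdot> a' = (I \<cdot> P) \<boxplus> (I' \<cdot> P')" unfolding a'_def b''_def by (simp add: r)
    hence 1: "b'' \<cdot> a' = Ident M (T \<star>\<^sub>o X 0)" using M.biprodD(18)[OF bI] by simp
    have q: "P \<cdot> (I \<cdot> b) = b" "P \<cdot> (I' \<cdot> (inv_arr M t \<cdot> \<pi> m)) = Null M Y (V \<star>\<^sub>o X 0)"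
      "P' \<cdot> (I \<cdot> b) = Null M Y (L l \<star>\<^sub>o X 0)" "P' \<cdot> (I' \<cdot> (inv_arr M t \<cdot> \<pi> m)) = inv_arr M t \<cdot> \<pi> m"
      using M.reassoc[OF M.biprodD(16)[OF bI], of b] M.reassoc[OF cross(1), of "inv_arr M t \<cdot> \<pi> m"] M.reassoc[OF cross(2), of b]
        M.reassoc[OF M.biprodD(17)[OF bI], of "inv_arr M t \<cdot> \<pi> m"] by simp_all
    have "a' \<cdot> b'' = (a \<cdot> b) \<boxplus> (\<iota> m \<cdot> \<pi> m)" unfolding a'_def b''_def by (simp add: q)
    hence 2: "a' \<cdot> b'' = ?S (Suc m)" unfolding S_Suc[OF m] aS using Sm by (simp add: M.plus_comm)
    have "a' \<in> Arr M" "Dom M a' = T \<star>\<^sub>o X 0" "Cod M a' = Y" "b'' \<in> Arr M" "Dom M b'' = Y" "Cod M b'' = T \<star>\<^sub>o X 0"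
      unfolding a'_def b''_def by simp_all
    with 1 2 C.biprodD(1)[OF c] show ?case by blast
  qed
  from this[of "length Zs"] s obtain V a b where "V \<in> Obj C" "a \<in> Arr M" "Dom M a = V \<star>\<^sub>o X 0" "Cod M a = Y" "b \<in> Arr M" "Dom M b = Y" "Cod M b = V \<star>\<^sub>o X 0"
    "b \<cdot> a = Ident M (V \<star>\<^sub>o X 0)" "a \<cdot> b = Ident M Y" by auto
  thus ?thesis by (intro exI[of _ V]) (auto intro!: isomorphicI[of _ a] iso_arrI[of _ _ b])
qed

end

section \<open>Comparison of two module categories through their orbit functors\<close>

locale orbit_equivalences = A: strict_action C M + B: strict_action C N
  + F: linear_functor C M "\<lambda>V. V \<star>\<^sub>o X" "\<lambda>f. f \<star>\<^sub>a Ident M X"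
  + G: linear_functor C N "\<lambda>V. V \<star>\<^sub>o\<^bsub>N\<^esub> Y" "\<lambda>f. f \<star>\<^sub>a\<^bsub>N\<^esub> Ident N Y"
  for C :: "('v, 'c, 'y) moncat_scheme"
    and M :: "('v, 'c, 'o, 'a, 'z) modcat_scheme" (structure) and N :: "('v, 'c, 'p, 'b, 'x) modcat_scheme"
    and X :: 'o and Y :: 'p +
  assumes X [simp]: "X \<in> Obj M" and Y [simp]: "Y \<in> Obj N"
    and F_ff: "V \<in> Obj C \<Longrightarrow> W \<in> Obj C \<Longrightarrow> F.ff V W"
    and G_ff: "V \<in> Obj C \<Longrightarrow> W \<in> Obj C \<Longrightarrow> G.ff V W"
    and F_es: "Z \<in> Obj M \<Longrightarrow> \<exists>V. V \<in> Obj C \<and> isomorphic M (V \<star>\<^sub>o X) Z"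
    and G_es: "T \<in> Obj N \<Longrightarrow> \<exists>V. V \<in> Obj C \<and> isomorphic N (V \<star>\<^sub>o\<^bsub>N\<^esub> Y) T"
begin

text \<open>The orbit functor \<open>V \<mapsto> V \<star> X\<close> has a quasi-inverse \<open>Po\<close>; the required functor is
  \<open>Z \<mapsto> Po Z \<star> Y\<close>. The comparison \<open>g V Z\<close> from \<open>Po (V \<star> Z)\<close> to \<open>V \<otimes> Po Z\<close> is determined by its
  image under the orbit functor, which also reduces its coherence to that of \<open>M\<close>.\<close>

theorem module_equivalent: "module_equivalent C M N"
proof -
  obtain Po Pa \<theta> where P: "linear_functor M C Po Pa"
    and \<theta>_iso: "\<And>Z. Z \<in> Obj M \<Longrightarrow> iso_arr M (\<theta> Z)" and \<theta>_dom: "\<And>Z. Z \<in> Obj M \<Longrightarrow> Dom M (\<theta> Z) = Po Z \<star>\<^sub>o X"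
    and \<theta>_cod: "\<And>Z. Z \<in> Obj M \<Longrightarrow> Cod M (\<theta> Z) = Z"
    and \<theta>_nat: "\<And>h. h \<in> Arr M \<Longrightarrow> \<theta> (Cod M h) \<cdot> (Pa h \<star>\<^sub>a Ident M X) = h \<cdot> \<theta> (Dom M h)"
    using F.quasi_inverse[OF F_ff F_es] by blast
  interpret P: linear_functor M C Po Pa by (rule P)
  note [simp] = \<theta>_iso \<theta>_dom \<theta>_cod iso_arrD(1)[OF \<theta>_iso]
  let ?a = "act_assoc M" and ?b = "act_assoc N" and ?I = "Ident C"
  \<comment> \<open>The composite from the orbit of \<open>Po (V \<star>\<^sub>o Z)\<close> to
    \<open>V \<star>\<^sub>o Z\<close>, on to
    \<open>V \<star>\<^sub>o (Po Z \<star>\<^sub>o X)\<close>, and by the associator to the orbit of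
    \<open>V \<otimes>\<^sub>o Po Z\<close>. Full faithfulness lifts it to \<open>C\<close>.\<close>
  define t where "t V Z = inv_arr M (?a V (Po Z) X) \<cdot> ((?I V \<star>\<^sub>a inv_arr M (\<theta> Z)) \<cdot> \<theta> (V \<star>\<^sub>o Z))" for V Z
  have "\<exists>g. V \<in> Obj C \<longrightarrow> Z \<in> Obj M \<longrightarrow> iso_arr C g \<and> Dom C g = Po (V \<star>\<^sub>o Z) \<and> Cod C g = V \<otimes>\<^sub>o\<^bsub>C\<^esub> Po Z \<and>
    g \<star>\<^sub>a Ident M X = t V Z" for V Z
  proof (cases "V \<in> Obj C \<and> Z \<in> Obj M")
    case True
    hence [simp]: "V \<in> Obj C" "Z \<in> Obj M" by auto
    note [simp] = iso_arrD[OF \<theta>_iso[of Z]]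
    have "iso_arr M (t V Z)" unfolding t_def by (intro A.M.iso_comp A.M.iso_inv A.iso_act) simp_all
    moreover have "Dom M (t V Z) = Po (V \<star>\<^sub>o Z) \<star>\<^sub>o X" "Cod M (t V Z) = (V \<otimes>\<^sub>o\<^bsub>C\<^esub> Po Z) \<star>\<^sub>o X"
      unfolding t_def by simp_all
    ultimately show ?thesis using F.ff_lift_iso[OF F_ff, of "Po (V \<star>\<^sub>o Z)" "V \<otimes>\<^sub>o\<^bsub>C\<^esub> Po Z" "t V Z"] by auto
  qed auto
  then obtain g where g: "\<And>V Z. V \<in> Obj C \<Longrightarrow> Z \<in> Obj M \<Longrightarrow> iso_arr C (g V Z) \<and> Dom C (g V Z) = Po (V \<star>\<^sub>o Z) \<and>
    Cod C (g V Z) = V \<otimes>\<^sub>o\<^bsub>C\<^esub> Po Z \<and> g V Z \<star>\<^sub>a Ident M X = t V Z" by metis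
  have [simp]: "iso_arr C (g V Z)" "Dom C (g V Z) = Po (V \<star>\<^sub>o Z)" "Cod C (g V Z) = V \<otimes>\<^sub>o\<^bsub>C\<^esub> Po Z" "g V Z \<in> Arr C"
    if "V \<in> Obj C" "Z \<in> Obj M" for V Z using g[OF that] iso_arrD(1)[of C "g V Z"] by auto
  have g_image: "(?I V \<star>\<^sub>a \<theta> Z) \<cdot> (?a V (Po Z) X \<cdot> (g V Z \<star>\<^sub>a Ident M X)) = \<theta> (V \<star>\<^sub>o Z)"
    if [simp]: "V \<in> Obj C" "Z \<in> Obj M" for V Z
  proof -
    note [simp] = iso_arrD[OF \<theta>_iso[of Z]]
    have "(?I V \<star>\<^sub>a \<theta> Z) \<cdot> (?I V \<star>\<^sub>a inv_arr M (\<theta> Z)) = Ident M (V \<star>\<^sub>o Z)" by (subst A.interchange) simp_all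
    from A.M.reassoc[OF this, of "\<theta> (V \<star>\<^sub>o Z)"] show ?thesis using g[OF that] by (simp add: t_def)
  qed
  \<comment> \<open>The test for equations about \<open>g\<close>: apply the orbit functor and
    compose with invertible arrows so that \<open>g_image\<close> can replace \<open>g\<close> by
    \<open>\<theta>\<close>.\<close>
  have eqI: "f = f'"
    if "(?I V \<star>\<^sub>a \<theta> Z) \<cdot> (?a V (Po Z) X \<cdot> (f \<star>\<^sub>a Ident M X)) = (?I V \<star>\<^sub>a \<theta> Z) \<cdot> (?a V (Po Z) X \<cdot> (f' \<star>\<^sub>a Ident M X))"
      and [simp]: "V \<in> Obj C" "Z \<in> Obj M" "f \<in> Arr C" "f' \<in> Arr C" "Dom C f = Dom C f'" "Cod C f = V \<otimes>\<^sub>o\<^bsub>C\<^esub> Po Z" "Cod C f' = V \<otimes>\<^sub>o\<^bsub>C\<^esub> Po Z"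
    for V Z f f'
  proof -
    have "?a V (Po Z) X \<cdot> (f \<star>\<^sub>a Ident M X) = ?a V (Po Z) X \<cdot> (f' \<star>\<^sub>a Ident M X)"
      by (rule A.M.iso_cancelL[OF that(1)]) (auto intro!: A.iso_act)
    hence "f \<star>\<^sub>a Ident M X = f' \<star>\<^sub>a Ident M X" by (rule A.M.iso_cancelL) simp_all
    thus ?thesis by (rule F.ff_inj[OF _ F_ff]) simp_all
  qed
  have g_natural: "g (Cod C f) (Cod M h) \<cdot>\<^bsub>C\<^esub> Pa (f \<star>\<^sub>a h) = (f \<otimes>\<^sub>a\<^bsub>C\<^esub> Pa h) \<cdot>\<^bsub>C\<^esub> g (Dom C f) (Dom M h)"
    if [simp]: "f \<in> Arr C" "h \<in> Arr M" for f h
  proof (rule eqI)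
    let ?V = "Dom C f" and ?W = "Cod C f" and ?Z = "Dom M h" and ?Z' = "Cod M h"
    let ?gW = "g ?W ?Z' \<star>\<^sub>a Ident M X" and ?gV = "g ?V ?Z \<star>\<^sub>a Ident M X"
    have "(?I ?W \<star>\<^sub>a \<theta> ?Z') \<cdot> (?a ?W (Po ?Z') X \<cdot> ((g ?W ?Z' \<cdot>\<^bsub>C\<^esub> Pa (f \<star>\<^sub>a h)) \<star>\<^sub>a Ident M X)) =
      ((?I ?W \<star>\<^sub>a \<theta> ?Z') \<cdot> (?a ?W (Po ?Z') X \<cdot> ?gW)) \<cdot> (Pa (f \<star>\<^sub>a h) \<star>\<^sub>a Ident M X)" by simp
    also have "\<dots> = (f \<star>\<^sub>a h) \<cdot> \<theta> (?V \<star>\<^sub>o ?Z)" using \<theta>_nat[of "f \<star>\<^sub>a h"] by (subst g_image) simp_all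
    finally have 1: "(?I ?W \<star>\<^sub>a \<theta> ?Z') \<cdot> (?a ?W (Po ?Z') X \<cdot> ((g ?W ?Z' \<cdot>\<^bsub>C\<^esub> Pa (f \<star>\<^sub>a h)) \<star>\<^sub>a Ident M X)) =
      (f \<star>\<^sub>a h) \<cdot> \<theta> (?V \<star>\<^sub>o ?Z)" .
    have 2: "(?I ?W \<star>\<^sub>a \<theta> ?Z') \<cdot> (f \<star>\<^sub>a (Pa h \<star>\<^sub>a Ident M X)) = (f \<star>\<^sub>a h) \<cdot> (?I ?V \<star>\<^sub>a \<theta> ?Z)"
      by (simp add: A.interchange \<theta>_nat)
    have "(?I ?W \<star>\<^sub>a \<theta> ?Z') \<cdot> (?a ?W (Po ?Z') X \<cdot> (((f \<otimes>\<^sub>a\<^bsub>C\<^esub> Pa h) \<cdot>\<^bsub>C\<^esub> g ?V ?Z) \<star>\<^sub>a Ident M X)) =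
      (?I ?W \<star>\<^sub>a \<theta> ?Z') \<cdot> ((?a ?W (Po ?Z') X \<cdot> ((f \<otimes>\<^sub>a\<^bsub>C\<^esub> Pa h) \<star>\<^sub>a Ident M X)) \<cdot> ?gV)" by simp
    also have "?a ?W (Po ?Z') X \<cdot> ((f \<otimes>\<^sub>a\<^bsub>C\<^esub> Pa h) \<star>\<^sub>a Ident M X) = (f \<star>\<^sub>a (Pa h \<star>\<^sub>a Ident M X)) \<cdot> ?a ?V (Po ?Z) X"
      using A.assoc_natural[of f "Pa h" "Ident M X"] by simp
    also have "(?I ?W \<star>\<^sub>a \<theta> ?Z') \<cdot> (((f \<star>\<^sub>a (Pa h \<star>\<^sub>a Ident M X)) \<cdot> ?a ?V (Po ?Z) X) \<cdot> ?gV) =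
      ((?I ?W \<star>\<^sub>a \<theta> ?Z') \<cdot> (f \<star>\<^sub>a (Pa h \<star>\<^sub>a Ident M X))) \<cdot> (?a ?V (Po ?Z) X \<cdot> ?gV)" by simp
    also have "\<dots> = (f \<star>\<^sub>a h) \<cdot> ((?I ?V \<star>\<^sub>a \<theta> ?Z) \<cdot> (?a ?V (Po ?Z) X \<cdot> ?gV))" unfolding 2 by simp
    also have "\<dots> = (f \<star>\<^sub>a h) \<cdot> \<theta> (?V \<star>\<^sub>o ?Z)" by (subst g_image) simp_all
    finally show "(?I ?W \<star>\<^sub>a \<theta> ?Z') \<cdot> (?a ?W (Po ?Z') X \<cdot> ((g ?W ?Z' \<cdot>\<^bsub>C\<^esub> Pa (f \<star>\<^sub>a h)) \<star>\<^sub>a Ident M X)) =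
      (?I ?W \<star>\<^sub>a \<theta> ?Z') \<cdot> (?a ?W (Po ?Z') X \<cdot> (((f \<otimes>\<^sub>a\<^bsub>C\<^esub> Pa h) \<cdot>\<^bsub>C\<^esub> g ?V ?Z) \<star>\<^sub>a Ident M X))"
      using 1 by simp
  qed simp_all
  \<comment> \<open>The associativity of \<open>g\<close> is the pentagon of \<open>M\<close> seen
    through \<open>\<theta>\<close>. Both sides are compared after a further associator, which is
    cancelled at the end.\<close>
  have g_assoc: "g (V \<otimes>\<^sub>o\<^bsub>C\<^esub> W) Z = (?I V \<otimes>\<^sub>a\<^bsub>C\<^esub> g W Z) \<cdot>\<^bsub>C\<^esub> (g V (W \<star>\<^sub>o Z) \<cdot>\<^bsub>C\<^esub> Pa (?a V W Z))"
    if [simp]: "V \<in> Obj C" "W \<in> Obj C" "Z \<in> Obj M" for V W Z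
  proof (rule eqI)
    let ?VW = "V \<otimes>\<^sub>o\<^bsub>C\<^esub> W" and ?WZ = "W \<star>\<^sub>o Z"
    let ?g = "g W Z \<star>\<^sub>a Ident M X" and ?h = "g V ?WZ \<star>\<^sub>a Ident M X" and ?p = "Pa (?a V W Z) \<star>\<^sub>a Ident M X"
    let ?k = "(?I V \<otimes>\<^sub>a\<^bsub>C\<^esub> g W Z) \<star>\<^sub>a Ident M X"
    have n1: "?a V W Z \<cdot> (?I ?VW \<star>\<^sub>a \<theta> Z) = (?I V \<star>\<^sub>a (?I W \<star>\<^sub>a \<theta> Z)) \<cdot> ?a V W (Po Z \<star>\<^sub>o X)"
      using A.assoc_natural[of "?I V" "?I W" "\<theta> Z"] by simp
    have n2: "?a V (W \<otimes>\<^sub>o\<^bsub>C\<^esub> Po Z) X \<cdot> ?k = (?I V \<star>\<^sub>a ?g) \<cdot> ?a V (Po ?WZ) X"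
      using A.assoc_natural[of "?I V" "g W Z" "Ident M X"] by simp
    have p: "?a V W (Po Z \<star>\<^sub>o X) \<cdot> ?a ?VW (Po Z) X = (?I V \<star>\<^sub>a ?a W (Po Z) X) \<cdot> ?a V (W \<otimes>\<^sub>o\<^bsub>C\<^esub> Po Z) X"
      by (rule A.pentagon) simp_all
    have "?a V W Z \<cdot> ((?I ?VW \<star>\<^sub>a \<theta> Z) \<cdot> (?a ?VW (Po Z) X \<cdot> (?k \<cdot> (?h \<cdot> ?p)))) =
      (?a V W Z \<cdot> (?I ?VW \<star>\<^sub>a \<theta> Z)) \<cdot> (?a ?VW (Po Z) X \<cdot> (?k \<cdot> (?h \<cdot> ?p)))" by simp
    also have "\<dots> = (?I V \<star>\<^sub>a (?I W \<star>\<^sub>a \<theta> Z)) \<cdot> ((?a V W (Po Z \<star>\<^sub>o X) \<cdot> ?a ?VW (Po Z) X) \<cdot> (?k \<cdot> (?h \<cdot> ?p)))"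
      unfolding n1 by simp
    also have "\<dots> = (?I V \<star>\<^sub>a (?I W \<star>\<^sub>a \<theta> Z)) \<cdot> ((?I V \<star>\<^sub>a ?a W (Po Z) X) \<cdot> ((?a V (W \<otimes>\<^sub>o\<^bsub>C\<^esub> Po Z) X \<cdot> ?k) \<cdot> (?h \<cdot> ?p)))"
      unfolding p by simp
    also have "\<dots> = (?I V \<star>\<^sub>a ((?I W \<star>\<^sub>a \<theta> Z) \<cdot> (?a W (Po Z) X \<cdot> ?g))) \<cdot> (?a V (Po ?WZ) X \<cdot> (?h \<cdot> ?p))"
      unfolding n2 by simp
    also have "\<dots> = ((?I V \<star>\<^sub>a \<theta> ?WZ) \<cdot> (?a V (Po ?WZ) X \<cdot> ?h)) \<cdot> ?p" by (subst g_image) simp_all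
    also have "\<dots> = ?a V W Z \<cdot> \<theta> (?VW \<star>\<^sub>o Z)" using \<theta>_nat[of "?a V W Z"] by (subst g_image) simp_all
    finally have "(?I ?VW \<star>\<^sub>a \<theta> Z) \<cdot> (?a ?VW (Po Z) X \<cdot> (?k \<cdot> (?h \<cdot> ?p))) = \<theta> (?VW \<star>\<^sub>o Z)"
      by (rule A.M.iso_cancelL) simp_all
    thus "(?I ?VW \<star>\<^sub>a \<theta> Z) \<cdot> (?a ?VW (Po Z) X \<cdot> (g ?VW Z \<star>\<^sub>a Ident M X)) =
      (?I ?VW \<star>\<^sub>a \<theta> Z) \<cdot> (?a ?VW (Po Z) X \<cdot> (((?I V \<otimes>\<^sub>a\<^bsub>C\<^esub> g W Z) \<cdot>\<^bsub>C\<^esub> (g V ?WZ \<cdot>\<^bsub>C\<^esub> Pa (?a V W Z))) \<star>\<^sub>a Ident M X))"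
      using g_image[of ?VW Z] by simp
  qed simp_all
  \<comment> \<open>Naturality of \<open>act_unit\<close> and the coherence \<open>unit_left\<close>
    take the place of the pentagon.\<close>
  have g_unit: "g (tens_unit C) Z = Pa (act_unit M Z)" if [simp]: "Z \<in> Obj M" for Z
  proof (rule eqI)
    let ?J = "tens_unit C" and ?p = "Pa (act_unit M Z) \<star>\<^sub>a Ident M X"
    have "act_unit M Z \<cdot> ((?I ?J \<star>\<^sub>a \<theta> Z) \<cdot> (?a ?J (Po Z) X \<cdot> ?p)) =
      (act_unit M Z \<cdot> (?I ?J \<star>\<^sub>a \<theta> Z)) \<cdot> (?a ?J (Po Z) X \<cdot> ?p)" by simp
    also have "act_unit M Z \<cdot> (?I ?J \<star>\<^sub>a \<theta> Z) = \<theta> Z \<cdot> act_unit M (Po Z \<star>\<^sub>o X)" using A.unit_natural[of "\<theta> Z"] by simp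
    also have "(\<theta> Z \<cdot> act_unit M (Po Z \<star>\<^sub>o X)) \<cdot> (?a ?J (Po Z) X \<cdot> ?p) =
      \<theta> Z \<cdot> ((act_unit M (Po Z \<star>\<^sub>o X) \<cdot> ?a ?J (Po Z) X) \<cdot> ?p)" by simp
    also have "\<dots> = \<theta> Z \<cdot> ?p" by (subst A.unit_left) simp_all
    also have "\<dots> = act_unit M Z \<cdot> \<theta> (?J \<star>\<^sub>o Z)" using \<theta>_nat[of "act_unit M Z"] by simp
    finally have "(?I ?J \<star>\<^sub>a \<theta> Z) \<cdot> (?a ?J (Po Z) X \<cdot> ?p) = \<theta> (?J \<star>\<^sub>o Z)" by (rule A.M.iso_cancelL) simp_all
    thus "(?I ?J \<star>\<^sub>a \<theta> Z) \<cdot> (?a ?J (Po Z) X \<cdot> (g ?J Z \<star>\<^sub>a Ident M X)) = (?I ?J \<star>\<^sub>a \<theta> Z) \<cdot> (?a ?J (Po Z) X \<cdot> ?p)"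
      using g_image[of ?J Z] by simp
  qed simp_all
  let ?Go = "\<lambda>V. V \<star>\<^sub>o\<^bsub>N\<^esub> Y" and ?Ga = "\<lambda>f. f \<star>\<^sub>a\<^bsub>N\<^esub> Ident N Y"
  interpret H: linear_functor M N "?Go \<circ> Po" "?Ga \<circ> Pa" by (rule linear_functor_comp[OF P G.linear_functor_axioms])
  \<comment> \<open>\<open>g\<close> lives in \<open>C\<close> and so can be pushed forward to
    \<open>N\<close>, where one associator completes it. Its coherence is that of \<open>g\<close>
    combined with the pentagon and the unit coherence of \<open>N\<close>.\<close>
  define s where "s V Z = ?b V (Po Z) Y \<cdot>\<^bsub>N\<^esub> (g V Z \<star>\<^sub>a\<^bsub>N\<^esub> Ident N Y)" for V Z
  have "module_functor C M N (?Go \<circ> Po) (?Ga \<circ> Pa) s"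
  proof
    show "iso_in N (s V Z) ((?Go \<circ> Po) (V \<star>\<^sub>o Z)) (V \<star>\<^sub>o\<^bsub>N\<^esub> (?Go \<circ> Po) Z)" if [simp]: "V \<in> Obj C" "Z \<in> Obj M" for V Z
      unfolding s_def iso_in_iff by (auto intro!: B.M.iso_comp B.iso_act)
    show "s W Z' \<cdot>\<^bsub>N\<^esub> (?Ga \<circ> Pa) (f \<star>\<^sub>a h) = (f \<star>\<^sub>a\<^bsub>N\<^esub> (?Ga \<circ> Pa) h) \<cdot>\<^bsub>N\<^esub> s V Z"
      if "f \<in> Hom C V W" "h \<in> Hom M Z Z'" for f V W h Z Z'
    proof -
      note [simp] = that[unfolded in_Hom]
      have [simp]: "V \<in> Obj C" "W \<in> Obj C" "Z \<in> Obj M" "Z' \<in> Obj M"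
        using A.C.dom_cod[of f] A.M.dom_cod[of h] by simp_all
      have "s W Z' \<cdot>\<^bsub>N\<^esub> (?Ga \<circ> Pa) (f \<star>\<^sub>a h) = ?b W (Po Z') Y \<cdot>\<^bsub>N\<^esub> ((g W Z' \<cdot>\<^bsub>C\<^esub> Pa (f \<star>\<^sub>a h)) \<star>\<^sub>a\<^bsub>N\<^esub> Ident N Y)"
        by (simp add: s_def)
      also have "g W Z' \<cdot>\<^bsub>C\<^esub> Pa (f \<star>\<^sub>a h) = (f \<otimes>\<^sub>a\<^bsub>C\<^esub> Pa h) \<cdot>\<^bsub>C\<^esub> g V Z" using g_natural[of f h] by simp
      also have "?b W (Po Z') Y \<cdot>\<^bsub>N\<^esub> (((f \<otimes>\<^sub>a\<^bsub>C\<^esub> Pa h) \<cdot>\<^bsub>C\<^esub> g V Z) \<star>\<^sub>a\<^bsub>N\<^esub> Ident N Y) =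
        (?b W (Po Z') Y \<cdot>\<^bsub>N\<^esub> ((f \<otimes>\<^sub>a\<^bsub>C\<^esub> Pa h) \<star>\<^sub>a\<^bsub>N\<^esub> Ident N Y)) \<cdot>\<^bsub>N\<^esub> (g V Z \<star>\<^sub>a\<^bsub>N\<^esub> Ident N Y)" by simp
      also have "?b W (Po Z') Y \<cdot>\<^bsub>N\<^esub> ((f \<otimes>\<^sub>a\<^bsub>C\<^esub> Pa h) \<star>\<^sub>a\<^bsub>N\<^esub> Ident N Y) = (f \<star>\<^sub>a\<^bsub>N\<^esub> (Pa h \<star>\<^sub>a\<^bsub>N\<^esub> Ident N Y)) \<cdot>\<^bsub>N\<^esub> ?b V (Po Z) Y"
        using B.assoc_natural[of f "Pa h" "Ident N Y"] by simp
      finally show ?thesis by (simp add: s_def)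
    qed
    show "?b V W ((?Go \<circ> Po) Z) \<cdot>\<^bsub>N\<^esub> s (V \<otimes>\<^sub>o\<^bsub>C\<^esub> W) Z = (?I V \<star>\<^sub>a\<^bsub>N\<^esub> s W Z) \<cdot>\<^bsub>N\<^esub> s V (W \<star>\<^sub>o Z) \<cdot>\<^bsub>N\<^esub> (?Ga \<circ> Pa) (?a V W Z)"
      if [simp]: "V \<in> Obj C" "W \<in> Obj C" "Z \<in> Obj M" for V W Z
    proof -
      let ?VW = "V \<otimes>\<^sub>o\<^bsub>C\<^esub> W" and ?WZ = "W \<star>\<^sub>o Z"
      let ?g = "g W Z \<star>\<^sub>a\<^bsub>N\<^esub> Ident N Y" and ?h = "g V ?WZ \<star>\<^sub>a\<^bsub>N\<^esub> Ident N Y" and ?p = "Pa (?a V W Z) \<star>\<^sub>a\<^bsub>N\<^esub> Ident N Y"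
      let ?k = "(?I V \<otimes>\<^sub>a\<^bsub>C\<^esub> g W Z) \<star>\<^sub>a\<^bsub>N\<^esub> Ident N Y"
      have n: "?b V (W \<otimes>\<^sub>o\<^bsub>C\<^esub> Po Z) Y \<cdot>\<^bsub>N\<^esub> ?k = (?I V \<star>\<^sub>a\<^bsub>N\<^esub> ?g) \<cdot>\<^bsub>N\<^esub> ?b V (Po ?WZ) Y"
        using B.assoc_natural[of "?I V" "g W Z" "Ident N Y"] by simp
      have "?b V W (Po Z \<star>\<^sub>o\<^bsub>N\<^esub> Y) \<cdot>\<^bsub>N\<^esub> s ?VW Z = (?b V W (Po Z \<star>\<^sub>o\<^bsub>N\<^esub> Y) \<cdot>\<^bsub>N\<^esub> ?b ?VW (Po Z) Y) \<cdot>\<^bsub>N\<^esub> (?k \<cdot>\<^bsub>N\<^esub> (?h \<cdot>\<^bsub>N\<^esub> ?p))"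
        by (simp add: s_def g_assoc)
      also have "?b V W (Po Z \<star>\<^sub>o\<^bsub>N\<^esub> Y) \<cdot>\<^bsub>N\<^esub> ?b ?VW (Po Z) Y = (?I V \<star>\<^sub>a\<^bsub>N\<^esub> ?b W (Po Z) Y) \<cdot>\<^bsub>N\<^esub> ?b V (W \<otimes>\<^sub>o\<^bsub>C\<^esub> Po Z) Y"
        by (rule B.pentagon) simp_all
      also have "((?I V \<star>\<^sub>a\<^bsub>N\<^esub> ?b W (Po Z) Y) \<cdot>\<^bsub>N\<^esub> ?b V (W \<otimes>\<^sub>o\<^bsub>C\<^esub> Po Z) Y) \<cdot>\<^bsub>N\<^esub> (?k \<cdot>\<^bsub>N\<^esub> (?h \<cdot>\<^bsub>N\<^esub> ?p)) =
        (?I V \<star>\<^sub>a\<^bsub>N\<^esub> ?b W (Po Z) Y) \<cdot>\<^bsub>N\<^esub> ((?b V (W \<otimes>\<^sub>o\<^bsub>C\<^esub> Po Z) Y \<cdot>\<^bsub>N\<^esub> ?k) \<cdot>\<^bsub>N\<^esub> (?h \<cdot>\<^bsub>N\<^esub> ?p))" by simp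
      finally show ?thesis unfolding n by (simp add: s_def)
    qed
    show "act_unit N ((?Go \<circ> Po) Z) \<cdot>\<^bsub>N\<^esub> s (tens_unit C) Z = (?Ga \<circ> Pa) (act_unit M Z)" if [simp]: "Z \<in> Obj M" for Z
      using B.M.reassoc[OF B.unit_left[of "Po Z" Y], of "g (tens_unit C) Z \<star>\<^sub>a\<^bsub>N\<^esub> Ident N Y"] by (simp add: s_def g_unit)
  qed
  moreover have "equivalence_functor M N (?Go \<circ> Po) (?Ga \<circ> Pa)"
  proof (rule H.equivalence)
    have q: "P.ff Z Z'" if "Z \<in> Obj M" "Z' \<in> Obj M" for Z Z'
      by (rule F.quasi_inverse_ff(1)[OF F_ff P \<theta>_iso \<theta>_dom \<theta>_cod \<theta>_nat]) (use that in simp_all)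
    show "H.ff Z Z'" if "Z \<in> Obj M" "Z' \<in> Obj M" for Z Z'
      by (rule ff_comp[OF P G.linear_functor_axioms q[OF that] G_ff]) (use that in simp_all)
    show "\<exists>Z. Z \<in> Obj M \<and> isomorphic N ((?Go \<circ> Po) Z) T" if T: "T \<in> Obj N" for T
    proof -
      obtain V where V: "V \<in> Obj C" "isomorphic N (V \<star>\<^sub>o\<^bsub>N\<^esub> Y) T" using G_es[OF T] by blast
      obtain Z where Z: "Z \<in> Obj M" "isomorphic C (Po Z) V" using F.quasi_inverse_ff(2)[OF F_ff P \<theta>_iso \<theta>_dom \<theta>_cod \<theta>_nat V(1)] by blast
      obtain u where u: "iso_arr C u" "Dom C u = Po Z" "Cod C u = V" using Z(2) by (rule isomorphic_isoE)
      obtain v where v: "iso_arr N v" "Dom N v = V \<star>\<^sub>o\<^bsub>N\<^esub> Y" "Cod N v = T" using V(2) by (rule isomorphic_isoE)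
      note [simp] = iso_arrD(1)[OF u(1)] iso_arrD(1)[OF v(1)] u v
      have "isomorphic N (Po Z \<star>\<^sub>o\<^bsub>N\<^esub> Y) T"
        by (rule isomorphicI[OF B.M.iso_comp[OF G.Fa_iso[OF u(1)] v(1)]]) simp_all
      thus ?thesis using Z(1) by (intro exI[of _ Z]) simp
    qed
  qed
  ultimately show ?thesis unfolding module_equivalent_def by blast
qed

end

text \<open>For a biproduct decomposition the idempotent \<open>i p\<close> is zero or the identity,
  and accordingly the first or the second summand vanishes.\<close>

lemma (in linear_category) local_indecomposable:
  assumes X: "local_endomorphisms M X"
  shows "indecomposable M X"
  unfolding indecomposable_def direct_sum_2
proof (intro conjI allI impI)
  show "X \<in> Obj M" "\<not> zero_object M X" using X by (auto simp: local_endomorphisms_def)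
  fix Y Z assume "\<exists>i p i' p'. biprod M X Y Z i p i' p'"
  then obtain i p i' p' where b: "biprod M X Y Z i p i' p'" by blast
  note [simp] = biprodD(1-15)[OF b]
  note e = biprodD(16,17)[OF b]
  have "(i \<cdot> p) \<cdot> (i \<cdot> p) = i \<cdot> p" using reassoc[OF e(1), of p] by simp
  hence "i \<cdot> p = Null M X X \<or> i \<cdot> p = Ident M X" by (intro local_idem[OF X]) simp_all
  thus "zero_object M Y \<or> zero_object M Z"
  proof
    assume 0: "i \<cdot> p = Null M X X"
    have "Ident M Y = p \<cdot> ((i \<cdot> p) \<cdot> i)" using reassoc[OF e(1), of "p \<cdot> i"] e(1) by simp
    also have "\<dots> = Null M Y Y" unfolding 0 by simp
    finally show ?thesis by (simp add: zero_object_def)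
  next
    assume 1: "i \<cdot> p = Ident M X"
    have "Ident M Z = p' \<cdot> ((i \<cdot> p) \<cdot> i')" unfolding 1 using e(2) by simp
    also have "\<dots> = (p' \<cdot> i) \<cdot> (p \<cdot> i')" by simp
    also have "\<dots> = Null M Z Z" unfolding biprod_cross[OF b] by simp
    finally show ?thesis by (simp add: zero_object_def)
  qed
qed

section \<open>Application to modules over sl2\<close>

lemma strict_monoidal_sl2_cat: "strict_monoidal sl2_cat"
proof (rule strict_monoidal.intro[OF linear_monoidal_category_sl2_cat])
  show "strict_monoidal_axioms sl2_cat"
    by unfold_locales (simp_all add: mult.assoc)
qed

text \<open>The dimension \<open>fst\<close> serves as the induction measure of the abstract
  argument, Schur's lemma and complete reducibility describe the simple objects, and
  \<open>cup_cap\<close> provides the self-duality of \<open>L1\<close>.\<close>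

lemma type_A_action_sl2:
  fixes M :: "(sl2_module, sl2_hom, 'o, 'a) modcat"
  assumes "module_category sl2_cat M" and fin: "locally_finitary M"
    and simple: "simple_transitive sl2_cat M" and A: "type_A_infinity M"
  obtains X cup cap where "type_A_action sl2_cat M L1 cup cap X simple_module fst"
proof -
  interpret module_category sl2_cat M by fact
  interpret C: strict_monoidal sl2_cat by (rule strict_monoidal_sl2_cat)
  from A obtain X :: "nat \<Rightarrow> 'o" where "\<forall>i. indecomposable M (X i)" "\<forall>Y. indecomposable M Y \<longrightarrow> (\<exists>i. isomorphic M Y (X i))"
    "\<forall>i j. isomorphic M (X i) (X j) \<longrightarrow> i = j" and X_0: "isomorphic M (L1 \<star>\<^sub>o\<^bsub>M\<^esub> X 0) (X 1)"
    and "\<forall>i \<ge> 1. direct_sum M (L1 \<star>\<^sub>o\<^bsub>M\<^esub> X i) [X (i - 1), X (i + 1)]"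
    unfolding type_A_infinity_def by blast
  hence X: "\<And>i. indecomposable M (X i)" "\<And>Y. indecomposable M Y \<Longrightarrow> \<exists>i. isomorphic M Y (X i)"
    "\<And>i j. isomorphic M (X i) (X j) \<Longrightarrow> i = j"
    and chain: "\<And>i. i \<ge> 1 \<Longrightarrow> direct_sum M (L1 \<star>\<^sub>o\<^bsub>M\<^esub> X i) [X (i - 1), X (i + 1)]" by simp_all
  obtain cup cap where cc: "cup \<in> Hom sl2_cat trivial_module (tensor_module L1 L1)" "cap \<in> Hom sl2_cat (tensor_module L1 L1) trivial_module"
    "Comp sl2_cat (tens_arr sl2_cat cap (Ident sl2_cat L1)) (tens_arr sl2_cat (Ident sl2_cat L1) cup) = Ident sl2_cat L1"
    "Comp sl2_cat (tens_arr sl2_cat (Ident sl2_cat L1) cap) (tens_arr sl2_cat cup (Ident sl2_cat L1)) = Ident sl2_cat L1"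
    by (rule cup_cap)
  have K: "self_dual_action sl2_cat M L1 cup cap"
    using cc L1_closed by (intro self_dual_action.intro strict_action.intro self_dual_action_axioms.intro strict_monoidal_sl2_cat assms) (simp_all only: sl2_cat_simps)
  have "type_A_action_axioms sl2_cat M L1 X simple_module fst"
  proof
    show "f = Null sl2_cat (simple_module i) (simple_module j)" if "f \<in> Hom sl2_cat (simple_module i) (simple_module j)" "i \<noteq> j" for f i j
      by (rule schur(1)[OF that])
    show "\<exists>c. f = Scale sl2_cat c (Ident sl2_cat (simple_module i))" if "f \<in> Hom sl2_cat (simple_module i) (simple_module i)" for f i
      by (rule schur(2)[OF that refl])
    show "zero_object sl2_cat V \<or> (\<exists>k V' i p i' p'. biprod sl2_cat V (simple_module k) V' i p i' p' \<and> fst V' < fst V)" if "V \<in> Obj sl2_cat" for V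
      using complete_reducibility[of V] zero_dim[of V] that by (metis sl2_cat_simps(1) neq0_conv)
    show "\<exists>S i p i' p'. biprod sl2_cat S V W i p i' p'" if "V \<in> Obj sl2_cat" "W \<in> Obj sl2_cat" for V W
      using block_sum[of V W] that by (metis sl2_cat_simps(1))
    show "\<exists>Z. zero_object sl2_cat Z" using zero_module by blast
    show "\<exists>Z. zero_object M Z"
    proof -
      from fin obtain S where S: "direct_sum M S []" unfolding locally_finitary_def has_direct_sums_def by force
      hence "S \<in> Obj M" by (simp add: direct_sum_def)
      with S show ?thesis using M.finsum_hom_0 by (auto simp: direct_sum_def zero_object_def)
    qed
    show "direct_sum M (L1 \<star>\<^sub>o\<^bsub>M\<^esub> X (Suc k)) [X k, X (Suc (Suc k))]" for k using chain[of "Suc k"] by simp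
    \<comment> \<open>Krull-Schmidt summands are local, hence indecomposable, hence isomorphic to
      members of the list \<open>X\<close>.\<close>
    show "\<exists>Zs. direct_sum M Y Zs \<and> (\<forall>Z \<in> set Zs. \<exists>i. isomorphic M Z (X i))" if "Y \<in> Obj M" for Y
      using fin that X(2) M.local_indecomposable unfolding locally_finitary_def krull_schmidt_def by metis
    show "\<exists>i p i' p'. biprod sl2_cat (L1 \<otimes>\<^sub>o\<^bsub>sl2_cat\<^esub> simple_module (Suc k)) (simple_module (Suc (Suc k))) (simple_module k) i p i' p'" for k
      using clebsch_gordan[of k] by simp
  qed (use X_0 simple in \<open>simp_all add: simple_module_0 simple_module_1[simplified]\<close>)
  moreover have "indec_family M X" by (rule M.indec_familyI[OF fin X(1) X(3)])
  ultimately show ?thesis using K by (intro that type_A_action.intro)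
qed

theorem proposition7:
  fixes M :: "(sl2_module, sl2_hom, 'o, 'a) modcat"
    and N :: "(sl2_module, sl2_hom, 'p, 'b) modcat"
  assumes "module_category sl2_cat M" and "module_category sl2_cat N"
    and "locally_finitary M" and "locally_finitary N"
    and "admissible M" and "admissible N"
    and "simple_transitive sl2_cat M" and "simple_transitive sl2_cat N"
    and "type_A_infinity M" and "type_A_infinity N"
  shows "module_equivalent sl2_cat M N"
proof -
  obtain X cup cap where "type_A_action sl2_cat M L1 cup cap X simple_module fst"
    using type_A_action_sl2[OF assms(1,3,7,9)] by blast
  then interpret M: type_A_action sl2_cat M L1 cup cap X simple_module fst .
  obtain Y cup' cap' where "type_A_action sl2_cat N L1 cup' cap' Y simple_module fst"
    using type_A_action_sl2[OF assms(2,4,8,10)] by blast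
  then interpret N: type_A_action sl2_cat N L1 cup' cap' Y simple_module fst .
  have "orbit_equivalences sl2_cat M N (X 0) (Y 0)"
    using M.ff N.ff M.essentially_surjective N.essentially_surjective by unfold_locales (simp_all add: Bex_def)
  thus ?thesis by (rule orbit_equivalences.module_equivalent)
qed

end
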